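(* Let $\vec\lambda=(\lambda^1,\ldots,\lambda^n)$ be a sequence of dominant minuscule weights of $GL_m$. Then the irreducible components of the polygon space $\mathrm{Poly}(\vec\lambda)$ are in bijection with the affine growth diagrams of type $\vec\lambda$.
   Context: Let $\mathcal O=\mathbb{C}[[t]]$, $\mathcal K=\mathbb{C}((t))$, $G=GL_m$, and $Gr=G(\mathcal K)/G(\mathcal O)$ the affine Grassmannian; for a dominant weight $\lambda$ let $t^\lambda\in Gr$ be the corresponding torus fixed point ($t^0$ the base point). For $p,q\in Gr$ the distance $d(p,q)$ is the unique dominant weight $\lambda$ such that $(gp,gq)=(t^0,t^\lambda)$ for some $g\in G(\mathcal K)$. The polygon space is $\mathrm{Poly}(\vec\lambda)=\{(g_1,\ldots,g_{n-1})\in Gr^{n-1}: d(t^0,g_1)=\lambda^1,\ d(g_{i-1},g_i)=\lambda^i\ (2\le i\le n-1),\ d(g_{n-1},t^0)=\lambda^n\}$. Dominant weights of $GL_m$ are weakly decreasing sequences of $m$ integers; $\emptyset$ is the zero weight; minuscule weights are $\omega_i=(1^i,0^{m-i})$ and $\omega_i^*=(0^{m-i},(-1)^i)$, $1\le i\le m$; $\mathrm{sort}(v)$ rearranges $v\in\mathbb{Z}^m$ in weakly decreasing order. Staircase vertices: $V=\{(i,j)\in\mathbb{Z}^2: i\le j\le i+n\}$; unit squares for $i+1\le j\le i+n-1$ with NW $(i,j)$, NE $(i,j+1)$, SW $(i+1,j)$, SE $(i+1,j+1)$. An affine growth diagram of type $\vec\lambda$ is a map $L$ from $V$ to dominant weights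 with $L(i,i)=L(i,i+n)=\emptyset$, $L(i,i+1)=\lambda^r$ ($r\in\{1,\ldots,n\}$, $r\equiv i\bmod n$), and $L(\mathrm{SE})=\mathrm{sort}(L(\mathrm{SW})+L(\mathrm{NE})-L(\mathrm{NW}))$ on every unit square. *)

theory Defs
  imports
    "HOL-Analysis.Abstract_Topology"
    "HOL-Algebra.Left_Coset"
    "HOL-Computational_Algebra.Formal_Laurent_Series"
    "HOL-Number_Theory.Cong"
    "Jordan_Normal_Form.Matrix"
begin

section \<open>Dominant weights of \<open>GL\<^sub>m\<close>\<close>

definition dominant :: "nat \<Rightarrow> int list set" where
  "dominant m = {\<mu>. length \<mu> = m \<and> sorted_wrt (\<ge>) \<mu>}"

definition zero_weight :: "nat \<Rightarrow> int list" where
  "zero_weight m = replicate m 0"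

definition minuscule :: "nat \<Rightarrow> int list set" where
  "minuscule m =
     (\<Union>i\<in>{1..m}. {replicate i 1 @ replicate (m - i) 0, replicate (m - i) 0 @ replicate i (- 1)})"

definition sort_weight :: "int list \<Rightarrow> int list" where
  "sort_weight v = rev (sort v)"


section \<open>The affine Grassmannian\<close>

definition GL_K :: "nat \<Rightarrow> complex fls mat monoid" where
  "GL_K m = units_of (ring_mat TYPE(complex fls) m ())"

definition GL_O :: "nat \<Rightarrow> complex fls mat set" where
  "GL_O m = map_mat fps_to_fls ` Units (ring_mat TYPE(complex fps) m ())"

definition Gr :: "nat \<Rightarrow> complex fls mat set set" where
  "Gr m = lcosets\<^bsub>GL_K m\<^esub> (GL_O m)"

definition torus_point :: "nat \<Rightarrow> int list \<Rightarrow> complex fls mat set" where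
  "torus_point m \<mu> = mat_diag m (\<lambda>k. fls_X_intpow (\<mu> ! k)) <#\<^bsub>GL_K m\<^esub> GL_O m"

definition base_point :: "nat \<Rightarrow> complex fls mat set" where
  "base_point m = torus_point m (zero_weight m)"

definition dist_Gr :: "nat \<Rightarrow> complex fls mat set \<Rightarrow> complex fls mat set \<Rightarrow> int list" where
  "dist_Gr m p q =
     (THE \<mu>. \<mu> \<in> dominant m \<and>
        (\<exists>g\<in>carrier (GL_K m). g <#\<^bsub>GL_K m\<^esub> p = base_point m \<and> g <#\<^bsub>GL_K m\<^esub> q = torus_point m \<mu>))"


section \<open>Zariski topology\<close>

text \<open>
  \<open>GL\<^sub>m(K)\<close> is the set of complex points of an ind-scheme: the increasing union of the affine
  schemes of those \<open>g\<close> for which the entries of \<open>g\<close> and of its inverse have poles of order at most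
  \<open>N\<close>; coordinates are the Laurent coefficients of these entries. A subset of the power
  \<open>GL\<^sub>m(K)\<^sup>I\<close> is closed iff on every piece it is the common zero locus of a family of polynomials in
  the coordinates of all components (so this is not the product topology).
\<close>

definition loop_power :: "nat \<Rightarrow> 'i set \<Rightarrow> ('i \<Rightarrow> complex fls mat) set" where
  "loop_power m I = (\<Pi>\<^sub>E i\<in>I. carrier (GL_K m))"

definition loop_piece :: "nat \<Rightarrow> 'i set \<Rightarrow> nat \<Rightarrow> ('i \<Rightarrow> complex fls mat) set" where
  "loop_piece m I N = {g \<in> loop_power m I. \<forall>i\<in>I. \<forall>a<m. \<forall>b<m. \<forall>e < - int N.
     fls_nth (g i $$ (a, b)) e = 0 \<and> fls_nth ((inv\<^bsub>GL_K m\<^esub> (g i)) $$ (a, b)) e = 0}"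

inductive_set loop_polys :: "nat \<Rightarrow> 'i set \<Rightarrow> (('i \<Rightarrow> complex fls mat) \<Rightarrow> complex) set"
  for m :: nat and I :: "'i set"
where
  const: "(\<lambda>_. c) \<in> loop_polys m I"
| entry: "\<lbrakk>i \<in> I; a < m; b < m\<rbrakk> \<Longrightarrow> (\<lambda>g. fls_nth (g i $$ (a, b)) e) \<in> loop_polys m I"
| inv_entry: "\<lbrakk>i \<in> I; a < m; b < m\<rbrakk>
    \<Longrightarrow> (\<lambda>g. fls_nth ((inv\<^bsub>GL_K m\<^esub> (g i)) $$ (a, b)) e) \<in> loop_polys m I"
| add: "\<lbrakk>p \<in> loop_polys m I; q \<in> loop_polys m I\<rbrakk> \<Longrightarrow> (\<lambda>g. p g + q g) \<in> loop_polys m I"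
| mult: "\<lbrakk>p \<in> loop_polys m I; q \<in> loop_polys m I\<rbrakk> \<Longrightarrow> (\<lambda>g. p g * q g) \<in> loop_polys m I"

definition loop_closed :: "nat \<Rightarrow> 'i set \<Rightarrow> ('i \<Rightarrow> complex fls mat) set \<Rightarrow> bool" where
  "loop_closed m I Z \<longleftrightarrow> Z \<subseteq> loop_power m I \<and>
     (\<forall>N. \<exists>P \<subseteq> loop_polys m I. Z \<inter> loop_piece m I N = {g \<in> loop_piece m I N. \<forall>p\<in>P. p g = 0})"

definition loop_top :: "nat \<Rightarrow> 'i set \<Rightarrow> ('i \<Rightarrow> complex fls mat) topology" where
  "loop_top m I = topology (\<lambda>U. U \<subseteq> loop_power m I \<and> loop_closed m I (loop_power m I - U))"

lemma loop_closedD: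
  assumes "loop_closed m I Z"
  obtains P where "P \<subseteq> loop_polys m I"
    "Z \<inter> loop_piece m I N = {g \<in> loop_piece m I N. \<forall>p\<in>P. p g = 0}"
  using assms unfolding loop_closed_def by meson

lemma loop_closed_Un:
  assumes "loop_closed m I A" and "loop_closed m I B"
  shows "loop_closed m I (A \<union> B)"
  unfolding loop_closed_def
proof (intro conjI allI)
  show "A \<union> B \<subseteq> loop_power m I"
    using assms by (auto simp: loop_closed_def)
  fix N
  let ?S = "loop_piece m I N"
  obtain P where P: "P \<subseteq> loop_polys m I" "A \<inter> ?S = {g \<in> ?S. \<forall>p\<in>P. p g = 0}"
    using loop_closedD[OF assms(1)] .
  obtain Q where Q: "Q \<subseteq> loop_polys m I" "B \<inter> ?S = {g \<in> ?S. \<forall>q\<in>Q. q g = 0}"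
    using loop_closedD[OF assms(2)] .
  let ?R = "{\<lambda>g. p g * q g |p q. p \<in> P \<and> q \<in> Q}"
  have "?R \<subseteq> loop_polys m I"
    using P(1) Q(1) by (auto intro: loop_polys.mult)
  moreover have "(A \<union> B) \<inter> ?S = {g \<in> ?S. \<forall>r\<in>?R. r g = 0}"
  proof (intro Set.set_eqI iffI)
    fix g assume "g \<in> (A \<union> B) \<inter> ?S"
    then have "g \<in> ?S" and "g \<in> A \<inter> ?S \<or> g \<in> B \<inter> ?S" by auto
    then show "g \<in> {g \<in> ?S. \<forall>r\<in>?R. r g = 0}"
      unfolding P(2) Q(2) by auto
  next
    fix g assume g: "g \<in> {g \<in> ?S. \<forall>r\<in>?R. r g = 0}"
    then have "p g * q g = 0" if "p \<in> P" "q \<in> Q" for p q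
      using that by fastforce
    then have "(\<forall>p\<in>P. p g = 0) \<or> (\<forall>q\<in>Q. q g = 0)" by auto
    then have "g \<in> A \<inter> ?S \<or> g \<in> B \<inter> ?S"
      unfolding P(2) Q(2) using g by auto
    then show "g \<in> (A \<union> B) \<inter> ?S" by auto
  qed
  ultimately show "\<exists>R\<subseteq>loop_polys m I. (A \<union> B) \<inter> ?S = {g \<in> ?S. \<forall>r\<in>R. r g = 0}"
    by blast
qed

lemma loop_closed_Inter:
  assumes "\<And>Z. Z \<in> F \<Longrightarrow> loop_closed m I Z"
  shows "loop_closed m I (loop_power m I \<inter> \<Inter>F)"
  unfolding loop_closed_def
proof (intro conjI allI)
  show "loop_power m I \<inter> \<Inter>F \<subseteq> loop_power m I" by blast
  fix N
  let ?S = "loop_piece m I N"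
  have "\<exists>P\<subseteq>loop_polys m I. Z \<inter> ?S = {g \<in> ?S. \<forall>p\<in>P. p g = 0}" if "Z \<in> F" for Z
    by (rule loop_closedD[OF assms[OF that], of N]) (intro exI conjI)
  then have "\<exists>P. \<forall>Z\<in>F. P Z \<subseteq> loop_polys m I \<and> Z \<inter> ?S = {g \<in> ?S. \<forall>p\<in>P Z. p g = 0}"
    by (intro bchoice ballI)
  then obtain P where
      P: "\<forall>Z\<in>F. P Z \<subseteq> loop_polys m I \<and> Z \<inter> ?S = {g \<in> ?S. \<forall>p\<in>P Z. p g = 0}"
    by (rule exE)
  have sub: "?S \<subseteq> loop_power m I" by (auto simp: loop_piece_def)
  have mem: "g \<in> Z \<longleftrightarrow> (\<forall>p\<in>P Z. p g = 0)" if "Z \<in> F" "g \<in> ?S" for Z g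
  proof -
    have "Z \<inter> ?S = {g \<in> ?S. \<forall>p\<in>P Z. p g = 0}" using P that(1) by blast
    then show ?thesis using that(2) by blast
  qed
  have "loop_power m I \<inter> \<Inter>F \<inter> ?S = {g \<in> ?S. \<forall>p\<in>\<Union>(P ` F). p g = 0}"
    using sub mem by auto
  moreover have "\<Union>(P ` F) \<subseteq> loop_polys m I"
    using P by blast
  ultimately show "\<exists>R\<subseteq>loop_polys m I. loop_power m I \<inter> \<Inter>F \<inter> ?S = {g \<in> ?S. \<forall>p\<in>R. p g = 0}"
    by (intro exI conjI)
qed

lemma loop_closed_empty: "loop_closed m I {}"
  unfolding loop_closed_def
  by (auto intro!: exI[of _ "{\<lambda>_. 1}"] loop_polys.const)

lemma openin_loop_top:
  "openin (loop_top m I) U \<longleftrightarrow> U \<subseteq> loop_power m I \<and> loop_closed m I (loop_power m I - U)"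
proof -
  have "istopology (\<lambda>U. U \<subseteq> loop_power m I \<and> loop_closed m I (loop_power m I - U))"
    unfolding istopology_def
  proof (intro conjI allI impI)
    fix U V
    assume "U \<subseteq> loop_power m I \<and> loop_closed m I (loop_power m I - U)"
      and "V \<subseteq> loop_power m I \<and> loop_closed m I (loop_power m I - V)"
    then show "U \<inter> V \<subseteq> loop_power m I" "loop_closed m I (loop_power m I - U \<inter> V)"
      by (auto simp: Diff_Int intro: loop_closed_Un)
  next
    fix F
    assume F: "\<forall>U\<in>F. U \<subseteq> loop_power m I \<and> loop_closed m I (loop_power m I - U)"
    then show "\<Union>F \<subseteq> loop_power m I" by blast
    have "loop_power m I - \<Union>F = loop_power m I \<inter> \<Inter>((\<lambda>U. loop_power m I - U) ` F)"
      by auto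
    moreover have "loop_closed m I (loop_power m I \<inter> \<Inter>((\<lambda>U. loop_power m I - U) ` F))"
      by (rule loop_closed_Inter) (use F in blast)
    ultimately show "loop_closed m I (loop_power m I - \<Union>F)"
      by simp
  qed
  then show ?thesis
    by (simp add: loop_top_def topology_inverse')
qed

lemma topspace_loop_top: "topspace (loop_top m I) = loop_power m I"
proof
  show "topspace (loop_top m I) \<subseteq> loop_power m I"
    using openin_topspace[of "loop_top m I"] unfolding openin_loop_top by (rule conjunct1)
  have "openin (loop_top m I) (loop_power m I)"
    by (simp add: openin_loop_top loop_closed_empty)
  then show "loop_power m I \<subseteq> topspace (loop_top m I)"
    by (rule openin_subset)
qed

lemma closedin_loop_top: "closedin (loop_top m I) Z \<longleftrightarrow> loop_closed m I Z"
proof -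
  have "Z \<subseteq> loop_power m I" if "loop_closed m I Z"
    using that unfolding loop_closed_def by (rule conjunct1)
  then show ?thesis
    by (auto simp: closedin_def topspace_loop_top openin_loop_top double_diff)
qed

text \<open>
  The Zariski topology on a power of the affine Grassmannian is the quotient topology for the
  \<open>GL\<^sub>m(O)\<^sup>I\<close>-torsor \<open>GL\<^sub>m(K)\<^sup>I \<rightarrow> Gr\<^sup>I\<close>.
\<close>

definition Gr_power :: "nat \<Rightarrow> 'i set \<Rightarrow> ('i \<Rightarrow> complex fls mat set) set" where
  "Gr_power m I = (\<Pi>\<^sub>E i\<in>I. Gr m)"

definition Gr_proj :: "nat \<Rightarrow> 'i set \<Rightarrow> ('i \<Rightarrow> complex fls mat) \<Rightarrow> ('i \<Rightarrow> complex fls mat set)" where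
  "Gr_proj m I g = (\<lambda>i\<in>I. g i <#\<^bsub>GL_K m\<^esub> GL_O m)"

definition Gr_top :: "nat \<Rightarrow> 'i set \<Rightarrow> ('i \<Rightarrow> complex fls mat set) topology" where
  "Gr_top m I = topology (\<lambda>U. U \<subseteq> Gr_power m I \<and>
     openin (loop_top m I) {g \<in> loop_power m I. Gr_proj m I g \<in> U})"

lemma openin_Gr_top:
  "openin (Gr_top m I) U \<longleftrightarrow>
     U \<subseteq> Gr_power m I \<and> openin (loop_top m I) {g \<in> loop_power m I. Gr_proj m I g \<in> U}"
proof -
  have "istopology (\<lambda>U. U \<subseteq> Gr_power m I \<and>
      openin (loop_top m I) {g \<in> loop_power m I. Gr_proj m I g \<in> U})"
    unfolding istopology_def
  proof (intro conjI allI impI)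
    fix U V
    assume U: "U \<subseteq> Gr_power m I \<and> openin (loop_top m I) {g \<in> loop_power m I. Gr_proj m I g \<in> U}"
      and V: "V \<subseteq> Gr_power m I \<and> openin (loop_top m I) {g \<in> loop_power m I. Gr_proj m I g \<in> V}"
    then show "U \<inter> V \<subseteq> Gr_power m I" by blast
    have "{g \<in> loop_power m I. Gr_proj m I g \<in> U \<inter> V} =
        {g \<in> loop_power m I. Gr_proj m I g \<in> U} \<inter> {g \<in> loop_power m I. Gr_proj m I g \<in> V}"
      by blast
    then show "openin (loop_top m I) {g \<in> loop_power m I. Gr_proj m I g \<in> U \<inter> V}"
      using U V by (simp add: openin_Int)
  next
    fix F
    assume F: "\<forall>U\<in>F. U \<subseteq> Gr_power m I \<and>
      openin (loop_top m I) {g \<in> loop_power m I. Gr_proj m I g \<in> U}"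
    then show "\<Union>F \<subseteq> Gr_power m I" by blast
    have "{g \<in> loop_power m I. Gr_proj m I g \<in> \<Union>F} =
        (\<Union>U\<in>F. {g \<in> loop_power m I. Gr_proj m I g \<in> U})"
      by blast
    then show "openin (loop_top m I) {g \<in> loop_power m I. Gr_proj m I g \<in> \<Union>F}"
      using F by auto
  qed
  then show ?thesis
    by (simp add: Gr_top_def topology_inverse')
qed

lemma Gr_proj_image: "Gr_proj m I ` loop_power m I = Gr_power m I"
proof (intro subset_antisym subsetI)
  fix x assume "x \<in> Gr_proj m I ` loop_power m I"
  then show "x \<in> Gr_power m I"
    by (auto simp: Gr_proj_def loop_power_def Gr_power_def Gr_def LCOSETS_def PiE_def Pi_def)
next
  fix x assume x: "x \<in> Gr_power m I"
  then have "\<forall>i\<in>I. \<exists>g\<in>carrier (GL_K m). x i = g <#\<^bsub>GL_K m\<^esub> GL_O m"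
    by (auto simp: Gr_power_def Gr_def LCOSETS_def PiE_def Pi_def)
  then obtain h where h: "\<And>i. i \<in> I \<Longrightarrow> h i \<in> carrier (GL_K m) \<and> x i = h i <#\<^bsub>GL_K m\<^esub> GL_O m"
    by metis
  have "restrict h I \<in> loop_power m I"
    using h by (auto simp: loop_power_def)
  moreover have "Gr_proj m I (restrict h I) = x"
    using h x by (auto simp: Gr_proj_def Gr_power_def PiE_def extensional_def fun_eq_iff)
  ultimately show "x \<in> Gr_proj m I ` loop_power m I"
    by blast
qed

lemma topspace_Gr_top: "topspace (Gr_top m I) = Gr_power m I"
proof
  show "topspace (Gr_top m I) \<subseteq> Gr_power m I"
    using openin_topspace[of "Gr_top m I"] unfolding openin_Gr_top by (rule conjunct1)
  have "{g \<in> loop_power m I. Gr_proj m I g \<in> Gr_power m I} = topspace (loop_top m I)"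
    using Gr_proj_image[of m I] by (auto simp: topspace_loop_top)
  then have "openin (Gr_top m I) (Gr_power m I)"
    by (simp add: openin_Gr_top)
  then show "Gr_power m I \<subseteq> topspace (Gr_top m I)"
    by (rule openin_subset)
qed

lemma quotient_map_Gr_proj: "quotient_map (loop_top m I) (Gr_top m I) (Gr_proj m I)"
  by (auto simp: quotient_map_def topspace_loop_top topspace_Gr_top Gr_proj_image openin_Gr_top)


section \<open>Irreducible components\<close>

definition irreducible_in :: "'a topology \<Rightarrow> 'a set \<Rightarrow> bool" where
  "irreducible_in X S \<longleftrightarrow> S \<subseteq> topspace X \<and> S \<noteq> {} \<and>
     (\<forall>A B. closedin X A \<and> closedin X B \<and> S \<subseteq> A \<union> B \<longrightarrow> S \<subseteq> A \<or> S \<subseteq> B)"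

definition irreducible_components :: "'a topology \<Rightarrow> 'a set set" where
  "irreducible_components X =
     {S. irreducible_in X S \<and> (\<forall>T. irreducible_in X T \<and> S \<subseteq> T \<longrightarrow> T = S)}"


section \<open>Polygon spaces\<close>

text \<open>
  The vertices of a polygon are indexed by \<open>0, \<dots>, n\<close>, with both end vertices at the base point.
\<close>

definition polygon_vertex ::
    "nat \<Rightarrow> nat \<Rightarrow> (nat \<Rightarrow> complex fls mat set) \<Rightarrow> nat \<Rightarrow> complex fls mat set" where
  "polygon_vertex m n g i = (if i \<in> {1..<n} then g i else base_point m)"

definition Poly :: "nat \<Rightarrow> nat \<Rightarrow> (nat \<Rightarrow> int list) \<Rightarrow> (nat \<Rightarrow> complex fls mat set) set" where
  "Poly m n lam = {g \<in> Gr_power m {1..<n}.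
     \<forall>i\<in>{1..n}. dist_Gr m (polygon_vertex m n g (i - 1)) (polygon_vertex m n g i) = lam i}"

definition Poly_top ::
    "nat \<Rightarrow> nat \<Rightarrow> (nat \<Rightarrow> int list) \<Rightarrow> (nat \<Rightarrow> complex fls mat set) topology" where
  "Poly_top m n lam = subtopology (Gr_top m {1..<n}) (Poly m n lam)"


section \<open>Affine growth diagrams\<close>

definition staircase :: "nat \<Rightarrow> (int \<times> int) set" where
  "staircase n = {(i, j). i \<le> j \<and> j \<le> i + int n}"

definition affine_growth_diagrams ::
    "nat \<Rightarrow> nat \<Rightarrow> (nat \<Rightarrow> int list) \<Rightarrow> (int \<times> int \<Rightarrow> int list) set" where
  "affine_growth_diagrams m n lam = {L \<in> staircase n \<rightarrow>\<^sub>E dominant m.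
     (\<forall>i. L (i, i) = zero_weight m \<and> L (i, i + int n) = zero_weight m) \<and>
     (\<forall>i. \<forall>r\<in>{1..n}. [int r = i] (mod int n) \<longrightarrow> L (i, i + 1) = lam r) \<and>
     (\<forall>i j. i + 1 \<le> j \<and> j \<le> i + int n - 1 \<longrightarrow>
        L (i + 1, j + 1) =
          sort_weight (map (\<lambda>k. L (i + 1, j) ! k + L (i, j + 1) ! k - L (i, j) ! k) [0..<m]))}"

end

theory Submission
  imports Defs "Jordan_Normal_Form.Determinant"
begin

text \<open>
  The vertices of a polygon are the partial products of factors \<open>p\<^sub>i t\<^bsup>w\<^sub>i\<^esup>\<close>, with \<open>p\<^sub>i\<close> constant and \<open>w\<^sub>i\<close> a
  rearrangement of \<open>\<lambda>\<^sup>i\<close>. Recording the distances from the base point decomposes the polygon space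
  into pieces indexed by minuscule paths, the closed sequences of dominant weights with steps \<open>w\<^sub>i\<close>;
  each piece is parametrized by a product of parabolic groups and hence irreducible. Recording the
  Schubert cells instead gives a cover by affine spaces, one for each sequence \<open>w\<close> with sum zero, of
  dimension \<open>\<Sum>\<^sub>i\<^sub><\<^sub>n inv(w\<^sub>i)\<close>. The sum over \<open>i \<le> n\<close> of these numbers of inversions does not depend on
  \<open>w\<close>, and \<open>inv(w\<^sub>n) = 0\<close> if \<open>w\<close> comes from a path, so the cells of the paths have maximal dimension and
  a cell of a path lies in the closure of no other cell. Therefore the closures of the pieces are
  the irreducible components. Finally, a row of an affine growth diagram is a minuscule path, and the
  local rule turns each such path into the next row, bijectively, because it can be cancelled and
  because \<open>n\<close> steps lead back to the same finite set of paths.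
\<close>

section \<open>Laurent series and their valuation\<close>

text \<open>Dimension enters only as a count of monomials: more polynomial functions than variables
  are algebraically dependent, whereas the coordinates of a cell are independent. To compare two
  cells, both must be described by the same functions. These are Pluecker coordinates of the
  lattices at the vertices, which are defined only up to a factor depending on a frame; hence
  products over all vertices generate a graded ring, and its homogeneous elements have well-defined
  zero sets in \<open>Gr\<close>. Such an element becomes a function on a cell once a Pluecker
  coordinate that is constant on this cell is set to 1. The hard point is that every coordinate of a
  cell arises in this way. The closing condition at the last vertex is not imposed on the cells:
  they live in the space of the first \<open>n - 1\<close> steps and may stick out of the polygon
  space, which they only have to cover. This is recovered from the Euclidean length, which the local
  rule does not increase and which, for a given sum, is least on a minuscule orbit.\<close>

definition val_ge :: "int \<Rightarrow> complex fls \<Rightarrow> bool" where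
  "val_ge d f \<longleftrightarrow> (\<forall>k<d. fls_nth f k = 0)"

definition tp :: "int \<Rightarrow> complex fls" where
  "tp z = fls_X_intpow z"

lemma fls_nth_tp: "fls_nth (tp z) k = (if k = z then 1 else 0)"
  by (auto simp: tp_def)

lemma tp_0 [simp]: "tp 0 = 1"
  by (simp add: tp_def)

lemma tp_add: "tp (a + b) = tp a * tp b"
  by (simp add: tp_def fls_X_intpow_times_fls_X_intpow)

lemma tp_nonzero [simp]: "tp z \<noteq> 0"
  by (simp add: tp_def)

lemma fls_nth_tp_mult [simp]:
  "fls_nth (tp z * f) k = fls_nth f (k - z)" "fls_nth (f * tp z) k = fls_nth f (k - z)"
  by (simp_all add: tp_def fls_X_intpow_times_conv_shift)

lemma val_ge_0 [simp]: "val_ge d 0"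
  by (simp add: val_ge_def)

lemma val_ge_const [simp]: "val_ge 0 (fls_const c)"
  by (simp add: val_ge_def)

lemma val_ge_1 [simp]: "val_ge 0 1"
  by (simp add: val_ge_def)

lemma val_ge_tp: "val_ge d (tp z) \<longleftrightarrow> d \<le> z"
  by (force simp: val_ge_def fls_nth_tp)

lemma val_ge_mono: "val_ge d f \<Longrightarrow> e \<le> d \<Longrightarrow> val_ge e f"
  by (auto simp: val_ge_def)

text \<open>The disjunct \<open>f = 0\<close> is what a definition through
  \<open>fls_subdegree\<close> would carry along everywhere, since the zero series has subdegree 0;
  hence the definition by coefficients.\<close>

lemma val_ge_iff: "val_ge d f \<longleftrightarrow> f = 0 \<or> d \<le> fls_subdegree f"
  unfolding val_ge_def
  by (metis fls_eq0_below_subdegree fls_zero_nth leI less_le_trans nth_fls_subdegree_nonzero)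

lemma val_ge_add: "val_ge d f \<Longrightarrow> val_ge d g \<Longrightarrow> val_ge d (f + g)"
  and val_ge_minus: "val_ge d f \<Longrightarrow> val_ge d (- f)"
  and val_ge_diff: "val_ge d f \<Longrightarrow> val_ge d g \<Longrightarrow> val_ge d (f - g)"
  by (auto simp: val_ge_def)

lemma val_ge_mult: "val_ge d f \<Longrightarrow> val_ge e g \<Longrightarrow> val_ge (d + e) (f * g)"
  by (cases "f = 0 \<or> g = 0") (auto simp: val_ge_iff)

lemma val_ge_mult0: "val_ge 0 f \<Longrightarrow> val_ge 0 g \<Longrightarrow> val_ge 0 (f * g)"
  using val_ge_mult[of 0 f 0 g] by simp

lemma val_ge_sum: "(\<And>x. x \<in> A \<Longrightarrow> val_ge d (f x)) \<Longrightarrow> val_ge d (\<Sum>x\<in>A. f x)"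
  by (induction A rule: infinite_finite_induct) (auto intro: val_ge_add)

lemma val_ge_prod0: "(\<And>x. x \<in> A \<Longrightarrow> val_ge 0 (f x)) \<Longrightarrow> val_ge 0 (\<Prod>x\<in>A. f x)"
  by (induction A rule: infinite_finite_induct) (auto intro: val_ge_mult0)

lemma val_ge_tp_mult: "val_ge d (tp z * f) \<longleftrightarrow> val_ge (d - z) f"
  unfolding val_ge_def fls_nth_tp_mult
  by (metis add_diff_cancel_right' add_less_cancel_right diff_add_cancel)

lemma val_ge_mult_tp: "val_ge d (f * tp z) \<longleftrightarrow> val_ge (d - z) f"
  using val_ge_tp_mult[of d z f] by (simp add: mult.commute)

lemma fls_nth_sum: "fls_nth (\<Sum>x\<in>A. f x) k = (\<Sum>x\<in>A. fls_nth (f x) k)"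
  by (induction A rule: infinite_finite_induct) auto

text \<open>The range of summation depends on the bounds \<open>d\<close> and \<open>e\<close> only,
  not on the true subdegrees. For a family of series with a common bound, each coefficient of a
  product is thus one fixed polynomial in the coefficients of the factors.\<close>

lemma fls_nth_mult_val_ge:
  assumes "val_ge d f" and "val_ge e g"
  shows "fls_nth (f * g) k = (\<Sum>i=d..k - e. fls_nth f i * fls_nth g (k - i))"
proof (cases "f = 0 \<or> g = 0")
  case False
  then have le: "d \<le> fls_subdegree f" "e \<le> fls_subdegree g"
    using assms by (auto simp: val_ge_iff)
  have "fls_nth (f * g) k
      = (\<Sum>i=fls_subdegree f..k - fls_subdegree g. fls_nth f i * fls_nth g (k - i))"
    by (rule fls_times_nth(2))
  also have "\<dots> = (\<Sum>i=d..k - e. fls_nth f i * fls_nth g (k - i))"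
  proof (rule sum.mono_neutral_left)
    show "{fls_subdegree f..k - fls_subdegree g} \<subseteq> {d..k - e}"
      using le by auto
    show "\<forall>i\<in>{d..k - e} - {fls_subdegree f..k - fls_subdegree g}. fls_nth f i * fls_nth g (k - i) = 0"
    proof
      fix i assume "i \<in> {d..k - e} - {fls_subdegree f..k - fls_subdegree g}"
      then have "i < fls_subdegree f \<or> k - i < fls_subdegree g" by auto
      then show "fls_nth f i * fls_nth g (k - i) = 0" by auto
    qed
  qed simp
  finally show ?thesis .
qed auto

lemma fls_nth_mult_lead:
  assumes "val_ge d f" and "val_ge e g"
  shows "fls_nth (f * g) (d + e) = fls_nth f d * fls_nth g e"
  using fls_nth_mult_val_ge[OF assms, of "d + e"] by simp

lemma fls_nth_mult_lead0:
  "val_ge 0 f \<Longrightarrow> val_ge 0 g \<Longrightarrow> fls_nth (f * g) 0 = fls_nth f 0 * fls_nth g 0"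
  using fls_nth_mult_lead[of 0 f 0 g] by simp

lemma val_ge_inverse: "val_ge 0 f \<Longrightarrow> fls_nth f 0 \<noteq> 0 \<Longrightarrow> val_ge 0 (inverse f)"
proof -
  assume "val_ge 0 f" "fls_nth f 0 \<noteq> 0"
  then have "fls_subdegree f = 0"
    by (intro fls_subdegree_eqI) (auto simp: val_ge_def)
  then show ?thesis
    by (simp add: val_ge_iff)
qed

lemma val_ge_0_iff_fps: "val_ge 0 f \<longleftrightarrow> f \<in> range fps_to_fls"
proof
  assume "val_ge 0 f"
  then have "fps_to_fls (fls_regpart f) = f"
    by (cases "f = 0") (auto simp: val_ge_iff)
  then show "f \<in> range fps_to_fls" by (metis rangeI)
qed (auto simp: val_ge_def)

interpretation fls_const_hom: comm_ring_hom "fls_const :: complex \<Rightarrow> complex fls"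
  by standard (auto simp: fls_plus_const)

interpretation fps_to_fls_hom: inj_comm_ring_hom "fps_to_fls :: complex fps \<Rightarrow> complex fls"
  by standard (auto simp: fls_times_fps_to_fls)


section \<open>The loop group and its integral points\<close>

lemma mult_mat_index:
  assumes "A \<in> carrier_mat r c" "B \<in> carrier_mat c s" "a < r" "b < s"
  shows "(A * B) $$ (a, b) = (\<Sum>k<c. A $$ (a, k) * B $$ (k, b))"
  using assms by (auto simp: scalar_prod_def atLeast0LessThan intro!: sum.cong)

definition mat_val_ge :: "nat \<Rightarrow> int \<Rightarrow> complex fls mat \<Rightarrow> bool" where
  "mat_val_ge m d A \<longleftrightarrow> A \<in> carrier_mat m m \<and> (\<forall>a<m. \<forall>b<m. val_ge d (A $$ (a, b)))"

lemma permutes_lessThan: "f permutes {..<m} \<Longrightarrow> a < m \<Longrightarrow> f a < (m::nat)"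
  using permutes_in_image[of f "{..<m}" a] by simp

lemma mat_val_ge_mult: "mat_val_ge m d A \<Longrightarrow> mat_val_ge m e B \<Longrightarrow> mat_val_ge m (d + e) (A * B)"
  by (auto simp: mat_val_ge_def mult_mat_index[of _ m m _ m] simp del: index_mult_mat(1)
      intro!: val_ge_sum val_ge_mult)

lemma mat_val_ge_mult0: "mat_val_ge m 0 A \<Longrightarrow> mat_val_ge m 0 B \<Longrightarrow> mat_val_ge m 0 (A * B)"
  using mat_val_ge_mult[of m 0 A 0 B] by simp

lemma mat_val_ge_one [simp]: "mat_val_ge m 0 (1\<^sub>m m)"
  by (auto simp: mat_val_ge_def)

lemma val_ge_signof: "val_ge 0 (signof p)"
  by (cases "sign p = 1") (auto simp: sign_def val_ge_minus)

lemma val_ge_det: "mat_val_ge m 0 A \<Longrightarrow> val_ge 0 (det A)"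
  unfolding mat_val_ge_def
  by (auto simp: det_def' permutes_in_image intro!: val_ge_sum val_ge_mult0 val_ge_signof val_ge_prod0)

lemma mat_val_ge_delete:
  "mat_val_ge (Suc m) 0 A \<Longrightarrow> mat_val_ge m 0 (mat_delete A i j)"
  by (auto simp: mat_val_ge_def mat_delete_def)

lemma mat_val_ge_adj:
  assumes "mat_val_ge m 0 A"
  shows "mat_val_ge m 0 (adj_mat A)"
proof (cases m)
  case 0
  then show ?thesis using assms adj_mat(1)[of A m] by (auto simp: mat_val_ge_def)
next
  case (Suc k)
  have "val_ge 0 ((- 1) ^ i :: complex fls)" for i
    by (induction i) (auto intro: val_ge_minus)
  moreover have "val_ge 0 (det (mat_delete A i j))" for i j
    using val_ge_det[OF mat_val_ge_delete] assms Suc by blast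
  ultimately show ?thesis
    using assms unfolding mat_val_ge_def
    by (auto simp: adj_mat_def cofactor_def intro!: val_ge_mult0)
qed

section \<open>The loop group and its integral points as sets of matrices\<close>

lemma carrier_GL_K: "A \<in> carrier (GL_K m) \<longleftrightarrow> A \<in> carrier_mat m m \<and> det A \<noteq> 0"
proof -
  have "A \<in> carrier (GL_K m) \<longleftrightarrow> A \<in> Units (ring_mat TYPE(complex fls) m ())"
    by (simp add: GL_K_def units_of_def)
  also have "\<dots> \<longleftrightarrow> A \<in> carrier_mat m m \<and> det A \<noteq> 0"
    using det_non_zero_imp_unit[of A m "()"] unit_imp_det_non_zero[of A m "()"]
    by (auto simp: Units_def ring_mat_def)
  finally show ?thesis .
qed

lemma mult_GL_K [simp]: "A \<otimes>\<^bsub>GL_K m\<^esub> B = A * B"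
  by (simp add: GL_K_def units_of_def ring_mat_def)

lemma one_GL_K [simp]: "\<one>\<^bsub>GL_K m\<^esub> = 1\<^sub>m m"
  by (simp add: GL_K_def units_of_def ring_mat_def)

lemma group_GL_K: "group (GL_K m)"
proof -
  interpret r: semiring "ring_mat TYPE(complex fls) m ()"
    by (rule semiring_mat)
  show ?thesis
    unfolding GL_K_def by (rule r.units_group)
qed

lemma GL_K_carrier_mat: "A \<in> carrier (GL_K m) \<Longrightarrow> A \<in> carrier_mat m m"
  by (simp add: carrier_GL_K)

lemma GL_K_inv:
  assumes "A \<in> carrier (GL_K m)"
  shows "inv\<^bsub>GL_K m\<^esub> A \<in> carrier (GL_K m)" "A * inv\<^bsub>GL_K m\<^esub> A = 1\<^sub>m m" "inv\<^bsub>GL_K m\<^esub> A * A = 1\<^sub>m m"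
  using group.inv_closed[OF group_GL_K assms] group.r_inv[OF group_GL_K assms]
    group.l_inv[OF group_GL_K assms] by simp_all

lemma GL_K_of_inverse:
  assumes "A \<in> carrier_mat m m" "B \<in> carrier_mat m m" "A * B = 1\<^sub>m m"
  shows "A \<in> carrier (GL_K m)" "B \<in> carrier (GL_K m)" "inv\<^bsub>GL_K m\<^esub> A = B" "B * A = 1\<^sub>m m"
proof -
  have "det A * det B = 1"
    using assms det_mult[of A m B] by simp
  then show *: "A \<in> carrier (GL_K m)" "B \<in> carrier (GL_K m)"
    using assms by (auto simp: carrier_GL_K)
  show BA: "B * A = 1\<^sub>m m"
    by (rule mat_mult_left_right_inverse[OF assms])
  show "inv\<^bsub>GL_K m\<^esub> A = B"
    using group.inv_equality[OF group_GL_K[of m], of B A] * BA by simp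
qed

lemma GL_K_mult:
  "A \<in> carrier (GL_K m) \<Longrightarrow> B \<in> carrier (GL_K m) \<Longrightarrow> A * B \<in> carrier (GL_K m)"
  by (auto simp: carrier_GL_K det_mult[of A m B])

lemma GL_K_one [simp]: "1\<^sub>m m \<in> carrier (GL_K m)"
  by (simp add: carrier_GL_K)

text \<open>Cramer's rule: the adjugate of an integral matrix is integral, and a determinant with
  nonzero constant term is a unit of \<open>C[[t]]\<close>.\<close>

lemma unit_det_inverse:
  assumes A: "mat_val_ge m 0 A" and d: "fls_nth (det A) 0 \<noteq> 0"
  obtains B where "mat_val_ge m 0 B" "A * B = 1\<^sub>m m" "B * A = 1\<^sub>m m"
proof
  let ?B = "inverse (det A) \<cdot>\<^sub>m adj_mat A"
  have Ac: "A \<in> carrier_mat m m" using A by (simp add: mat_val_ge_def)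
  have adj: "adj_mat A \<in> carrier_mat m m" "A * adj_mat A = det A \<cdot>\<^sub>m 1\<^sub>m m"
    "adj_mat A * A = det A \<cdot>\<^sub>m 1\<^sub>m m"
    using adj_mat[OF Ac] by auto
  have nz: "det A \<noteq> 0" using d by auto
  have "val_ge 0 (inverse (det A))"
    by (rule val_ge_inverse[OF val_ge_det[OF A] d])
  then show "mat_val_ge m 0 ?B"
    using mat_val_ge_adj[OF A] adj(1) by (auto simp: mat_val_ge_def intro!: val_ge_mult0)
  have "A * ?B = inverse (det A) \<cdot>\<^sub>m (det A \<cdot>\<^sub>m 1\<^sub>m m)"
    using Ac adj by (simp add: mult_smult_distrib)
  also have "\<dots> = 1\<^sub>m m"
    using nz by (intro eq_matI) auto
  finally show "A * ?B = 1\<^sub>m m" .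
  have "?B * A = inverse (det A) \<cdot>\<^sub>m (det A \<cdot>\<^sub>m 1\<^sub>m m)"
    using Ac adj by (simp add: mult_smult_assoc_mat[of _ m m])
  also have "\<dots> = 1\<^sub>m m"
    using nz by (intro eq_matI) auto
  finally show "?B * A = 1\<^sub>m m" .
qed

lemma mat_val_ge_0_lift:
  assumes "mat_val_ge m 0 A"
  obtains A' where "A' \<in> carrier_mat m m" "A = map_mat fps_to_fls A'"
proof
  let ?A' = "mat m m (\<lambda>ij. fls_regpart (A $$ ij))"
  have *: "fps_to_fls (fls_regpart (A $$ (a, b))) = A $$ (a, b)" if "a < m" "b < m" for a b
  proof -
    have "val_ge 0 (A $$ (a, b))" using assms that by (simp add: mat_val_ge_def)
    then obtain f where "A $$ (a, b) = fps_to_fls f" by (auto simp: val_ge_0_iff_fps)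
    then show ?thesis by simp
  qed
  show "?A' \<in> carrier_mat m m" by simp
  show "A = map_mat fps_to_fls ?A'"
    using assms by (intro eq_matI) (auto simp: mat_val_ge_def *)
qed

text \<open>The unit of \<open>C[[t]]\<close> is visible at the constant term of the determinant.
  From here on the group of integral points is handled only through this criterion and its
  consequences.\<close>

lemma GL_O_iff: "A \<in> GL_O m \<longleftrightarrow> mat_val_ge m 0 A \<and> fls_nth (det A) 0 \<noteq> 0"
proof
  assume "A \<in> GL_O m"
  then obtain A' where A': "A' \<in> Units (ring_mat TYPE(complex fps) m ())" "A = map_mat fps_to_fls A'"
    by (auto simp: GL_O_def)
  then obtain B' where c: "A' \<in> carrier_mat m m" "B' \<in> carrier_mat m m" "A' * B' = 1\<^sub>m m"
    by (auto simp: Units_def ring_mat_def)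
  have "det A' * det B' = 1"
    using c det_mult[of A' m B'] by simp
  then have "fps_nth (det A') 0 * fps_nth (det B') 0 = 1"
    by (metis fps_mult_nth_0 fps_one_nth)
  then have "fps_nth (det A') 0 \<noteq> 0" by auto
  then show "mat_val_ge m 0 A \<and> fls_nth (det A) 0 \<noteq> 0"
    using A'(2) c(1) by (auto simp: mat_val_ge_def val_ge_0_iff_fps)
next
  assume *: "mat_val_ge m 0 A \<and> fls_nth (det A) 0 \<noteq> 0"
  obtain B where B: "mat_val_ge m 0 B" "A * B = 1\<^sub>m m" "B * A = 1\<^sub>m m"
    using unit_det_inverse * by blast
  obtain A' where A': "A' \<in> carrier_mat m m" "A = map_mat fps_to_fls A'"
    using mat_val_ge_0_lift[OF conjunct1[OF *]] .
  obtain B' where B': "B' \<in> carrier_mat m m" "B = map_mat fps_to_fls B'"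
    using mat_val_ge_0_lift[OF B(1)] .
  have "map_mat fps_to_fls (A' * B') = (map_mat fps_to_fls (1\<^sub>m m) :: complex fls mat)"
    using A' B' B by (simp add: fps_to_fls_hom.mat_hom_mult[of _ m m _ m] fps_to_fls_hom.mat_hom_one)
  then have 1: "A' * B' = 1\<^sub>m m" by (rule fps_to_fls_hom.mat_hom_inj)
  have "map_mat fps_to_fls (B' * A') = (map_mat fps_to_fls (1\<^sub>m m) :: complex fls mat)"
    using A' B' B by (simp add: fps_to_fls_hom.mat_hom_mult[of _ m m _ m] fps_to_fls_hom.mat_hom_one)
  then have 2: "B' * A' = 1\<^sub>m m" by (rule fps_to_fls_hom.mat_hom_inj)
  have "A' \<in> Units (ring_mat TYPE(complex fps) m ())"
    using A'(1) B'(1) 1 2 by (auto simp: Units_def ring_mat_def)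
  then show "A \<in> GL_O m"
    using A'(2) by (auto simp: GL_O_def)
qed

lemma GL_O_carrier_mat: "A \<in> GL_O m \<Longrightarrow> A \<in> carrier_mat m m"
  by (simp add: GL_O_iff mat_val_ge_def)

lemma GL_O_GL_K: "A \<in> GL_O m \<Longrightarrow> A \<in> carrier (GL_K m)"
  by (auto simp: GL_O_iff carrier_GL_K mat_val_ge_def)

lemma GL_O_one [simp]: "1\<^sub>m m \<in> GL_O m"
  by (simp add: GL_O_iff)

lemma GL_O_mult: "A \<in> GL_O m \<Longrightarrow> B \<in> GL_O m \<Longrightarrow> A * B \<in> GL_O m"
proof -
  assume "A \<in> GL_O m" "B \<in> GL_O m"
  then have AB: "mat_val_ge m 0 A" "mat_val_ge m 0 B" "fls_nth (det A) 0 \<noteq> 0" "fls_nth (det B) 0 \<noteq> 0"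
    by (auto simp: GL_O_iff)
  then have "det (A * B) = det A * det B"
    by (intro det_mult) (auto simp: mat_val_ge_def)
  then show "A * B \<in> GL_O m"
    using AB fls_nth_mult_lead0[OF val_ge_det val_ge_det, OF AB(1,2)]
    by (simp add: GL_O_iff mat_val_ge_mult0)
qed

lemma GL_O_of_inverse:
  assumes "mat_val_ge m 0 A" "mat_val_ge m 0 B" "A * B = 1\<^sub>m m"
  shows "A \<in> GL_O m"
proof -
  have "det A * det B = 1"
    using assms det_mult[of A m B] by (simp add: mat_val_ge_def)
  then have "fls_nth (det A) 0 * fls_nth (det B) 0 = 1"
    using fls_nth_mult_lead0[OF val_ge_det val_ge_det] assms by (metis fls_one_nth)
  then show ?thesis using assms by (auto simp: GL_O_iff)
qed

lemma GL_O_inverse: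
  assumes "A \<in> GL_O m"
  obtains B where "B \<in> GL_O m" "A * B = 1\<^sub>m m" "B * A = 1\<^sub>m m"
proof -
  obtain B where B: "mat_val_ge m 0 B" "A * B = 1\<^sub>m m" "B * A = 1\<^sub>m m"
    using unit_det_inverse assms by (metis GL_O_iff)
  then show ?thesis
    using that[of B] GL_O_of_inverse[OF B(1) _ B(3)] assms by (simp add: GL_O_iff)
qed

text \<open>Equality of points of \<open>Gr\<close> becomes an equation between representatives, the
  form in which the quotient is used throughout.\<close>

lemma coset_GL_O:
  assumes x: "x \<in> carrier (GL_K m)" and y: "y \<in> carrier (GL_K m)"
  shows "x <#\<^bsub>GL_K m\<^esub> GL_O m = y <#\<^bsub>GL_K m\<^esub> GL_O m \<longleftrightarrow> (\<exists>k\<in>GL_O m. y = x * k)"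
proof
  assume "x <#\<^bsub>GL_K m\<^esub> GL_O m = y <#\<^bsub>GL_K m\<^esub> GL_O m"
  moreover have "y \<in> y <#\<^bsub>GL_K m\<^esub> GL_O m"
    using y by (auto simp: l_coset_def intro!: bexI[of _ "1\<^sub>m m"] dest: GL_K_carrier_mat)
  ultimately show "\<exists>k\<in>GL_O m. y = x * k"
    by (auto simp: l_coset_def)
next
  assume "\<exists>k\<in>GL_O m. y = x * k"
  then obtain k where k: "k \<in> GL_O m" "y = x * k" by blast
  obtain k' where k': "k' \<in> GL_O m" "k * k' = 1\<^sub>m m"
    using GL_O_inverse[OF k(1)] by blast
  note c = GL_O_carrier_mat[OF k(1)] GL_O_carrier_mat[OF k'(1)] GL_K_carrier_mat[OF x]
  have "x * h = y * (k' * h)" if "h \<in> GL_O m" for h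
  proof -
    have h: "h \<in> carrier_mat m m" by (rule GL_O_carrier_mat[OF that])
    have "y * (k' * h) = x * ((k * k') * h)"
      unfolding k(2) using c h by (simp add: assoc_mult_mat[of _ m m _ m _ m])
    then show ?thesis using k'(2) h by simp
  qed
  moreover have "y * h = x * (k * h)" if "h \<in> GL_O m" for h
    using c GL_O_carrier_mat[OF that] k(2) by (simp add: assoc_mult_mat[of _ m m _ m _ m])
  ultimately show "x <#\<^bsub>GL_K m\<^esub> GL_O m = y <#\<^bsub>GL_K m\<^esub> GL_O m"
    unfolding l_coset_def mult_GL_K using k(1) k'(1) GL_O_mult by blast
qed

lemma l_coset_coset:
  assumes "g \<in> carrier (GL_K m)" "x \<in> carrier (GL_K m)"
  shows "g <#\<^bsub>GL_K m\<^esub> (x <#\<^bsub>GL_K m\<^esub> GL_O m) = (g * x) <#\<^bsub>GL_K m\<^esub> GL_O m"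
proof -
  have "g * (x * h) = g * x * h" if "h \<in> GL_O m" for h
    using GL_O_carrier_mat[OF that] assms by (simp add: carrier_GL_K assoc_mult_mat[of g m m x m h m])
  then show ?thesis by (auto simp: l_coset_def)
qed


section \<open>Torus elements, permutation matrices and constant matrices\<close>

definition tpow :: "nat \<Rightarrow> (nat \<Rightarrow> int) \<Rightarrow> complex fls mat" where
  "tpow m v = mat_diag m (\<lambda>k. tp (v k))"

lemma tpow_carrier [simp]: "tpow m v \<in> carrier_mat m m"
  by (simp add: tpow_def)

lemma tpow_dim [simp]: "dim_row (tpow m v) = m" "dim_col (tpow m v) = m"
  using tpow_carrier[of m v] unfolding carrier_mat_def by auto

lemma tpow_index: "a < m \<Longrightarrow> b < m \<Longrightarrow> tpow m v $$ (a, b) = (if a = b then tp (v a) else 0)"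
  by (simp add: tpow_def mat_diag_def)

lemma mult_tpow_index: "A \<in> carrier_mat m m \<Longrightarrow> a < m \<Longrightarrow> b < m \<Longrightarrow>
    (A * tpow m v) $$ (a, b) = A $$ (a, b) * tp (v b)"
  unfolding tpow_def by (subst mat_diag_mult_right[of A m m]) (auto simp: mult.commute)

lemma tpow_mult_index: "A \<in> carrier_mat m m \<Longrightarrow> a < m \<Longrightarrow> b < m \<Longrightarrow>
    (tpow m v * A) $$ (a, b) = tp (v a) * A $$ (a, b)"
  unfolding tpow_def by (subst mat_diag_mult_left[of A m m]) auto

lemma tpow_add: "tpow m v * tpow m w = tpow m (\<lambda>a. v a + w a)"
  by (simp add: tpow_def mat_diag_diag tp_add)

lemma tpow_0: "(\<And>a. a < m \<Longrightarrow> v a = 0) \<Longrightarrow> tpow m v = 1\<^sub>m m"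
  by (intro eq_matI) (auto simp: tpow_index)

lemma tpow_cong: "(\<And>a. a < m \<Longrightarrow> v a = w a) \<Longrightarrow> tpow m v = tpow m w"
  by (intro eq_matI) (auto simp: tpow_index)

lemma tpow_inverse: "tpow m v * tpow m (\<lambda>a. - v a) = 1\<^sub>m m" "tpow m (\<lambda>a. - v a) * tpow m v = 1\<^sub>m m"
  by (simp_all add: tpow_add tpow_0)

lemma tpow_GL_K [simp]: "tpow m v \<in> carrier (GL_K m)"
  using GL_K_of_inverse(1)[OF _ _ tpow_inverse(1)[of m v]] by simp

lemma torus_point_tpow: "torus_point m \<mu> = tpow m (\<lambda>k. \<mu> ! k) <#\<^bsub>GL_K m\<^esub> GL_O m"
  by (simp add: torus_point_def tpow_def tp_def)

lemma base_point_coset: "base_point m = 1\<^sub>m m <#\<^bsub>GL_K m\<^esub> GL_O m"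
  unfolding base_point_def torus_point_tpow by (subst tpow_0) (auto simp: zero_weight_def)

text \<open>Column \<open>b\<close> is the unit vector of index \<open>f b\<close>. So right
  multiplication reindexes columns by \<open>f\<close>, and a power \<open>t^v\<close> passes to the
  right of the matrix as \<open>t^(v o f)\<close>.\<close>

definition perm_mat :: "nat \<Rightarrow> (nat \<Rightarrow> nat) \<Rightarrow> complex mat" where
  "perm_mat m f = mat m m (\<lambda>(a, b). if a = f b then 1 else 0)"

definition cmat :: "complex mat \<Rightarrow> complex fls mat" where
  "cmat A = map_mat fls_const A"

lemma cmat_carrier [simp]: "cmat A \<in> carrier_mat m m \<longleftrightarrow> A \<in> carrier_mat m m"
  by (simp add: cmat_def)

lemma cmat_dim [simp]: "dim_row (cmat A) = dim_row A" "dim_col (cmat A) = dim_col A"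
  by (simp_all add: cmat_def)

lemma cmat_index: "a < dim_row A \<Longrightarrow> b < dim_col A \<Longrightarrow> cmat A $$ (a, b) = fls_const (A $$ (a, b))"
  by (simp add: cmat_def)

lemma cmat_mult: "A \<in> carrier_mat m m \<Longrightarrow> B \<in> carrier_mat m m \<Longrightarrow> cmat (A * B) = cmat A * cmat B"
  by (simp add: cmat_def fls_const_hom.mat_hom_mult)

lemma cmat_one [simp]: "cmat (1\<^sub>m m) = 1\<^sub>m m"
  by (simp add: cmat_def fls_const_hom.mat_hom_one)

lemma det_cmat: "det (cmat A) = fls_const (det A)"
  by (simp add: cmat_def)

lemma cmat_GL_O: "A \<in> carrier_mat m m \<Longrightarrow> det A \<noteq> 0 \<Longrightarrow> cmat A \<in> GL_O m"
  by (auto simp: GL_O_iff det_cmat mat_val_ge_def cmat_index)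

lemma perm_mat_carrier [simp]: "perm_mat m f \<in> carrier_mat m m"
  by (simp add: perm_mat_def)

lemma perm_mat_dim [simp]: "dim_row (perm_mat m f) = m" "dim_col (perm_mat m f) = m"
  by (simp_all add: perm_mat_def)

lemma mult_perm_mat_index:
  assumes "A \<in> carrier_mat r m" "f permutes {..<m}" "a < r" "b < m"
  shows "(A * perm_mat m f) $$ (a, b) = A $$ (a, f b)"
proof -
  have fb: "f b < m" using assms by (simp add: permutes_lessThan)
  have "(A * perm_mat m f) $$ (a, b) = (\<Sum>k<m. A $$ (a, k) * perm_mat m f $$ (k, b))"
    using assms by (intro mult_mat_index) auto
  also have "\<dots> = (\<Sum>k<m. if k = f b then A $$ (a, k) else 0)"
    using assms by (intro sum.cong) (auto simp: perm_mat_def)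
  also have "\<dots> = A $$ (a, f b)" using fb by simp
  finally show ?thesis .
qed

lemma perm_mat_inverse:
  assumes "f permutes {..<m}"
  shows "perm_mat m f * perm_mat m (inv_into UNIV f) = 1\<^sub>m m"
proof (rule eq_matI)
  fix a b assume "a < dim_row (1\<^sub>m m)" "b < dim_col (1\<^sub>m m)"
  then have ab: "a < m" "b < m" by auto
  have i: "inv_into UNIV f permutes {..<m}" using permutes_inv[OF assms] .
  have "inv_into UNIV f b < m" using i ab(2) by (simp add: permutes_lessThan)
  then show "(perm_mat m f * perm_mat m (inv_into UNIV f)) $$ (a, b) = 1\<^sub>m m $$ (a, b)"
    using ab permutes_inverses(1)[OF assms, of b]
    by (subst mult_perm_mat_index[OF _ i]) (auto simp: perm_mat_def)
qed auto

lemma det_perm_mat: "f permutes {..<m} \<Longrightarrow> det (perm_mat m f) \<noteq> 0"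
  using det_mult[of "perm_mat m f" m "perm_mat m (inv_into UNIV f)"] by (auto simp: perm_mat_inverse)

lemma tpow_perm_mat:
  assumes "f permutes {..<m}"
  shows "tpow m v * cmat (perm_mat m f) = cmat (perm_mat m f) * tpow m (v \<circ> f)"
proof (rule eq_matI)
  fix a b assume "a < dim_row (cmat (perm_mat m f) * tpow m (v \<circ> f))"
    "b < dim_col (cmat (perm_mat m f) * tpow m (v \<circ> f))"
  then have ab: "a < m" "b < m" by auto
  have c: "cmat (perm_mat m f) \<in> carrier_mat m m" by simp
  show "(tpow m v * cmat (perm_mat m f)) $$ (a, b) = (cmat (perm_mat m f) * tpow m (v \<circ> f)) $$ (a, b)"
    unfolding tpow_mult_index[OF c ab] mult_tpow_index[OF c ab]
    using ab by (simp add: cmat_index perm_mat_def)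
qed auto

section \<open>Cartan decomposition\<close>

lemma permutes_escape:
  assumes "p permutes {0..<n}" "R \<subseteq> {..<n}" "finite C" "card C < card R"
  obtains i where "i \<in> R" "p i \<notin> C"
proof -
  have "\<not> p ` R \<subseteq> C"
  proof
    assume "p ` R \<subseteq> C"
    then have "card (p ` R) \<le> card C" using assms(3) by (rule card_mono[rotated])
    moreover have "card (p ` R) = card R"
      by (rule card_image) (metis assms(1) inj_on_subset permutes_inj subset_UNIV)
    ultimately show False using assms(4) by simp
  qed
  then show ?thesis using that by blast
qed

text \<open>The easy half of the Frobenius-Koenig theorem: no permutation maps \<open>R\<close> into
  the smaller set \<open>C\<close>, so every term of the Leibniz expansion meets the zero
  block.\<close>

lemma det_zero_block:
  fixes A :: "'a :: comm_ring_1 mat"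
  assumes A: "A \<in> carrier_mat n n" and R: "R \<subseteq> {..<n}" and C: "finite C" "card C < card R"
    and z: "\<And>p q. p \<in> R \<Longrightarrow> q < n \<Longrightarrow> q \<notin> C \<Longrightarrow> A $$ (p, q) = 0"
  shows "det A = 0"
proof -
  have "(\<Prod>i = 0..<n. A $$ (i, p i)) = 0" if p: "p permutes {0..<n}" for p
  proof -
    obtain i where i: "i \<in> R" "p i \<notin> C" using permutes_escape[OF p R C] .
    have "i < n" using i(1) R by auto
    moreover have "p i < n" using p \<open>i < n\<close> permutes_in_image[OF p, of i] by simp
    ultimately show ?thesis
      using z[OF i(1) _ i(2)] by (intro prod_zero) (auto intro!: bexI[of _ i])
  qed
  then show ?thesis by (simp add: det_def'[OF A])
qed

text \<open>The same block argument modulo \<open>t\<close>.\<close>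

lemma det_val_ge_1_block:
  assumes A: "mat_val_ge n 0 A" and R: "R \<subseteq> {..<n}" and C: "finite C" "card C < card R"
    and z: "\<And>p q. p \<in> R \<Longrightarrow> q < n \<Longrightarrow> q \<notin> C \<Longrightarrow> val_ge 1 (A $$ (p, q))"
  shows "val_ge 1 (det A)"
proof -
  have "val_ge 1 (\<Prod>i = 0..<n. A $$ (i, p i))" if p: "p permutes {0..<n}" for p
  proof -
    obtain i where i: "i \<in> R" "p i \<notin> C" using permutes_escape[OF p R C] .
    have "i < n" using i(1) R by auto
    moreover have "p i < n" using p \<open>i < n\<close> permutes_in_image[OF p, of i] by simp
    ultimately have "val_ge 1 (A $$ (i, p i))" using z[OF i(1) _ i(2)] by blast
    moreover have "val_ge 0 (\<Prod>j \<in> {0..<n} - {i}. A $$ (j, p j))"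
      using A p by (intro val_ge_prod0) (auto simp: mat_val_ge_def permutes_in_image)
    moreover have "(\<Prod>j = 0..<n. A $$ (j, p j)) = A $$ (i, p i) * (\<Prod>j \<in> {0..<n} - {i}. A $$ (j, p j))"
      using \<open>i < n\<close> by (intro prod.remove) auto
    ultimately show ?thesis using val_ge_mult[of 1 _ 0] by simp
  qed
  then have "val_ge 1 (signof p * (\<Prod>i = 0..<n. A $$ (i, p i)))" if "p permutes {0..<n}" for p
    using val_ge_mult[OF val_ge_signof[of p], of 1] that by simp
  then show ?thesis
    using A by (subst det_def'[of A n]) (auto simp: mat_val_ge_def intro!: val_ge_sum)
qed

section \<open>Uniqueness of the Cartan decomposition\<close>

lemma mat_assoc:
  "A \<in> carrier_mat m m \<Longrightarrow> B \<in> carrier_mat m m \<Longrightarrow> C \<in> carrier_mat m m \<Longrightarrow> A * B * C = A * (B * C)"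
  by (rule assoc_mult_mat)

lemma mat_cancel:
  fixes A :: "'a :: semiring_1 mat"
  assumes "A * B = 1\<^sub>m m" "A \<in> carrier_mat m m" "B \<in> carrier_mat m m" "C \<in> carrier_mat m m"
  shows "A * (B * C) = C"
  using assms by (metis left_mult_one_mat mat_assoc)

text \<open>If \<open>\<mu> j > \<nu> j\<close>, the entry \<open>(p, q)\<close> of \<open>k\<close>
  with \<open>p \<le> j \<le> q\<close> equals that of \<open>k'\<close> times \<open>t\<close> to
  the power \<open>\<mu> p - \<nu> q > 0\<close>. Modulo \<open>t\<close> this is a zero block with
  \<open>j + 1\<close> rows and \<open>m - j\<close> columns, so \<open>det k\<close> would not be a
  unit.\<close>

lemma tpow_double_coset_le:
  assumes k: "k \<in> GL_O m" and k': "mat_val_ge m 0 k'"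
    and eq: "tpow m \<mu> * k' = k * tpow m \<nu>"
    and mono: "\<And>a b. a \<le> b \<Longrightarrow> b < m \<Longrightarrow> \<mu> b \<le> \<mu> a" "\<And>a b. a \<le> b \<Longrightarrow> b < m \<Longrightarrow> \<nu> b \<le> \<nu> a"
    and j: "j < m"
  shows "\<mu> j \<le> \<nu> j"
proof (rule ccontr)
  assume less: "\<not> \<mu> j \<le> \<nu> j"
  have kc: "k \<in> carrier_mat m m" "k' \<in> carrier_mat m m"
    using GL_O_carrier_mat[OF k] k' by (auto simp: mat_val_ge_def)
  have "val_ge 1 (det k)"
  proof (rule det_val_ge_1_block)
    show "mat_val_ge m 0 k" using k by (simp add: GL_O_iff)
    show "{..j} \<subseteq> {..<m}" "finite {..<j}" "card {..<j} < card {..j}" using j by auto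
    fix p q assume pq: "p \<in> {..j}" "q < m" "q \<notin> {..<j}"
    have "tp (\<mu> p) * k' $$ (p, q) = k $$ (p, q) * tp (\<nu> q)"
      using arg_cong[OF eq, of "\<lambda>M. M $$ (p, q)"] pq j
      by (simp add: tpow_mult_index[OF kc(2)] mult_tpow_index[OF kc(1)] del: index_mult_mat(1))
    moreover have "val_ge (\<mu> p) (tp (\<mu> p) * k' $$ (p, q))"
      using k' pq j by (auto simp: val_ge_tp_mult mat_val_ge_def)
    ultimately have "val_ge (\<mu> p - \<nu> q) (k $$ (p, q))"
      by (simp add: val_ge_mult_tp)
    moreover have "\<mu> p - \<nu> q \<ge> 1"
      using mono(1)[of p j] mono(2)[of j q] pq j less by auto
    ultimately show "val_ge 1 (k $$ (p, q))" by (rule val_ge_mono)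
  qed
  then show False using k by (simp add: GL_O_iff val_ge_def)
qed

lemma tpow_double_coset_unique:
  assumes k: "k \<in> GL_O m" "k' \<in> GL_O m"
    and eq: "tpow m \<mu> * k' = k * tpow m \<nu>"
    and mono: "\<And>a b. a \<le> b \<Longrightarrow> b < m \<Longrightarrow> \<mu> b \<le> \<mu> a" "\<And>a b. a \<le> b \<Longrightarrow> b < m \<Longrightarrow> \<nu> b \<le> \<nu> a"
    and j: "j < m"
  shows "\<mu> j = \<nu> j"
proof (rule antisym)
  show "\<mu> j \<le> \<nu> j"
    by (rule tpow_double_coset_le[OF k(1) _ eq mono j]) (use k in \<open>auto simp: GL_O_iff\<close>)
  \<comment> \<open>Inverting both integral factors exchanges the roles of \<open>\<mu>\<close> and
    \<open>\<nu>\<close>, which gives the other inequality.\<close>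
  obtain l where l: "l \<in> GL_O m" "k * l = 1\<^sub>m m" "l * k = 1\<^sub>m m" using GL_O_inverse[OF k(1)] .
  obtain l' where l': "l' \<in> GL_O m" "k' * l' = 1\<^sub>m m" "l' * k' = 1\<^sub>m m" using GL_O_inverse[OF k(2)] .
  note c = GL_O_carrier_mat[OF k(1)] GL_O_carrier_mat[OF k(2)] GL_O_carrier_mat[OF l(1)] GL_O_carrier_mat[OF l'(1)]
  have "tpow m \<nu> * l' = l * (k * (tpow m \<nu> * l'))"
    using c by (subst mat_cancel[OF l(3)]) auto
  also have "\<dots> = l * (k * tpow m \<nu> * l')" using c by (simp add: mat_assoc[of k m])
  also have "\<dots> = l * (tpow m \<mu> * k' * l')" by (simp add: eq)
  also have "\<dots> = l * (tpow m \<mu> * (k' * l'))"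
    using c tpow_carrier by (metis mat_assoc)
  also have "\<dots> = l * tpow m \<mu>" using c l'(2) by simp
  finally have eq': "tpow m \<nu> * l' = l * tpow m \<mu>" .
  show "\<nu> j \<le> \<mu> j"
    by (rule tpow_double_coset_le[OF l(1) _ eq' mono(2,1) j]) (use l' in \<open>auto simp: GL_O_iff\<close>)
qed

text \<open>Elimination along one row by integral column operations: an entry of least valuation
  divides the others over \<open>C[[t]]\<close>, so it clears them, and is then moved to the last
  column.\<close>

lemma row_reduction:
  assumes r: "\<And>c. c < Suc n \<Longrightarrow> val_ge e (r c)" and b0: "b0 < Suc n" "fls_nth (r b0) e \<noteq> 0"
  obtains Q where "Q \<in> GL_O (Suc n)"
    "\<And>b. b < Suc n \<Longrightarrow> (\<Sum>c<Suc n. r c * Q $$ (c, b)) = (if b = n then tp e else 0)"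
proof -
  define \<rho> where "\<rho> c = tp (- e) * r c" for c
  have \<rho>: "val_ge 0 (\<rho> c)" if "c < Suc n" for c
    using r[OF that] by (simp add: \<rho>_def val_ge_tp_mult)
  have r_\<rho>: "r c = tp e * \<rho> c" for c
    by (simp add: \<rho>_def mult.assoc[symmetric] tp_add[symmetric])
  have nz: "\<rho> b0 \<noteq> 0" and unit: "fls_nth (\<rho> b0) 0 \<noteq> 0"
    using b0(2) by (auto simp: \<rho>_def)
  have inv: "val_ge 0 (inverse (\<rho> b0))" using val_ge_inverse[OF \<rho>[OF b0(1)] unit] .
  define f where "f = transpose b0 n"
  have fb: "f b < Suc n" if "b < Suc n" for b
    using that b0(1) by (auto simp: f_def transpose_def)
  have f_inj: "f b = f c \<longleftrightarrow> b = c" for b c by (metis f_def transpose_involutory)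
  have fn: "f n = b0" by (simp add: f_def)
  have fne: "f b \<noteq> b0" if "b \<noteq> n" for b using that f_inj fn by metis
  define Q where "Q = mat (Suc n) (Suc n) (\<lambda>(c, b).
    if b = n then (if c = b0 then inverse (\<rho> b0) else 0)
    else (if c = f b then 1 else 0) - (if c = b0 then \<rho> (f b) * inverse (\<rho> b0) else 0))"
  \<comment> \<open>The inverse of \<open>Q\<close>: its last row is the normalized row itself, its
    other rows pick the coordinates \<open>f b\<close>. Only one of the two products is computed;
    the other one follows as the matrices are square.\<close>
  define Q' where "Q' = mat (Suc n) (Suc n) (\<lambda>(b, c).
    if b = n then \<rho> c else if c = f b then 1 else 0)"
  have Qc: "Q \<in> carrier_mat (Suc n) (Suc n)" "Q' \<in> carrier_mat (Suc n) (Suc n)"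
    by (auto simp: Q_def Q'_def)
  have lin: "(\<Sum>c<Suc n. \<rho> c * Q $$ (c, b)) = (if b = n then 1 else 0)" if b: "b < Suc n" for b
  proof (cases "b = n")
    case True
    have "(\<Sum>c<Suc n. \<rho> c * Q $$ (c, b)) = (\<Sum>c<Suc n. if c = b0 then \<rho> b0 * inverse (\<rho> b0) else 0)"
      using True by (intro sum.cong) (auto simp: Q_def)
    then show ?thesis using b0 nz True by simp
  next
    case False
    have "(\<Sum>c<Suc n. \<rho> c * Q $$ (c, b)) = (\<Sum>c<Suc n. if c = f b then \<rho> (f b) else 0)
      - (\<Sum>c<Suc n. if c = b0 then \<rho> b0 * (\<rho> (f b) * inverse (\<rho> b0)) else 0)"
      unfolding sum_subtractf[symmetric]
      using False b by (intro sum.cong) (auto simp: Q_def algebra_simps)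
    also have "\<dots> = 0" using fb[OF b] b0 nz by simp
    finally show ?thesis using False by simp
  qed
  have "Q' * Q = 1\<^sub>m (Suc n)"
  proof (rule eq_matI)
    fix a b assume "a < dim_row (1\<^sub>m (Suc n))" "b < dim_col (1\<^sub>m (Suc n))"
    then have ab: "a < Suc n" "b < Suc n" by auto
    have *: "(Q' * Q) $$ (a, b) = (\<Sum>c<Suc n. Q' $$ (a, c) * Q $$ (c, b))"
      by (rule mult_mat_index[OF Qc(2,1) ab])
    show "(Q' * Q) $$ (a, b) = 1\<^sub>m (Suc n) $$ (a, b)"
    proof (cases "a = n")
      case True
      have "(\<Sum>c<Suc n. Q' $$ (a, c) * Q $$ (c, b)) = (\<Sum>c<Suc n. \<rho> c * Q $$ (c, b))"
        using True by (intro sum.cong) (auto simp: Q'_def)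
      then show ?thesis using * lin[OF ab(2)] True ab by auto
    next
      case False
      have "(\<Sum>c<Suc n. Q' $$ (a, c) * Q $$ (c, b)) = (\<Sum>c<Suc n. if c = f a then Q $$ (f a, b) else 0)"
        using False ab by (intro sum.cong) (auto simp: Q'_def)
      also have "\<dots> = Q $$ (f a, b)" using fb[OF ab(1)] by simp
      also have "\<dots> = (if a = b then 1 else 0)"
        using fb[OF ab(1)] ab False fne by (auto simp: Q_def f_inj)
      finally show ?thesis using * ab by simp
    qed
  qed (use Qc in auto)
  moreover have "mat_val_ge (Suc n) 0 Q"
  proof -
    have "val_ge 0 (\<rho> (f b) * inverse (\<rho> b0))" if "b < Suc n" for b
      by (rule val_ge_mult0[OF \<rho>[OF fb[OF that]] inv])
    then have "val_ge 0 (Q $$ (c, b))" if "c < Suc n" "b < Suc n" for c b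
      using that inv by (simp add: Q_def val_ge_diff val_ge_minus)
    then show ?thesis using Qc by (simp add: mat_val_ge_def)
  qed
  moreover have "mat_val_ge (Suc n) 0 Q'"
    using \<rho> Qc by (simp add: mat_val_ge_def Q'_def)
  ultimately have "Q \<in> GL_O (Suc n)"
    using GL_O_of_inverse mat_mult_left_right_inverse[OF Qc(2,1)] by blast
  moreover have "(\<Sum>c<Suc n. r c * Q $$ (c, b)) = (if b = n then tp e else 0)" if "b < Suc n" for b
    using lin[OF that] by (auto simp: r_\<rho> mult.assoc sum_distrib_left[symmetric])
  ultimately show ?thesis using that by blast
qed

text \<open>The shape reached once the last row is cleared; the inductions on the size in
  \<open>cartan_exists\<close> and \<open>minuscule_echelon\<close> split off the last row and
  column in this form.\<close>

definition block_tri :: "nat \<Rightarrow> 'a :: zero mat \<Rightarrow> (nat \<Rightarrow> 'a) \<Rightarrow> 'a \<Rightarrow> 'a mat" where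
  "block_tri n A y c = mat (Suc n) (Suc n) (\<lambda>(a, b).
     if a < n then (if b < n then A $$ (a, b) else y a) else if b < n then 0 else c)"

lemma block_tri_carrier [simp]: "block_tri n A y c \<in> carrier_mat (Suc n) (Suc n)"
  by (simp add: block_tri_def)

lemma block_tri_dim [simp]: "dim_row (block_tri n A y c) = Suc n" "dim_col (block_tri n A y c) = Suc n"
  by (simp_all add: block_tri_def)

lemma block_tri_index: "a < Suc n \<Longrightarrow> b < Suc n \<Longrightarrow> block_tri n A y c $$ (a, b) =
    (if a < n then (if b < n then A $$ (a, b) else y a) else if b < n then 0 else c)"
  by (simp add: block_tri_def)

lemma block_tri_cong: "(\<And>a b. a < n \<Longrightarrow> b < n \<Longrightarrow> A $$ (a, b) = A' $$ (a, b)) \<Longrightarrow>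
    (\<And>a. a < n \<Longrightarrow> y a = y' a) \<Longrightarrow> c = c' \<Longrightarrow> block_tri n A y c = block_tri n A' y' c'"
  by (auto simp: block_tri_def intro!: cong_mat)

lemma block_tri_mult:
  fixes A :: "'a :: comm_ring_1 mat"
  assumes "A \<in> carrier_mat n n" "A' \<in> carrier_mat n n"
  shows "block_tri n A y c * block_tri n A' y' c' =
    block_tri n (A * A') (\<lambda>a. (\<Sum>k<n. A $$ (a, k) * y' k) + y a * c') (c * c')"
proof (rule eq_matI)
  fix a b assume "a < dim_row (block_tri n (A * A') (\<lambda>a. (\<Sum>k<n. A $$ (a, k) * y' k) + y a * c') (c * c'))"
    "b < dim_col (block_tri n (A * A') (\<lambda>a. (\<Sum>k<n. A $$ (a, k) * y' k) + y a * c') (c * c'))"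
  then have ab: "a < Suc n" "b < Suc n" by auto
  have "(block_tri n A y c * block_tri n A' y' c') $$ (a, b)
      = (\<Sum>k<Suc n. block_tri n A y c $$ (a, k) * block_tri n A' y' c' $$ (k, b))"
    by (rule mult_mat_index) (use ab in auto)
  also have "\<dots> = (\<Sum>k<n. block_tri n A y c $$ (a, k) * block_tri n A' y' c' $$ (k, b))
      + block_tri n A y c $$ (a, n) * block_tri n A' y' c' $$ (n, b)" by simp
  also have "\<dots> = block_tri n (A * A') (\<lambda>a. (\<Sum>k<n. A $$ (a, k) * y' k) + y a * c') (c * c') $$ (a, b)"
  proof (cases "a < n \<and> b < n")
    case True
    then have "(\<Sum>k<n. block_tri n A y c $$ (a, k) * block_tri n A' y' c' $$ (k, b)) = (A * A') $$ (a, b)"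
      using assms ab by (subst mult_mat_index[of _ n n _ n]) (auto simp: block_tri_index intro!: sum.cong)
    then show ?thesis using True ab by (simp add: block_tri_index)
  qed (use ab in \<open>auto simp: block_tri_index intro!: sum.cong sum.neutral\<close>)
  finally show "(block_tri n A y c * block_tri n A' y' c') $$ (a, b)
    = block_tri n (A * A') (\<lambda>a. (\<Sum>k<n. A $$ (a, k) * y' k) + y a * c') (c * c') $$ (a, b)" .
qed auto

lemma block_tri_mult_0:
  fixes A :: "'a :: comm_ring_1 mat"
  assumes "A \<in> carrier_mat n n" "A' \<in> carrier_mat n n"
  shows "block_tri n A y c * block_tri n A' (\<lambda>_. 0) c' = block_tri n (A * A') (\<lambda>a. y a * c') (c * c')"
  by (simp add: block_tri_mult[OF assms])

lemma block_tri_one: "block_tri n (1\<^sub>m n) (\<lambda>_. 0) 1 = 1\<^sub>m (Suc n)"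
  by (intro eq_matI) (auto simp: block_tri_index)

lemma block_tri_exhaust:
  assumes "g \<in> carrier_mat (Suc n) (Suc n)" and "\<And>b. b < n \<Longrightarrow> g $$ (n, b) = 0"
  shows "g = block_tri n (mat n n (\<lambda>ij. g $$ ij)) (\<lambda>a. g $$ (a, n)) (g $$ (n, n))"
proof (rule eq_matI)
  fix a b assume "a < dim_row (block_tri n (mat n n (\<lambda>ij. g $$ ij)) (\<lambda>a. g $$ (a, n)) (g $$ (n, n)))"
    "b < dim_col (block_tri n (mat n n (\<lambda>ij. g $$ ij)) (\<lambda>a. g $$ (a, n)) (g $$ (n, n)))"
  then have ab: "a < Suc n" "b < Suc n" by auto
  then show "g $$ (a, b) = block_tri n (mat n n (\<lambda>ij. g $$ ij)) (\<lambda>a. g $$ (a, n)) (g $$ (n, n)) $$ (a, b)"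
    using assms(2) by (cases "a = n"; cases "b = n") (auto simp: block_tri_index less_Suc_eq)
qed (use assms in auto)

lemma block_tri_tpow: "block_tri n (tpow n v) (\<lambda>_. 0) (tp d) = tpow (Suc n) (v(n := d))"
  by (intro eq_matI) (auto simp: block_tri_index tpow_index less_Suc_eq)

lemma block_tri_GL_O:
  assumes "A \<in> GL_O n" "\<And>a. a < n \<Longrightarrow> val_ge 0 (y a)"
  shows "block_tri n A y 1 \<in> GL_O (Suc n)"
proof -
  obtain B where B: "B \<in> GL_O n" "A * B = 1\<^sub>m n" "B * A = 1\<^sub>m n" using GL_O_inverse[OF assms(1)] .
  note c = GL_O_carrier_mat[OF assms(1)] GL_O_carrier_mat[OF B(1)]
  define z where "z a = - (\<Sum>k<n. B $$ (a, k) * y k)" for a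
  have z: "val_ge 0 (z a)" if "a < n" for a
    unfolding z_def using B(1) assms(2) that
    by (intro val_ge_minus val_ge_sum val_ge_mult0) (auto simp: GL_O_iff mat_val_ge_def)
  have "block_tri n B z 1 * block_tri n A y 1 = block_tri n (B * A) (\<lambda>_. 0) (1 * 1)"
    unfolding block_tri_mult[OF c(2,1)] by (rule block_tri_cong) (auto simp: z_def)
  then have 1: "block_tri n B z 1 * block_tri n A y 1 = 1\<^sub>m (Suc n)"
    by (simp add: B(3) block_tri_one)
  have 2: "block_tri n A y 1 * block_tri n B z 1 = 1\<^sub>m (Suc n)"
    by (rule mat_mult_left_right_inverse[OF block_tri_carrier block_tri_carrier 1])
  have "mat_val_ge (Suc n) 0 (block_tri n A y 1)"
    using assms unfolding GL_O_iff mat_val_ge_def by (simp add: block_tri_index)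
  moreover have "mat_val_ge (Suc n) 0 (block_tri n B z 1)"
    using B(1) z unfolding GL_O_iff mat_val_ge_def by (simp add: block_tri_index)
  ultimately show ?thesis using 2 by (rule GL_O_of_inverse)
qed

lemma det_block_tri:
  fixes A :: "'a :: idom mat"
  assumes "A \<in> carrier_mat n n"
  shows "det (block_tri n A y c) = det A * c"
proof -
  have "block_tri n A y c = four_block_mat A (mat n 1 (\<lambda>(a, b). y a)) (0\<^sub>m 1 n) (mat 1 1 (\<lambda>_. c))"
    using assms by (intro eq_matI) (auto simp: block_tri_index less_Suc_eq)
  then show ?thesis
    using det_four_block_mat_lower_left_zero[OF assms, of "mat n 1 (\<lambda>(a, b). y a)" 1 "0\<^sub>m 1 n" "mat 1 1 (\<lambda>_. c)"]
    by (simp add: det_single)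
qed

lemma mat_val_ge_mult_GL_O:
  "mat_val_ge m e A \<Longrightarrow> B \<in> GL_O m \<Longrightarrow> mat_val_ge m e (A * B)"
  "B \<in> GL_O m \<Longrightarrow> mat_val_ge m e A \<Longrightarrow> mat_val_ge m e (B * A)"
  using mat_val_ge_mult[of m e A 0 B] mat_val_ge_mult[of m 0 B e A] by (auto simp: GL_O_iff)

lemma permute_row_index:
  assumes g: "g \<in> carrier_mat m m" and f: "f permutes {..<m}" and ab: "a < m" "b < m"
  shows "(cmat (perm_mat m f) * g) $$ (f a, b) = g $$ (a, b)"
proof -
  have fa: "f a < m" using f ab by (simp add: permutes_lessThan)
  have inj: "f a = f k \<longleftrightarrow> a = k" for k using f by (metis permutes_inj injD)
  have "(cmat (perm_mat m f) * g) $$ (f a, b) = (\<Sum>k<m. cmat (perm_mat m f) $$ (f a, k) * g $$ (k, b))"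
    by (rule mult_mat_index) (use g ab fa in auto)
  also have "\<dots> = (\<Sum>k<m. if k = a then g $$ (a, b) else 0)"
    using fa inj by (intro sum.cong) (auto simp: cmat_index perm_mat_def)
  finally show ?thesis using ab by simp
qed

lemma nonzero_entry_of_minimal_valuation:
  assumes "g \<in> carrier_mat m m" "det g \<noteq> 0" "m > 0"
  obtains d a b where "mat_val_ge m d g" "a < m" "b < m" "fls_nth (g $$ (a, b)) d \<noteq> 0"
proof -
  let ?S = "{ab. fst ab < m \<and> snd ab < m \<and> g $$ ab \<noteq> 0}"
  have fin: "finite ?S" by (rule finite_subset[of _ "{..<m} \<times> {..<m}"]) auto
  have "?S \<noteq> {}"
  proof
    assume "?S = {}"
    then have "det g = 0"
      using assms by (intro det_zero_block[OF assms(1), of "{0}" "{}"]) auto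
    then show False using assms by simp
  qed
  then have "\<exists>ab. is_arg_min (\<lambda>ab. fls_subdegree (g $$ ab)) (\<lambda>ab. ab \<in> ?S) ab"
    by (rule ex_is_arg_min_if_finite[OF fin])
  then obtain ab where "is_arg_min (\<lambda>ab. fls_subdegree (g $$ ab)) (\<lambda>ab. ab \<in> ?S) ab"
    by (rule exE)
  then have ab: "ab \<in> ?S" "\<And>cd. cd \<in> ?S \<Longrightarrow> fls_subdegree (g $$ ab) \<le> fls_subdegree (g $$ cd)"
    unfolding is_arg_min_linorder by blast+
  show ?thesis
  proof (rule that[of "fls_subdegree (g $$ ab)" "fst ab" "snd ab"])
    show "mat_val_ge m (fls_subdegree (g $$ ab)) g"
    proof -
      have "val_ge (fls_subdegree (g $$ ab)) (g $$ (a, b))" if "a < m" "b < m" for a b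
        using ab(2)[of "(a, b)"] that by (cases "g $$ (a, b) = 0") (simp_all add: val_ge_iff)
      then show ?thesis using assms(1) by (simp add: mat_val_ge_def)
    qed
    show "fst ab < m" "snd ab < m" "fls_nth (g $$ (fst ab, snd ab)) (fls_subdegree (g $$ ab)) \<noteq> 0"
      using ab(1) by simp_all
  qed
qed

text \<open>Induction with a pivot of least valuation \<open>d\<close>, moved to the last place and
  cleared in its row and column. Integral operations keep all valuations at least \<open>d\<close>,
  so the bound \<open>e \<le> \<nu> a\<close>, applied to the remaining block, shows that the
  exponent \<open>d\<close> in the last place is the smallest.\<close>

lemma cartan_exists:
  assumes "g \<in> carrier_mat n n" "det g \<noteq> 0" "mat_val_ge n e g"
  shows "\<exists>P\<in>GL_O n. \<exists>Q\<in>GL_O n. \<exists>\<nu>. (\<forall>b<n. \<forall>a\<le>b. \<nu> b \<le> \<nu> a) \<and> (\<forall>a<n. e \<le> \<nu> a) \<and> P * g * Q = tpow n \<nu>"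
  using assms
proof (induction n arbitrary: g e)
  case 0
  then show ?case
    by (intro bexI[of _ "1\<^sub>m 0"] exI[of _ "\<lambda>_. 0"]) (auto intro!: eq_matI)
next
  case (Suc n)
  note g = Suc.prems
  obtain d a b0 where d: "mat_val_ge (Suc n) d g" "a < Suc n" "b0 < Suc n" "fls_nth (g $$ (a, b0)) d \<noteq> 0"
    using nonzero_entry_of_minimal_valuation[OF g(1,2)] by auto
  have de: "e \<le> d"
  proof (rule ccontr)
    assume "\<not> e \<le> d"
    then have "fls_nth (g $$ (a, b0)) d = 0"
      using g(3) d(2,3) by (simp add: mat_val_ge_def val_ge_def)
    then show False using d(4) by simp
  qed
  define f where "f = transpose a n"
  have f: "f permutes {..<Suc n}"
    unfolding f_def by (rule permutes_swap_id) (use d in auto)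
  define P1 where "P1 = cmat (perm_mat (Suc n) f)"
  have P1: "P1 \<in> GL_O (Suc n)"
    unfolding P1_def by (rule cmat_GL_O) (use f det_perm_mat in auto)
  have g1v: "mat_val_ge (Suc n) d (P1 * g)" by (rule mat_val_ge_mult_GL_O(2)[OF P1 d(1)])
  then have g1c: "P1 * g \<in> carrier_mat (Suc n) (Suc n)" by (simp add: mat_val_ge_def)
  have row: "(P1 * g) $$ (n, b) = g $$ (a, b)" if "b < Suc n" for b
    using permute_row_index[OF g(1) f d(2) that] by (simp add: P1_def f_def)
  obtain Q where Q: "Q \<in> GL_O (Suc n)"
    "\<And>b. b < Suc n \<Longrightarrow> (\<Sum>c<Suc n. g $$ (a, c) * Q $$ (c, b)) = (if b = n then tp d else 0)"
    using row_reduction[of n d "\<lambda>c. g $$ (a, c)" b0] d by (auto simp: mat_val_ge_def)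
  define g2 where "g2 = P1 * g * Q"
  have g2v: "mat_val_ge (Suc n) d g2" unfolding g2_def by (rule mat_val_ge_mult_GL_O(1)[OF g1v Q(1)])
  then have g2c: "g2 \<in> carrier_mat (Suc n) (Suc n)" by (simp add: mat_val_ge_def)
  have "g2 $$ (n, b) = (if b = n then tp d else 0)" if "b < Suc n" for b
    unfolding g2_def using Q(2)[OF that] row
    by (subst mult_mat_index[OF g1c GL_O_carrier_mat[OF Q(1)] _ that]) (auto simp del: sum.lessThan_Suc)
  then have g2: "g2 = block_tri n (mat n n (\<lambda>ij. g2 $$ ij)) (\<lambda>a. g2 $$ (a, n)) (tp d)"
    using block_tri_exhaust[OF g2c] by simp
  define D y where "D = mat n n (\<lambda>ij. g2 $$ ij)" and "y = (\<lambda>a. g2 $$ (a, n))"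
  have Dc: "D \<in> carrier_mat n n" by (simp add: D_def)
  have Dv: "mat_val_ge n d D" using g2v by (auto simp: mat_val_ge_def D_def)
  have yv: "val_ge d (y a)" if "a < n" for a using g2v that by (auto simp: mat_val_ge_def y_def)
  \<comment> \<open>Clears the last column above the pivot \<open>t^d\<close>, by which all its
    entries are divisible.\<close>
  define P2 where "P2 = block_tri n (1\<^sub>m n) (\<lambda>a. - (tp (- d) * y a)) 1"
  have P2: "P2 \<in> GL_O (Suc n)"
    unfolding P2_def using yv by (intro block_tri_GL_O val_ge_minus) (auto simp: val_ge_tp_mult)
  have P2g2: "P2 * g2 = block_tri n D (\<lambda>_. 0) (tp d)"
  proof -
    have *: "(\<Sum>k<n. 1\<^sub>m n $$ (a, k) * y k) = y a" if "a < n" for a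
    proof -
      have "(\<Sum>k<n. 1\<^sub>m n $$ (a, k) * y k) = (\<Sum>k<n. if k = a then y a else 0)"
        using that by (intro sum.cong) auto
      then show ?thesis using that by simp
    qed
    have **: "tp (- d) * y a * tp d = y a" for a
    proof -
      have "tp (- d) * y a * tp d = (tp (- d) * tp d) * y a" by (simp add: mult_ac)
      then show ?thesis by (simp add: tp_add[symmetric])
    qed
    have "P2 * g2 = block_tri n (1\<^sub>m n * D) (\<lambda>a. (\<Sum>k<n. 1\<^sub>m n $$ (a, k) * y k) + - (tp (- d) * y a) * tp d) (1 * tp d)"
      unfolding P2_def by (subst g2, fold D_def y_def) (rule block_tri_mult[OF one_carrier_mat Dc])
    also have "\<dots> = block_tri n D (\<lambda>_. 0) (tp d)"
      by (rule block_tri_cong) (use Dc * ** in auto)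
    finally show ?thesis .
  qed
  have "det D \<noteq> 0"
  proof
    assume "det D = 0"
    then have "det g2 = 0" by (subst g2, fold D_def y_def) (simp add: det_block_tri[OF Dc])
    moreover have "det g2 = det P1 * det g * det Q"
      unfolding g2_def using GL_O_carrier_mat[OF P1] GL_O_carrier_mat[OF Q(1)] g(1)
      by (simp add: det_mult[of _ "Suc n"])
    moreover have "det P1 \<noteq> 0" "det Q \<noteq> 0"
      using GL_O_GL_K[OF P1] GL_O_GL_K[OF Q(1)] by (auto simp: carrier_GL_K)
    ultimately show False using g(2) by simp
  qed
  from Suc.IH[OF Dc this Dv] obtain P3 Q3 \<nu> where IH: "P3 \<in> GL_O n" "Q3 \<in> GL_O n"
    "\<forall>b<n. \<forall>a\<le>b. \<nu> b \<le> \<nu> a" "\<forall>a<n. d \<le> \<nu> a" "P3 * D * Q3 = tpow n \<nu>" by blast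
  note c3 = GL_O_carrier_mat[OF IH(1)] GL_O_carrier_mat[OF IH(2)]
  define P4 Q4 where "P4 = block_tri n P3 (\<lambda>_. 0) 1" and "Q4 = block_tri n Q3 (\<lambda>_. 0) 1"
  have P4: "P4 \<in> GL_O (Suc n)" and Q4: "Q4 \<in> GL_O (Suc n)"
    unfolding P4_def Q4_def using IH by (auto intro!: block_tri_GL_O)
  have fin: "P4 * (P2 * g2) * Q4 = tpow (Suc n) (\<nu>(n := d))"
    unfolding P2g2 P4_def Q4_def using c3 Dc
    by (simp add: block_tri_mult_0 mult_carrier_mat[of P3 n n D n] IH(5) block_tri_tpow)
  have "P4 * P2 * P1 * g * (Q * Q4) = tpow (Suc n) (\<nu>(n := d))"
    unfolding fin[symmetric] g2_def
    using GL_O_carrier_mat[OF P1] GL_O_carrier_mat[OF Q(1)] GL_O_carrier_mat[OF P2]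
      GL_O_carrier_mat[OF P4] GL_O_carrier_mat[OF Q4] g(1)
    by (simp add: mat_assoc[of _ "Suc n"])
  moreover have "P4 * P2 * P1 \<in> GL_O (Suc n)" "Q * Q4 \<in> GL_O (Suc n)"
    using P1 P2 P4 Q(1) Q4 by (auto intro: GL_O_mult)
  moreover have "\<forall>b<Suc n. \<forall>a\<le>b. (\<nu>(n := d)) b \<le> (\<nu>(n := d)) a" "\<forall>a<Suc n. e \<le> (\<nu>(n := d)) a"
    using IH(3,4) de by (auto simp: less_Suc_eq)
  ultimately show ?case by blast
qed

lemma mult_carrier_square [simp]:
  "A \<in> carrier_mat m m \<Longrightarrow> B \<in> carrier_mat m m \<Longrightarrow> A * B \<in> carrier_mat m m"
  by (rule mult_carrier_mat)

section \<open>The distance on the affine Grassmannian\<close>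

lemma dominant_antimono: "\<mu> \<in> dominant m \<Longrightarrow> a \<le> b \<Longrightarrow> b < m \<Longrightarrow> \<mu> ! b \<le> \<mu> ! a"
  by (cases "a = b") (auto simp: dominant_def sorted_wrt_iff_nth_less)

text \<open>Moving \<open>x\<close> to the base point leaves the freedom of \<open>GL_O m\<close> in
  the choice of \<open>g\<close>, and the coset of \<open>y\<close> adds another factor on the
  right; so a relative position is a double coset.\<close>

lemma relative_position_iff:
  assumes x: "x \<in> carrier (GL_K m)" and y: "y \<in> carrier (GL_K m)"
  shows "(\<exists>g\<in>carrier (GL_K m). g <#\<^bsub>GL_K m\<^esub> (x <#\<^bsub>GL_K m\<^esub> GL_O m) = base_point m \<and>
      g <#\<^bsub>GL_K m\<^esub> (y <#\<^bsub>GL_K m\<^esub> GL_O m) = torus_point m \<mu>) \<longleftrightarrow>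
    (\<exists>k\<in>GL_O m. \<exists>k'\<in>GL_O m. y = x * k * tpow m ((!) \<mu>) * k')" (is "?L \<longleftrightarrow> ?R")
proof
  assume ?L
  then obtain g where g: "g \<in> carrier (GL_K m)"
    "(g * x) <#\<^bsub>GL_K m\<^esub> GL_O m = 1\<^sub>m m <#\<^bsub>GL_K m\<^esub> GL_O m"
    "(g * y) <#\<^bsub>GL_K m\<^esub> GL_O m = tpow m ((!) \<mu>) <#\<^bsub>GL_K m\<^esub> GL_O m"
    using x y by (auto simp: l_coset_coset base_point_coset torus_point_tpow)
  obtain k where k: "k \<in> GL_O m" "1\<^sub>m m = g * x * k"
    using g x coset_GL_O[of "g * x" m "1\<^sub>m m"] by (auto simp: GL_K_mult)
  obtain k' where k': "k' \<in> GL_O m" "g * y = tpow m ((!) \<mu>) * k'"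
    using g(1) y coset_GL_O[of "tpow m ((!) \<mu>)" m "g * y"] g(3)[symmetric] by (auto simp: GL_K_mult)
  note c = GL_K_carrier_mat[OF x] GL_K_carrier_mat[OF y] GL_K_carrier_mat[OF g(1)]
    GL_O_carrier_mat[OF k(1)] GL_O_carrier_mat[OF k'(1)]
  have "g * (x * k) = 1\<^sub>m m" using k(2) c by (simp add: mat_assoc[of _ m])
  then have "x * k * g = 1\<^sub>m m" using c by (intro mat_mult_left_right_inverse[of g m]) auto
  then have "x * k * (g * y) = y" using c by (intro mat_cancel) auto
  then have "y = x * k * tpow m ((!) \<mu>) * k'"
    unfolding k'(2) using c mat_assoc[of "x * k" m "tpow m ((!) \<mu>)" k'] by simp
  then show ?R using k k' by blast
next
  assume ?R
  then obtain k k' where k: "k \<in> GL_O m" "k' \<in> GL_O m" "y = x * k * tpow m ((!) \<mu>) * k'" by blast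
  have xk: "x * k \<in> carrier (GL_K m)" by (rule GL_K_mult[OF x GL_O_GL_K[OF k(1)]])
  obtain g where g: "g \<in> carrier (GL_K m)" "g * (x * k) = 1\<^sub>m m"
    using GL_K_inv[OF xk] by blast
  note c = GL_K_carrier_mat[OF x] GL_K_carrier_mat[OF y] GL_K_carrier_mat[OF g(1)]
    GL_O_carrier_mat[OF k(1)] GL_O_carrier_mat[OF k(2)]
  have "1\<^sub>m m = g * x * k" using g(2) c by (simp add: mat_assoc[of _ m])
  then have "(g * x) <#\<^bsub>GL_K m\<^esub> GL_O m = 1\<^sub>m m <#\<^bsub>GL_K m\<^esub> GL_O m"
    using coset_GL_O[OF GL_K_mult[OF g(1) x] GL_K_one] k(1) by blast
  moreover have "(g * y) <#\<^bsub>GL_K m\<^esub> GL_O m = tpow m ((!) \<mu>) <#\<^bsub>GL_K m\<^esub> GL_O m"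
  proof -
    have "y = x * k * (tpow m ((!) \<mu>) * k')"
      using k(3) c by (simp add: mat_assoc[of _ m])
    then have "g * y = tpow m ((!) \<mu>) * k'"
      using c mat_cancel[OF g(2), of "tpow m ((!) \<mu>) * k'"] by simp
    then show ?thesis
      using coset_GL_O[OF tpow_GL_K GL_K_mult[OF g(1) y]] k(2) by blast
  qed
  ultimately show ?L
    using g(1) x y by (auto simp: l_coset_coset base_point_coset torus_point_tpow)
qed

lemma relative_position_unique:
  assumes k: "k \<in> GL_O m" "k' \<in> GL_O m" "l \<in> GL_O m" "l' \<in> GL_O m" and x: "x \<in> carrier (GL_K m)"
    and eq: "x * k * tpow m ((!) \<mu>) * k' = x * l * tpow m ((!) \<nu>) * l'"
    and d: "\<mu> \<in> dominant m" "\<nu> \<in> dominant m"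
  shows "\<mu> = \<nu>"
proof -
  obtain li where li: "li \<in> GL_O m" "l * li = 1\<^sub>m m" "li * l = 1\<^sub>m m" using GL_O_inverse[OF k(3)] .
  obtain ki where ki: "ki \<in> GL_O m" "k' * ki = 1\<^sub>m m" "ki * k' = 1\<^sub>m m" using GL_O_inverse[OF k(2)] .
  obtain xi where xi: "xi \<in> carrier (GL_K m)" "xi * x = 1\<^sub>m m" using GL_K_inv[OF x] by blast
  note c = GL_K_carrier_mat[OF x] k[THEN GL_O_carrier_mat] GL_O_carrier_mat[OF li(1)]
    GL_O_carrier_mat[OF ki(1)] GL_K_carrier_mat[OF xi(1)]
  define M N where "M = tpow m ((!) \<mu>)" and "N = tpow m ((!) \<nu>)"
  have MN: "M \<in> carrier_mat m m" "N \<in> carrier_mat m m" by (auto simp: M_def N_def)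
  have "li * (xi * (x * (k * (M * k'))) * ki) = li * (xi * (x * (l * (N * l'))) * ki)"
    using eq c MN unfolding M_def[symmetric] N_def[symmetric] by (simp add: mat_assoc[of _ m])
  then have "li * ((k * (M * k')) * ki) = li * ((l * (N * l')) * ki)"
    using c MN mat_cancel[OF xi(2)] by simp
  then have "li * k * (M * (k' * ki)) = li * (l * (N * (l' * ki)))"
    using c MN by (simp add: mat_assoc[of _ m])
  then have "li * k * M = N * (l' * ki)"
    using c MN ki(2) mat_cancel[OF li(3)] by simp
  then have "\<nu> ! j = \<mu> ! j" if "j < m" for j
    using tpow_double_coset_unique[of "li * k" m "l' * ki" "(!) \<nu>" "(!) \<mu>" j] that d k li ki
    by (auto simp: M_def N_def dominant_antimono intro: GL_O_mult)
  then show ?thesis using d by (intro nth_equalityI) (auto simp: dominant_def)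
qed

lemma relative_position_exists:
  assumes x: "x \<in> carrier (GL_K m)" and y: "y \<in> carrier (GL_K m)"
  shows "\<exists>\<mu>\<in>dominant m. \<exists>k\<in>GL_O m. \<exists>k'\<in>GL_O m. y = x * k * tpow m ((!) \<mu>) * k'"
proof -
  obtain xi where xi: "xi \<in> carrier (GL_K m)" "xi * x = 1\<^sub>m m" "x * xi = 1\<^sub>m m"
    using GL_K_inv[OF x] by blast
  define g where "g = xi * y"
  have gK: "g \<in> carrier (GL_K m)" unfolding g_def by (rule GL_K_mult[OF xi(1) y])
  then have g: "g \<in> carrier_mat m m" "det g \<noteq> 0" by (auto simp: carrier_GL_K)
  obtain e where e: "mat_val_ge m e g"
  proof (cases "m = 0")
    case True
    then show ?thesis using that[of 0] g by (auto simp: mat_val_ge_def)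
  next
    case False
    then show ?thesis using nonzero_entry_of_minimal_valuation[OF g] that by auto
  qed
  obtain P Q \<nu> where P: "P \<in> GL_O m" "Q \<in> GL_O m" "\<forall>b<m. \<forall>a\<le>b. \<nu> b \<le> \<nu> a" "P * g * Q = tpow m \<nu>"
    using cartan_exists[OF g e] by blast
  obtain Pi where Pi: "Pi \<in> GL_O m" "P * Pi = 1\<^sub>m m" "Pi * P = 1\<^sub>m m" using GL_O_inverse[OF P(1)] .
  obtain Qi where Qi: "Qi \<in> GL_O m" "Q * Qi = 1\<^sub>m m" "Qi * Q = 1\<^sub>m m" using GL_O_inverse[OF P(2)] .
  note c = GL_K_carrier_mat[OF x] GL_K_carrier_mat[OF y] GL_K_carrier_mat[OF xi(1)] g(1)
    GL_O_carrier_mat[OF P(1)] GL_O_carrier_mat[OF P(2)] GL_O_carrier_mat[OF Pi(1)] GL_O_carrier_mat[OF Qi(1)]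
  define \<mu> where "\<mu> = map \<nu> [0..<m]"
  have "\<mu> \<in> dominant m"
    using P(3) by (auto simp: \<mu>_def dominant_def sorted_wrt_iff_nth_less)
  moreover have "tpow m ((!) \<mu>) = tpow m \<nu>" by (rule tpow_cong) (simp add: \<mu>_def)
  moreover have "y = x * Pi * tpow m \<nu> * Qi"
  proof -
    have "x * Pi * tpow m \<nu> * Qi = x * (Pi * (P * (g * (Q * Qi))))"
      unfolding P(4)[symmetric] using c by (simp add: mat_assoc[of _ m])
    also have "\<dots> = x * (xi * y)" using c mat_cancel[OF Pi(3), of g] by (simp add: Qi(2) g_def)
    also have "\<dots> = y" using c mat_cancel[OF xi(3), of y] by simp
    finally show ?thesis by simp
  qed
  ultimately show ?thesis using Pi(1) Qi(1)
    by (intro bexI[of _ \<mu>] bexI[of _ Pi] bexI[of _ Qi]) simp_all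
qed

text \<open>Existence and uniqueness in the Cartan decomposition make the definite description in
  \<open>dist_Gr\<close> meaningful. Afterwards distances are used only in this double coset
  form.\<close>

lemma dist_Gr_eq_iff:
  assumes x: "x \<in> carrier (GL_K m)" and y: "y \<in> carrier (GL_K m)"
  shows "dist_Gr m (x <#\<^bsub>GL_K m\<^esub> GL_O m) (y <#\<^bsub>GL_K m\<^esub> GL_O m) = \<mu> \<longleftrightarrow>
    \<mu> \<in> dominant m \<and> (\<exists>k\<in>GL_O m. \<exists>k'\<in>GL_O m. y = x * k * tpow m ((!) \<mu>) * k')"
proof -
  let ?P = "\<lambda>\<mu>. \<mu> \<in> dominant m \<and> (\<exists>k\<in>GL_O m. \<exists>k'\<in>GL_O m. y = x * k * tpow m ((!) \<mu>) * k')"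
  have d: "dist_Gr m (x <#\<^bsub>GL_K m\<^esub> GL_O m) (y <#\<^bsub>GL_K m\<^esub> GL_O m) = (THE \<mu>. ?P \<mu>)"
    unfolding dist_Gr_def relative_position_iff[OF x y] ..
  have ex: "\<exists>!\<mu>. ?P \<mu>"
  proof (rule ex_ex1I)
    show "\<exists>\<mu>. ?P \<mu>" using relative_position_exists[OF x y] by blast
    fix \<mu> \<nu> assume "?P \<mu>" "?P \<nu>"
    then show "\<mu> = \<nu>" using relative_position_unique[OF _ _ _ _ x] by metis
  qed
  show ?thesis
    unfolding d
  proof
    assume "(THE \<mu>. ?P \<mu>) = \<mu>"
    then show "?P \<mu>" using theI'[OF ex] by (rule subst)
  next
    assume "?P \<mu>"
    then show "(THE \<mu>. ?P \<mu>) = \<mu>" by (rule the1_equality[OF ex])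
  qed
qed


section \<open>Schubert cells of minuscule orbits\<close>

text \<open>For \<open>w\<close> with two adjacent values, \<open>cmat u * tpow m w\<close> runs
  through representatives of the Schubert cell of \<open>t^w\<close>. An entry above the diagonal at
  \<open>(a, b)\<close> with \<open>w a \<le> w b\<close> could be moved through \<open>t^w\<close>
  into \<open>GL_O m\<close>, so entries are kept at the inversions of \<open>w\<close>
  only.\<close>

definition echelon :: "nat \<Rightarrow> (nat \<Rightarrow> int) \<Rightarrow> complex mat \<Rightarrow> bool" where
  "echelon m w u \<longleftrightarrow> u \<in> carrier_mat m m \<and> (\<forall>a<m. u $$ (a, a) = 1) \<and>
     (\<forall>a<m. \<forall>b<m. a \<noteq> b \<and> u $$ (a, b) \<noteq> 0 \<longrightarrow> a < b \<and> w b < w a)"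

lemma echelonD:
  assumes "echelon m w u"
  shows "u \<in> carrier_mat m m" "a < m \<Longrightarrow> u $$ (a, a) = 1"
    "a < m \<Longrightarrow> b < m \<Longrightarrow> a \<noteq> b \<Longrightarrow> u $$ (a, b) \<noteq> 0 \<Longrightarrow> a < b \<and> w b < w a"
  using assms unfolding echelon_def by blast+

lemma echelon_det:
  assumes u: "echelon m w u"
  shows "det u = 1"
proof -
  note uc = echelonD(1)[OF u]
  have "u $$ (i, j) = 0" if "j < i" "i < m" for i j
    using echelonD(3)[OF u, of i j] that by linarith
  then have "upper_triangular u" using uc by (simp add: upper_triangular_def)
  then have "det u = prod_list (diag_mat u)" using uc by (rule det_upper_triangular)
  also have "diag_mat u = map (\<lambda>_. 1) [0..<m]"
    using uc echelonD(2)[OF u] by (simp add: diag_mat_def)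
  also have "prod_list \<dots> = 1" by (simp add: map_replicate_const)
  finally show ?thesis .
qed

lemma echelon_GL_O: "echelon m w u \<Longrightarrow> cmat u \<in> GL_O m"
  using echelon_det[of m w u] echelonD(1)[of m w u] by (simp add: cmat_GL_O)

lemma cmat_block_tri: "u \<in> carrier_mat n n \<Longrightarrow>
  cmat (block_tri n u y c) = block_tri n (cmat u) (\<lambda>a. fls_const (y a)) (fls_const c)"
  by (intro eq_matI) (auto simp: cmat_index block_tri_index)

text \<open>The hypotheses say that the lattice spanned by \<open>g\<close> lies between
  \<open>t C[[t]]^n\<close> and \<open>C[[t]]^n\<close>, hence comes from a subspace of
  \<open>C^n\<close>; the conclusion is a reduced echelon form of it. Clearing the last row leaves
  an upper left block that satisfies the same hypotheses.\<close>

lemma minuscule_echelon: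
  assumes "mat_val_ge n 0 g" "mat_val_ge n 0 h" "g * h = tp 1 \<cdot>\<^sub>m 1\<^sub>m n"
  shows "\<exists>w u k. (\<forall>a<n. w a \<in> {0, 1}) \<and> echelon n w u \<and> k \<in> GL_O n \<and> g = cmat u * tpow n w * k"
  using assms
proof (induction n arbitrary: g h)
  case 0
  have "g = cmat (1\<^sub>m 0) * tpow 0 (\<lambda>_. 0) * 1\<^sub>m 0"
    using 0 by (intro eq_matI) (auto simp: mat_val_ge_def)
  moreover have "echelon 0 (\<lambda>_. 0) (1\<^sub>m 0)" by (simp add: echelon_def)
  ultimately show ?case using GL_O_one by blast
next
  case (Suc n)
  note g = Suc.prems
  have gc: "g \<in> carrier_mat (Suc n) (Suc n)" and hc: "h \<in> carrier_mat (Suc n) (Suc n)"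
    using g by (auto simp: mat_val_ge_def)
  define r where "r b = g $$ (n, b)" for b
  have rv: "val_ge 0 (r b)" if "b < Suc n" for b using g(1) that by (simp add: mat_val_ge_def r_def)
  \<comment> \<open>Otherwise the corner entry of \<open>g * h\<close>, which is \<open>t\<close>,
    would be divisible by \<open>t^2\<close>. So the pivot of the last row has exponent 0 or
    1.\<close>
  have low: "\<not> (\<forall>b<Suc n. val_ge 2 (r b))"
  proof
    assume *: "\<forall>b<Suc n. val_ge 2 (r b)"
    have "(g * h) $$ (n, n) = (\<Sum>k<Suc n. r k * h $$ (k, n))"
      unfolding r_def by (rule mult_mat_index[OF gc hc]) auto
    moreover have "val_ge 2 (\<Sum>k<Suc n. r k * h $$ (k, n))"
      using * g(2) val_ge_mult[of 2 _ 0] by (intro val_ge_sum) (simp add: mat_val_ge_def)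
    ultimately have "val_ge 2 (tp 1)" using g(3) by simp
    then show False by (simp add: val_ge_tp)
  qed
  obtain e b0 where e: "e = 0 \<or> e = 1" "\<And>b. b < Suc n \<Longrightarrow> val_ge e (r b)" "b0 < Suc n" "fls_nth (r b0) e \<noteq> 0"
  proof (cases "\<exists>b<Suc n. fls_nth (r b) 0 \<noteq> 0")
    case True
    then show ?thesis using that[of 0] rv by blast
  next
    case False
    have 1: "val_ge 1 (r b)" if "b < Suc n" for b
      unfolding val_ge_def
    proof (intro allI impI)
      fix k :: int assume "k < 1"
      then have "k < 0 \<or> k = 0" by linarith
      then show "fls_nth (r b) k = 0"
        using False rv[OF that] that unfolding val_ge_def by blast
    qed
    have "\<exists>b<Suc n. fls_nth (r b) 1 \<noteq> 0"
    proof (rule ccontr)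
      assume no: "\<not> ?thesis"
      have "val_ge 2 (r b)" if "b < Suc n" for b
        unfolding val_ge_def
      proof (intro allI impI)
        fix k :: int assume "k < 2"
        then have "k < 1 \<or> k = 1" by linarith
        then show "fls_nth (r b) k = 0"
          using no 1[OF that] that unfolding val_ge_def by blast
      qed
      then show False using low by blast
    qed
    then show ?thesis using that[of 1] 1 by blast
  qed
  obtain Q where Q: "Q \<in> GL_O (Suc n)"
    "\<And>b. b < Suc n \<Longrightarrow> (\<Sum>c<Suc n. r c * Q $$ (c, b)) = (if b = n then tp e else 0)"
    using row_reduction[of n e r b0] e(2-4) by metis
  obtain Qi where Qi: "Qi \<in> GL_O (Suc n)" "Q * Qi = 1\<^sub>m (Suc n)" "Qi * Q = 1\<^sub>m (Suc n)"
    using GL_O_inverse[OF Q(1)] .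
  note c = gc hc GL_O_carrier_mat[OF Q(1)] GL_O_carrier_mat[OF Qi(1)]
  define g2 h2 where "g2 = g * Q" and "h2 = Qi * h"
  have g2v: "mat_val_ge (Suc n) 0 g2" "mat_val_ge (Suc n) 0 h2"
    unfolding g2_def h2_def using mat_val_ge_mult_GL_O g(1,2) Q(1) Qi(1) by auto
  have g2c: "g2 \<in> carrier_mat (Suc n) (Suc n)" "h2 \<in> carrier_mat (Suc n) (Suc n)"
    using g2v by (auto simp: mat_val_ge_def)
  have g2h2: "g2 * h2 = tp 1 \<cdot>\<^sub>m 1\<^sub>m (Suc n)"
  proof -
    have "g2 * h2 = g * (Q * (Qi * h))" unfolding g2_def h2_def using c by (simp add: mat_assoc[of _ "Suc n"])
    also have "\<dots> = g * h" using c mat_cancel[OF Qi(2)] by simp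
    finally show ?thesis using g(3) by simp
  qed
  have g_g2: "g = g2 * Qi"
    unfolding g2_def using c Qi(2) by (simp add: mat_assoc[of _ "Suc n"])
  have last: "g2 $$ (n, b) = (if b = n then tp e else 0)" if "b < Suc n" for b
    unfolding g2_def Q(2)[OF that, symmetric] r_def by (rule mult_mat_index[OF c(1,3) _ that]) simp
  define D y where "D = mat n n (\<lambda>ij. g2 $$ ij)" and "y = (\<lambda>a. g2 $$ (a, n))"
  define D' y' where "D' = mat n n (\<lambda>ij. h2 $$ ij)" and "y' = (\<lambda>a. h2 $$ (a, n))"
  have Dc: "D \<in> carrier_mat n n" "D' \<in> carrier_mat n n" by (auto simp: D_def D'_def)
  have Dv: "mat_val_ge n 0 D" "mat_val_ge n 0 D'" using g2v by (auto simp: mat_val_ge_def D_def D'_def)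
  have yv: "val_ge 0 (y a)" "val_ge 0 (y' a)" if "a < n" for a
    using g2v that by (auto simp: mat_val_ge_def y_def y'_def)
  have g2: "g2 = block_tri n D y (tp e)"
    using block_tri_exhaust[OF g2c(1)] last unfolding D_def y_def by simp
  \<comment> \<open>The last row of \<open>g2\<close> is \<open>t^e\<close> times a unit vector,
    which determines the last row of \<open>h2\<close>; thus \<open>h2\<close> is block triangular
    too and the upper left blocks multiply to \<open>t\<close>.\<close>
  have h2last: "tp e * h2 $$ (n, b) = (if b = n then tp 1 else 0)" if "b < Suc n" for b
  proof -
    have "(g2 * h2) $$ (n, b) = (\<Sum>k<Suc n. g2 $$ (n, k) * h2 $$ (k, b))"
      by (rule mult_mat_index[OF g2c _ that]) simp
    also have "\<dots> = (\<Sum>k<Suc n. if k = n then tp e * h2 $$ (n, b) else 0)"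
      using last by (intro sum.cong) auto
    finally show ?thesis using that unfolding g2h2 by (cases "b = n") auto
  qed
  have "h2 $$ (n, b) = 0" if "b < n" for b using h2last[of b] that by simp
  then have h2: "h2 = block_tri n D' y' (h2 $$ (n, n))"
    using block_tri_exhaust[OF g2c(2)] unfolding D'_def y'_def by simp
  have prod: "block_tri n (D * D') (\<lambda>a. (\<Sum>k<n. D $$ (a, k) * y' k) + y a * h2 $$ (n, n)) (tp e * h2 $$ (n, n))
      = tp 1 \<cdot>\<^sub>m 1\<^sub>m (Suc n)"
    using g2h2 block_tri_mult[OF Dc, of y "tp e" y' "h2 $$ (n, n)"] g2 h2 by metis
  have "D * D' = tp 1 \<cdot>\<^sub>m 1\<^sub>m n"
  proof (rule eq_matI)
    fix a b assume "a < dim_row (tp 1 \<cdot>\<^sub>m 1\<^sub>m n)" "b < dim_col (tp 1 \<cdot>\<^sub>m 1\<^sub>m n)"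
    then show "(D * D') $$ (a, b) = (tp 1 \<cdot>\<^sub>m 1\<^sub>m n) $$ (a, b)"
      using arg_cong[OF prod, of "\<lambda>M. M $$ (a, b)"] by (simp add: block_tri_index del: index_mult_mat(1))
  qed (use Dc in auto)
  from Suc.IH[OF Dv this] obtain w u k where IH: "\<forall>a<n. w a \<in> {0, 1}" "echelon n w u" "k \<in> GL_O n"
    "D = cmat u * tpow n w * k" by blast
  have uc: "u \<in> carrier_mat n n" using IH(2) by (simp add: echelon_def)
  note kc = GL_O_carrier_mat[OF IH(3)]
  define k2 where "k2 = block_tri n k (\<lambda>_. 0) 1"
  have k2: "k2 \<in> GL_O (Suc n)" unfolding k2_def by (rule block_tri_GL_O) (use IH in auto)
  have fac: "block_tri n D y0 (tp e) = cmat (block_tri n u Y 1) * tpow (Suc n) (w(n := e)) * k2"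
    if "\<And>a. a < n \<Longrightarrow> y0 a = fls_const (Y a) * tp e" for y0 Y
  proof -
    have "cmat (block_tri n u Y 1) * tpow (Suc n) (w(n := e)) * k2
      = block_tri n (cmat u * tpow n w * k) (\<lambda>a. fls_const (Y a) * tp e * 1) (1 * tp e * 1)"
      unfolding k2_def using uc kc
      by (simp add: cmat_block_tri block_tri_tpow[symmetric] block_tri_mult_0 mult_carrier_mat[of _ n n _ n])
    also have "\<dots> = block_tri n D y0 (tp e)"
      unfolding IH(4) by (rule block_tri_cong) (use that in auto)
    finally show ?thesis by simp
  qed
  have absorb: "block_tri n D (\<lambda>a. y0 a + (\<Sum>k<n. D $$ (a, k) * z k)) (tp e)
      = block_tri n D y0 (tp e) * block_tri n (1\<^sub>m n) z 1" for y0 z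
    unfolding block_tri_mult[OF Dc(1) one_carrier_mat]
    by (rule block_tri_cong) (use Dc in \<open>auto simp: add.commute\<close>)
  \<comment> \<open>Splits the last column into constants \<open>Y\<close>, to be kept in the
    echelon matrix, and a combination of the columns of \<open>D\<close>, to be absorbed on the
    right. For \<open>e = 1\<close> the product with \<open>h2\<close> exhibits the whole column as
    such a combination; for \<open>e = 0\<close> constants survive in the rows with
    \<open>w a = 1\<close>.\<close>
  obtain Y z where Y: "\<And>a. a < n \<Longrightarrow> Y a \<noteq> 0 \<Longrightarrow> e < w a"
    and z: "\<And>a. a < n \<Longrightarrow> val_ge 0 (z a)"
    and y: "\<And>a. a < n \<Longrightarrow> y a = fls_const (Y a) * tp e + (\<Sum>k<n. D $$ (a, k) * z k)"
  proof (cases "e = 1")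
    case True
    have "h2 $$ (n, n) = 1" using h2last[of n] True by simp
    then have "y a = (\<Sum>k<n. D $$ (a, k) * - y' k)" if "a < n" for a
      using arg_cong[OF prod, of "\<lambda>M. M $$ (a, n)"] that
      by (simp add: block_tri_index sum_negf) (metis add_eq_0_iff)
    then show ?thesis using that[of "\<lambda>_. 0" "\<lambda>a. - y' a"] yv(2) by (auto simp: val_ge_minus)
  next
    case False
    then have e0: "e = 0" using e(1) by simp
    obtain ui where ui: "ui \<in> GL_O n" "cmat u * ui = 1\<^sub>m n" using GL_O_inverse[OF echelon_GL_O[OF IH(2)]] .
    obtain ki where ki: "ki \<in> GL_O n" "k * ki = 1\<^sub>m n" using GL_O_inverse[OF IH(3)] .
    note uic = GL_O_carrier_mat[OF ui(1)] GL_O_carrier_mat[OF ki(1)]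
    define s where "s a = (\<Sum>b<n. ui $$ (a, b) * y b)" for a
    have sv: "val_ge 0 (s a)" if "a < n" for a
      unfolding s_def using ui(1) yv(1) that by (intro val_ge_sum val_ge_mult0) (auto simp: GL_O_iff mat_val_ge_def)
    define Y where "Y a = (if w a = 1 then fls_nth (s a) 0 else 0)" for a
    \<comment> \<open>After removal of the constant part, row \<open>a\<close> of \<open>s\<close>
      is divisible by \<open>t^(w a)\<close>; the quotient is what the torus factor can
      absorb.\<close>
    define s' where "s' a = tp (- w a) * (s a - fls_const (Y a))" for a
    have s's: "s a = fls_const (Y a) + tp (w a) * s' a" for a
      by (simp add: s'_def mult.assoc[symmetric] tp_add[symmetric])
    have s'v: "val_ge 0 (s' a)" if "a < n" for a
    proof -
      have w: "w a \<in> {0, 1}" using IH(1) that by blast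
      show ?thesis
      proof (cases "w a = 1")
        case True
        have "fls_nth (s a - fls_const (Y a)) k = 0" if "k < 1" for k
        proof -
          have "k < 0 \<or> k = 0" using that by linarith
          then show ?thesis using sv[OF \<open>a < n\<close>] True by (auto simp: Y_def val_ge_def)
        qed
        then show ?thesis using True by (simp add: s'_def val_ge_tp_mult val_ge_def)
      next
        case False
        then have "w a = 0" using w by auto
        then show ?thesis using sv[OF that] by (simp add: s'_def Y_def)
      qed
    qed
    define z where "z a = (\<Sum>b<n. ki $$ (a, b) * s' b)" for a
    have zv: "val_ge 0 (z a)" if "a < n" for a
      unfolding z_def using ki(1) s'v that by (intro val_ge_sum val_ge_mult0) (auto simp: GL_O_iff mat_val_ge_def)
    have app: "(\<Sum>j<n. A $$ (a, j) * (\<Sum>b<n. B $$ (j, b) * x b)) = (\<Sum>b<n. (A * B) $$ (a, b) * x b)"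
      if "A \<in> carrier_mat n n" "B \<in> carrier_mat n n" "a < n" for A B :: "complex fls mat" and x a
    proof -
      have "(\<Sum>b<n. (A * B) $$ (a, b) * x b) = (\<Sum>b<n. \<Sum>j<n. A $$ (a, j) * B $$ (j, b) * x b)"
        using that by (intro sum.cong) (auto simp: mult_mat_index[of A n n B n] sum_distrib_right simp del: index_mult_mat(1))
      also have "\<dots> = (\<Sum>j<n. \<Sum>b<n. A $$ (a, j) * B $$ (j, b) * x b)" by (rule sum.swap)
      finally show ?thesis by (simp add: sum_distrib_left mult.assoc)
    qed
    have one: "(\<Sum>b<n. 1\<^sub>m n $$ (a, b) * x b) = x a" if "a < n" for x :: "nat \<Rightarrow> complex fls" and a
    proof -
      have "(\<Sum>b<n. 1\<^sub>m n $$ (a, b) * x b) = (\<Sum>b<n. if b = a then x a else 0)"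
        using that by (intro sum.cong) auto
      then show ?thesis using that by simp
    qed
    have "y a = fls_const (Y a) * tp e + (\<Sum>k<n. D $$ (a, k) * z k)" if a: "a < n" for a
    proof -
      have "y a = (\<Sum>j<n. cmat u $$ (a, j) * s j)"
        unfolding s_def by (subst app) (use uc uic a ui(2) one in auto)
      also have "\<dots> = (\<Sum>j<n. cmat u $$ (a, j) * fls_const (Y j)) + (\<Sum>j<n. cmat u $$ (a, j) * tp (w j) * s' j)"
        by (subst s's) (simp add: sum.distrib algebra_simps)
      \<comment> \<open>An entry of \<open>u\<close> off the diagonal in column \<open>j\<close>
        requires \<open>w j < w a\<close>, hence \<open>w j = 0\<close>, whereas \<open>Y j\<close>
        is nonzero only for \<open>w j = 1\<close>. So \<open>u\<close> acts on \<open>Y\<close> as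
        the identity.\<close>
      also have "(\<Sum>j<n. cmat u $$ (a, j) * fls_const (Y j)) = (\<Sum>j<n. if j = a then fls_const (Y a) else 0)"
      proof (rule sum.cong)
        fix j assume j: "j \<in> {..<n}"
        show "cmat u $$ (a, j) * fls_const (Y j) = (if j = a then fls_const (Y a) else 0)"
        proof (cases "j = a \<or> u $$ (a, j) = 0")
          case True
          then show ?thesis using j a uc IH(2) by (auto simp: cmat_index echelon_def)
        next
          case False
          then have "w j < w a" using IH(2) a j by (auto simp: echelon_def)
          then have "w j \<noteq> 1" using IH(1) a by force
          then show ?thesis using False by (simp add: Y_def)
        qed
      qed simp
      also have "(\<Sum>j<n. cmat u $$ (a, j) * tp (w j) * s' j) = (\<Sum>j<n. (cmat u * tpow n w) $$ (a, j) * s' j)"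
        using uc a by (intro sum.cong) (auto simp: mult_tpow_index simp del: index_mult_mat(1))
      also have "\<dots> = (\<Sum>k<n. D $$ (a, k) * z k)"
      proof -
        have "D * ki = cmat u * tpow n w"
          unfolding IH(4) using uc kc uic ki(2) by (simp add: mat_assoc[of _ n])
        then show ?thesis unfolding z_def by (subst app[OF Dc(1) uic(2) a]) simp
      qed
      finally show ?thesis using a e0 by simp
    qed
    moreover have "e < w a" if "a < n" "Y a \<noteq> 0" for a
      using that e0 by (auto simp: Y_def split: if_splits)
    ultimately show ?thesis using that zv by blast
  qed
  define k3 where "k3 = k2 * (block_tri n (1\<^sub>m n) z 1) * Qi"
  have bz: "block_tri n (1\<^sub>m n) z 1 \<in> GL_O (Suc n)" by (rule block_tri_GL_O) (use z in auto)
  have k3: "k3 \<in> GL_O (Suc n)"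
    unfolding k3_def by (intro GL_O_mult k2 Qi(1) bz)
  have "g2 = block_tri n D (\<lambda>a. fls_const (Y a) * tp e + (\<Sum>k<n. D $$ (a, k) * z k)) (tp e)"
    unfolding g2 by (rule block_tri_cong) (use y in auto)
  also have "\<dots> = block_tri n D (\<lambda>a. fls_const (Y a) * tp e) (tp e) * block_tri n (1\<^sub>m n) z 1"
    by (rule absorb)
  also have "block_tri n D (\<lambda>a. fls_const (Y a) * tp e) (tp e)
      = cmat (block_tri n u Y 1) * tpow (Suc n) (w(n := e)) * k2" by (rule fac) simp
  finally have "g = cmat (block_tri n u Y 1) * tpow (Suc n) (w(n := e)) * k3"
    unfolding g_g2 k3_def using c GL_O_carrier_mat[OF k2] GL_O_carrier_mat[OF bz]
    by (simp add: mat_assoc[of _ "Suc n"])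
  moreover have "echelon (Suc n) (w(n := e)) (block_tri n u Y 1)"
    using IH(2) Y unfolding echelon_def by (auto simp: block_tri_index less_Suc_eq)
  moreover have "\<forall>a<Suc n. (w(n := e)) a \<in> {0, 1}" using IH(1) e(1) by (auto simp: less_Suc_eq)
  ultimately show ?case using k3 by blast
qed

lemma det_tpow: "det (tpow m v) = tp (\<Sum>a<m. v a)"
proof -
  have "upper_triangular (tpow m v)" by (auto simp: upper_triangular_def tpow_index)
  then have "det (tpow m v) = prod_list (diag_mat (tpow m v))"
    by (intro det_upper_triangular) auto
  also have "diag_mat (tpow m v) = map (\<lambda>a. tp (v a)) [0..<m]"
    by (auto simp: diag_mat_def tpow_index)
  also have "prod_list \<dots> = tp (\<Sum>a<m. v a)"
    by (induction m) (auto simp: tp_add)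
  finally show ?thesis .
qed

text \<open>Comparison of determinants: those of elements of \<open>GL_O m\<close> have valuation
  0.\<close>

lemma GL_O_tpow_sum_eq:
  assumes "k \<in> GL_O m" "l \<in> GL_O m" "k' \<in> GL_O m" "k * tpow m v = l * tpow m w * k'"
  shows "(\<Sum>a<m. v a) = (\<Sum>a<m. w a)"
proof -
  note c = assms(1-3)[THEN GL_O_carrier_mat]
  have "fls_subdegree (det x) = 0 \<and> det x \<noteq> 0" if "x \<in> GL_O m" for x
    using that val_ge_det[of m x] by (auto simp: GL_O_iff val_ge_def intro!: fls_subdegree_eqI)
  moreover have "det k * tp (\<Sum>a<m. v a) = det l * tp (\<Sum>a<m. w a) * det k'"
    using arg_cong[OF assms(4), of det] c by (simp add: det_mult[of _ m] det_tpow mult_carrier_mat[of _ m m _ m])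
  moreover have "fls_subdegree (tp z) = z" for z by (simp add: tp_def)
  ultimately show ?thesis
    using assms(1-3) by (metis (no_types, lifting) add.commute add_0 fls_subdegree_mult mult_eq_0_iff tp_nonzero)
qed

lemma two_valued_mset_eq:
  assumes "length xs = length ys" "sum_list xs = sum_list ys"
    "set xs \<subseteq> {z, z + 1}" "set ys \<subseteq> {z, z + 1 :: int}"
  shows "mset xs = mset ys"
proof -
  have *: "sum_list xs = z * int (length xs) + int (count (mset xs) (z + 1)) \<and>
      count (mset xs) z + count (mset xs) (z + 1) = length xs" if "set xs \<subseteq> {z, z + 1}" for xs
    using that by (induction xs) (auto simp: algebra_simps)
  show ?thesis
  proof (rule multiset_eqI)
    fix x
    show "count (mset xs) x = count (mset ys) x"
    proof (cases "x = z \<or> x = z + 1")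
      case True
      then show ?thesis using *[OF assms(3)] *[OF assms(4)] assms(1,2) by auto
    next
      case False
      then have "x \<notin># mset xs" "x \<notin># mset ys" using assms by auto
      then show ?thesis by (metis count_eq_zero_iff)
    qed
  qed
qed

text \<open>The scalar \<open>t^z\<close> is central, so \<open>v\<close> may be shifted to values
  in \<open>{0, 1}\<close>, where the lattice lies between \<open>t C[[t]]^m\<close> and
  \<open>C[[t]]^m\<close>. The determinant then fixes how often \<open>w\<close> takes the value
  \<open>z + 1\<close>, which makes it a rearrangement of \<open>v\<close>.\<close>

lemma minuscule_step:
  fixes v :: "int list"
  assumes k: "k \<in> GL_O m" and v: "length v = m" "set v \<subseteq> {z, z + 1}"
  obtains w u k' where "mset w = mset v" "echelon m ((!) w) u" "k' \<in> GL_O m"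
    "k * tpow m ((!) v) = cmat u * tpow m ((!) w) * k'"
proof -
  obtain ki where ki: "ki \<in> GL_O m" "k * ki = 1\<^sub>m m" using GL_O_inverse[OF k] .
  note c = GL_O_carrier_mat[OF k] GL_O_carrier_mat[OF ki(1)]
  have vz: "v ! a = z \<or> v ! a = z + 1" if "a < m" for a using v that nth_mem by blast
  define g where "g = k * tpow m (\<lambda>a. v ! a - z)"
  \<comment> \<open>This is \<open>t\<close> times the inverse of \<open>g\<close>; it is integral
    because \<open>1 - (v ! a - z)\<close> is again 0 or 1.\<close>
  define h where "h = tpow m (\<lambda>a. 1 - (v ! a - z)) * ki"
  have "val_ge 0 (tp (v ! a - z))" "val_ge 0 (tp (1 - (v ! a - z)))" if "a < m" for a
    using vz[OF that] by (auto simp: val_ge_tp)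
  then have "mat_val_ge m 0 (tpow m (\<lambda>a. v ! a - z))" "mat_val_ge m 0 (tpow m (\<lambda>a. 1 - (v ! a - z)))"
    by (simp_all add: mat_val_ge_def tpow_index)
  then have "mat_val_ge m 0 g" "mat_val_ge m 0 h"
    unfolding g_def h_def using mat_val_ge_mult_GL_O k ki(1) by blast+
  moreover have "g * h = tp 1 \<cdot>\<^sub>m 1\<^sub>m m"
  proof -
    have "g * h = k * (tpow m (\<lambda>a. v ! a - z) * tpow m (\<lambda>a. 1 - (v ! a - z)) * ki)"
      unfolding g_def h_def using c by (simp add: mat_assoc[of _ m])
    also have "tpow m (\<lambda>a. v ! a - z) * tpow m (\<lambda>a. 1 - (v ! a - z)) = tp 1 \<cdot>\<^sub>m 1\<^sub>m m"
      unfolding tpow_add by (intro eq_matI) (auto simp: tpow_index)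
    also have "k * (tp 1 \<cdot>\<^sub>m 1\<^sub>m m * ki) = tp 1 \<cdot>\<^sub>m (k * ki)"
      using c by (simp add: mult_smult_assoc_mat[of _ m m] mult_smult_distrib[of _ m m])
    finally show ?thesis by (simp add: ki(2))
  qed
  ultimately obtain w0 u k' where w0: "\<forall>a<m. w0 a \<in> {0, 1}" "echelon m w0 u" "k' \<in> GL_O m"
    "g = cmat u * tpow m w0 * k'" using minuscule_echelon by blast
  define w where "w = map (\<lambda>a. w0 a + z) [0..<m]"
  note uc = GL_O_carrier_mat[OF echelon_GL_O[OF w0(2)]] GL_O_carrier_mat[OF w0(3)]
  have e: "echelon m ((!) w) u" using w0(2) by (auto simp: echelon_def w_def)
  have scal: "A * tpow m (\<lambda>_. z) = tp z \<cdot>\<^sub>m A" if "A \<in> carrier_mat m m" for A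
    using that by (intro eq_matI) (auto simp: mult_tpow_index mult.commute simp del: index_mult_mat(1))
  have eq: "k * tpow m ((!) v) = cmat u * tpow m ((!) w) * k'"
  proof -
    have "tpow m ((!) v) = tpow m (\<lambda>a. v ! a - z) * tpow m (\<lambda>_. z)"
      unfolding tpow_add by simp
    then have "k * tpow m ((!) v) = g * tpow m (\<lambda>_. z)"
      unfolding g_def using c by (simp add: mat_assoc[of _ m])
    also have "\<dots> = tp z \<cdot>\<^sub>m (cmat u * tpow m w0 * k')" unfolding w0(4) using uc by (intro scal) auto
    also have "\<dots> = (tp z \<cdot>\<^sub>m (cmat u * tpow m w0)) * k'"
      using uc by (subst mult_smult_assoc_mat[of _ m m _ m]) auto
    also have "tp z \<cdot>\<^sub>m (cmat u * tpow m w0) = cmat u * tpow m w0 * tpow m (\<lambda>_. z)"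
      using uc by (intro scal[symmetric]) auto
    also have "\<dots> = cmat u * tpow m (\<lambda>a. w0 a + z)"
      using uc by (simp add: mat_assoc[of _ m] tpow_add)
    also have "tpow m (\<lambda>a. w0 a + z) = tpow m ((!) w)" by (rule tpow_cong) (simp add: w_def)
    finally show ?thesis .
  qed
  have "(\<Sum>a<m. v ! a) = (\<Sum>a<m. w ! a)"
    by (rule GL_O_tpow_sum_eq[OF k echelon_GL_O[OF e] w0(3) eq])
  then have "mset w = mset v"
    using w0(1) v by (intro two_valued_mset_eq[of _ _ z])
      (auto simp: sum_list_sum_nth w_def atLeast0LessThan)
  then show ?thesis using that e w0(3) eq by blast
qed

section \<open>Parametrizing polygons\<close>

primrec gprod :: "nat \<Rightarrow> (nat \<Rightarrow> complex mat) \<Rightarrow> (nat \<Rightarrow> int list) \<Rightarrow> nat \<Rightarrow> complex fls mat" where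
  "gprod m p w 0 = 1\<^sub>m m"
| "gprod m p w (Suc i) = gprod m p w i * (cmat (p (Suc i)) * tpow m ((!) (w (Suc i))))"

definition weight_step :: "nat \<Rightarrow> (nat \<Rightarrow> int list) \<Rightarrow> nat \<Rightarrow> int list" where
  "weight_step m mu i = map (\<lambda>k. mu i ! k - mu (i - 1) ! k) [0..<m]"

text \<open>Equality of multisets says that a step lies in the Weyl group orbit of
  \<open>lam i\<close>. The functions are extensional, so that a path is determined by its weights
  and the set of paths is finite.\<close>

definition minuscule_paths :: "nat \<Rightarrow> nat \<Rightarrow> (nat \<Rightarrow> int list) \<Rightarrow> (nat \<Rightarrow> int list) set" where
  "minuscule_paths m n lam = {mu \<in> {0..n} \<rightarrow>\<^sub>E dominant m. mu 0 = zero_weight m \<and> mu n = zero_weight m \<and>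
     (\<forall>i\<in>{1..n}. mset (weight_step m mu i) = mset (lam i))}"

text \<open>\<open>parabolic m \<mu>\<close> consists of the constant matrices \<open>p\<close> such that
  \<open>t\<^sup>\<mu> p t\<^sup>-\<^sup>\<mu>\<close> is integral.\<close>

definition parabolic :: "nat \<Rightarrow> int list \<Rightarrow> complex mat \<Rightarrow> bool" where
  "parabolic m \<mu> p \<longleftrightarrow> p \<in> carrier_mat m m \<and> det p \<noteq> 0 \<and>
     (\<forall>a<m. \<forall>b<m. p $$ (a, b) \<noteq> 0 \<longrightarrow> \<mu> ! b \<le> \<mu> ! a)"

lemma zero_weight_dominant: "zero_weight m \<in> dominant m"
  by (auto simp: dominant_def zero_weight_def sorted_wrt_iff_nth_less)

lemma gprod_cong:
  "(\<And>i. i \<in> {1..j} \<Longrightarrow> p i = p' i) \<Longrightarrow> (\<And>i. i \<in> {1..j} \<Longrightarrow> w i = w' i) \<Longrightarrow>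
    gprod m p w j = gprod m p' w' j"
proof (induction j)
  case (Suc j)
  have "gprod m p w j = gprod m p' w' j" by (rule Suc.IH) (use Suc.prems in auto)
  moreover have "p (Suc j) = p' (Suc j)" "w (Suc j) = w' (Suc j)" using Suc.prems by auto
  ultimately show ?case by simp
qed simp

lemma gprod_GL_K:
  "(\<And>i. i \<in> {1..j} \<Longrightarrow> cmat (p i) \<in> GL_O m) \<Longrightarrow> gprod m p w j \<in> carrier (GL_K m)"
proof (induction j)
  case (Suc j)
  have "gprod m p w j \<in> carrier (GL_K m)" by (rule Suc.IH) (use Suc.prems in auto)
  moreover have "cmat (p (Suc j)) * tpow m ((!) (w (Suc j))) \<in> carrier (GL_K m)"
    by (rule GL_K_mult[OF GL_O_GL_K tpow_GL_K]) (use Suc.prems in auto)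
  ultimately show ?case by (simp add: GL_K_mult)
qed simp

lemma parabolicD:
  "parabolic m \<mu> p \<Longrightarrow> a < m \<Longrightarrow> b < m \<Longrightarrow> p $$ (a, b) \<noteq> 0 \<Longrightarrow> \<mu> ! b \<le> \<mu> ! a"
  unfolding parabolic_def by blast

lemma parabolic_carrier: "parabolic m \<mu> p \<Longrightarrow> p \<in> carrier_mat m m"
  by (simp add: parabolic_def)

lemma parabolic_GL_O: "parabolic m \<mu> p \<Longrightarrow> cmat p \<in> GL_O m"
  by (simp add: parabolic_def cmat_GL_O)

lemma parabolic_one: "parabolic m \<mu> (1\<^sub>m m)"
  by (simp add: parabolic_def)

lemma echelon_parabolic:
  assumes u: "echelon m w u" and \<mu>: "\<mu> \<in> dominant m"
  shows "parabolic m \<mu> u"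
  unfolding parabolic_def
proof (intro conjI allI impI)
  show "u \<in> carrier_mat m m" using echelonD(1)[OF u] .
  show "det u \<noteq> 0" using echelon_det[OF u] by simp
  fix a b assume ab: "a < m" "b < m" "u $$ (a, b) \<noteq> 0"
  then have "a \<le> b" using echelonD(3)[OF u ab(1,2)] by (cases "a = b") auto
  then show "\<mu> ! b \<le> \<mu> ! a" using dominant_antimono[OF \<mu>] ab by simp
qed

lemma parabolic_conj:
  assumes p: "parabolic m \<mu> p"
  obtains K where "K \<in> GL_O m" "tpow m ((!) \<mu>) * cmat p = K * tpow m ((!) \<mu>)"
proof
  let ?K = "tpow m ((!) \<mu>) * cmat p * tpow m (\<lambda>a. - (\<mu> ! a))"
  have c: "cmat p \<in> carrier_mat m m" using p by (simp add: parabolic_def)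
  have "val_ge 0 (?K $$ (a, b))" if ab: "a < m" "b < m" for a b
  proof -
    have "?K $$ (a, b) = tp (\<mu> ! a) * cmat p $$ (a, b) * tp (- (\<mu> ! b))"
      using c ab by (simp add: mult_tpow_index tpow_mult_index del: index_mult_mat(1))
    moreover have "cmat p $$ (a, b) = 0 \<or> \<mu> ! b \<le> \<mu> ! a"
      using parabolicD[OF p ab] parabolic_carrier[OF p] ab by (auto simp: cmat_index)
    moreover have "val_ge 0 (cmat p $$ (a, b))" using ab c by (simp add: cmat_index)
    ultimately show ?thesis
      by (auto simp: val_ge_mult_tp val_ge_tp_mult intro: val_ge_mono)
  qed
  then have v: "mat_val_ge m 0 ?K" using c by (simp add: mat_val_ge_def)
  have "det ?K = (tp (\<Sum>a<m. \<mu> ! a) * tp (- (\<Sum>a<m. \<mu> ! a))) * fls_const (det p)"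
    using c by (simp add: det_mult[of _ m] det_tpow det_cmat sum_negf)
  then have "det ?K = fls_const (det p)" by (simp add: tp_add[symmetric])
  then show "?K \<in> GL_O m" using v p by (simp add: GL_O_iff parabolic_def)
  show "tpow m ((!) \<mu>) * cmat p = ?K * tpow m ((!) \<mu>)"
    using c tpow_inverse(2)[of m "(!) \<mu>"] by (simp add: mat_assoc[of _ m])
qed

lemma mset_permutation:
  assumes "mset v = mset nu" "length nu = m"
  obtains f where "f permutes {..<m}" "\<And>a. a < m \<Longrightarrow> v ! a = nu ! f a"
proof -
  obtain f where f: "f permutes {..<length nu}" "permute_list f nu = v"
    using mset_eq_permutation[OF assms(1)] .
  have "v ! a = nu ! f a" if "a < m" for a
    using that assms(2) f by (metis permute_list_nth)
  then show ?thesis using that f assms(2) by blast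
qed

text \<open>Permutation matrices are integral, so a rearrangement of \<open>nu\<close> lies in the
  same double coset as \<open>nu\<close>.\<close>

lemma dist_Gr_step:
  assumes A: "A \<in> carrier (GL_K m)" and p: "cmat p \<in> GL_O m" and v: "mset v = mset nu"
    and nu: "nu \<in> dominant m"
  shows "dist_Gr m (A <#\<^bsub>GL_K m\<^esub> GL_O m) ((A * (cmat p * tpow m ((!) v))) <#\<^bsub>GL_K m\<^esub> GL_O m) = nu"
proof -
  obtain f where f: "f permutes {..<m}" "\<And>a. a < m \<Longrightarrow> v ! a = nu ! f a"
    using mset_permutation[OF v] nu by (auto simp: dominant_def)
  define P where "P = cmat (perm_mat m f)"
  have P: "P \<in> GL_O m" unfolding P_def by (rule cmat_GL_O) (use det_perm_mat[OF f(1)] in auto)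
  obtain Pi where Pi: "Pi \<in> GL_O m" "P * Pi = 1\<^sub>m m" "Pi * P = 1\<^sub>m m" using GL_O_inverse[OF P] .
  note c = GL_K_carrier_mat[OF A] GL_O_carrier_mat[OF p] GL_O_carrier_mat[OF P] GL_O_carrier_mat[OF Pi(1)]
  have "tpow m ((!) v) = tpow m ((!) nu \<circ> f)" by (rule tpow_cong) (simp add: f(2))
  then have "tpow m ((!) nu) * P = P * tpow m ((!) v)"
    unfolding P_def using tpow_perm_mat[OF f(1)] by simp
  then have "tpow m ((!) v) = Pi * (tpow m ((!) nu) * P)"
    using c mat_cancel[OF Pi(3), of "tpow m ((!) v)"] by simp
  then have "A * (cmat p * tpow m ((!) v)) = A * (cmat p * Pi) * tpow m ((!) nu) * P"
    using c by (simp add: mat_assoc[of _ m])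
  then show ?thesis
    unfolding dist_Gr_eq_iff[OF A GL_K_mult[OF A GL_K_mult[OF GL_O_GL_K[OF p] tpow_GL_K]]]
    using nu GL_O_mult[OF p Pi(1)] P by blast
qed

text \<open>Each parabolic factor passes through the power of \<open>t\<close> accumulated to its
  left and stays integral. Hence a dominant \<open>\<mu> j\<close> is the distance of the
  \<open>j\<close>-th vertex from the base point, and a path that ends at zero closes up.\<close>

lemma gprod_path:
  assumes \<mu>0: "\<mu> 0 = zero_weight m" and p: "\<And>i. i \<in> {1..j} \<Longrightarrow> parabolic m (\<mu> (i - 1)) (p i)"
  obtains K where "K \<in> GL_O m" "gprod m p (weight_step m \<mu>) j = K * tpow m ((!) (\<mu> j))"
proof -
  have "\<exists>K\<in>GL_O m. gprod m p (weight_step m \<mu>) j = K * tpow m ((!) (\<mu> j))"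
    using p
  proof (induction j)
    case 0
    have "tpow m ((!) (\<mu> 0)) = 1\<^sub>m m" unfolding \<mu>0 by (rule tpow_0) (simp add: zero_weight_def)
    then show ?case by (intro bexI[of _ "1\<^sub>m m"]) simp_all
  next
    case (Suc j)
    have "\<exists>K\<in>GL_O m. gprod m p (weight_step m \<mu>) j = K * tpow m ((!) (\<mu> j))"
      by (rule Suc.IH) (use Suc.prems in auto)
    then obtain K where K: "K \<in> GL_O m" "gprod m p (weight_step m \<mu>) j = K * tpow m ((!) (\<mu> j))" by blast
    have pj: "parabolic m (\<mu> j) (p (Suc j))" using Suc.prems[of "Suc j"] by simp
    obtain L where L: "L \<in> GL_O m" "tpow m ((!) (\<mu> j)) * cmat (p (Suc j)) = L * tpow m ((!) (\<mu> j))"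
      using parabolic_conj[OF pj] .
    note c = GL_O_carrier_mat[OF K(1)] GL_O_carrier_mat[OF L(1)] GL_O_carrier_mat[OF parabolic_GL_O[OF pj]]
    have "tpow m ((!) (\<mu> (Suc j))) = tpow m ((!) (\<mu> j)) * tpow m ((!) (weight_step m \<mu> (Suc j)))"
      unfolding tpow_add by (rule tpow_cong) (simp add: weight_step_def)
    moreover have "tpow m ((!) (\<mu> j)) * (cmat (p (Suc j)) * tpow m ((!) (weight_step m \<mu> (Suc j))))
        = L * (tpow m ((!) (\<mu> j)) * tpow m ((!) (weight_step m \<mu> (Suc j))))"
      using c L(2) by (simp add: mat_assoc[of _ m, symmetric])
    ultimately have "gprod m p (weight_step m \<mu>) (Suc j) = K * L * tpow m ((!) (\<mu> (Suc j)))"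
      using c K(2) by (simp add: mat_assoc[of _ m])
    then show ?case using GL_O_mult[OF K(1) L(1)] by blast
  qed
  then show ?thesis using that by blast
qed

definition gpolygon :: "nat \<Rightarrow> nat \<Rightarrow> (nat \<Rightarrow> complex mat) \<Rightarrow> (nat \<Rightarrow> int list) \<Rightarrow> nat \<Rightarrow> complex fls mat" where
  "gpolygon m n p w = restrict (gprod m p w) {1..<n}"

text \<open>Only \<open>n - 1\<close> factors occur, one for each free vertex; that the last edge
  has the right length follows from \<open>mu n = 0\<close>.\<close>

definition path_piece :: "nat \<Rightarrow> nat \<Rightarrow> (nat \<Rightarrow> int list) \<Rightarrow> (nat \<Rightarrow> complex fls mat set) set" where
  "path_piece m n mu = {Gr_proj m {1..<n} (gpolygon m n p (weight_step m mu)) | p.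
     \<forall>i\<in>{1..<n}. parabolic m (mu (i - 1)) (p i)}"

definition cell :: "nat \<Rightarrow> nat \<Rightarrow> (nat \<Rightarrow> int list) \<Rightarrow> (nat \<Rightarrow> complex fls mat set) set" where
  "cell m n w = {Gr_proj m {1..<n} (gpolygon m n u w) | u. \<forall>i\<in>{1..<n}. echelon m ((!) (w i)) (u i)}"

lemma minuscule_pathsD:
  assumes "mu \<in> minuscule_paths m n lam"
  shows "i \<le> n \<Longrightarrow> mu i \<in> dominant m" "mu 0 = zero_weight m" "mu n = zero_weight m"
    "i \<in> {1..n} \<Longrightarrow> mset (weight_step m mu i) = mset (lam i)"
  using assms by (auto simp: minuscule_paths_def)

text \<open>Inversions are positions above the diagonal, and there the parabolic condition is just
  that \<open>mu (i - 1)\<close> is weakly decreasing.\<close>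

lemma cell_subset_path_piece:
  assumes "mu \<in> minuscule_paths m n lam"
  shows "cell m n (weight_step m mu) \<subseteq> path_piece m n mu"
proof
  fix x assume "x \<in> cell m n (weight_step m mu)"
  then obtain u where u: "x = Gr_proj m {1..<n} (gpolygon m n u (weight_step m mu))"
    "\<forall>i\<in>{1..<n}. echelon m ((!) (weight_step m mu i)) (u i)" by (auto simp: cell_def)
  have "parabolic m (mu (i - 1)) (u i)" if "i \<in> {1..<n}" for i
    by (rule echelon_parabolic[OF u(2)[rule_format, OF that]])
      (use that in \<open>auto intro: minuscule_pathsD[OF assms]\<close>)
  then show "x \<in> path_piece m n mu" using u(1) by (auto simp: path_piece_def)
qed

lemma gpolygon_loop_power:
  "(\<And>i. i \<in> {1..<n} \<Longrightarrow> cmat (p i) \<in> GL_O m) \<Longrightarrow> gpolygon m n p w \<in> loop_power m {1..<n}"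
  by (auto simp: gpolygon_def loop_power_def intro!: gprod_GL_K)

lemma Gr_proj_Gr_power: "g \<in> loop_power m I \<Longrightarrow> Gr_proj m I g \<in> Gr_power m I"
  using Gr_proj_image by blast

lemma polygon_vertex_gpolygon:
  assumes "i \<le> n" and "i = n \<Longrightarrow> n \<ge> 1 \<Longrightarrow> gprod m p w n \<in> GL_O m"
  shows "polygon_vertex m n (Gr_proj m {1..<n} (gpolygon m n p w)) i = gprod m p w i <#\<^bsub>GL_K m\<^esub> GL_O m"
proof (cases "i \<in> {1..<n}")
  case True
  then show ?thesis by (simp add: polygon_vertex_def Gr_proj_def gpolygon_def)
next
  case False
  then have "i = 0 \<or> i = n \<and> n \<ge> 1" using assms(1) by auto
  then show ?thesis
  proof
    assume "i = 0"
    then show ?thesis by (simp add: polygon_vertex_def base_point_coset)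
  next
    assume i: "i = n \<and> n \<ge> 1"
    then have k: "gprod m p w n \<in> GL_O m" using assms(2) by blast
    have "1\<^sub>m m <#\<^bsub>GL_K m\<^esub> GL_O m = gprod m p w n <#\<^bsub>GL_K m\<^esub> GL_O m"
    proof -
      have "gprod m p w n = 1\<^sub>m m * gprod m p w n" using GL_O_carrier_mat[OF k] by simp
      then show ?thesis using coset_GL_O[OF GL_K_one GL_O_GL_K[OF k]] k by blast
    qed
    then show ?thesis using i by (simp add: polygon_vertex_def base_point_coset)
  qed
qed

lemma path_piece_subset_Poly:
  assumes mu: "mu \<in> minuscule_paths m n lam"
    and lam: "\<And>i. i \<in> {1..n} \<Longrightarrow> lam i \<in> dominant m"
  shows "path_piece m n mu \<subseteq> Poly m n lam"
proof
  fix x assume "x \<in> path_piece m n mu"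
  then obtain p0 where p0: "x = Gr_proj m {1..<n} (gpolygon m n p0 (weight_step m mu))"
    "\<And>i. i \<in> {1..<n} \<Longrightarrow> parabolic m (mu (i - 1)) (p0 i)" by (auto simp: path_piece_def)
  \<comment> \<open>The piece says nothing about a factor number \<open>n\<close>; the identity
    serves for the closing edge.\<close>
  define p where "p = p0(n := 1\<^sub>m m)"
  have p: "parabolic m (mu (i - 1)) (p i)" if "i \<in> {1..n}" for i
    using p0(2)[of i] that parabolic_one by (cases "i = n") (auto simp: p_def)
  have "gpolygon m n p0 (weight_step m mu) = gpolygon m n p (weight_step m mu)"
    unfolding gpolygon_def by (rule restrict_ext, rule gprod_cong) (auto simp: p_def)
  then have x: "x = Gr_proj m {1..<n} (gpolygon m n p (weight_step m mu))" using p0(1) by simp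
  have K: "gprod m p (weight_step m mu) i \<in> carrier (GL_K m)" if "i \<le> n" for i
    by (rule gprod_GL_K, rule parabolic_GL_O, rule p) (use that in auto)
  have "gprod m p (weight_step m mu) n \<in> GL_O m"
  proof -
    obtain K where K: "K \<in> GL_O m" "gprod m p (weight_step m mu) n = K * tpow m ((!) (mu n))"
      using gprod_path[OF minuscule_pathsD(2)[OF mu] p] .
    have "tpow m ((!) (mu n)) = 1\<^sub>m m"
      unfolding minuscule_pathsD(3)[OF mu] by (rule tpow_0) (simp add: zero_weight_def)
    then show ?thesis using K GL_O_carrier_mat[OF K(1)] by simp
  qed
  then have v: "polygon_vertex m n x i = gprod m p (weight_step m mu) i <#\<^bsub>GL_K m\<^esub> GL_O m" if "i \<le> n" for i
    unfolding x using polygon_vertex_gpolygon[OF that] by blast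
  have "dist_Gr m (polygon_vertex m n x (i - 1)) (polygon_vertex m n x i) = lam i" if i: "i \<in> {1..n}" for i
  proof -
    obtain j where j: "i = Suc j" using i by (cases i) auto
    have ms: "mset (weight_step m mu (Suc j)) = mset (lam i)"
      using minuscule_pathsD(4)[OF mu, of i] i j by simp
    have pj: "parabolic m (mu j) (p (Suc j))" using p[of i] i j by simp
    have "dist_Gr m (gprod m p (weight_step m mu) j <#\<^bsub>GL_K m\<^esub> GL_O m)
      ((gprod m p (weight_step m mu) j * (cmat (p (Suc j)) * tpow m ((!) (weight_step m mu (Suc j)))))
         <#\<^bsub>GL_K m\<^esub> GL_O m) = lam i"
      by (rule dist_Gr_step[OF K parabolic_GL_O[OF pj] ms lam[OF i]]) (use i j in auto)
    then show ?thesis using v[of j] v[of i] i j by simp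
  qed
  moreover have "x \<in> Gr_power m {1..<n}"
    unfolding x by (rule Gr_proj_Gr_power, rule gpolygon_loop_power, rule parabolic_GL_O, rule p) auto
  ultimately show "x \<in> Poly m n lam" by (simp add: Poly_def)
qed

lemma polygon_vertex_Gr:
  assumes "x \<in> Gr_power m {1..<n}"
  obtains y where "y \<in> carrier (GL_K m)" "polygon_vertex m n x i = y <#\<^bsub>GL_K m\<^esub> GL_O m"
proof (cases "i \<in> {1..<n}")
  case True
  then have "x i \<in> Gr m" using assms by (auto simp: Gr_power_def)
  then show ?thesis using that True by (auto simp: Gr_def LCOSETS_def polygon_vertex_def)
next
  case False
  then show ?thesis using that[of "1\<^sub>m m"] by (auto simp: polygon_vertex_def base_point_coset)
qed

lemma minuscule_two_valued:
  assumes "nu \<in> minuscule m"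
  obtains z where "set nu \<subseteq> {z, z + 1}" "z = 0 \<or> z = - 1"
proof -
  obtain i where "nu = replicate i 1 @ replicate (m - i) 0 \<or> nu = replicate (m - i) 0 @ replicate i (- 1)"
    using assms by (auto simp: minuscule_def)
  then have "set nu \<subseteq> {0, 0 + 1} \<or> set nu \<subseteq> {- 1, - 1 + 1}" by (auto split: if_splits)
  then show ?thesis using that by blast
qed

lemma minuscule_dominant:
  assumes "nu \<in> minuscule m"
  shows "nu \<in> dominant m"
proof -
  obtain i where "i \<le> m" "nu = replicate i 1 @ replicate (m - i) 0 \<or> nu = replicate (m - i) 0 @ replicate i (- 1)"
    using assms by (auto simp: minuscule_def)
  then show ?thesis
    by (auto simp: dominant_def sorted_wrt_append) (auto simp: sorted_wrt_iff_nth_less)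
qed

text \<open>One edge in normal form. Any representative \<open>A\<close> of the first vertex will
  do, so normal forms can be built edge by edge without touching earlier factors.\<close>

lemma Poly_step:
  assumes x: "x \<in> Poly m n lam" and i: "i < n" and lam: "lam (Suc i) \<in> minuscule m"
    and A: "A \<in> carrier (GL_K m)" "polygon_vertex m n x i = A <#\<^bsub>GL_K m\<^esub> GL_O m"
  obtains w u where "mset w = mset (lam (Suc i))" "echelon m ((!) w) u"
    "polygon_vertex m n x (Suc i) = (A * (cmat u * tpow m ((!) w))) <#\<^bsub>GL_K m\<^esub> GL_O m"
proof -
  have xG: "x \<in> Gr_power m {1..<n}" using x by (simp add: Poly_def)
  obtain y where y: "y \<in> carrier (GL_K m)" "polygon_vertex m n x (Suc i) = y <#\<^bsub>GL_K m\<^esub> GL_O m"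
    using polygon_vertex_Gr[OF xG] .
  have "\<forall>i\<in>{1..n}. dist_Gr m (polygon_vertex m n x (i - 1)) (polygon_vertex m n x i) = lam i"
    using x by (simp add: Poly_def)
  from this[rule_format, of "Suc i"]
  have "dist_Gr m (A <#\<^bsub>GL_K m\<^esub> GL_O m) (y <#\<^bsub>GL_K m\<^esub> GL_O m) = lam (Suc i)"
    using i y(2) A(2) by simp
  then obtain k k' where k: "k \<in> GL_O m" "k' \<in> GL_O m" "y = A * k * tpow m ((!) (lam (Suc i))) * k'"
    unfolding dist_Gr_eq_iff[OF A(1) y(1)] by blast
  obtain z where z: "set (lam (Suc i)) \<subseteq> {z, z + 1}" using minuscule_two_valued[OF lam] .
  have len: "length (lam (Suc i)) = m" using minuscule_dominant[OF lam] by (simp add: dominant_def)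
  obtain w u k'' where w: "mset w = mset (lam (Suc i))" "echelon m ((!) w) u" "k'' \<in> GL_O m"
    "k * tpow m ((!) (lam (Suc i))) = cmat u * tpow m ((!) w) * k''"
    using minuscule_step[OF k(1) len z] .
  have uG: "cmat u \<in> GL_O m" by (rule echelon_GL_O[OF w(2)])
  note c = GL_K_carrier_mat[OF A(1)] GL_O_carrier_mat[OF k(1)] GL_O_carrier_mat[OF k(2)]
    GL_O_carrier_mat[OF w(3)] GL_O_carrier_mat[OF uG]
  have "y = A * (k * tpow m ((!) (lam (Suc i)))) * k'"
    unfolding k(3) using c by (simp add: mat_assoc[of _ m])
  also have "\<dots> = A * (cmat u * tpow m ((!) w)) * (k'' * k')"
    unfolding w(4) using c by (simp add: mat_assoc[of _ m])
  finally have "(A * (cmat u * tpow m ((!) w))) <#\<^bsub>GL_K m\<^esub> GL_O m = y <#\<^bsub>GL_K m\<^esub> GL_O m"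
    using coset_GL_O[OF GL_K_mult[OF A(1) GL_K_mult[OF GL_O_GL_K[OF uG] tpow_GL_K]] y(1)]
      GL_O_mult[OF w(3) k(2)] by blast
  then show ?thesis using that w(1,2) y(2) by metis
qed

text \<open>The product of all \<open>n\<close> factors is recorded as well: it is integral since
  the polygon closes up, and \<open>psum_eq_0\<close> reads off from it that the weights have sum
  zero.\<close>

lemma Poly_cell_cover:
  assumes x: "x \<in> Poly m n lam" and n: "n \<ge> 1" and lam: "\<And>i. i \<in> {1..n} \<Longrightarrow> lam i \<in> minuscule m"
  obtains w u where "\<And>i. i \<in> {1..n} \<Longrightarrow> mset (w i) = mset (lam i)"
    "\<And>i. i \<in> {1..n} \<Longrightarrow> echelon m ((!) (w i)) (u i)"
    "x = Gr_proj m {1..<n} (gpolygon m n u w)" "gprod m u w n \<in> GL_O m"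
proof -
  have cov: "\<exists>w u. (\<forall>i\<in>{1..j}. mset (w i) = mset (lam i) \<and> echelon m ((!) (w i)) (u i)) \<and>
    (\<forall>i\<le>j. polygon_vertex m n x i = gprod m u w i <#\<^bsub>GL_K m\<^esub> GL_O m)" if "j \<le> n" for j
    using that
  proof (induction j)
    case 0
    then show ?case by (simp add: polygon_vertex_def base_point_coset)
  next
    case (Suc j)
    then obtain w u where wu: "\<forall>i\<in>{1..j}. mset (w i) = mset (lam i) \<and> echelon m ((!) (w i)) (u i)"
      "\<forall>i\<le>j. polygon_vertex m n x i = gprod m u w i <#\<^bsub>GL_K m\<^esub> GL_O m" by auto
    have A: "gprod m u w j \<in> carrier (GL_K m)"
      by (rule gprod_GL_K, rule echelon_GL_O) (use wu(1) in blast)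
    obtain w1 u1 where 1: "mset w1 = mset (lam (Suc j))" "echelon m ((!) w1) u1"
      "polygon_vertex m n x (Suc j) = (gprod m u w j * (cmat u1 * tpow m ((!) w1))) <#\<^bsub>GL_K m\<^esub> GL_O m"
      using Poly_step[OF x _ lam A wu(2)[rule_format]] Suc.prems by auto
    let ?w = "w(Suc j := w1)" and ?u = "u(Suc j := u1)"
    have g: "gprod m ?u ?w i = gprod m u w i" if "i \<le> j" for i
      by (rule gprod_cong) (use that in auto)
    have "polygon_vertex m n x i = gprod m ?u ?w i <#\<^bsub>GL_K m\<^esub> GL_O m" if "i \<le> Suc j" for i
    proof (cases "i = Suc j")
      case True
      then show ?thesis using 1(3) g[of j] by simp
    next
      case False
      then show ?thesis using that g[of i] wu(2) by simp
    qed
    moreover have "mset (?w i) = mset (lam i) \<and> echelon m ((!) (?w i)) (?u i)" if "i \<in> {1..Suc j}" for i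
      using that wu(1) 1(1,2) by (cases "i = Suc j") auto
    ultimately show ?case by blast
  qed
  obtain w u where wu0: "(\<forall>i\<in>{1..n}. mset (w i) = mset (lam i) \<and> echelon m ((!) (w i)) (u i)) \<and>
    (\<forall>i\<le>n. polygon_vertex m n x i = gprod m u w i <#\<^bsub>GL_K m\<^esub> GL_O m)"
    using cov[OF order.refl] by (elim exE) (rule that)
  then have wu: "\<And>i. i \<in> {1..n} \<Longrightarrow> mset (w i) = mset (lam i)"
    "\<And>i. i \<in> {1..n} \<Longrightarrow> echelon m ((!) (w i)) (u i)"
    "\<And>i. i \<le> n \<Longrightarrow> polygon_vertex m n x i = gprod m u w i <#\<^bsub>GL_K m\<^esub> GL_O m"
    by simp_all
  have "x = Gr_proj m {1..<n} (gpolygon m n u w)"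
  proof
    fix i show "x i = Gr_proj m {1..<n} (gpolygon m n u w) i"
    proof (cases "i \<in> {1..<n}")
      case True
      then show ?thesis using wu(3)[of i] by (simp add: polygon_vertex_def Gr_proj_def gpolygon_def)
    next
      case False
      then show ?thesis using x by (auto simp: Poly_def Gr_power_def Gr_proj_def PiE_def extensional_def)
    qed
  qed
  moreover have "gprod m u w n \<in> GL_O m"
  proof -
    have A: "gprod m u w n \<in> carrier (GL_K m)"
      by (rule gprod_GL_K, rule echelon_GL_O) (use wu(2) in blast)
    have "1\<^sub>m m <#\<^bsub>GL_K m\<^esub> GL_O m = gprod m u w n <#\<^bsub>GL_K m\<^esub> GL_O m"
      using wu(3)[of n] by (simp add: polygon_vertex_def base_point_coset)
    then obtain k where "k \<in> GL_O m" "gprod m u w n = 1\<^sub>m m * k"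
      unfolding coset_GL_O[OF GL_K_one A] by blast
    then show ?thesis by (simp add: GL_O_mult)
  qed
  ultimately show ?thesis using that[of w u] wu(1,2) by blast
qed

text \<open>Sorting \<open>2\<mu> + w\<close> instead of \<open>\<mu> + w\<close> forces the permutation to preserve the blocks of \<open>\<mu>\<close>.\<close>

lemma sorting_permutation:
  fixes \<mu> w :: "int list"
  assumes \<mu>: "\<mu> \<in> dominant m" and w: "length w = m" "set w \<subseteq> {z, z + 1}"
  obtains f where "f permutes {..<m}" "\<And>a. a < m \<Longrightarrow> \<mu> ! f a = \<mu> ! a"
    "\<And>a b. a \<le> b \<Longrightarrow> b < m \<Longrightarrow> \<mu> ! b + w ! f b \<le> \<mu> ! a + w ! f a"
proof -
  define key where "key = map (\<lambda>a. 2 * (\<mu> ! a) + (w ! a - z)) [0..<m]"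
  have lk: "length key = m" by (simp add: key_def)
  obtain f where f: "f permutes {..<m}" "\<And>a. a < m \<Longrightarrow> rev (sort key) ! a = key ! f a"
    using mset_permutation[of "rev (sort key)" key m] lk by auto
  have fm: "f a < m" if "a < m" for a using permutes_lessThan[OF f(1) that] .
  have wz: "w ! a = z \<or> w ! a = z + 1" if "a < m" for a using w that nth_mem by blast
  have key_anti: "key ! f b \<le> key ! f a" if "a \<le> b" "b < m" for a b
  proof -
    have sw: "sorted_wrt (\<ge>) (rev (sort key))" by (simp add: sorted_wrt_rev)
    show ?thesis
      using that lk f(2)[of a] f(2)[of b] sorted_wrt_nth_less[OF sw, of a b] by (cases "a = b") auto
  qed
  have key: "key ! f a = 2 * (\<mu> ! f a) + (w ! f a - z)" if "a < m" for a
    using fm[OF that] by (simp add: key_def)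
  have \<mu>f: "\<mu> ! f b \<le> \<mu> ! f a" if "a \<le> b" "b < m" for a b
    using key_anti[OF that] key[of a] key[of b] wz[OF fm[of a]] wz[OF fm[of b]] that by auto
  have "map (\<lambda>a. \<mu> ! f a) [0..<m] = \<mu>"
  proof -
    have lm: "length \<mu> = m" using \<mu> by (simp add: dominant_def)
    have f': "f permutes {..<length \<mu>}" using f(1) lm by simp
    have "map (\<lambda>a. \<mu> ! f a) [0..<m] = permute_list f \<mu>"
      using lm by (simp add: permute_list_def)
    then have "mset (rev (map (\<lambda>a. \<mu> ! f a) [0..<m])) = mset \<mu>" using f' by simp
    moreover have "sorted_wrt (\<ge>) (map (\<lambda>a. \<mu> ! f a) [0..<m])"
      using \<mu>f by (simp add: sorted_wrt_iff_nth_less)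
    then have "sorted (rev (map (\<lambda>a. \<mu> ! f a) [0..<m]))" by (simp add: sorted_wrt_rev)
    ultimately have "sort \<mu> = rev (map (\<lambda>a. \<mu> ! f a) [0..<m])" by (rule properties_for_sort)
    moreover have "sort \<mu> = rev \<mu>"
      using \<mu> by (intro properties_for_sort) (auto simp: dominant_def sorted_wrt_rev)
    ultimately show ?thesis by simp
  qed
  then have same: "\<mu> ! f a = \<mu> ! a" if "a < m" for a
    using that by (metis (no_types, lifting) add_0 diff_zero length_upt nth_map nth_upt)
  \<comment> \<open>Within a block of \<open>\<mu>\<close> the keys compare the values of
    \<open>w\<close>; between blocks the gap of \<open>\<mu>\<close> is at least 1 and outweighs any
    difference of the two adjacent values of \<open>w\<close>.\<close>
  have "\<mu> ! b + w ! f b \<le> \<mu> ! a + w ! f a" if "a \<le> b" "b < m" for a b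
    using key_anti[OF that] key[of a] key[of b] same[of a] same[of b] wz[OF fm[of a]] wz[OF fm[of b]] that by auto
  then show ?thesis using that f(1) same by blast
qed

text \<open>The weight of each echelon factor is permuted so that the partial sums become dominant,
  and the permutation matrix is moved into the constant factor. The partial sums are then the
  distances from the base point.\<close>

lemma Poly_path_cover:
  assumes x: "x \<in> Poly m n lam" and n: "n \<ge> 1" and lam: "\<And>i. i \<in> {1..n} \<Longrightarrow> lam i \<in> minuscule m"
  obtains mu where "mu \<in> minuscule_paths m n lam" "x \<in> path_piece m n mu"
proof -
  have cov: "\<exists>mu p. mu 0 = zero_weight m \<and> (\<forall>i\<in>{1..j}. mu i \<in> dominant m \<and>
      mset (weight_step m mu i) = mset (lam i) \<and> parabolic m (mu (i - 1)) (p i)) \<and>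
    (\<forall>i\<le>j. polygon_vertex m n x i = gprod m p (weight_step m mu) i <#\<^bsub>GL_K m\<^esub> GL_O m)" if "j \<le> n" for j
    using that
  proof (induction j)
    case 0
    show ?case by (rule exI[of _ "\<lambda>_. zero_weight m"]) (simp add: polygon_vertex_def base_point_coset)
  next
    case (Suc j)
    then obtain mu p where mp: "mu 0 = zero_weight m" "\<forall>i\<in>{1..j}. mu i \<in> dominant m \<and>
        mset (weight_step m mu i) = mset (lam i) \<and> parabolic m (mu (i - 1)) (p i)"
      "\<forall>i\<le>j. polygon_vertex m n x i = gprod m p (weight_step m mu) i <#\<^bsub>GL_K m\<^esub> GL_O m" by auto
    have A: "gprod m p (weight_step m mu) j \<in> carrier (GL_K m)"
      by (rule gprod_GL_K, rule parabolic_GL_O) (use mp(2) in blast)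
    have lamj: "lam (Suc j) \<in> minuscule m" using lam Suc.prems by simp
    obtain w u where wu: "mset w = mset (lam (Suc j))" "echelon m ((!) w) u"
      "polygon_vertex m n x (Suc j) = (gprod m p (weight_step m mu) j * (cmat u * tpow m ((!) w))) <#\<^bsub>GL_K m\<^esub> GL_O m"
      using Poly_step[OF x _ lamj A mp(3)[rule_format]] Suc.prems by auto
    have dj: "mu j \<in> dominant m"
      using mp(1,2) by (cases "j = 0") (auto simp: dominant_def zero_weight_def sorted_wrt_iff_nth_less)
    obtain z where z: "set (lam (Suc j)) \<subseteq> {z, z + 1}" using minuscule_two_valued[OF lamj] .
    have lw: "length w = m" using minuscule_dominant[OF lamj] wu(1) mset_eq_length by (fastforce simp: dominant_def)
    have sw: "set w \<subseteq> {z, z + 1}" using z mset_eq_setD[OF wu(1)] by simp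
    obtain f where f: "f permutes {..<m}" "\<And>a. a < m \<Longrightarrow> mu j ! f a = mu j ! a"
      "\<And>a b. a \<le> b \<Longrightarrow> b < m \<Longrightarrow> mu j ! b + w ! f b \<le> mu j ! a + w ! f a"
      using sorting_permutation[OF dj lw sw] by metis
    define v where "v = map (\<lambda>a. w ! f a) [0..<m]"
    define mu' where "mu' = mu(Suc j := map (\<lambda>a. mu j ! a + w ! f a) [0..<m])"
    \<comment> \<open>Still parabolic for \<open>mu j\<close>, because \<open>f\<close> moves
      indices only within the blocks on which \<open>mu j\<close> is constant.\<close>
    define p1 where "p1 = u * perm_mat m f"
    define p' where "p' = p(Suc j := p1)"
    have uc: "u \<in> carrier_mat m m" using echelonD(1)[OF wu(2)] .
    have step_v: "weight_step m mu' (Suc j) = v"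
      by (simp add: weight_step_def mu'_def v_def)
    have step: "weight_step m mu' i = weight_step m mu i" if "i \<in> {1..j}" for i
      using that by (auto simp: weight_step_def mu'_def)
    have mset_v: "mset v = mset (lam (Suc j))"
    proof -
      have "v = permute_list f w" using lw by (simp add: v_def permute_list_def)
      then show ?thesis using f(1) lw wu(1) by simp
    qed
    have par: "parabolic m (mu j) p1"
      unfolding parabolic_def
    proof (intro conjI allI impI)
      show "p1 \<in> carrier_mat m m" using uc by (simp add: p1_def)
      show "det p1 \<noteq> 0"
        using uc echelon_det[OF wu(2)] det_perm_mat[OF f(1)] by (simp add: p1_def det_mult[of _ m])
      fix a b assume ab: "a < m" "b < m" "p1 $$ (a, b) \<noteq> 0"
      then have "u $$ (a, f b) \<noteq> 0" using mult_perm_mat_index[OF uc f(1) ab(1,2)] by (simp add: p1_def)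
      then have "mu j ! f b \<le> mu j ! a"
        using echelon_parabolic[OF wu(2) dj] ab permutes_lessThan[OF f(1)] by (simp add: parabolic_def)
      then show "mu j ! b \<le> mu j ! a" using f(2)[OF ab(2)] by simp
    qed
    have g: "gprod m p' (weight_step m mu') i = gprod m p (weight_step m mu) i" if "i \<le> j" for i
      by (rule gprod_cong) (use that step in \<open>auto simp: p'_def\<close>)
    have coset: "polygon_vertex m n x (Suc j) = gprod m p' (weight_step m mu') (Suc j) <#\<^bsub>GL_K m\<^esub> GL_O m"
    proof -
      let ?A = "gprod m p (weight_step m mu) j" and ?P = "cmat (perm_mat m f)"
      have P: "?P \<in> GL_O m" by (rule cmat_GL_O) (use det_perm_mat[OF f(1)] in auto)
      have uG: "cmat u \<in> GL_O m" by (rule echelon_GL_O[OF wu(2)])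
      have "tpow m ((!) v) = tpow m ((!) w \<circ> f)" by (rule tpow_cong) (simp add: v_def)
      then have "tpow m ((!) w) * ?P = ?P * tpow m ((!) v)" using tpow_perm_mat[OF f(1)] by simp
      then have "?A * (cmat u * tpow m ((!) w)) * ?P = ?A * (cmat p1 * tpow m ((!) v))"
        unfolding p1_def cmat_mult[OF uc perm_mat_carrier]
        using GL_K_carrier_mat[OF A] uc by (simp add: mat_assoc[of _ m])
      then have "(?A * (cmat u * tpow m ((!) w))) <#\<^bsub>GL_K m\<^esub> GL_O m
          = (?A * (cmat p1 * tpow m ((!) v))) <#\<^bsub>GL_K m\<^esub> GL_O m"
        using coset_GL_O[of "?A * (cmat u * tpow m ((!) w))" m "?A * (cmat p1 * tpow m ((!) v))"] P
          GL_K_mult[OF A GL_K_mult[OF GL_O_GL_K[OF uG] tpow_GL_K]]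
          GL_K_mult[OF A GL_K_mult[OF GL_O_GL_K[OF parabolic_GL_O[OF par]] tpow_GL_K]] by metis
      then show ?thesis using wu(3) g[of j] by (simp add: step_v p'_def)
    qed
    have "mu' 0 = zero_weight m" using mp(1) by (simp add: mu'_def)
    moreover have "mu' i \<in> dominant m \<and> mset (weight_step m mu' i) = mset (lam i) \<and>
        parabolic m (mu' (i - 1)) (p' i)" if i: "i \<in> {1..Suc j}" for i
    proof (cases "i = Suc j")
      case True
      have "mu' (Suc j) \<in> dominant m"
        using f(3) by (auto simp: mu'_def dominant_def sorted_wrt_iff_nth_less)
      then show ?thesis using True par mset_v by (simp add: step_v p'_def) (simp add: mu'_def)
    next
      case False
      then have "i \<in> {1..j}" using i by auto
      then show ?thesis using mp(2) step[of i] False by (auto simp: mu'_def p'_def)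
    qed
    moreover have "polygon_vertex m n x i = gprod m p' (weight_step m mu') i <#\<^bsub>GL_K m\<^esub> GL_O m" if "i \<le> Suc j" for i
      using coset g[of i] mp(3) that by (cases "i = Suc j") auto
    ultimately show ?case by blast
  qed
  obtain mu p where "mu 0 = zero_weight m \<and> (\<forall>i\<in>{1..n}. mu i \<in> dominant m \<and>
      mset (weight_step m mu i) = mset (lam i) \<and> parabolic m (mu (i - 1)) (p i)) \<and>
    (\<forall>i\<le>n. polygon_vertex m n x i = gprod m p (weight_step m mu) i <#\<^bsub>GL_K m\<^esub> GL_O m)"
    using cov[OF order.refl] by (elim exE) (rule that)
  then have mp: "mu 0 = zero_weight m" "\<And>i. i \<in> {1..n} \<Longrightarrow> mu i \<in> dominant m"
      "\<And>i. i \<in> {1..n} \<Longrightarrow> mset (weight_step m mu i) = mset (lam i)"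
      "\<And>i. i \<in> {1..n} \<Longrightarrow> parabolic m (mu (i - 1)) (p i)"
    "\<And>i. i \<le> n \<Longrightarrow> polygon_vertex m n x i = gprod m p (weight_step m mu) i <#\<^bsub>GL_K m\<^esub> GL_O m"
    by simp_all
  \<comment> \<open>The closing vertex is the base point itself, and relative positions are
    unique.\<close>
  have mun: "mu n = zero_weight m"
  proof -
    obtain K where K: "K \<in> GL_O m" "gprod m p (weight_step m mu) n = K * tpow m ((!) (mu n))"
      using gprod_path[OF mp(1,4)] .
    have "1\<^sub>m m <#\<^bsub>GL_K m\<^esub> GL_O m = (K * tpow m ((!) (mu n))) <#\<^bsub>GL_K m\<^esub> GL_O m"
      using mp(5)[of n] K(2) by (simp add: polygon_vertex_def base_point_coset)
    then obtain k where k: "k \<in> GL_O m" "K * tpow m ((!) (mu n)) = 1\<^sub>m m * k"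
      unfolding coset_GL_O[OF GL_K_one GL_K_mult[OF GL_O_GL_K[OF K(1)] tpow_GL_K]] by blast
    note z = zero_weight_dominant
    have "tpow m ((!) (zero_weight m)) = 1\<^sub>m m" by (rule tpow_0) (simp add: zero_weight_def)
    then have "1\<^sub>m m * K * tpow m ((!) (mu n)) * 1\<^sub>m m = 1\<^sub>m m * 1\<^sub>m m * tpow m ((!) (zero_weight m)) * k"
      using k(2) GL_O_carrier_mat[OF K(1)] GL_O_carrier_mat[OF k(1)] by simp
    then show ?thesis
      using relative_position_unique[OF K(1) GL_O_one GL_O_one k(1) GL_K_one _ mp(2) z] n by auto
  qed
  define mu' where "mu' = restrict mu {0..n}"
  have step: "weight_step m mu' i = weight_step m mu i" if "i \<in> {1..n}" for i
    using that by (auto simp: weight_step_def mu'_def)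
  have dom: "mu i \<in> dominant m" if "i \<le> n" for i
    using mp(1) mp(2)[of i] zero_weight_dominant that by (cases "i = 0") auto
  have "mu' \<in> minuscule_paths m n lam"
    unfolding minuscule_paths_def
  proof (intro CollectI conjI ballI)
    show "mu' \<in> {0..n} \<rightarrow>\<^sub>E dominant m" using dom by (simp add: mu'_def)
    show "mu' 0 = zero_weight m" "mu' n = zero_weight m" using mp(1) mun by (simp_all add: mu'_def)
    fix i assume "i \<in> {1..n}"
    then show "mset (weight_step m mu' i) = mset (lam i)" using step mp(3) by simp
  qed
  moreover have "x \<in> path_piece m n mu'"
    unfolding path_piece_def
  proof (intro CollectI exI[of _ p] conjI ballI)
    fix i assume "i \<in> {1..<n}"
    then show "parabolic m (mu' (i - 1)) (p i)" using mp(4)[of i] by (auto simp: mu'_def)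
  next
    show "x = Gr_proj m {1..<n} (gpolygon m n p (weight_step m mu'))"
    proof
      fix i show "x i = Gr_proj m {1..<n} (gpolygon m n p (weight_step m mu')) i"
      proof (cases "i \<in> {1..<n}")
        case True
        have "gprod m p (weight_step m mu') i = gprod m p (weight_step m mu) i"
          by (rule gprod_cong) (use True step in auto)
        then show ?thesis using mp(5)[of i] True by (simp add: polygon_vertex_def Gr_proj_def gpolygon_def)
      next
        case False
        then show ?thesis using x by (auto simp: Poly_def Gr_power_def Gr_proj_def PiE_def extensional_def)
      qed
    qed
  qed
  ultimately show ?thesis using that by blast
qed

section \<open>Algebraic families of loops\<close>

text \<open>An algebra of functions on a parameter space. Instances are polynomials in one variable
  and their localizations, polynomials in the coordinates of a cell, loop polynomials, and the
  functions that semi-invariants induce on a cell; families of matrices are treated for all of them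
  at once.\<close>

locale fun_algebra =
  fixes F :: "('x \<Rightarrow> complex) set"
  assumes const: "(\<lambda>_. c) \<in> F"
    and add: "f \<in> F \<Longrightarrow> g \<in> F \<Longrightarrow> (\<lambda>x. f x + g x) \<in> F"
    and mult: "f \<in> F \<Longrightarrow> g \<in> F \<Longrightarrow> (\<lambda>x. f x * g x) \<in> F"
begin

lemma sum: "(\<And>y. y \<in> A \<Longrightarrow> f y \<in> F) \<Longrightarrow> (\<lambda>x. \<Sum>y\<in>A. f y x) \<in> F"
  by (induction A rule: infinite_finite_induct) (auto intro: const add)

lemma prod: "(\<And>y. y \<in> A \<Longrightarrow> f y \<in> F) \<Longrightarrow> (\<lambda>x. \<Prod>y\<in>A. f y x) \<in> F"
  by (induction A rule: infinite_finite_induct) (auto intro: const mult)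

lemma minus: "f \<in> F \<Longrightarrow> (\<lambda>x. - f x) \<in> F"
  using mult[OF const[of "- 1"]] by simp

lemma diff: "f \<in> F \<Longrightarrow> g \<in> F \<Longrightarrow> (\<lambda>x. f x - g x) \<in> F"
  using add[OF _ minus, of f g] by simp

lemma det:
  assumes "\<And>x. M x \<in> carrier_mat k k" "\<And>a b. a < k \<Longrightarrow> b < k \<Longrightarrow> (\<lambda>x. M x $$ (a, b)) \<in> F"
  shows "(\<lambda>x. det (M x)) \<in> F"
proof -
  have "(\<lambda>x. \<Sum>p\<in>{p. p permutes {0..<k}}. signof p * (\<Prod>i = 0..<k. M x $$ (i, p i))) \<in> F"
    by (intro sum mult const prod assms(2)) (auto simp: permutes_in_image)
  then show ?thesis using det_def'[OF assms(1)] by simp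
qed

lemma adj_mat:
  assumes M: "\<And>x. M x \<in> carrier_mat k k" "\<And>a b. a < k \<Longrightarrow> b < k \<Longrightarrow> (\<lambda>x. M x $$ (a, b)) \<in> F"
    and ab: "a < k" "b < k"
  shows "(\<lambda>x. adj_mat (M x) $$ (a, b)) \<in> F"
proof -
  have dims: "dim_row (M x) = k" "dim_col (M x) = k" for x using M(1)[of x] by auto
  have "(\<lambda>x. (- 1) ^ (b + a) * Determinant.det (mat_delete (M x) b a)) \<in> F"
  proof (intro mult const det)
    show "mat_delete (M x) b a \<in> carrier_mat (k - 1) (k - 1)" for x
      using M(1) by (rule mat_delete_carrier)
    fix i j assume "i < k - 1" "j < k - 1"
    then have "(\<lambda>x. mat_delete (M x) b a $$ (i, j)) =
        (\<lambda>x. M x $$ (if i < b then i else Suc i, if j < a then j else Suc j))"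
      by (simp add: mat_delete_def dims)
    moreover have "(if i < b then i else Suc i) < k" "(if j < a then j else Suc j) < k"
      using \<open>i < k - 1\<close> \<open>j < k - 1\<close> by auto
    ultimately show "(\<lambda>x. mat_delete (M x) b a $$ (i, j)) \<in> F" using M(2) by simp
  qed
  then show ?thesis using ab by (simp add: adj_mat_def cofactor_def dims)
qed

text \<open>A uniform bound on the poles belongs to the notion: it makes coefficients of products
  sums over a fixed finite range. Agreement with an element of \<open>F\<close> is asked for on
  \<open>X\<close> only, because functions with denominators have arbitrary values
  elsewhere.\<close>

definition regular :: "'x set \<Rightarrow> ('x \<Rightarrow> complex fls) \<Rightarrow> bool" where
  "regular X M \<longleftrightarrow> (\<exists>N. \<forall>x\<in>X. val_ge N (M x)) \<and> (\<forall>e. \<exists>f\<in>F. \<forall>x\<in>X. fls_nth (M x) e = f x)"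

lemma regular_bound:
  assumes "regular X M"
  obtains N where "\<And>x. x \<in> X \<Longrightarrow> val_ge N (M x)"
  using assms unfolding regular_def by blast

lemma regular_nth:
  assumes "regular X M"
  obtains f where "f \<in> F" "\<And>x. x \<in> X \<Longrightarrow> fls_nth (M x) e = f x"
  using assms unfolding regular_def by blast

lemma regularI:
  "(\<And>x. x \<in> X \<Longrightarrow> val_ge N (M x)) \<Longrightarrow> (\<And>e. \<exists>f\<in>F. \<forall>x\<in>X. fls_nth (M x) e = f x) \<Longrightarrow> regular X M"
  unfolding regular_def by blast

lemma regular_cong: "(\<And>x. x \<in> X \<Longrightarrow> M x = M' x) \<Longrightarrow> regular X M \<longleftrightarrow> regular X M'"
  by (simp add: regular_def)

lemma regular_fixed: "regular X (\<lambda>_. c)"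
  by (rule regularI[of _ "fls_subdegree c"]) (auto simp: val_ge_iff intro: const)

lemma regular_const: "f \<in> F \<Longrightarrow> regular X (\<lambda>x. fls_const (f x))"
proof (rule regularI[of _ 0])
  fix e :: int assume "f \<in> F"
  then show "\<exists>g\<in>F. \<forall>x\<in>X. fls_nth (fls_const (f x)) e = g x"
    using const[of 0] by (cases "e = 0") auto
qed auto

lemma regular_add:
  assumes M: "regular X M" and M': "regular X M'"
  shows "regular X (\<lambda>x. M x + M' x)"
proof -
  obtain N N' where N: "\<And>x. x \<in> X \<Longrightarrow> val_ge N (M x)" "\<And>x. x \<in> X \<Longrightarrow> val_ge N' (M' x)"
    using regular_bound[OF M] regular_bound[OF M'] by metis
  show ?thesis
  proof (rule regularI)
    show "val_ge (min N N') (M x + M' x)" if "x \<in> X" for x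
      using N[OF that] by (auto intro!: val_ge_add intro: val_ge_mono)
    fix e
    obtain f where "f \<in> F" "\<And>x. x \<in> X \<Longrightarrow> fls_nth (M x) e = f x" using regular_nth[OF M] by blast
    moreover obtain g where "g \<in> F" "\<And>x. x \<in> X \<Longrightarrow> fls_nth (M' x) e = g x" using regular_nth[OF M'] by blast
    ultimately show "\<exists>f\<in>F. \<forall>x\<in>X. fls_nth (M x + M' x) e = f x"
      by (intro bexI[of _ "\<lambda>x. f x + g x"]) (auto intro: add)
  qed
qed

lemma regular_mult:
  assumes M: "regular X M" and M': "regular X M'"
  shows "regular X (\<lambda>x. M x * M' x)"
proof -
  obtain N where N: "\<And>x. x \<in> X \<Longrightarrow> val_ge N (M x)" using regular_bound[OF M] by blast
  obtain N' where N': "\<And>x. x \<in> X \<Longrightarrow> val_ge N' (M' x)" using regular_bound[OF M'] by blast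
  have "\<forall>e. \<exists>f. f \<in> F \<and> (\<forall>x\<in>X. fls_nth (M x) e = f x)" using M unfolding regular_def by blast
  then obtain f where f: "\<And>e. f e \<in> F" "\<And>e x. x \<in> X \<Longrightarrow> fls_nth (M x) e = f e x" by metis
  have "\<forall>e. \<exists>f. f \<in> F \<and> (\<forall>x\<in>X. fls_nth (M' x) e = f x)" using M' unfolding regular_def by blast
  then obtain g where g: "\<And>e. g e \<in> F" "\<And>e x. x \<in> X \<Longrightarrow> fls_nth (M' x) e = g e x" by metis
  show ?thesis
  proof (rule regularI)
    show "val_ge (N + N') (M x * M' x)" if "x \<in> X" for x
      by (rule val_ge_mult[OF N[OF that] N'[OF that]])
    fix e
    have 1: "fls_nth (M x * M' x) e = (\<Sum>i=N..e - N'. f i x * g (e - i) x)" if "x \<in> X" for x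
      unfolding fls_nth_mult_val_ge[OF N[OF that] N'[OF that]] using f(2)[OF that] g(2)[OF that] by simp
    have 2: "(\<lambda>x. \<Sum>i=N..e - N'. f i x * g (e - i) x) \<in> F"
      by (intro sum mult f g)
    show "\<exists>f\<in>F. \<forall>x\<in>X. fls_nth (M x * M' x) e = f x"
      by (rule bexI[OF _ 2], rule ballI, rule 1)
  qed
qed

lemma regular_sum: "(\<And>y. y \<in> A \<Longrightarrow> regular X (M y)) \<Longrightarrow> regular X (\<lambda>x. \<Sum>y\<in>A. M y x)"
  by (induction A rule: infinite_finite_induct) (auto intro: regular_fixed regular_add)

definition regular_mat :: "nat \<Rightarrow> 'x set \<Rightarrow> ('x \<Rightarrow> complex fls mat) \<Rightarrow> bool" where
  "regular_mat m X M \<longleftrightarrow> (\<forall>x\<in>X. M x \<in> carrier_mat m m) \<and>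
     (\<forall>a<m. \<forall>b<m. regular X (\<lambda>x. M x $$ (a, b)))"

lemma regular_mat_cong: "(\<And>x. x \<in> X \<Longrightarrow> M x = M' x) \<Longrightarrow> regular_mat m X M \<longleftrightarrow> regular_mat m X M'"
  using regular_cong[of X "\<lambda>x. M x $$ _" "\<lambda>x. M' x $$ _"] by (simp add: regular_mat_def cong: regular_cong)

lemma regular_mat_mult:
  assumes "regular_mat m X M" "regular_mat m X M'"
  shows "regular_mat m X (\<lambda>x. M x * M' x)"
  unfolding regular_mat_def
proof (intro conjI allI impI ballI)
  fix a b assume ab: "a < m" "b < m"
  have "regular X (\<lambda>x. (M x * M' x) $$ (a, b)) \<longleftrightarrow>
      regular X (\<lambda>x. \<Sum>k<m. M x $$ (a, k) * M' x $$ (k, b))"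
    by (rule regular_cong, rule mult_mat_index) (use assms ab in \<open>auto simp: regular_mat_def\<close>)
  moreover have "regular X (\<lambda>x. \<Sum>k<m. M x $$ (a, k) * M' x $$ (k, b))"
    by (intro regular_sum regular_mult) (use assms ab in \<open>auto simp: regular_mat_def\<close>)
  ultimately show "regular X (\<lambda>x. (M x * M' x) $$ (a, b))" by simp
qed (use assms in \<open>auto simp: regular_mat_def\<close>)

lemma regular_mat_fixed: "A \<in> carrier_mat m m \<Longrightarrow> regular_mat m X (\<lambda>_. A)"
  by (simp add: regular_mat_def regular_fixed)

lemma regular_mat_cmat:
  assumes "\<And>x. p x \<in> carrier_mat m m" "\<And>a b. a < m \<Longrightarrow> b < m \<Longrightarrow> (\<lambda>x. p x $$ (a, b)) \<in> F"
  shows "regular_mat m X (\<lambda>x. cmat (p x))"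
proof -
  have dims: "dim_row (p x) = m" "dim_col (p x) = m" for x using assms(1)[of x] by auto
  show ?thesis
    using assms by (simp add: regular_mat_def cmat_index dims regular_const)
qed

lemma regular_mat_gprod:
  assumes "\<And>i x. i \<in> {1..j} \<Longrightarrow> p x i \<in> carrier_mat m m"
    "\<And>i a b. i \<in> {1..j} \<Longrightarrow> a < m \<Longrightarrow> b < m \<Longrightarrow> (\<lambda>x. p x i $$ (a, b)) \<in> F"
  shows "regular_mat m X (\<lambda>x. gprod m (p x) w j)"
  using assms
proof (induction j)
  case 0
  then show ?case by (simp add: regular_mat_fixed)
next
  case (Suc j)
  have "regular_mat m X (\<lambda>x. gprod m (p x) w j)" by (rule Suc.IH) (use Suc.prems in auto)
  then show ?case
    unfolding gprod.simps
    by (intro regular_mat_mult regular_mat_cmat regular_mat_fixed) (use Suc.prems in auto)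
qed

text \<open>The inverse is included because the coordinates on the loop group comprise the
  coefficients of the inverse matrix.\<close>

definition biregular :: "nat \<Rightarrow> 'x set \<Rightarrow> ('x \<Rightarrow> complex fls mat) \<Rightarrow> bool" where
  "biregular m X M \<longleftrightarrow> (\<forall>x\<in>X. M x \<in> carrier (GL_K m)) \<and> regular_mat m X M \<and>
     regular_mat m X (\<lambda>x. inv\<^bsub>GL_K m\<^esub> (M x))"

lemma biregular_mult:
  assumes M: "biregular m X M" and M': "biregular m X M'"
  shows "biregular m X (\<lambda>x. M x * M' x)"
proof -
  have "inv\<^bsub>GL_K m\<^esub> (M x * M' x) = inv\<^bsub>GL_K m\<^esub> (M' x) * inv\<^bsub>GL_K m\<^esub> (M x)" if "x \<in> X" for x
    using group.inv_mult_group[OF group_GL_K, of "M x" m "M' x"] M M' that by (simp add: biregular_def)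
  then have "regular_mat m X (\<lambda>x. inv\<^bsub>GL_K m\<^esub> (M x * M' x)) \<longleftrightarrow>
      regular_mat m X (\<lambda>x. inv\<^bsub>GL_K m\<^esub> (M' x) * inv\<^bsub>GL_K m\<^esub> (M x))"
    by (rule regular_mat_cong)
  moreover have "regular_mat m X (\<lambda>x. inv\<^bsub>GL_K m\<^esub> (M' x) * inv\<^bsub>GL_K m\<^esub> (M x))"
    using M M' by (intro regular_mat_mult) (simp_all add: biregular_def)
  ultimately show ?thesis
    using M M' by (simp add: biregular_def GL_K_mult regular_mat_mult)
qed

lemma biregular_fixed: "A \<in> carrier (GL_K m) \<Longrightarrow> biregular m X (\<lambda>_. A)"
  using GL_K_inv(1)[of A m] by (simp add: biregular_def regular_mat_fixed GL_K_carrier_mat)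

lemma biregular_cmat:
  assumes "\<And>x. p x \<in> carrier_mat m m" "\<And>a b. a < m \<Longrightarrow> b < m \<Longrightarrow> (\<lambda>x. p x $$ (a, b)) \<in> F"
    and "\<And>x. q x \<in> carrier_mat m m" "\<And>a b. a < m \<Longrightarrow> b < m \<Longrightarrow> (\<lambda>x. q x $$ (a, b)) \<in> F"
    and "\<And>x. x \<in> X \<Longrightarrow> p x * q x = 1\<^sub>m m"
  shows "biregular m X (\<lambda>x. cmat (p x))"
proof -
  have "cmat (p x) * cmat (q x) = 1\<^sub>m m" if "x \<in> X" for x
    using assms(5)[OF that] by (simp add: cmat_mult[OF assms(1,3), symmetric])
  then have i: "cmat (p x) \<in> carrier (GL_K m)" "inv\<^bsub>GL_K m\<^esub> (cmat (p x)) = cmat (q x)" if "x \<in> X" for x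
    using GL_K_of_inverse[of "cmat (p x)" m "cmat (q x)"] assms(1,3) that by simp_all
  have "regular_mat m X (\<lambda>x. inv\<^bsub>GL_K m\<^esub> (cmat (p x))) \<longleftrightarrow> regular_mat m X (\<lambda>x. cmat (q x))"
    by (rule regular_mat_cong[OF i(2)])
  then show ?thesis
    using i(1) regular_mat_cmat[OF assms(1,2), of X] regular_mat_cmat[OF assms(3,4), of X]
    by (simp add: biregular_def)
qed

lemma biregular_gprod:
  assumes "\<And>i. i \<in> {1..j} \<Longrightarrow> biregular m X (\<lambda>x. cmat (p x i))"
  shows "biregular m X (\<lambda>x. gprod m (p x) w j)"
  using assms
proof (induction j)
  case 0
  then show ?case by (simp add: biregular_fixed)
next
  case (Suc j)
  have "biregular m X (\<lambda>x. gprod m (p x) w j)" by (rule Suc.IH) (use Suc.prems in auto)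
  then show ?case
    unfolding gprod.simps using Suc.prems[of "Suc j"] by (intro biregular_mult biregular_fixed) auto
qed

lemma loop_polys_pullback:
  assumes h: "\<And>i. i \<in> I \<Longrightarrow> biregular m X (\<lambda>x. h x i)" and p: "p \<in> loop_polys m I"
  shows "\<exists>f\<in>F. \<forall>x\<in>X. p (h x) = f x"
  using p
proof induction
  case (const c)
  then show ?case by (intro bexI[of _ "\<lambda>_. c"]) (auto intro: fun_algebra.const[OF fun_algebra_axioms])
next
  case (entry i a b e)
  then have "regular X (\<lambda>x. h x i $$ (a, b))" using h by (simp add: biregular_def regular_mat_def)
  then show ?case by (auto simp: regular_def)
next
  case (inv_entry i a b e)
  then have "regular X (\<lambda>x. (inv\<^bsub>GL_K m\<^esub> (h x i)) $$ (a, b))" using h by (simp add: biregular_def regular_mat_def)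
  then show ?case by (auto simp: regular_def)
next
  case (add p q)
  then obtain f g where "f \<in> F" "\<forall>x\<in>X. p (h x) = f x" "g \<in> F" "\<forall>x\<in>X. q (h x) = g x" by blast
  then show ?case
    by (intro bexI[of _ "\<lambda>x. f x + g x"]) (auto intro: fun_algebra.add[OF fun_algebra_axioms])
next
  case (mult p q)
  then obtain f g where "f \<in> F" "\<forall>x\<in>X. p (h x) = f x" "g \<in> F" "\<forall>x\<in>X. q (h x) = g x" by blast
  then show ?case
    by (intro bexI[of _ "\<lambda>x. f x * g x"]) (auto intro: fun_algebra.mult[OF fun_algebra_axioms])
qed

lemma regular_mat_bound:
  assumes "regular_mat m X M"
  shows "\<exists>N. \<forall>x\<in>X. \<forall>a<m. \<forall>b<m. val_ge (- int N) (M x $$ (a, b))"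
proof -
  have "\<forall>ab\<in>{..<m} \<times> {..<m}. \<exists>N. \<forall>x\<in>X. val_ge N (M x $$ ab)"
    using assms by (auto simp: regular_mat_def regular_def)
  then obtain N where N0: "\<forall>ab\<in>{..<m} \<times> {..<m}. \<forall>x\<in>X. val_ge (N ab) (M x $$ ab)"
    by (rule bchoice[THEN exE])
  have N: "val_ge (N (a, b)) (M x $$ (a, b))" if "a < m" "b < m" "x \<in> X" for a b x
    using N0[rule_format, of "(a, b)" x] that by simp
  let ?K = "\<Sum>ab\<in>{..<m} \<times> {..<m}. nat (- N ab)"
  have "val_ge (- int ?K) (M x $$ (a, b))" if "a < m" "b < m" "x \<in> X" for a b x
  proof (rule val_ge_mono[OF N[OF that]])
    have "nat (- N (a, b)) \<le> ?K"
      by (rule member_le_sum) (use that in auto)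
    then show "- int ?K \<le> N (a, b)" by linarith
  qed
  then show ?thesis by blast
qed

lemma loop_piece_pullback:
  assumes I: "finite I" and h: "\<And>i. i \<in> I \<Longrightarrow> biregular m X (\<lambda>x. h x i)"
    and hx: "\<And>x. x \<in> X \<Longrightarrow> h x \<in> loop_power m I"
  shows "\<exists>N. \<forall>x\<in>X. h x \<in> loop_piece m I N"
proof -
  have "\<exists>N. \<forall>x\<in>X. \<forall>a<m. \<forall>b<m. val_ge (- int N) (h x i $$ (a, b)) \<and>
      val_ge (- int N) ((inv\<^bsub>GL_K m\<^esub> (h x i)) $$ (a, b))" if i: "i \<in> I" for i
  proof -
    have r: "regular_mat m X (\<lambda>x. h x i)" "regular_mat m X (\<lambda>x. inv\<^bsub>GL_K m\<^esub> (h x i))"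
      using h[OF i] by (simp_all add: biregular_def)
    obtain N where N: "\<forall>x\<in>X. \<forall>a<m. \<forall>b<m. val_ge (- int N) (h x i $$ (a, b))"
      using regular_mat_bound[OF r(1)] by (rule exE)
    obtain N' where N': "\<forall>x\<in>X. \<forall>a<m. \<forall>b<m. val_ge (- int N') ((inv\<^bsub>GL_K m\<^esub> (h x i)) $$ (a, b))"
      using regular_mat_bound[OF r(2)] by (rule exE)
    show ?thesis
    proof (intro exI[of _ "N + N'"] ballI allI impI conjI)
      fix x a b assume x: "x \<in> X" "a < m" "b < m"
      show "val_ge (- int (N + N')) (h x i $$ (a, b))"
        by (rule val_ge_mono[OF N[rule_format, OF x]]) simp
      show "val_ge (- int (N + N')) ((inv\<^bsub>GL_K m\<^esub> (h x i)) $$ (a, b))"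
        by (rule val_ge_mono[OF N'[rule_format, OF x]]) simp
    qed
  qed
  then have "\<forall>i\<in>I. \<exists>N. \<forall>x\<in>X. \<forall>a<m. \<forall>b<m. val_ge (- int N) (h x i $$ (a, b)) \<and>
      val_ge (- int N) ((inv\<^bsub>GL_K m\<^esub> (h x i)) $$ (a, b))" by blast
  then obtain N where N: "\<forall>i\<in>I. \<forall>x\<in>X. \<forall>a<m. \<forall>b<m. val_ge (- int (N i)) (h x i $$ (a, b)) \<and>
      val_ge (- int (N i)) ((inv\<^bsub>GL_K m\<^esub> (h x i)) $$ (a, b))" by (rule bchoice[THEN exE])
  have "h x \<in> loop_piece m I (\<Sum>i\<in>I. N i)" if x: "x \<in> X" for x
    unfolding loop_piece_def
  proof (intro CollectI conjI ballI allI impI)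
    show "h x \<in> loop_power m I" by (rule hx[OF x])
    fix i a b and e :: int
    assume i: "i \<in> I" "a < m" "b < m" "e < - int (\<Sum>i\<in>I. N i)"
    have "N i \<le> (\<Sum>i\<in>I. N i)" by (rule member_le_sum) (use I i in auto)
    then have "e < - int (N i)" using i(4) by linarith
    then show "fls_nth (h x i $$ (a, b)) e = 0" "fls_nth ((inv\<^bsub>GL_K m\<^esub> (h x i)) $$ (a, b)) e = 0"
      using N i x unfolding val_ge_def by blast+
  qed
  then show ?thesis by blast
qed

text \<open>By the uniform bounds the family stays inside one \<open>loop_piece\<close>, where a
  closed set is cut out by polynomials; these pull back to \<open>F\<close>.\<close>

lemma loop_closed_pullback:
  assumes I: "finite I" and h: "\<And>i. i \<in> I \<Longrightarrow> biregular m X (\<lambda>x. h x i)"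
    and hx: "\<And>x. x \<in> X \<Longrightarrow> h x \<in> loop_power m I" and Z: "loop_closed m I Z"
  obtains G where "G \<subseteq> F" "\<And>x. x \<in> X \<Longrightarrow> h x \<in> Z \<longleftrightarrow> (\<forall>f\<in>G. f x = 0)"
proof -
  obtain N where N: "\<forall>x\<in>X. h x \<in> loop_piece m I N"
    using loop_piece_pullback[of I m X h, OF I h hx] by (rule exE)
  obtain P where P: "P \<subseteq> loop_polys m I" "Z \<inter> loop_piece m I N = {g \<in> loop_piece m I N. \<forall>p\<in>P. p g = 0}"
    using loop_closedD[OF Z] .
  have "\<forall>p\<in>P. \<exists>f. f \<in> F \<and> (\<forall>x\<in>X. p (h x) = f x)"
  proof
    fix p assume "p \<in> P"
    then have "p \<in> loop_polys m I" using P(1) by (rule subsetD[rotated])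
    then have "\<exists>f\<in>F. \<forall>x\<in>X. p (h x) = f x" using loop_polys_pullback[of I m X h p] h by blast
    then show "\<exists>f. f \<in> F \<and> (\<forall>x\<in>X. p (h x) = f x)" by (simp add: Bex_def)
  qed
  then obtain f where f: "\<forall>p\<in>P. f p \<in> F \<and> (\<forall>x\<in>X. p (h x) = f p x)" by (rule bchoice[THEN exE])
  show ?thesis
  proof (rule that[of "f ` P"])
    show "f ` P \<subseteq> F" using f by blast
    fix x assume x: "x \<in> X"
    have hN: "h x \<in> loop_piece m I N" using N x by (rule bspec)
    then have "h x \<in> Z \<longleftrightarrow> h x \<in> Z \<inter> loop_piece m I N" by simp
    also have "\<dots> \<longleftrightarrow> (\<forall>p\<in>P. p (h x) = 0)" unfolding P(2) using hN by simp
    also have "\<dots> \<longleftrightarrow> (\<forall>g\<in>f ` P. g x = 0)" using f x by auto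
    finally show "h x \<in> Z \<longleftrightarrow> (\<forall>f\<in>f ` P. f x = 0)" .
  qed
qed

end

lemma closedin_Gr_top:
  "closedin (Gr_top m I) Z \<longleftrightarrow> Z \<subseteq> Gr_power m I \<and> loop_closed m I {g \<in> loop_power m I. Gr_proj m I g \<in> Z}"
proof -
  have "closedin (loop_top m I) {g \<in> topspace (loop_top m I). Gr_proj m I g \<in> Z} \<longleftrightarrow> closedin (Gr_top m I) Z"
    if "Z \<subseteq> Gr_power m I"
    using quotient_map_Gr_proj[of m I] that unfolding quotient_map_closedin topspace_Gr_top by blast
  then show ?thesis
    using closedin_subset[of "Gr_top m I" Z] by (auto simp: topspace_loop_top topspace_Gr_top closedin_loop_top)
qed


section \<open>Irreducibility of the pieces\<close>

text \<open>The ring \<open>C[s]\<close> localized at \<open>Q\<close>, as functions on the whole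
  field with arbitrary values at the zeros of \<open>Q\<close>.\<close>

definition rational_funs :: "complex poly \<Rightarrow> (complex \<Rightarrow> complex) set" where
  "rational_funs Q = {f. \<exists>P k. \<forall>s. poly Q s \<noteq> 0 \<longrightarrow> f s = poly P s / poly Q s ^ k}"

lemma fun_algebra_rational_funs: "fun_algebra (rational_funs Q)"
proof
  show "(\<lambda>_. c) \<in> rational_funs Q" for c
    unfolding rational_funs_def by (intro CollectI exI[of _ "[:c:]"] exI[of _ 0]) simp
  fix f g assume "f \<in> rational_funs Q" "g \<in> rational_funs Q"
  then obtain P k P' k' where f: "\<And>s. poly Q s \<noteq> 0 \<Longrightarrow> f s = poly P s / poly Q s ^ k"
    and g: "\<And>s. poly Q s \<noteq> 0 \<Longrightarrow> g s = poly P' s / poly Q s ^ k'"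
    unfolding rational_funs_def by auto
  show "(\<lambda>s. f s + g s) \<in> rational_funs Q"
    unfolding rational_funs_def
    by (intro CollectI exI[of _ "P * Q ^ k' + P' * Q ^ k"] exI[of _ "k + k'"])
      (simp add: f g field_simps power_add)
  show "(\<lambda>s. f s * g s) \<in> rational_funs Q"
    unfolding rational_funs_def
    by (intro CollectI exI[of _ "P * P'"] exI[of _ "k + k'"]) (simp add: f g power_add)
qed

lemma rational_funs_poly: "poly P \<in> rational_funs Q"
  unfolding rational_funs_def by (intro CollectI exI[of _ P] exI[of _ 0]) simp

lemma rational_funs_finite_zeros:
  assumes "f \<in> rational_funs Q" "poly Q s0 \<noteq> 0" "f s0 \<noteq> 0"
  shows "finite {s. poly Q s \<noteq> 0 \<and> f s = 0}"
proof -
  obtain P k where f: "\<And>s. poly Q s \<noteq> 0 \<Longrightarrow> f s = poly P s / poly Q s ^ k"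
    using assms(1) unfolding rational_funs_def by auto
  have "P \<noteq> 0" using f[OF assms(2)] assms(3) by auto
  then have "finite {s. poly P s = 0}" by (rule poly_roots_finite)
  then show ?thesis by (rule finite_subset[rotated]) (auto simp: f)
qed

lemma fun_algebra_range_poly: "fun_algebra (range (poly :: complex poly \<Rightarrow> _))"
proof
  show "(\<lambda>_. c) \<in> range poly" for c :: complex by (rule image_eqI[of _ _ "[:c:]"]) auto
  fix f g :: "complex \<Rightarrow> complex" assume "f \<in> range poly" "g \<in> range poly"
  then obtain P Q where "f = poly P" "g = poly Q" by blast
  then have "(\<lambda>s. f s + g s) = poly (P + Q)" "(\<lambda>s. f s * g s) = poly (P * Q)" by auto
  then show "(\<lambda>s. f s + g s) \<in> range poly" "(\<lambda>s. f s * g s) \<in> range poly" by (metis rangeI)+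
qed

definition line_mat :: "nat \<Rightarrow> complex mat \<Rightarrow> complex mat \<Rightarrow> complex \<Rightarrow> complex mat" where
  "line_mat m p p' s = mat m m (\<lambda>ab. (1 - s) * p $$ ab + s * p' $$ ab)"

lemma line_mat_poly:
  assumes "a < m" "b < m"
  shows "(\<lambda>s. line_mat m p p' s $$ (a, b)) = poly [:p $$ (a, b), p' $$ (a, b) - p $$ (a, b):]"
  using assms by (auto simp: line_mat_def algebra_simps)

text \<open>Parabolic matrices are an open part of a linear space, so two points of the piece are
  joined by a line of parameters with finitely many points removed. If closed sets \<open>A\<close>
  and \<open>B\<close> covered the piece while each misses one of the two points, each would contain
  the points of finitely many parameters only, and the complex numbers would be finite.\<close>

lemma irreducible_path_piece: "irreducible_in (Gr_top m {1..<n}) (path_piece m n mu)"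
  unfolding irreducible_in_def
proof (intro conjI allI impI)
  let ?I = "{1..<n}" and ?w = "weight_step m mu"
  show "path_piece m n mu \<subseteq> topspace (Gr_top m ?I)"
  proof
    fix x assume "x \<in> path_piece m n mu"
    then obtain p where p: "x = Gr_proj m ?I (gpolygon m n p ?w)" "\<forall>i\<in>?I. parabolic m (mu (i - 1)) (p i)"
      unfolding path_piece_def by blast
    have "cmat (p i) \<in> GL_O m" if "i \<in> ?I" for i
      by (rule parabolic_GL_O[OF p(2)[rule_format, OF that]])
    then show "x \<in> topspace (Gr_top m ?I)"
      unfolding topspace_Gr_top p(1) by (intro Gr_proj_Gr_power gpolygon_loop_power)
  qed
  show "path_piece m n mu \<noteq> {}"
  proof -
    have "Gr_proj m ?I (gpolygon m n (\<lambda>_. 1\<^sub>m m) ?w) \<in> path_piece m n mu"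
      unfolding path_piece_def by (intro CollectI exI[of _ "\<lambda>_. 1\<^sub>m m"] conjI refl ballI parabolic_one)
    then show ?thesis by auto
  qed
  fix A B assume AB: "closedin (Gr_top m ?I) A \<and> closedin (Gr_top m ?I) B \<and> path_piece m n mu \<subseteq> A \<union> B"
  show "path_piece m n mu \<subseteq> A \<or> path_piece m n mu \<subseteq> B"
  proof (rule ccontr)
    assume "\<not> ?thesis"
    then obtain x x' where x: "x \<in> path_piece m n mu" "x \<notin> A" "x' \<in> path_piece m n mu" "x' \<notin> B" by blast
    obtain p where p: "x = Gr_proj m ?I (gpolygon m n p ?w)" "\<forall>i\<in>?I. parabolic m (mu (i - 1)) (p i)"
      using x(1) unfolding path_piece_def by blast
    obtain p' where p': "x' = Gr_proj m ?I (gpolygon m n p' ?w)" "\<forall>i\<in>?I. parabolic m (mu (i - 1)) (p' i)"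
      using x(3) unfolding path_piece_def by blast
    define q where "q s i = line_mat m (p i) (p' i) s" for s i
    have qc: "q s i \<in> carrier_mat m m" for s i by (simp add: q_def line_mat_def)
    have q_poly: "(\<lambda>s. q s i $$ (a, b)) \<in> range poly" if "a < m" "b < m" for i a b
      unfolding q_def line_mat_poly[OF that] by blast
    have q0: "q 0 i = p i" "q 1 i = p' i" if "i \<in> ?I" for i
    proof -
      have "p i \<in> carrier_mat m m" "p' i \<in> carrier_mat m m"
        using parabolic_carrier p(2) p'(2) that by blast+
      then show "q 0 i = p i" "q 1 i = p' i" by (auto simp: q_def line_mat_def intro!: eq_matI)
    qed
    have p_det: "det (p i) \<noteq> 0" "det (p' i) \<noteq> 0" if "i \<in> ?I" for i
      using p(2)[rule_format, OF that] p'(2)[rule_format, OF that] by (simp_all add: parabolic_def)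
    have "\<forall>i. \<exists>D. (\<lambda>s. det (q s i)) = poly D"
    proof
      fix i
      have "(\<lambda>s. det (q s i)) \<in> range poly"
        by (rule fun_algebra.det[OF fun_algebra_range_poly, of "\<lambda>s. q s i" m, OF qc q_poly])
      then show "\<exists>D. (\<lambda>s. det (q s i)) = poly D" by (elim rangeE) (rule exI)
    qed
    then obtain D where "\<forall>i. (\<lambda>s. det (q s i)) = poly (D i)" by (rule choice[THEN exE])
    then have D: "det (q s i) = poly (D i) s" for i s by (metis (no_types))
    \<comment> \<open>The line leaves the invertible matrices where one of the determinants
      vanishes. Inverting the product of the determinants makes all inverse matrices regular at
      once.\<close>
    define Q where "Q = (\<Prod>i\<in>?I. D i)"
    have Q_nz: "poly Q s \<noteq> 0 \<longleftrightarrow> (\<forall>i\<in>?I. det (q s i) \<noteq> 0)" for s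
      by (simp add: Q_def poly_prod D)
    have Q01: "poly Q 0 \<noteq> 0" "poly Q 1 \<noteq> 0"
      unfolding Q_nz using q0 p_det by auto
    define X where "X = {s. poly Q s \<noteq> 0}"
    interpret R: fun_algebra "rational_funs Q" by (rule fun_algebra_rational_funs)
    have Dinv: "(\<lambda>s. inverse (det (q s i))) \<in> rational_funs Q" if i: "i \<in> ?I" for i
      unfolding rational_funs_def
    proof (intro CollectI exI[of _ "\<Prod>j\<in>?I - {i}. D j"] exI[of _ 1] allI impI)
      fix s assume s: "poly Q s \<noteq> 0"
      have "Q = D i * (\<Prod>j\<in>?I - {i}. D j)" unfolding Q_def by (rule prod.remove) (use i in auto)
      then show "inverse (det (q s i)) = poly (\<Prod>j\<in>?I - {i}. D j) s / poly Q s ^ 1"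
        using s by (auto simp: D field_simps)
    qed
    have bireg: "R.biregular m X (\<lambda>s. cmat (q s i))" if i: "i \<in> ?I" for i
    proof (rule R.biregular_cmat[where q = "\<lambda>s. inverse (det (q s i)) \<cdot>\<^sub>m adj_mat (q s i)"])
      show "q s i \<in> carrier_mat m m" for s by (rule qc)
      show qr: "(\<lambda>s. q s i $$ (a, b)) \<in> rational_funs Q" if "a < m" "b < m" for a b
        using q_poly[OF that, of i] rational_funs_poly by auto
      have adjc: "adj_mat (q s i) \<in> carrier_mat m m" for s by (rule adj_mat(1)[OF qc])
      show "inverse (det (q s i)) \<cdot>\<^sub>m adj_mat (q s i) \<in> carrier_mat m m" for s
        using adjc by simp
      show "(\<lambda>s. (inverse (det (q s i)) \<cdot>\<^sub>m adj_mat (q s i)) $$ (a, b)) \<in> rational_funs Q" if ab: "a < m" "b < m" for a b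
      proof -
        have "(\<lambda>s. inverse (det (q s i)) * adj_mat (q s i) $$ (a, b)) \<in> rational_funs Q"
          by (rule R.mult[OF Dinv[OF i] R.adj_mat[OF qc qr ab]])
        moreover have "dim_row (adj_mat (q s i)) = m" "dim_col (adj_mat (q s i)) = m" for s
          using adjc[of s] by auto
        ultimately show ?thesis using ab by simp
      qed
      fix s assume "s \<in> X"
      then have nz: "det (q s i) \<noteq> 0" using i Q_nz by (simp add: X_def)
      have "q s i * (inverse (det (q s i)) \<cdot>\<^sub>m adj_mat (q s i)) = inverse (det (q s i)) \<cdot>\<^sub>m (det (q s i) \<cdot>\<^sub>m 1\<^sub>m m)"
        using adj_mat(2)[OF qc, of s i] mult_smult_distrib[OF qc adjc] by simp
      also have "\<dots> = 1\<^sub>m m" using nz by (intro eq_matI) auto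
      finally show "q s i * (inverse (det (q s i)) \<cdot>\<^sub>m adj_mat (q s i)) = 1\<^sub>m m" .
    qed
    have par: "parabolic m (mu (i - 1)) (q s i)" if s: "s \<in> X" and i: "i \<in> ?I" for s i
      unfolding parabolic_def
    proof (intro conjI allI impI)
      show "q s i \<in> carrier_mat m m" by (rule qc)
      show "det (q s i) \<noteq> 0" using s i Q_nz by (simp add: X_def)
      fix a b assume ab: "a < m" "b < m" "q s i $$ (a, b) \<noteq> 0"
      then have "p i $$ (a, b) \<noteq> 0 \<or> p' i $$ (a, b) \<noteq> 0" by (auto simp: q_def line_mat_def)
      then show "mu (i - 1) ! b \<le> mu (i - 1) ! a"
        using parabolicD[OF p(2)[rule_format, OF i] ab(1,2)] parabolicD[OF p'(2)[rule_format, OF i] ab(1,2)] by blast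
    qed
    let ?h = "\<lambda>s. gpolygon m n (q s) ?w"
    have hX: "?h s \<in> loop_power m ?I" if "s \<in> X" for s
      by (rule gpolygon_loop_power, rule parabolic_GL_O, rule par[OF that])
    have hbi: "R.biregular m X (\<lambda>s. ?h s i)" if "i \<in> ?I" for i
    proof -
      have "R.biregular m X (\<lambda>s. gprod m (q s) ?w i)"
        by (rule R.biregular_gprod, rule bireg) (use that in auto)
      then show ?thesis using that by (simp add: gpolygon_def)
    qed
    have in_piece: "Gr_proj m ?I (?h s) \<in> path_piece m n mu" if "s \<in> X" for s
      unfolding path_piece_def by (intro CollectI exI[of _ "q s"] conjI refl ballI par[OF that])
    have fin: "finite {s \<in> X. Gr_proj m ?I (?h s) \<in> Z}"
      if Z: "closedin (Gr_top m ?I) Z" and s0: "s0 \<in> X" "Gr_proj m ?I (?h s0) \<notin> Z" for Z s0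
    proof -
      have "loop_closed m ?I {g \<in> loop_power m ?I. Gr_proj m ?I g \<in> Z}" using Z by (simp add: closedin_Gr_top)
      then obtain G where G: "G \<subseteq> rational_funs Q"
        "\<And>s. s \<in> X \<Longrightarrow> ?h s \<in> {g \<in> loop_power m ?I. Gr_proj m ?I g \<in> Z} \<longleftrightarrow> (\<forall>f\<in>G. f s = 0)"
        using R.loop_closed_pullback[of ?I m X ?h, OF _ hbi hX] by (metis (no_types, lifting) finite_atLeastLessThan)
      have "\<exists>f\<in>G. f s0 \<noteq> 0" using G(2)[OF s0(1)] s0(2) by auto
      then obtain f where f: "f \<in> G" "f s0 \<noteq> 0" by (rule bexE)
      have "finite {s. poly Q s \<noteq> 0 \<and> f s = 0}"
        by (rule rational_funs_finite_zeros[of _ _ s0]) (use f G(1) s0 in \<open>auto simp: X_def\<close>)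
      then show ?thesis
      proof (rule finite_subset[rotated])
        show "{s \<in> X. Gr_proj m ?I (?h s) \<in> Z} \<subseteq> {s. poly Q s \<noteq> 0 \<and> f s = 0}"
          using G(2) f(1) hX by (auto simp: X_def)
      qed
    qed
    have "gpolygon m n (q 0) ?w = gpolygon m n p ?w" "gpolygon m n (q 1) ?w = gpolygon m n p' ?w"
      unfolding gpolygon_def by (rule restrict_ext, rule gprod_cong, use q0 in auto)+
    then have "Gr_proj m ?I (?h 0) \<notin> A" "Gr_proj m ?I (?h 1) \<notin> B" using x p(1) p'(1) by simp_all
    then have fAB: "finite {s \<in> X. Gr_proj m ?I (?h s) \<in> A}" "finite {s \<in> X. Gr_proj m ?I (?h s) \<in> B}"
      using fin[of A 0] fin[of B 1] AB Q01 by (auto simp: X_def)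
    have sub: "X \<subseteq> {s \<in> X. Gr_proj m ?I (?h s) \<in> A} \<union> {s \<in> X. Gr_proj m ?I (?h s) \<in> B}"
      using in_piece AB by blast
    have fX: "finite X" by (rule finite_subset[OF sub finite_UnI[OF fAB]])
    have "finite (- X)"
    proof -
      have "Q \<noteq> 0" using Q01 by auto
      then have "finite {s. poly Q s = 0}" by (rule poly_roots_finite)
      moreover have "- X = {s. poly Q s = 0}" by (auto simp: X_def)
      ultimately show ?thesis by simp
    qed
    then have "finite (X \<union> - X)" using fX by (rule finite_UnI[rotated])
    then have "finite (UNIV :: complex set)" by simp
    then show False using infinite_UNIV_char_0 by blast
  qed
qed

section \<open>Polynomial functions in finitely many variables\<close>

inductive_set polyfun :: "'v set \<Rightarrow> (('v \<Rightarrow> complex) \<Rightarrow> complex) set" for V :: "'v set" where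
  const: "(\<lambda>_. c) \<in> polyfun V"
| var: "v \<in> V \<Longrightarrow> (\<lambda>x. x v) \<in> polyfun V"
| add: "f \<in> polyfun V \<Longrightarrow> g \<in> polyfun V \<Longrightarrow> (\<lambda>x. f x + g x) \<in> polyfun V"
| mult: "f \<in> polyfun V \<Longrightarrow> g \<in> polyfun V \<Longrightarrow> (\<lambda>x. f x * g x) \<in> polyfun V"

lemma fun_algebra_polyfun: "fun_algebra (polyfun V)"
  by standard (auto intro: polyfun.intros)

text \<open>Degrees are bounded in each variable separately, so that the exponents form a box and
  the monomials number \<open>(D + 1) ^ card V\<close>.\<close>

definition box_poly :: "'v set \<Rightarrow> nat \<Rightarrow> (('v \<Rightarrow> complex) \<Rightarrow> complex) set" where
  "box_poly V D = {f. \<exists>c. \<forall>x. f x = (\<Sum>\<beta>\<in>V \<rightarrow>\<^sub>E {..D}. c \<beta> * (\<Prod>v\<in>V. x v ^ \<beta> v))}"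

lemma box_poly_add: "f \<in> box_poly V D \<Longrightarrow> g \<in> box_poly V D \<Longrightarrow> (\<lambda>x. f x + g x) \<in> box_poly V D"
proof -
  assume "f \<in> box_poly V D" "g \<in> box_poly V D"
  then obtain c d where c: "\<forall>x. f x = (\<Sum>\<beta>\<in>V \<rightarrow>\<^sub>E {..D}. c \<beta> * (\<Prod>v\<in>V. x v ^ \<beta> v))"
    and d: "\<forall>x. g x = (\<Sum>\<beta>\<in>V \<rightarrow>\<^sub>E {..D}. d \<beta> * (\<Prod>v\<in>V. x v ^ \<beta> v))"
    unfolding box_poly_def by (elim CollectE exE)
  show ?thesis
    unfolding box_poly_def
    by (intro CollectI exI[of _ "\<lambda>\<beta>. c \<beta> + d \<beta>"] allI)
      (simp add: c[rule_format] d[rule_format] sum.distrib[symmetric] distrib_right)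
qed

lemma box_poly_scale: "f \<in> box_poly V D \<Longrightarrow> (\<lambda>x. a * f x) \<in> box_poly V D"
proof -
  assume "f \<in> box_poly V D"
  then obtain c where c: "\<forall>x. f x = (\<Sum>\<beta>\<in>V \<rightarrow>\<^sub>E {..D}. c \<beta> * (\<Prod>v\<in>V. x v ^ \<beta> v))"
    unfolding box_poly_def by (elim CollectE exE)
  show ?thesis
    unfolding box_poly_def
    by (intro CollectI exI[of _ "\<lambda>\<beta>. a * c \<beta>"] allI) (simp add: c[rule_format] sum_distrib_left mult.assoc)
qed

lemma box_poly_zero: "(\<lambda>_. 0) \<in> box_poly V D"
  unfolding box_poly_def by (intro CollectI exI[of _ "\<lambda>_. 0"]) simp

lemma box_poly_sum: "(\<And>y. y \<in> A \<Longrightarrow> f y \<in> box_poly V D) \<Longrightarrow> (\<lambda>x. \<Sum>y\<in>A. f y x) \<in> box_poly V D"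
  by (induction A rule: infinite_finite_induct) (auto intro: box_poly_zero box_poly_add)

lemma box_poly_monomial:
  assumes V: "finite V" and \<beta>: "\<And>v. v \<in> V \<Longrightarrow> \<beta> v \<le> D"
  shows "(\<lambda>x. \<Prod>v\<in>V. x v ^ \<beta> v) \<in> box_poly V D"
  unfolding box_poly_def
proof (intro CollectI exI[of _ "\<lambda>\<gamma>. if \<gamma> = restrict \<beta> V then 1 else 0"] allI)
  fix x :: "'a \<Rightarrow> complex"
  have "(\<Sum>\<gamma>\<in>V \<rightarrow>\<^sub>E {..D}. (if \<gamma> = restrict \<beta> V then 1 else 0) * (\<Prod>v\<in>V. x v ^ \<gamma> v))
      = (\<Sum>\<gamma>\<in>V \<rightarrow>\<^sub>E {..D}. if \<gamma> = restrict \<beta> V then (\<Prod>v\<in>V. x v ^ restrict \<beta> V v) else 0)"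
    by (intro sum.cong) auto
  also have "\<dots> = (\<Prod>v\<in>V. x v ^ restrict \<beta> V v)"
    using V \<beta> by (subst sum.delta) (auto simp: finite_PiE)
  also have "\<dots> = (\<Prod>v\<in>V. x v ^ \<beta> v)" by (intro prod.cong) auto
  finally show "(\<Prod>v\<in>V. x v ^ \<beta> v) =
      (\<Sum>\<gamma>\<in>V \<rightarrow>\<^sub>E {..D}. (if \<gamma> = restrict \<beta> V then 1 else 0) * (\<Prod>v\<in>V. x v ^ \<gamma> v))" by simp
qed

lemma box_poly_mult:
  assumes V: "finite V" and f: "f \<in> box_poly V D" and g: "g \<in> box_poly V E"
  shows "(\<lambda>x. f x * g x) \<in> box_poly V (D + E)"
proof -
  obtain c where c: "\<forall>x. f x = (\<Sum>\<beta>\<in>V \<rightarrow>\<^sub>E {..D}. c \<beta> * (\<Prod>v\<in>V. x v ^ \<beta> v))"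
    using f unfolding box_poly_def by (elim CollectE exE)
  obtain d where d: "\<forall>x. g x = (\<Sum>\<beta>\<in>V \<rightarrow>\<^sub>E {..E}. d \<beta> * (\<Prod>v\<in>V. x v ^ \<beta> v))"
    using g unfolding box_poly_def by (elim CollectE exE)
  have "f x * g x = (\<Sum>\<beta>\<in>V \<rightarrow>\<^sub>E {..D}. \<Sum>\<gamma>\<in>V \<rightarrow>\<^sub>E {..E}. (c \<beta> * d \<gamma>) * (\<Prod>v\<in>V. x v ^ (\<beta> v + \<gamma> v)))" for x
    unfolding c[rule_format] d[rule_format] sum_product by (simp add: power_add prod.distrib mult_ac)
  moreover have "(\<lambda>x. \<Sum>\<beta>\<in>V \<rightarrow>\<^sub>E {..D}. \<Sum>\<gamma>\<in>V \<rightarrow>\<^sub>E {..E}. (c \<beta> * d \<gamma>) * (\<Prod>v\<in>V. x v ^ (\<beta> v + \<gamma> v)))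
      \<in> box_poly V (D + E)"
    using V by (intro box_poly_sum box_poly_scale box_poly_monomial) (auto intro!: add_mono)
  ultimately show ?thesis by simp
qed

lemma box_poly_mono:
  assumes V: "finite V" and f: "f \<in> box_poly V D" and DE: "D \<le> E"
  shows "f \<in> box_poly V E"
proof -
  have "(\<lambda>_. 1) \<in> box_poly V (E - D)"
    using box_poly_monomial[OF V, of "\<lambda>_. 0" "E - D"] by simp
  from box_poly_mult[OF V f this] show ?thesis using DE by simp
qed

lemma polyfun_box_poly:
  assumes V: "finite V" and f: "f \<in> polyfun V"
  shows "\<exists>D. f \<in> box_poly V D"
  using f
proof induction
  case (const c)
  have "(\<lambda>x. c * 1) \<in> box_poly V 0"
    using box_poly_scale[OF box_poly_monomial[OF V, of "\<lambda>_. 0" 0]] by simp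
  then show ?case by auto
next
  case (var v)
  have "(\<lambda>x. \<Prod>u\<in>V. x u ^ (if u = v then 1 else 0)) \<in> box_poly V 1"
    by (rule box_poly_monomial[OF V]) auto
  moreover have "(\<Prod>u\<in>V. x u ^ (if u = v then 1 else 0)) = x v" for x :: "'a \<Rightarrow> complex"
  proof -
    have "(\<Prod>u\<in>V. x u ^ (if u = v then 1 else 0)) = (\<Prod>u\<in>V. if u = v then x v else 1)"
      by (intro prod.cong) auto
    then show ?thesis using var V by simp
  qed
  ultimately show ?case by auto
next
  case (add f g)
  then obtain D E where "f \<in> box_poly V D" "g \<in> box_poly V E" by blast
  then have "f \<in> box_poly V (D + E)" "g \<in> box_poly V (D + E)"
    by (auto intro: box_poly_mono[OF V])
  then show ?case using box_poly_add by blast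
next
  case (mult f g)
  then show ?case using box_poly_mult[OF V] by blast
qed

lemma box_poly_prod_power:
  assumes V: "finite V" and K: "finite K" and f: "\<And>k. k \<in> K \<Longrightarrow> f k \<in> box_poly V \<delta>"
    and \<alpha>: "\<And>k. k \<in> K \<Longrightarrow> \<alpha> k \<le> D"
  shows "(\<lambda>x. \<Prod>k\<in>K. f k x ^ \<alpha> k) \<in> box_poly V (card K * (D * \<delta>))"
  using K f \<alpha>
proof (induction K)
  case empty
  then show ?case using box_poly_monomial[OF V, of "\<lambda>_. 0" 0] by simp
next
  case (insert k K)
  have pow: "(\<lambda>x. f k x ^ j) \<in> box_poly V (j * \<delta>)" for j
  proof (induction j)
    case 0
    then show ?case using box_poly_monomial[OF V, of "\<lambda>_. 0" 0] by simp
  next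
    case (Suc j)
    then show ?case using box_poly_mult[OF V insert.prems(1) Suc, of k] by simp
  qed
  have "\<alpha> k * \<delta> \<le> D * \<delta>" using insert.prems(2)[of k] by simp
  then have "(\<lambda>x. f k x ^ \<alpha> k) \<in> box_poly V (D * \<delta>)" by (rule box_poly_mono[OF V pow])
  moreover have "(\<lambda>x. \<Prod>k\<in>K. f k x ^ \<alpha> k) \<in> box_poly V (card K * (D * \<delta>))"
    by (rule insert.IH) (use insert.prems in auto)
  ultimately show ?case using box_poly_mult[OF V] insert.hyps by simp
qed

text \<open>Elimination: the equation of \<open>b\<close> is solved for one unknown
  \<open>a0\<close>, which is substituted in the remaining equations.\<close>

lemma underdetermined_system:
  fixes M :: "'a \<Rightarrow> 'b \<Rightarrow> complex"
  assumes "finite B" "finite A" "card B < card A"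
  shows "\<exists>c. (\<exists>a\<in>A. c a \<noteq> 0) \<and> (\<forall>b\<in>B. (\<Sum>a\<in>A. c a * M a b) = 0)"
  using assms
proof (induction B arbitrary: A M)
  case empty
  then have "A \<noteq> {}" by auto
  then show ?case by (intro exI[of _ "\<lambda>_. 1"]) auto
next
  case (insert b B)
  show ?case
  proof (cases "\<forall>a\<in>A. M a b = 0")
    case True
    have "\<exists>c. (\<exists>a\<in>A. c a \<noteq> 0) \<and> (\<forall>b\<in>B. (\<Sum>a\<in>A. c a * M a b) = 0)"
      by (rule insert.IH) (use insert in auto)
    then show ?thesis using True by auto
  next
    case False
    then obtain a0 where a0: "a0 \<in> A" "M a0 b \<noteq> 0" by blast
    define A' where "A' = A - {a0}"
    define M' where "M' a b' = M a b' - M a b / M a0 b * M a0 b'" for a b'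
    have "card A = Suc (card A')" unfolding A'_def using card_Suc_Diff1[OF insert.prems(1) a0(1)] by simp
    then have "\<exists>c. (\<exists>a\<in>A'. c a \<noteq> 0) \<and> (\<forall>b\<in>B. (\<Sum>a\<in>A'. c a * M' a b) = 0)"
      by (intro insert.IH) (use insert in \<open>auto simp: A'_def\<close>)
    then obtain c where c: "\<exists>a\<in>A'. c a \<noteq> 0" "\<And>b. b \<in> B \<Longrightarrow> (\<Sum>a\<in>A'. c a * M' a b) = 0" by auto
    define s where "s = - (\<Sum>a\<in>A'. c a * (M a b / M a0 b))"
    define d where "d = c(a0 := s)"
    have sum_d: "(\<Sum>a\<in>A. d a * f a) = s * f a0 + (\<Sum>a\<in>A'. c a * f a)" for f
    proof -
      have "(\<Sum>a\<in>A. d a * f a) = d a0 * f a0 + (\<Sum>a\<in>A'. d a * f a)"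
        unfolding A'_def by (rule sum.remove) (use insert.prems a0 in auto)
      moreover have "(\<Sum>a\<in>A'. d a * f a) = (\<Sum>a\<in>A'. c a * f a)"
        by (intro sum.cong) (auto simp: d_def A'_def)
      ultimately show ?thesis by (simp add: d_def)
    qed
    have s_f: "s * y = - (\<Sum>a\<in>A'. c a * (M a b / M a0 b * y))" for y
      by (simp add: s_def sum_distrib_right mult.assoc)
    have "(\<Sum>a\<in>A. d a * M a b') = 0" if b': "b' \<in> insert b B" for b'
    proof (cases "b' = b")
      case True
      then show ?thesis using a0(2) unfolding sum_d s_f by simp
    next
      case False
      then have "(\<Sum>a\<in>A'. c a * M' a b') = 0" using c(2) b' by blast
      then show ?thesis
        unfolding sum_d s_f M'_def by (simp add: right_diff_distrib sum_subtractf)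
    qed
    moreover have "\<exists>a\<in>A. d a \<noteq> 0" using c(1) by (auto simp: d_def A'_def)
    ultimately show ?thesis by blast
  qed
qed

text \<open>The monomials of degree at most \<open>D\<close> in each \<open>F k\<close> number
  \<open>(D + 1) ^ card K\<close>, and they lie in a space of polynomials in \<open>V\<close> whose
  dimension grows only like \<open>D ^ card V\<close>. For large \<open>D\<close> this forces a
  linear relation.\<close>

lemma algebraic_dependence:
  assumes V: "finite V" and K: "finite K" "card V < card K" and F: "\<And>k. k \<in> K \<Longrightarrow> F k \<in> polyfun V"
  obtains D c where "\<exists>\<alpha>\<in>K \<rightarrow>\<^sub>E {..D}. c \<alpha> \<noteq> 0"
    "\<And>x. (\<Sum>\<alpha>\<in>K \<rightarrow>\<^sub>E {..D::nat}. c \<alpha> * (\<Prod>k\<in>K. F k x ^ \<alpha> k)) = (0::complex)"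
proof -
  have "\<forall>k\<in>K. \<exists>D. F k \<in> box_poly V D" using polyfun_box_poly[OF V F] by blast
  then obtain E where E: "\<forall>k\<in>K. F k \<in> box_poly V (E k)" by (rule bchoice[THEN exE])
  define \<delta> where "\<delta> = (\<Sum>k\<in>K. E k)"
  have F\<delta>: "F k \<in> box_poly V \<delta>" if "k \<in> K" for k
  proof (rule box_poly_mono[OF V E[rule_format, OF that]])
    show "E k \<le> \<delta>" unfolding \<delta>_def by (rule member_le_sum) (use K that in auto)
  qed
  \<comment> \<open>Chosen so that \<open>B + 1 \<le> t * (D + 1)\<close>. With
    \<open>D = t ^ card V\<close> the target space then has dimension at most
    \<open>D * (D + 1) ^ card V\<close>, which is below
    \<open>(D + 1) ^ Suc (card V)\<close>.\<close>
  define t where "t = card K * \<delta> + 1"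
  define D where "D = t ^ card V"
  define B where "B = card K * (D * \<delta>)"
  have "B + 1 \<le> t * (D + 1)" unfolding B_def t_def by (simp add: algebra_simps)
  then have "(B + 1) ^ card V \<le> (t * (D + 1)) ^ card V" by (rule power_mono) simp
  also have "\<dots> = D * (D + 1) ^ card V" by (simp only: power_mult_distrib D_def)
  also have "\<dots> < (D + 1) ^ Suc (card V)" by simp
  also have "\<dots> \<le> (D + 1) ^ card K" by (rule power_increasing) (use K in auto)
  finally have card: "card (V \<rightarrow>\<^sub>E {..B}) < card (K \<rightarrow>\<^sub>E {..D})"
    using V K by (simp add: card_funcsetE)
  have "\<forall>\<alpha>\<in>K \<rightarrow>\<^sub>E {..D}. \<exists>M. \<forall>x. (\<Prod>k\<in>K. F k x ^ \<alpha> k) = (\<Sum>\<beta>\<in>V \<rightarrow>\<^sub>E {..B}. M \<beta> * (\<Prod>v\<in>V. x v ^ \<beta> v))"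
  proof
    fix \<alpha> assume "\<alpha> \<in> K \<rightarrow>\<^sub>E {..D}"
    then have "(\<lambda>x. \<Prod>k\<in>K. F k x ^ \<alpha> k) \<in> box_poly V B"
      unfolding B_def by (intro box_poly_prod_power V K F\<delta>) auto
    then show "\<exists>M. \<forall>x. (\<Prod>k\<in>K. F k x ^ \<alpha> k) = (\<Sum>\<beta>\<in>V \<rightarrow>\<^sub>E {..B}. M \<beta> * (\<Prod>v\<in>V. x v ^ \<beta> v))"
      unfolding box_poly_def by (rule CollectD)
  qed
  then obtain M where M: "\<forall>\<alpha>\<in>K \<rightarrow>\<^sub>E {..D}. \<forall>x. (\<Prod>k\<in>K. F k x ^ \<alpha> k) =
      (\<Sum>\<beta>\<in>V \<rightarrow>\<^sub>E {..B}. M \<alpha> \<beta> * (\<Prod>v\<in>V. x v ^ \<beta> v))" by (rule bchoice[THEN exE])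
  have finV: "finite (V \<rightarrow>\<^sub>E {..B})" using V by (simp add: finite_PiE)
  have finK: "finite (K \<rightarrow>\<^sub>E {..D})" using K by (simp add: finite_PiE)
  obtain c where c: "\<exists>\<alpha>\<in>K \<rightarrow>\<^sub>E {..D}. c \<alpha> \<noteq> 0"
    "\<forall>\<beta>\<in>V \<rightarrow>\<^sub>E {..B}. (\<Sum>\<alpha>\<in>K \<rightarrow>\<^sub>E {..D}. c \<alpha> * M \<alpha> \<beta>) = 0"
    using underdetermined_system[OF finV finK card, of M] by (elim exE conjE)
  have "(\<Sum>\<alpha>\<in>K \<rightarrow>\<^sub>E {..D}. c \<alpha> * (\<Prod>k\<in>K. F k x ^ \<alpha> k)) = 0" for x
  proof -
    have "(\<Sum>\<alpha>\<in>K \<rightarrow>\<^sub>E {..D}. c \<alpha> * (\<Prod>k\<in>K. F k x ^ \<alpha> k))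
        = (\<Sum>\<alpha>\<in>K \<rightarrow>\<^sub>E {..D}. \<Sum>\<beta>\<in>V \<rightarrow>\<^sub>E {..B}. c \<alpha> * M \<alpha> \<beta> * (\<Prod>v\<in>V. x v ^ \<beta> v))"
      using M by (intro sum.cong) (simp_all add: sum_distrib_left mult.assoc)
    also have "\<dots> = (\<Sum>\<beta>\<in>V \<rightarrow>\<^sub>E {..B}. \<Sum>\<alpha>\<in>K \<rightarrow>\<^sub>E {..D}. c \<alpha> * M \<alpha> \<beta> * (\<Prod>v\<in>V. x v ^ \<beta> v))"
      by (rule sum.swap)
    also have "\<dots> = 0" using c(2) by (simp add: sum_distrib_right[symmetric])
    finally show ?thesis .
  qed
  then show ?thesis using that c(1) by blast
qed

text \<open>The monomials are indexed by an arbitrary set so that the induction on \<open>V\<close> goes through.\<close>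

lemma monomials_independent:
  fixes c :: "'s \<Rightarrow> complex" and b :: "'s \<Rightarrow> 'v \<Rightarrow> nat"
  assumes "finite V" "finite S"
    and "\<And>s s'. s \<in> S \<Longrightarrow> s' \<in> S \<Longrightarrow> (\<And>v. v \<in> V \<Longrightarrow> b s v = b s' v) \<Longrightarrow> s = s'"
    and "\<And>x. (\<Sum>s\<in>S. c s * (\<Prod>v\<in>V. x v ^ b s v)) = 0"
    and "s \<in> S"
  shows "c s = 0"
  using assms
proof (induction V arbitrary: S s rule: finite_induct)
  case empty
  have "s' = s" if "s' \<in> S" for s'
    by (rule empty.prems(2)[OF that empty.prems(4)]) simp
  then have "S = {s}" using empty.prems(4) by blast
  then show ?case using empty.prems(3) by simp
next
  case (insert v V)
  define J where "J = Max ((\<lambda>s. b s v) ` S)"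
  have J: "b s v \<le> J" if "s \<in> S" for s
    unfolding J_def by (rule Max_ge) (use insert.prems that in auto)
  \<comment> \<open>Collecting the monomials by the exponent of \<open>v\<close> gives a polynomial
    in one variable that vanishes identically; its coefficients are sums of the same kind in the
    variables \<open>V\<close>.\<close>
  define coef where "coef x j = (\<Sum>s\<in>{s \<in> S. b s v = j}. c s * (\<Prod>u\<in>V. x u ^ b s u))" for x j
  have "coef x j = 0" if j: "j \<le> J" for x j
  proof -
    have "(\<Sum>i\<le>J. coef x i * z ^ i) = 0" for z
    proof -
      have "(\<Sum>i\<le>J. coef x i * z ^ i) = (\<Sum>i\<le>J. \<Sum>s\<in>{s \<in> S. b s v = i}. c s * (\<Prod>u\<in>insert v V. (x(v := z)) u ^ b s u))"
      proof (intro sum.cong refl)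
        fix i
        show "coef x i * z ^ i = (\<Sum>s\<in>{s \<in> S. b s v = i}. c s * (\<Prod>u\<in>insert v V. (x(v := z)) u ^ b s u))"
          unfolding coef_def sum_distrib_right
        proof (intro sum.cong refl)
          fix s assume s: "s \<in> {s \<in> S. b s v = i}"
          have "(\<Prod>u\<in>V. (x(v := z)) u ^ b s u) = (\<Prod>u\<in>V. x u ^ b s u)"
            by (intro prod.cong) (use insert.hyps in auto)
          then show "c s * (\<Prod>u\<in>V. x u ^ b s u) * z ^ i = c s * (\<Prod>u\<in>insert v V. (x(v := z)) u ^ b s u)"
            using s insert.hyps by simp
        qed
      qed
      also have "\<dots> = (\<Sum>s\<in>S. c s * (\<Prod>u\<in>insert v V. (x(v := z)) u ^ b s u))"
        by (rule sum.group) (use insert.prems J in auto)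
      also have "\<dots> = 0" by (rule insert.prems(3))
      finally show ?thesis .
    qed
    then show ?thesis using polyfun_eq_0[of "coef x" J] j by blast
  qed
  then have zero: "(\<Sum>s'\<in>{s' \<in> S. b s' v = b s v}. c s' * (\<Prod>u\<in>V. x u ^ b s' u)) = 0" for x
    using J[OF insert.prems(4)] unfolding coef_def by blast
  show ?case
  proof (rule insert.IH[of "{s' \<in> S. b s' v = b s v}"])
    show "finite {s' \<in> S. b s' v = b s v}" using insert.prems by simp
    show "s \<in> {s' \<in> S. b s' v = b s v}" using insert.prems by simp
    show "(\<Sum>s'\<in>{s' \<in> S. b s' v = b s v}. c s' * (\<Prod>u\<in>V. x u ^ b s' u)) = 0" for x by (rule zero)
    fix s1 s2 assume s: "s1 \<in> {s' \<in> S. b s' v = b s v}" "s2 \<in> {s' \<in> S. b s' v = b s v}"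
      and eq: "\<And>u. u \<in> V \<Longrightarrow> b s1 u = b s2 u"
    show "s1 = s2"
    proof (rule insert.prems(2))
      show "s1 \<in> S" "s2 \<in> S" using s by simp_all
      fix u assume "u \<in> insert v V"
      then show "b s1 u = b s2 u" using s eq[of u] by (cases "u = v") auto
    qed
  qed
qed

section \<open>Pluecker coordinates of lattices\<close>

text \<open>The coordinates of \<open>C((t))\<^sup>m\<close> with exponents in \<open>[-n, n)\<close> are numbered by \<open>p < 2mn\<close>:
  the number \<open>p\<close> stands for the coefficient of \<open>t\<^sup>e\<close>, \<open>e = expo n p\<close>, in row \<open>p div (2n)\<close>.\<close>

definition expo :: "nat \<Rightarrow> nat \<Rightarrow> int" where
  "expo n p = int (p mod (2 * n)) - int n"

text \<open>The positions of the monomials that belong to the lattice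
  \<open>t^\<nu> C[[t]]^m\<close>. If all \<open>\<nu> a\<close> lie between \<open>-n\<close> and
  \<open>n\<close>, their number is the dimension of this lattice modulo
  \<open>t^n C[[t]]^m\<close>.\<close>

definition lat_set :: "nat \<Rightarrow> nat \<Rightarrow> (nat \<Rightarrow> int) \<Rightarrow> nat set" where
  "lat_set m n \<nu> = {p. p < m * (2 * n) \<and> \<nu> (p div (2 * n)) \<le> expo n p}"

text \<open>Lists the positions of the standard lattice first, as the first columns of
  \<open>delta_mat\<close> are those holding lattice vectors.\<close>

definition lat_perm :: "nat \<Rightarrow> nat \<Rightarrow> (nat \<Rightarrow> int) \<Rightarrow> nat \<Rightarrow> nat" where
  "lat_perm m n \<nu> = (SOME \<pi>. \<pi> permutes {..<m * (2 * n)} \<and> \<pi> ` {..<card (lat_set m n \<nu>)} = lat_set m n \<nu>)"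

text \<open>For \<open>g\<close> upper triangular with diagonal \<open>t^\<nu>\<close>, the vector
  \<open>g * H q\<close> has as its bottom nonzero entry exactly the monomial at position
  \<open>lat_perm m n \<nu> q\<close>.\<close>

definition std_frame :: "nat \<Rightarrow> nat \<Rightarrow> (nat \<Rightarrow> int) \<Rightarrow> nat \<Rightarrow> nat \<Rightarrow> complex fls" where
  "std_frame m n \<nu> q b =
     (if b = lat_perm m n \<nu> q div (2 * n) then tp (expo n (lat_perm m n \<nu> q) - \<nu> b) else 0)"

text \<open>With \<open>f\<close> the identity, the columns after the lattice vectors become the
  unit vectors at the positions outside the standard lattice; changing \<open>f\<close> at one
  position exchanges one of them.\<close>

definition std_compl :: "nat \<Rightarrow> nat \<Rightarrow> (nat \<Rightarrow> int) \<Rightarrow> (nat \<Rightarrow> nat) \<Rightarrow> nat \<Rightarrow> nat \<Rightarrow> complex" where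
  "std_compl m n \<nu> f q p = (if p = f (lat_perm m n \<nu> q) then 1 else 0)"

text \<open>The columns are \<open>r\<close> vectors of the lattice spanned by \<open>g\<close>, followed by fixed vectors \<open>T\<close>.
  For a lattice containing \<open>t\<^sup>n C[[t]]\<^sup>m\<close> with codimension \<open>r\<close> the determinants for different \<open>T\<close>
  are its Pluecker coordinates, up to a common factor depending on the frame \<open>H\<close>.\<close>

definition delta_mat :: "nat \<Rightarrow> nat \<Rightarrow> nat \<Rightarrow> (nat \<Rightarrow> nat \<Rightarrow> complex) \<Rightarrow> complex fls mat \<Rightarrow>
    (nat \<Rightarrow> nat \<Rightarrow> complex fls) \<Rightarrow> complex mat" where
  "delta_mat m n r T g H = mat (m * (2 * n)) (m * (2 * n)) (\<lambda>(p, q).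
     if q < r then fls_nth (\<Sum>b<m. g $$ (p div (2 * n), b) * H q b) (expo n p) else T q p)"

text \<open>This is \<open>delta_mat\<close> for the standard frame with the columns put back at
  their positions, so that triangularity of \<open>A\<close> becomes triangularity of a complex
  matrix.\<close>

definition lat_mat :: "nat \<Rightarrow> nat \<Rightarrow> (nat \<Rightarrow> int) \<Rightarrow> (nat \<Rightarrow> nat) \<Rightarrow> complex fls mat \<Rightarrow> complex mat" where
  "lat_mat m n \<nu> f A = mat (m * (2 * n)) (m * (2 * n)) (\<lambda>(p, q).
     if q \<in> lat_set m n \<nu>
     then fls_nth (A $$ (p div (2 * n), q div (2 * n))) (expo n p - expo n q + \<nu> (q div (2 * n)))
     else if p = f q then 1 else 0)"

lemma lat_set_subset: "lat_set m n \<nu> \<subseteq> {..<m * (2 * n)}"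
  by (auto simp: lat_set_def)

lemma finite_lat_set [simp]: "finite (lat_set m n \<nu>)"
  by (rule finite_subset[OF lat_set_subset]) simp

lemma div_less: "p < m * (2 * n) \<Longrightarrow> p div (2 * n) < (m::nat)"
  by (rule less_mult_imp_div_less)

lemma permutation_onto_subset:
  assumes "S \<subseteq> {..<M::nat}"
  shows "\<exists>\<pi>. \<pi> permutes {..<M} \<and> \<pi> ` {..<card S} = S"
proof -
  have fS: "finite S" by (rule finite_subset[OF assms]) simp
  have cS: "card S \<le> M" using card_mono[OF _ assms] by simp
  obtain f where f: "bij_betw f {..<card S} S"
    using finite_same_card_bij[of "{..<card S}" S] fS by auto
  have "card {card S..<M} = card ({..<M} - S)" using fS assms by (simp add: card_Diff_subset)
  then obtain g where g: "bij_betw g {card S..<M} ({..<M} - S)"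
    using finite_same_card_bij[of "{card S..<M}" "{..<M} - S"] by auto
  define \<pi> where "\<pi> q = (if q < card S then f q else if q < M then g q else q)" for q
  have 1: "bij_betw \<pi> {..<card S} S"
    using f by (rule bij_betw_cong[THEN iffD1, rotated]) (simp add: \<pi>_def)
  have 2: "bij_betw \<pi> {card S..<M} ({..<M} - S)"
    using g by (rule bij_betw_cong[THEN iffD1, rotated]) (simp add: \<pi>_def)
  have "bij_betw \<pi> ({..<card S} \<union> {card S..<M}) (S \<union> ({..<M} - S))"
    by (rule bij_betw_combine[OF 1 2]) blast
  moreover have "{..<card S} \<union> {card S..<M} = {..<M}" "S \<union> ({..<M} - S) = {..<M}" using cS assms by auto
  ultimately have "bij_betw \<pi> {..<M} {..<M}" by simp
  then have "\<pi> permutes {..<M}"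
    by (rule bij_imp_permutes) (use cS in \<open>simp add: \<pi>_def\<close>)
  then show ?thesis using bij_betw_imp_surj_on[OF 1] by (intro exI conjI)
qed

lemma lat_perm:
  "lat_perm m n \<nu> permutes {..<m * (2 * n)}"
  "lat_perm m n \<nu> ` {..<card (lat_set m n \<nu>)} = lat_set m n \<nu>"
  using someI_ex[OF permutation_onto_subset[OF lat_set_subset[of m n \<nu>]]] unfolding lat_perm_def by blast+

lemma lat_perm_inj: "lat_perm m n \<nu> p = lat_perm m n \<nu> q \<longleftrightarrow> p = q"
  using permutes_inj[OF lat_perm(1)] by (meson injD)

lemma lat_perm_mem: "lat_perm m n \<nu> q \<in> lat_set m n \<nu> \<longleftrightarrow> q < card (lat_set m n \<nu>)"
proof
  assume "lat_perm m n \<nu> q \<in> lat_set m n \<nu>"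
  then obtain q' where "q' < card (lat_set m n \<nu>)" "lat_perm m n \<nu> q = lat_perm m n \<nu> q'"
    using lat_perm(2)[of m n \<nu>] by (metis imageE lessThan_iff)
  then show "q < card (lat_set m n \<nu>)" by (simp add: lat_perm_inj)
next
  assume "q < card (lat_set m n \<nu>)"
  then show "lat_perm m n \<nu> q \<in> lat_set m n \<nu>" using lat_perm(2)[of m n \<nu>] by blast
qed

lemma lat_perm_less: "q < m * (2 * n) \<Longrightarrow> lat_perm m n \<nu> q < m * (2 * n)"
  by (rule permutes_lessThan[OF lat_perm(1)])

lemma delta_mat_carrier [simp]: "delta_mat m n r T g H \<in> carrier_mat (m * (2 * n)) (m * (2 * n))"
  by (simp add: delta_mat_def)

lemma lat_mat_carrier [simp]: "lat_mat m n \<nu> f A \<in> carrier_mat (m * (2 * n)) (m * (2 * n))"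
  by (simp add: lat_mat_def)

lemma std_frame_val_ge: "q < card (lat_set m n \<nu>) \<Longrightarrow> val_ge 0 (std_frame m n \<nu> q b)"
  using lat_perm_mem[of m n \<nu> q] by (auto simp: std_frame_def lat_set_def val_ge_tp)

lemma std_frame_apply:
  assumes "q < m * (2 * n)"
  shows "fls_nth (\<Sum>b<m. A $$ (a, b) * std_frame m n \<nu> q b) e =
    fls_nth (A $$ (a, lat_perm m n \<nu> q div (2 * n)))
      (e - expo n (lat_perm m n \<nu> q) + \<nu> (lat_perm m n \<nu> q div (2 * n)))"
proof -
  let ?b = "lat_perm m n \<nu> q div (2 * n)"
  have b: "?b < m" by (rule div_less[OF lat_perm_less[OF assms]])
  have "(\<Sum>b<m. A $$ (a, b) * std_frame m n \<nu> q b) =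
      (\<Sum>b<m. if b = ?b then A $$ (a, ?b) * tp (expo n (lat_perm m n \<nu> q) - \<nu> ?b) else 0)"
    by (intro sum.cong) (auto simp: std_frame_def)
  also have "\<dots> = A $$ (a, ?b) * tp (expo n (lat_perm m n \<nu> q) - \<nu> ?b)" using b by simp
  finally show ?thesis by (simp add: algebra_simps)
qed

text \<open>Separates the bookkeeping from the lattice: the reordering of columns contributes only a
  nonzero constant to the determinant.\<close>

lemma delta_mat_std:
  "delta_mat m n (card (lat_set m n \<nu>)) (std_compl m n \<nu> f) A (std_frame m n \<nu>) =
    lat_mat m n \<nu> f A * perm_mat (m * (2 * n)) (lat_perm m n \<nu>)"
proof (rule eq_matI)
  fix p q assume "p < dim_row (lat_mat m n \<nu> f A * perm_mat (m * (2 * n)) (lat_perm m n \<nu>))"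
    "q < dim_col (lat_mat m n \<nu> f A * perm_mat (m * (2 * n)) (lat_perm m n \<nu>))"
  then have pq: "p < m * (2 * n)" "q < m * (2 * n)" by (auto simp: lat_mat_def)
  have "(lat_mat m n \<nu> f A * perm_mat (m * (2 * n)) (lat_perm m n \<nu>)) $$ (p, q) =
      lat_mat m n \<nu> f A $$ (p, lat_perm m n \<nu> q)"
    by (rule mult_perm_mat_index[OF lat_mat_carrier lat_perm(1) pq])
  then show "delta_mat m n (card (lat_set m n \<nu>)) (std_compl m n \<nu> f) A (std_frame m n \<nu>) $$ (p, q) =
      (lat_mat m n \<nu> f A * perm_mat (m * (2 * n)) (lat_perm m n \<nu>)) $$ (p, q)"
    using pq lat_perm_less[OF pq(2)] std_frame_apply[OF pq(2)]
    by (simp add: delta_mat_def lat_mat_def lat_perm_mem std_compl_def)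
qed (auto simp: delta_mat_def lat_mat_def)

lemma mat_apply_assoc:
  fixes A B :: "'a :: comm_ring_1 mat"
  assumes "A \<in> carrier_mat k k" "B \<in> carrier_mat k k" "a < k"
  shows "(\<Sum>j<k. A $$ (a, j) * (\<Sum>b<k. B $$ (j, b) * x b)) = (\<Sum>b<k. (A * B) $$ (a, b) * x b)"
proof -
  have "(\<Sum>b<k. (A * B) $$ (a, b) * x b) = (\<Sum>b<k. \<Sum>j<k. A $$ (a, j) * B $$ (j, b) * x b)"
    using assms by (intro sum.cong) (auto simp: mult_mat_index[of A k k B k] sum_distrib_right simp del: index_mult_mat(1))
  also have "\<dots> = (\<Sum>j<k. \<Sum>b<k. A $$ (a, j) * B $$ (j, b) * x b)" by (rule sum.swap)
  finally show ?thesis by (simp add: sum_distrib_left mult.assoc)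
qed

lemma mat_apply_one:
  fixes x :: "nat \<Rightarrow> 'a :: comm_ring_1"
  assumes "a < k"
  shows "(\<Sum>b<k. 1\<^sub>m k $$ (a, b) * x b) = x a"
proof -
  have "(\<Sum>b<k. 1\<^sub>m k $$ (a, b) * x b) = (\<Sum>b<k. if b = a then x a else 0)"
    using assms by (intro sum.cong) auto
  then show ?thesis using assms by simp
qed

lemma linear_system_solvable:
  fixes N :: "complex mat"
  assumes "N \<in> carrier_mat k k" "Y \<in> carrier_mat k k" "N * Y = 1\<^sub>m k"
  shows "\<exists>z. \<forall>p<k. (\<Sum>q<k. N $$ (p, q) * z q) = v p"
proof (intro exI[of _ "\<lambda>q. \<Sum>p<k. Y $$ (q, p) * v p"] allI impI)
  fix p assume p: "p < k"
  show "(\<Sum>q<k. N $$ (p, q) * (\<Sum>p<k. Y $$ (q, p) * v p)) = v p"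
    unfolding mat_apply_assoc[OF assms(1,2) p] assms(3) by (rule mat_apply_one[OF p])
qed

lemma unimodular_inverse:
  fixes N :: "complex mat"
  assumes "N \<in> carrier_mat k k" "det N = 1"
  obtains Y where "Y \<in> carrier_mat k k" "N * Y = 1\<^sub>m k" "Y * N = 1\<^sub>m k"
proof
  show "adj_mat N \<in> carrier_mat k k" "N * adj_mat N = 1\<^sub>m k" "adj_mat N * N = 1\<^sub>m k"
    using adj_mat[OF assms(1)] assms(2) by (auto intro!: eq_matI)
qed

text \<open>The bounds on \<open>A\<close> and \<open>Ai\<close> place the lattice spanned by
  \<open>A\<close> between \<open>t^n C[[t]]^m\<close> and \<open>t^-n C[[t]]^m\<close>, so that it
  is determined by its image in the window of coordinates.\<close>

locale triangular_lattice =
  fixes m n :: nat and A Ai :: "complex fls mat" and \<nu> :: "nat \<Rightarrow> int"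
  assumes n: "n > 0"
    and A: "mat_val_ge m (- int n) A" and Ai: "mat_val_ge m (- int n) Ai" and inv: "A * Ai = 1\<^sub>m m"
    and upper: "\<And>a b. b < a \<Longrightarrow> a < m \<Longrightarrow> A $$ (a, b) = 0"
    and diag: "\<And>a. a < m \<Longrightarrow> A $$ (a, a) = tp (\<nu> a)"
    and bound: "\<And>a. a < m \<Longrightarrow> \<bar>\<nu> a\<bar> \<le> int n"
begin

abbreviation "M \<equiv> m * (2 * n)"
abbreviation "LS \<equiv> lat_set m n \<nu>"

lemma Ac: "A \<in> carrier_mat m m" "Ai \<in> carrier_mat m m"
  using A Ai by (simp_all add: mat_val_ge_def)

lemma expo_inj: "expo n p = expo n q \<Longrightarrow> p div (2 * n) = q div (2 * n) \<Longrightarrow> p = q"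
  by (metis add_diff_cancel_right' diff_add_cancel div_mult_mod_eq expo_def of_nat_eq_iff)

text \<open>Positions are numbered row after row, so an upper triangular \<open>A\<close> yields an
  upper triangular matrix. Within one row the diagonal entry of \<open>A\<close> is exactly a
  monomial and yields an identity block.\<close>

lemma det_lat_mat: "det (lat_mat m n \<nu> (\<lambda>q. q) A) = 1"
proof -
  let ?N = "lat_mat m n \<nu> (\<lambda>q. q) A"
  have entry: "?N $$ (p, q) = (if p = q then 1 else 0)" if pq: "q \<le> p" "p < M" for p q
  proof (cases "q \<in> LS")
    case True
    have qM: "q < M" using pq by simp
    have le: "q div (2 * n) \<le> p div (2 * n)" by (rule div_le_mono[OF pq(1)])
    have pm: "p div (2 * n) < m" by (rule div_less[OF pq(2)])
    show ?thesis
    proof (cases "q div (2 * n) = p div (2 * n)")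
      case eq: True
      have "?N $$ (p, q) = fls_nth (tp (\<nu> (p div (2 * n)))) (expo n p - expo n q + \<nu> (p div (2 * n)))"
        using True pq qM eq diag[OF pm] by (simp add: lat_mat_def)
      then show ?thesis using expo_inj[of p q] eq by (auto simp: fls_nth_tp)
    next
      case False
      then have "A $$ (p div (2 * n), q div (2 * n)) = 0" using le pm by (intro upper) auto
      then show ?thesis using True pq qM False by (auto simp: lat_mat_def)
    qed
  qed (use pq in \<open>auto simp: lat_mat_def\<close>)
  have "upper_triangular ?N" using entry by (auto simp: upper_triangular_def lat_mat_def)
  then have "det ?N = prod_list (diag_mat ?N)" by (rule det_upper_triangular[OF _ lat_mat_carrier])
  also have "diag_mat ?N = map (\<lambda>_. 1) [0..<M]"
    using entry by (simp add: diag_mat_def) (simp add: lat_mat_def)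
  also have "prod_list \<dots> = 1" by (simp add: map_replicate_const)
  finally show ?thesis .
qed

text \<open>The columns of \<open>lat_mat\<close> are a basis of the window; what needs proof is
  that the unit vectors outside \<open>LS\<close> do not contribute. After a correction in
  \<open>t^n C[[t]]^m\<close>, the leftover is a lattice vector with exponents below
  \<open>\<nu> a\<close> in each row \<open>a\<close>, and by triangularity such a vector is
  zero.\<close>

lemma lattice_spanned:
  assumes h: "\<And>b. b < m \<Longrightarrow> val_ge 0 (h b)"
  shows "\<exists>z. \<forall>p<M. fls_nth (\<Sum>b<m. A $$ (p div (2 * n), b) * h b) (expo n p) =
    (\<Sum>q\<in>LS. z q * fls_nth (A $$ (p div (2 * n), q div (2 * n))) (expo n p - expo n q + \<nu> (q div (2 * n))))"
proof -
  let ?N = "lat_mat m n \<nu> (\<lambda>q. q) A"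
  define v where "v p = fls_nth (\<Sum>b<m. A $$ (p div (2 * n), b) * h b) (expo n p)" for p
  define c where "c p q = fls_nth (A $$ (p div (2 * n), q div (2 * n))) (expo n p - expo n q + \<nu> (q div (2 * n)))" for p q
  obtain Y where Y: "Y \<in> carrier_mat M M" "?N * Y = 1\<^sub>m M" "Y * ?N = 1\<^sub>m M"
    by (rule unimodular_inverse[OF lat_mat_carrier det_lat_mat])
  obtain z where z: "\<forall>p<M. (\<Sum>q<M. ?N $$ (p, q) * z q) = v p"
    using linear_system_solvable[OF lat_mat_carrier Y(1,2), of v] by (rule exE)
  have vz: "v p = (\<Sum>q\<in>LS. z q * c p q) + (if p \<in> LS then 0 else z p)" if p: "p < M" for p
  proof -
    have "v p = (\<Sum>q<M. ?N $$ (p, q) * z q)" using z p by simp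
    also have "\<dots> = (\<Sum>q\<in>LS. ?N $$ (p, q) * z q) + (\<Sum>q\<in>{..<M} - LS. ?N $$ (p, q) * z q)"
      by (subst sum.subset_diff[OF lat_set_subset]) (simp_all add: add.commute)
    also have "(\<Sum>q\<in>LS. ?N $$ (p, q) * z q) = (\<Sum>q\<in>LS. z q * c p q)"
      using p lat_set_subset[of m n \<nu>] by (intro sum.cong) (auto simp: lat_mat_def c_def)
    also have "(\<Sum>q\<in>{..<M} - LS. ?N $$ (p, q) * z q) = (\<Sum>q\<in>{..<M} - LS. if q = p then z p else 0)"
      using p by (intro sum.cong) (auto simp: lat_mat_def)
    also have "\<dots> = (if p \<in> LS then 0 else z p)" using p by simp
    finally show ?thesis .
  qed
  \<comment> \<open>Removes the standard lattice vectors with the coefficients just found. In the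
    window, \<open>A\<close> applied to the rest has only the coefficients \<open>z p\<close> at
    positions outside \<open>LS\<close>.\<close>
  define h' where "h' b = h b - (\<Sum>q\<in>LS. if q div (2 * n) = b then fls_const (z q) * tp (expo n q - \<nu> b) else 0)" for b
  have h': "val_ge 0 (h' b)" if "b < m" for b
  proof -
    have "val_ge 0 (if q div (2 * n) = b then fls_const (z q) * tp (expo n q - \<nu> b) else 0)" if "q \<in> LS" for q
      using that by (auto simp: lat_set_def val_ge_tp intro!: val_ge_mult0)
    then show ?thesis unfolding h'_def by (intro val_ge_diff val_ge_sum h that)
  qed
  define y where "y a = (\<Sum>b<m. A $$ (a, b) * h' b)" for a
  have yv: "val_ge (- int n) (y a)" if "a < m" for a
    unfolding y_def using A h' that val_ge_mult[of "- int n" _ 0]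
    by (intro val_ge_sum) (simp add: mat_val_ge_def)
  have y_nth: "fls_nth (y a) e = fls_nth (\<Sum>b<m. A $$ (a, b) * h b) e -
      (\<Sum>q\<in>LS. z q * fls_nth (A $$ (a, q div (2 * n))) (e - expo n q + \<nu> (q div (2 * n))))" if a: "a < m" for a e
  proof -
    have "y a = (\<Sum>b<m. A $$ (a, b) * h b) - (\<Sum>b<m. \<Sum>q\<in>LS. if q div (2 * n) = b
        then fls_const (z q) * (A $$ (a, b) * tp (expo n q - \<nu> b)) else 0)"
      unfolding y_def h'_def
      by (simp add: right_diff_distrib sum_subtractf sum_distrib_left if_distrib[of "(*) _"] mult_ac cong: if_cong)
    also have "(\<Sum>b<m. \<Sum>q\<in>LS. if q div (2 * n) = b
        then fls_const (z q) * (A $$ (a, b) * tp (expo n q - \<nu> b)) else 0) =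
      (\<Sum>q\<in>LS. \<Sum>b<m. if q div (2 * n) = b
        then fls_const (z q) * (A $$ (a, b) * tp (expo n q - \<nu> b)) else 0)" by (rule sum.swap)
    also have "\<dots> = (\<Sum>q\<in>LS. fls_const (z q) * (A $$ (a, q div (2 * n)) * tp (expo n q - \<nu> (q div (2 * n)))))"
    proof (intro sum.cong refl)
      fix q assume "q \<in> LS"
      then have "q div (2 * n) < m" using lat_set_subset[of m n \<nu>] div_less by blast
      then show "(\<Sum>b<m. if q div (2 * n) = b then fls_const (z q) * (A $$ (a, b) * tp (expo n q - \<nu> b)) else 0)
          = fls_const (z q) * (A $$ (a, q div (2 * n)) * tp (expo n q - \<nu> (q div (2 * n))))" by simp
    qed
    finally have "fls_nth (y a) e = fls_nth (\<Sum>b<m. A $$ (a, b) * h b) e -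
        (\<Sum>q\<in>LS. fls_nth (fls_const (z q) * (A $$ (a, q div (2 * n)) * tp (expo n q - \<nu> (q div (2 * n))))) e)"
      by (simp only: fls_minus_nth fls_nth_sum[where A = LS])
    moreover have "e - (x - y) = e - x + y" for x y :: int by simp
    ultimately show ?thesis by simp
  qed
  have y_coef: "fls_nth (y (p div (2 * n))) (expo n p) = (if p \<in> LS then 0 else z p)" if p: "p < M" for p
    using y_nth[OF div_less[OF p], of "expo n p"] vz[OF p] unfolding v_def c_def by simp
  have y_hi: "fls_nth (y a) e = 0" if a: "a < m" and e: "\<nu> a \<le> e" "e < int n" for a e
  proof -
    define p where "p = a * (2 * n) + nat (e + int n)"
    have en: "0 \<le> e + int n" "nat (e + int n) < 2 * n" using bound[OF a] e by auto
    have p1: "p div (2 * n) = a" "expo n p = e" using en n by (auto simp: p_def expo_def)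
    have "p < (a + 1) * (2 * n)" using en by (simp add: p_def)
    also have "\<dots> \<le> M" by (rule mult_right_mono) (use a in auto)
    finally have pM: "p < M" .
    then have "p \<in> LS" using p1 e by (simp add: lat_set_def)
    then show ?thesis using y_coef[OF pM] p1 by simp
  qed
  \<comment> \<open>This is \<open>y\<close> cut off at \<open>\<nu> a\<close>. Between
    \<open>\<nu> a\<close> and \<open>n\<close> there is nothing by \<open>y_hi\<close>, and the
    tail from \<open>t^n\<close> on belongs to the lattice, as \<open>Ai\<close> has poles of order
    at most \<open>n\<close>.\<close>
  define y' where "y' a = (\<Sum>e\<in>{- int n..<\<nu> a}. fls_const (fls_nth (y a) e) * tp e)" for a
  have y'_nth: "fls_nth (y' a) k = (if - int n \<le> k \<and> k < \<nu> a then fls_nth (y a) k else 0)" for a k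
  proof -
    have "fls_nth (y' a) k = (\<Sum>e\<in>{- int n..<\<nu> a}. if e = k then fls_nth (y a) k else 0)"
      unfolding y'_def fls_nth_sum by (intro sum.cong) auto
    then show ?thesis by simp
  qed
  have tail: "val_ge (int n) (y a - y' a)" if a: "a < m" for a
    unfolding val_ge_def
  proof (intro allI impI)
    fix k assume k: "k < int n"
    consider "k < - int n" | "- int n \<le> k" "k < \<nu> a" | "\<nu> a \<le> k" "- int n \<le> k" by linarith
    then show "fls_nth (y a - y' a) k = 0"
    proof cases
      case 1
      then show ?thesis using yv[OF a] by (simp add: y'_nth val_ge_def)
    next
      case 2
      then show ?thesis by (simp add: y'_nth)
    next
      case 3
      then show ?thesis using y_hi[OF a _ k] by (simp add: y'_nth)
    qed
  qed
  define h'' where "h'' b = (\<Sum>c<m. Ai $$ (b, c) * (y c - y' c))" for b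
  have h'': "val_ge 0 (h'' b)" if "b < m" for b
    unfolding h''_def
  proof (rule val_ge_sum)
    fix c assume c: "c \<in> {..<m}"
    have "val_ge (- int n + int n) (Ai $$ (b, c) * (y c - y' c))"
      by (rule val_ge_mult) (use Ai that c tail in \<open>auto simp: mat_val_ge_def\<close>)
    then show "val_ge 0 (Ai $$ (b, c) * (y c - y' c))" by simp
  qed
  define g where "g b = h' b - h'' b" for b
  have gv: "val_ge 0 (g b)" if "b < m" for b unfolding g_def using h' h'' that by (intro val_ge_diff)
  have Ag: "(\<Sum>b<m. A $$ (a, b) * g b) = y' a" if a: "a < m" for a
  proof -
    have "(\<Sum>b<m. A $$ (a, b) * h'' b) = y a - y' a"
      unfolding h''_def mat_apply_assoc[OF Ac a] inv by (rule mat_apply_one[OF a])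
    then show ?thesis unfolding g_def by (simp add: right_diff_distrib sum_subtractf y_def[symmetric])
  qed
  \<comment> \<open>From the bottom row upwards: row \<open>b\<close> reads
    \<open>y' b = t^(\<nu> b) * g b\<close>, with exponents below \<open>\<nu> b\<close> on the left
    and at least \<open>\<nu> b\<close> on the right.\<close>
  have g0: "g b = 0" if "b < m" for b
    using that
  proof (induction "m - b" arbitrary: b rule: less_induct)
    case less
    have "A $$ (b, c) * g c = (if c = b then tp (\<nu> b) * g b else 0)" if "c < m" for c
    proof (rule linorder_cases[of c b])
      assume "c < b" then show ?thesis using upper[of c b] less.prems by simp
    next
      assume "c = b" then show ?thesis using diag[OF less.prems] by simp
    next
      assume "b < c" then show ?thesis using less.hyps[of c] that by simp
    qed
    then have "(\<Sum>c<m. A $$ (b, c) * g c) = (\<Sum>c<m. if c = b then tp (\<nu> b) * g b else 0)"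
      by (intro sum.cong) auto
    then have eq: "y' b = tp (\<nu> b) * g b" using Ag[OF less.prems] less.prems by simp
    have "fls_nth (g b) k = 0" for k
    proof (cases "k < 0")
      case True
      then show ?thesis using gv[OF less.prems] by (simp add: val_ge_def)
    next
      case False
      have "fls_nth (g b) k = fls_nth (y' b) (k + \<nu> b)" unfolding eq by simp
      then show ?thesis using False by (simp add: y'_nth)
    qed
    then show ?case by (intro fls_eqI) simp
  qed
  have z0: "z p = 0" if p: "p < M" "p \<notin> LS" for p
  proof -
    let ?a = "p div (2 * n)"
    have a: "?a < m" by (rule div_less[OF p(1)])
    have "y' ?a = 0" using Ag[OF a] g0 by simp
    moreover have "- int n \<le> expo n p" "expo n p < \<nu> ?a" using p by (auto simp: lat_set_def expo_def)
    ultimately have "fls_nth (y ?a) (expo n p) = 0" using y'_nth[of ?a "expo n p"] by simp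
    then show ?thesis using y_coef[OF p(1)] p(2) by simp
  qed
  have "v p = (\<Sum>q\<in>LS. z q * c p q)" if "p < M" for p using vz[OF that] z0[OF that] by simp
  then show ?thesis unfolding v_def c_def by (intro exI allI impI)
qed

text \<open>In the window the vectors of \<open>H\<close> are combinations of the standard ones, so
  the two matrices differ by a right factor \<Gamma> that is the identity on the fixed columns. It
  does not involve \<open>T\<close>, and \<open>c\<close> is its determinant.\<close>

lemma delta_mat_frame_change:
  assumes H: "\<And>q b. q < card LS \<Longrightarrow> b < m \<Longrightarrow> val_ge 0 (H q b)"
  shows "\<exists>c. \<forall>T. det (delta_mat m n (card LS) T A H) = c * det (delta_mat m n (card LS) T A (std_frame m n \<nu>))"
proof -
  let ?r = "card LS" and ?\<pi> = "lat_perm m n \<nu>"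
  have rM: "?r \<le> M" using card_mono[OF _ lat_set_subset[of m n \<nu>]] by simp
  have "\<forall>q\<in>{..<?r}. \<exists>z. \<forall>p<M. fls_nth (\<Sum>b<m. A $$ (p div (2 * n), b) * H q b) (expo n p) =
    (\<Sum>q'\<in>LS. z q' * fls_nth (A $$ (p div (2 * n), q' div (2 * n))) (expo n p - expo n q' + \<nu> (q' div (2 * n))))"
  proof
    fix q assume q: "q \<in> {..<?r}"
    show "\<exists>z. \<forall>p<M. fls_nth (\<Sum>b<m. A $$ (p div (2 * n), b) * H q b) (expo n p) =
      (\<Sum>q'\<in>LS. z q' * fls_nth (A $$ (p div (2 * n), q' div (2 * n))) (expo n p - expo n q' + \<nu> (q' div (2 * n))))"
      by (rule lattice_spanned) (use H q in auto)
  qed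
  then obtain z where z: "\<forall>q\<in>{..<?r}. \<forall>p<M. fls_nth (\<Sum>b<m. A $$ (p div (2 * n), b) * H q b) (expo n p) =
    (\<Sum>q'\<in>LS. z q q' * fls_nth (A $$ (p div (2 * n), q' div (2 * n))) (expo n p - expo n q' + \<nu> (q' div (2 * n))))"
    by (rule bchoice[THEN exE])
  define \<Gamma> where "\<Gamma> = mat M M (\<lambda>(q', q). if q < ?r then (if q' < ?r then z q (?\<pi> q') else 0)
      else if q' = q then 1 else (0::complex))"
  have "delta_mat m n ?r T A H = delta_mat m n ?r T A (std_frame m n \<nu>) * \<Gamma>" for T
  proof (rule eq_matI)
    let ?D = "delta_mat m n ?r T A (std_frame m n \<nu>)"
    fix p q assume "p < dim_row (?D * \<Gamma>)" "q < dim_col (?D * \<Gamma>)"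
    then have pq: "p < M" "q < M" by (auto simp: \<Gamma>_def delta_mat_def)
    have "(?D * \<Gamma>) $$ (p, q) = (\<Sum>q'<M. ?D $$ (p, q') * \<Gamma> $$ (q', q))"
      by (rule mult_mat_index[OF delta_mat_carrier _ pq]) (simp add: \<Gamma>_def)
    also have "\<dots> = delta_mat m n ?r T A H $$ (p, q)"
    proof (cases "q < ?r")
      case True
      have "(\<Sum>q'<M. ?D $$ (p, q') * \<Gamma> $$ (q', q)) = (\<Sum>q'<?r. ?D $$ (p, q') * z q (?\<pi> q'))"
        by (rule sum.mono_neutral_cong_right) (use True pq rM in \<open>auto simp: \<Gamma>_def\<close>)
      also have "\<dots> = (\<Sum>q'<?r. z q (?\<pi> q') * fls_nth (A $$ (p div (2 * n), ?\<pi> q' div (2 * n)))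
          (expo n p - expo n (?\<pi> q') + \<nu> (?\<pi> q' div (2 * n))))"
        using pq rM by (intro sum.cong) (auto simp: delta_mat_def std_frame_apply)
      also have "\<dots> = (\<Sum>q'\<in>?\<pi> ` {..<?r}. z q q' * fls_nth (A $$ (p div (2 * n), q' div (2 * n)))
          (expo n p - expo n q' + \<nu> (q' div (2 * n))))"
        by (subst sum.reindex) (auto simp: inj_on_def lat_perm_inj)
      also have "\<dots> = delta_mat m n ?r T A H $$ (p, q)"
        unfolding lat_perm(2) using z True pq by (simp add: delta_mat_def)
      finally show ?thesis .
    next
      case False
      have "(\<Sum>q'<M. ?D $$ (p, q') * \<Gamma> $$ (q', q)) = (\<Sum>q'<M. if q' = q then ?D $$ (p, q) else 0)"
        using False pq by (intro sum.cong) (auto simp: \<Gamma>_def)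
      then show ?thesis using False pq by (simp add: delta_mat_def)
    qed
    finally show "delta_mat m n ?r T A H $$ (p, q) = (?D * \<Gamma>) $$ (p, q)" by simp
  qed (auto simp: \<Gamma>_def delta_mat_def)
  then have "det (delta_mat m n ?r T A H) = det \<Gamma> * det (delta_mat m n ?r T A (std_frame m n \<nu>))" for T
    using det_mult[OF delta_mat_carrier, of \<Gamma> m n ?r T A "std_frame m n \<nu>"] by (simp add: \<Gamma>_def mult.commute)
  then show ?thesis by blast
qed

lemma det_delta_mat_std:
  "det (delta_mat m n (card LS) (std_compl m n \<nu> (\<lambda>q. q)) A (std_frame m n \<nu>)) =
    det (perm_mat M (lat_perm m n \<nu>))"
  unfolding delta_mat_std by (simp add: det_mult[OF lat_mat_carrier] det_lat_mat)

text \<open>Cramer's rule: exchanging one complementary unit vector turns the determinant into an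
  entry of the inverse of \<open>lat_mat\<close>. So such entries are quotients of Pluecker
  coordinates.\<close>

lemma det_delta_mat_exchange:
  assumes q: "q0 < M" "q0 \<notin> LS" "q1 < M"
    and Y: "Y \<in> carrier_mat M M" "lat_mat m n \<nu> (\<lambda>q. q) A * Y = 1\<^sub>m M"
  shows "det (delta_mat m n (card LS) (std_compl m n \<nu> ((\<lambda>q. q)(q0 := q1))) A (std_frame m n \<nu>)) =
    Y $$ (q0, q1) * det (perm_mat M (lat_perm m n \<nu>))"
proof -
  let ?N = "lat_mat m n \<nu> (\<lambda>q. q) A"
  have N: "?N *\<^sub>v col Y q1 = unit_vec M q1"
    using Y q col_mult2[OF lat_mat_carrier Y(1) q(3), of \<nu> "\<lambda>q. q" A] by simp
  have "lat_mat m n \<nu> ((\<lambda>q. q)(q0 := q1)) A = replace_col ?N (?N *\<^sub>v col Y q1) q0"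
    unfolding N replace_col_def using q by (intro eq_matI) (auto simp: lat_mat_def unit_vec_def)
  then have "det (lat_mat m n \<nu> ((\<lambda>q. q)(q0 := q1)) A) = Y $$ (q0, q1)"
    using cramer_lemma_mat[OF lat_mat_carrier, of "col Y q1" m n q0 \<nu> "\<lambda>q. q" A] q Y(1)
    by (simp add: det_lat_mat)
  then show ?thesis unfolding delta_mat_std by (simp add: det_mult[OF lat_mat_carrier])
qed

text \<open>The rows from \<open>b0\<close> on are met only by the columns in \<open>C1\<close> and
  \<open>C2\<close>. These are too few: the lattice supplies at most as many as \<open>LS\<close>
  has positions there, the complement at most as many as are missing there from
  \<open>lat_set m n \<mu>\<close>.\<close>

lemma det_delta_mat_zero:
  assumes r: "card (lat_set m n \<mu>) = card LS"
    and less: "card {p \<in> LS. b0 \<le> p div (2 * n)} < card {p \<in> lat_set m n \<mu>. b0 \<le> p div (2 * n)}"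
  shows "det (delta_mat m n (card LS) (std_compl m n \<mu> (\<lambda>q. q)) A (std_frame m n \<nu>)) = 0"
proof -
  let ?r = "card LS" and ?\<pi> = "lat_perm m n \<nu>" and ?\<rho> = "lat_perm m n \<mu>"
  define R where "R = {p. p < M \<and> b0 \<le> p div (2 * n)}"
  define C1 where "C1 = {q. q < ?r \<and> b0 \<le> ?\<pi> q div (2 * n)}"
  define C2 where "C2 = {q. ?r \<le> q \<and> q < M \<and> b0 \<le> ?\<rho> q div (2 * n)}"
  have fin: "finite R" "finite C1" "finite C2" by (auto simp: R_def C1_def C2_def)
  have 1: "card C1 \<le> card {p \<in> LS. b0 \<le> p div (2 * n)}"
  proof (rule card_inj_on_le[of ?\<pi>])
    show "?\<pi> ` C1 \<subseteq> {p \<in> LS. b0 \<le> p div (2 * n)}" by (auto simp: C1_def lat_perm_mem)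
  qed (auto simp: inj_on_def lat_perm_inj)
  have 2: "card C2 \<le> card (R - {p \<in> lat_set m n \<mu>. b0 \<le> p div (2 * n)})"
  proof (rule card_inj_on_le[of ?\<rho>])
    show "?\<rho> ` C2 \<subseteq> R - {p \<in> lat_set m n \<mu>. b0 \<le> p div (2 * n)}"
      using r by (auto simp: C2_def R_def lat_perm_mem lat_perm_less)
  qed (auto simp: inj_on_def lat_perm_inj fin)
  have sub: "{p \<in> lat_set m n \<mu>. b0 \<le> p div (2 * n)} \<subseteq> R" using lat_set_subset[of m n \<mu>] by (auto simp: R_def)
  have "card (C1 \<union> C2) \<le> card C1 + card C2" by (rule card_Un_le)
  also have "\<dots> < card R"
    using 1 2 less card_mono[OF fin(1) sub] card_Diff_subset[OF finite_subset[OF sub fin(1)] sub] by linarith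
  finally have c: "card (C1 \<union> C2) < card R" .
  show ?thesis
  proof (rule det_zero_block[OF delta_mat_carrier _ _ c])
    show "R \<subseteq> {..<M}" "finite (C1 \<union> C2)" using fin by (auto simp: R_def)
    fix p q assume pq: "p \<in> R" "q < M" "q \<notin> C1 \<union> C2"
    have pM: "p < M" "b0 \<le> p div (2 * n)" using pq by (auto simp: R_def)
    show "delta_mat m n ?r (std_compl m n \<mu> (\<lambda>q. q)) A (std_frame m n \<nu>) $$ (p, q) = 0"
    proof (cases "q < ?r")
      case True
      then have "?\<pi> q div (2 * n) < p div (2 * n)" using pq pM by (auto simp: C1_def)
      then have "A $$ (p div (2 * n), ?\<pi> q div (2 * n)) = 0" by (rule upper[OF _ div_less[OF pM(1)]])
      then show ?thesis using True pM pq by (simp add: delta_mat_def std_frame_apply)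
    next
      case False
      then have "p \<noteq> ?\<rho> q" using pq pM by (auto simp: C2_def)
      then show ?thesis using False pM pq by (simp add: delta_mat_def std_compl_def)
    qed
  qed
qed

end

text \<open>Row \<open>a\<close> contributes the exponents from \<open>\<nu> a\<close> up to
  \<open>n - 1\<close>.\<close>

lemma card_lat_set:
  assumes "n > 0" "\<And>a. a < m \<Longrightarrow> \<bar>\<nu> a\<bar> \<le> int n"
  shows "int (card {p \<in> lat_set m n \<nu>. b0 \<le> p div (2 * n)}) = (\<Sum>a\<in>{b0..<m}. int n - \<nu> a)"
proof -
  define B where "B a = {k. k < 2 * n \<and> \<nu> a \<le> int k - int n}" for a
  have "bij_betw (\<lambda>(a, k). a * (2 * n) + k) (SIGMA a:{b0..<m}. B a) {p \<in> lat_set m n \<nu>. b0 \<le> p div (2 * n)}"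
  proof (rule bij_betw_byWitness[where f' = "\<lambda>p. (p div (2 * n), p mod (2 * n))"])
    show "(\<lambda>(a, k). a * (2 * n) + k) ` (SIGMA a:{b0..<m}. B a) \<subseteq> {p \<in> lat_set m n \<nu>. b0 \<le> p div (2 * n)}"
    proof clarify
      fix a k assume ak: "a \<in> {b0..<m}" "k \<in> B a"
      have k: "k < 2 * n" "\<nu> a \<le> int k - int n" using ak by (auto simp: B_def)
      have "a * (2 * n) + k < (a + 1) * (2 * n)" using k by simp
      also have "\<dots> \<le> m * (2 * n)" by (rule mult_right_mono) (use ak in auto)
      finally have "a * (2 * n) + k < m * (2 * n)" .
      moreover have "(a * (2 * n) + k) div (2 * n) = a" "(a * (2 * n) + k) mod (2 * n) = k" using k by auto
      ultimately show "a * (2 * n) + k \<in> lat_set m n \<nu> \<and> b0 \<le> (a * (2 * n) + k) div (2 * n)"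
        using ak k by (simp add: lat_set_def expo_def)
    qed
    show "(\<lambda>p. (p div (2 * n), p mod (2 * n))) ` {p \<in> lat_set m n \<nu>. b0 \<le> p div (2 * n)} \<subseteq> (SIGMA a:{b0..<m}. B a)"
      using assms(1) by (auto simp: lat_set_def B_def expo_def div_less)
  qed (auto simp: B_def div_mult_mod_eq)
  then have "card {p \<in> lat_set m n \<nu>. b0 \<le> p div (2 * n)} = card (SIGMA a:{b0..<m}. B a)"
    by (rule bij_betw_same_card[symmetric])
  also have "\<dots> = (\<Sum>a\<in>{b0..<m}. card (B a))" by (rule card_SigmaI) (auto simp: B_def)
  finally have "int (card {p \<in> lat_set m n \<nu>. b0 \<le> p div (2 * n)}) = (\<Sum>a\<in>{b0..<m}. int (card (B a)))" by simp
  also have "\<dots> = (\<Sum>a\<in>{b0..<m}. int n - \<nu> a)"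
  proof (intro sum.cong refl)
    fix a assume "a \<in> {b0..<m}"
    then have b: "\<bar>\<nu> a\<bar> \<le> int n" using assms(2) by simp
    have "B a = {nat (\<nu> a + int n)..<2 * n}" using b by (auto simp: B_def)
    then show "int (card (B a)) = int n - \<nu> a" using b by simp
  qed
  finally show ?thesis .
qed

text \<open>The sums from \<open>a\<close> and from \<open>Suc a\<close> on differ by the single
  summand at \<open>a\<close>, so they cannot both agree.\<close>

lemma bottom_sums_differ:
  fixes \<mu> \<nu> :: "nat \<Rightarrow> int"
  assumes "a < m" "\<mu> a \<noteq> \<nu> a"
  obtains b0 where "b0 \<le> m" "(\<Sum>a\<in>{b0..<m}. \<mu> a) \<noteq> (\<Sum>a\<in>{b0..<m}. \<nu> a)"
proof -
  have "(\<Sum>a\<in>{a..<m}. \<mu> a) \<noteq> (\<Sum>a\<in>{a..<m}. \<nu> a) \<or> (\<Sum>a\<in>{Suc a..<m}. \<mu> a) \<noteq> (\<Sum>a\<in>{Suc a..<m}. \<nu> a)"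
    using assms by (auto simp: sum.atLeast_Suc_lessThan)
  then show ?thesis using that[of a] that[of "Suc a"] assms(1) by auto
qed

lemma coordinate_index:
  assumes "n > 0" "a < m" "- int n \<le> e" "e < int n"
  obtains p where "p < m * (2 * n)" "p div (2 * n) = a" "expo n p = e"
proof
  let ?p = "a * (2 * n) + nat (e + int n)"
  have en: "0 \<le> e + int n" "nat (e + int n) < 2 * n" using assms by auto
  show "?p div (2 * n) = a" "expo n ?p = e" using en assms(1) by (auto simp: expo_def)
  have "?p < (a + 1) * (2 * n)" using en by simp
  also have "\<dots> \<le> m * (2 * n)" by (rule mult_right_mono) (use assms in auto)
  finally show "?p < m * (2 * n)" .
qed

section \<open>Matrix coefficients in terms of the inverse of lat_mat\<close>

context triangular_lattice
begin

text \<open>\<open>lat_mat\<close> is block upper triangular with identity blocks on the diagonal,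
  one for each row of the lattice, and its inverse inherits this shape.\<close>

lemma inverse_row:
  assumes Y: "Y \<in> carrier_mat M M" "Y * lat_mat m n \<nu> (\<lambda>q. q) A = 1\<^sub>m M" and q0: "q0 < M"
    and q: "q < M" "q div (2 * n) \<le> q0 div (2 * n)"
  shows "Y $$ (q0, q) = (if q = q0 then 1 else 0)"
  using q
proof (induction "q div (2 * n)" arbitrary: q rule: less_induct)
  case less
  let ?N = "lat_mat m n \<nu> (\<lambda>q. q) A"
  have "(\<Sum>q'<M. Y $$ (q0, q') * ?N $$ (q', q)) = (if q = q0 then 1 else 0)"
    using mult_mat_index[OF Y(1) lat_mat_carrier q0 less.prems(1), of \<nu> "\<lambda>q. q" A] Y(2) q0 less.prems(1) by auto
  moreover have "(\<Sum>q'<M. Y $$ (q0, q') * ?N $$ (q', q)) = (\<Sum>q'<M. if q' = q then Y $$ (q0, q) else 0)"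
  proof (intro sum.cong refl)
    fix q' assume "q' \<in> {..<M}"
    then have q': "q' < M" by simp
    show "Y $$ (q0, q') * ?N $$ (q', q) = (if q' = q then Y $$ (q0, q) else 0)"
    proof (cases "q \<in> LS")
      case False
      then show ?thesis using q' less.prems by (simp add: lat_mat_def)
    next
      case True
      have N: "?N $$ (q', q) = fls_nth (A $$ (q' div (2 * n), q div (2 * n))) (expo n q' - expo n q + \<nu> (q div (2 * n)))"
        using True q' less.prems by (simp add: lat_mat_def)
      show ?thesis
      proof (rule linorder_cases[of "q' div (2 * n)" "q div (2 * n)"])
        assume lt: "q' div (2 * n) < q div (2 * n)"
        then have "Y $$ (q0, q') = 0" using less.hyps[OF lt q'] less.prems by auto
        then show ?thesis using lt by auto
      next
        assume eq: "q' div (2 * n) = q div (2 * n)"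
        then show ?thesis using expo_inj[of q' q] unfolding N by (auto simp: diag div_less[OF less.prems(1)] fls_nth_tp)
      next
        assume gt: "q div (2 * n) < q' div (2 * n)"
        then show ?thesis unfolding N using upper[OF gt div_less[OF q']] by auto
      qed
    qed
  qed
  ultimately show ?case using less.prems by simp
qed

text \<open>Row \<open>q0\<close> of the inverse is orthogonal to column \<open>q1\<close> of
  \<open>lat_mat\<close>. By the choice of the exponent at \<open>q1\<close>, this column is column
  \<open>b\<close> of \<open>A\<close> without a shift.\<close>

lemma coefficient_relation:
  assumes Y: "Y \<in> carrier_mat M M" "Y * lat_mat m n \<nu> (\<lambda>q. q) A = 1\<^sub>m M"
    and q0: "q0 < M" "q0 div (2 * n) = a" and q1: "q1 < M" "q1 div (2 * n) = b" "expo n q1 = \<nu> b" and ab: "a < b"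
  shows "fls_nth (A $$ (a, b)) (expo n q0) =
    - (\<Sum>q\<in>{q. q < M \<and> a < q div (2 * n)}. Y $$ (q0, q) * fls_nth (A $$ (q div (2 * n), b)) (expo n q))"
proof -
  let ?N = "lat_mat m n \<nu> (\<lambda>q. q) A" and ?S = "{q. q < M \<and> a < q div (2 * n)}"
  have "q1 \<in> LS" using q1 by (simp add: lat_set_def)
  then have N: "?N $$ (q, q1) = fls_nth (A $$ (q div (2 * n), b)) (expo n q)" if "q < M" for q
    using that q1 by (simp add: lat_mat_def)
  have ne: "q0 \<noteq> q1" using q0 q1 ab by auto
  have "0 = (\<Sum>q<M. Y $$ (q0, q) * ?N $$ (q, q1))"
    using mult_mat_index[OF Y(1) lat_mat_carrier q0(1) q1(1), of \<nu> "\<lambda>q. q" A] Y(2) q0(1) q1(1) ne by auto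
  also have "\<dots> = (\<Sum>q<M. Y $$ (q0, q) * fls_nth (A $$ (q div (2 * n), b)) (expo n q))"
    using N by (intro sum.cong) auto
  also have "\<dots> = (\<Sum>q\<in>{..<M} - ?S. Y $$ (q0, q) * fls_nth (A $$ (q div (2 * n), b)) (expo n q)) +
      (\<Sum>q\<in>?S. Y $$ (q0, q) * fls_nth (A $$ (q div (2 * n), b)) (expo n q))"
    by (rule sum.subset_diff) auto
  also have "(\<Sum>q\<in>{..<M} - ?S. Y $$ (q0, q) * fls_nth (A $$ (q div (2 * n), b)) (expo n q)) =
      (\<Sum>q\<in>{..<M} - ?S. if q = q0 then fls_nth (A $$ (a, b)) (expo n q0) else 0)"
    using inverse_row[OF Y q0(1)] q0(2) by (intro sum.cong) auto
  also have "\<dots> = fls_nth (A $$ (a, b)) (expo n q0)" using q0 by simp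
  finally show ?thesis by (simp add: eq_neg_iff_add_eq_0)
qed

end


section \<open>Semi-invariants of tuples of lattices\<close>

text \<open>The functions \<open>f g H\<close> of degree \<open>d\<close> get multiplied by a factor \<open>c\<^sup>d\<close>, with \<open>c\<close>
  independent of \<open>f\<close>, when the frames \<open>H\<close> of the lattices change; so they define closed subsets of \<open>Gr\<close>.\<close>

inductive semi_inv :: "nat \<Rightarrow> nat \<Rightarrow> (nat \<Rightarrow> nat) \<Rightarrow> nat \<Rightarrow>
    ((nat \<Rightarrow> complex fls mat) \<Rightarrow> (nat \<Rightarrow> nat \<Rightarrow> nat \<Rightarrow> complex fls) \<Rightarrow> complex) \<Rightarrow> bool"
  for m n r where
  const: "semi_inv m n r 0 (\<lambda>_ _. c)"
| delta: "semi_inv m n r 1 (\<lambda>g H. \<Prod>i\<in>{1..<n}. det (delta_mat m n (r i) (T i) (g i) (H i)))"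
| add: "semi_inv m n r d f \<Longrightarrow> semi_inv m n r d f' \<Longrightarrow> semi_inv m n r d (\<lambda>g H. f g H + f' g H)"
| mult: "semi_inv m n r d f \<Longrightarrow> semi_inv m n r e f' \<Longrightarrow> semi_inv m n r (d + e) (\<lambda>g H. f g H * f' g H)"

lemma semi_inv_scale: "semi_inv m n r d f \<Longrightarrow> semi_inv m n r d (\<lambda>g H. c * f g H)"
  using semi_inv.mult[OF semi_inv.const[of m n r c], of d f] by simp

lemma semi_inv_power: "semi_inv m n r d f \<Longrightarrow> semi_inv m n r (k * d) (\<lambda>g H. f g H ^ k)"
proof (induction k)
  case 0
  then show ?case using semi_inv.const[of m n r 1] by simp
next
  case (Suc k)
  then show ?case using semi_inv.mult[of m n r d f "k * d" "\<lambda>g H. f g H ^ k"] by simp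
qed

text \<open>Needed in every degree as the value of an empty sum; it is built from a power of a
  generator since constants have degree 0.\<close>

lemma semi_inv_zero: "semi_inv m n r d (\<lambda>_ _. 0)"
  using semi_inv_scale[OF semi_inv_power[OF semi_inv.delta[of m n r "\<lambda>_ _ _. 0"], of d], of 0] by simp

lemma semi_inv_sum:
  "(\<And>s. s \<in> S \<Longrightarrow> semi_inv m n r d (f s)) \<Longrightarrow> semi_inv m n r d (\<lambda>g H. \<Sum>s\<in>S. f s g H)"
  by (induction S rule: infinite_finite_induct) (auto intro: semi_inv_zero semi_inv.add)

lemma semi_inv_prod_power:
  assumes "finite K" "\<And>k. k \<in> K \<Longrightarrow> semi_inv m n r d (f k)"
  shows "semi_inv m n r ((\<Sum>k\<in>K. \<alpha> k) * d) (\<lambda>g H. \<Prod>k\<in>K. f k g H ^ \<alpha> k)"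
  using assms
proof (induction K)
  case empty
  then show ?case using semi_inv.const[of m n r 1] by simp
next
  case (insert k K)
  have "semi_inv m n r ((\<Sum>k\<in>K. \<alpha> k) * d) (\<lambda>g H. \<Prod>k\<in>K. f k g H ^ \<alpha> k)"
    by (rule insert.IH) (use insert.prems in auto)
  then have "semi_inv m n r (\<alpha> k * d + (\<Sum>k\<in>K. \<alpha> k) * d) (\<lambda>g H. f k g H ^ \<alpha> k * (\<Prod>k\<in>K. f k g H ^ \<alpha> k))"
    by (intro semi_inv.mult semi_inv_power insert.prems) auto
  then show ?case using insert.hyps by (simp add: add_mult_distrib)
qed

lemma semi_inv_cong:
  assumes "semi_inv m n r d f" "\<And>i. i \<in> {1..<n} \<Longrightarrow> g i = g' i"
  shows "f g H = f g' H"
  using assms(1)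
proof induction
  case (delta T)
  show ?case by (intro prod.cong) (use assms(2) in auto)
qed auto

definition integral_frame :: "nat \<Rightarrow> nat \<Rightarrow> (nat \<Rightarrow> nat) \<Rightarrow> (nat \<Rightarrow> nat \<Rightarrow> nat \<Rightarrow> complex fls) \<Rightarrow> bool" where
  "integral_frame m n r H \<longleftrightarrow> (\<forall>i\<in>{1..<n}. \<forall>q<r i. \<forall>b<m. val_ge 0 (H i q b))"

text \<open>The effect of right multiplication of the representatives by \<open>k\<close>, carried
  over to the frames.\<close>

definition frame_act :: "nat \<Rightarrow> (nat \<Rightarrow> complex fls mat) \<Rightarrow> (nat \<Rightarrow> nat \<Rightarrow> nat \<Rightarrow> complex fls) \<Rightarrow>
    nat \<Rightarrow> nat \<Rightarrow> nat \<Rightarrow> complex fls" where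
  "frame_act m k H i q b = (\<Sum>c<m. k i $$ (b, c) * H i q c)"

lemma integral_frame_act:
  assumes "integral_frame m n r H" "\<And>i. i \<in> {1..<n} \<Longrightarrow> k i \<in> GL_O m"
  shows "integral_frame m n r (frame_act m k H)"
  unfolding integral_frame_def frame_act_def
proof (intro ballI allI impI val_ge_sum val_ge_mult0)
  fix i q b c assume *: "i \<in> {1..<n}" "q < r i" "b < m" "c \<in> {..<m}"
  show "val_ge 0 (k i $$ (b, c))" using assms(2)[OF *(1)] * by (simp add: GL_O_iff mat_val_ge_def)
  show "val_ge 0 (H i q c)" using assms(1) * by (simp add: integral_frame_def)
qed

lemma semi_inv_right_mult:
  assumes "semi_inv m n r d f"
    and "\<And>i. i \<in> {1..<n} \<Longrightarrow> g i \<in> carrier_mat m m" "\<And>i. i \<in> {1..<n} \<Longrightarrow> k i \<in> carrier_mat m m"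
  shows "f (\<lambda>i. g i * k i) H = f g (frame_act m k H)"
  using assms(1)
proof induction
  case (delta T)
  have "delta_mat m n (r i) (T i) (g i * k i) (H i) = delta_mat m n (r i) (T i) (g i) (frame_act m k H i)"
    if i: "i \<in> {1..<n}" for i
    unfolding delta_mat_def
  proof (rule cong_mat, goal_cases)
    case (3 p q)
    have "p div (2 * n) < m" by (rule div_less[OF 3(1)])
    then have "(\<Sum>b<m. (g i * k i) $$ (p div (2 * n), b) * H i q b) =
        (\<Sum>b<m. g i $$ (p div (2 * n), b) * frame_act m k H i q b)"
      unfolding frame_act_def by (rule mat_apply_assoc[OF assms(2,3)[OF i], symmetric])
    then show ?case by simp
  qed simp_all
  then show ?case by (intro prod.cong) auto
qed auto

text \<open>One factor \<open>c\<close>, a product over the vertices, serves all semi-invariants at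
  once. So vanishing on the standard frames implies vanishing on all integral frames.\<close>

lemma semi_inv_frame_change:
  assumes tri: "\<And>i. i \<in> {1..<n} \<Longrightarrow> triangular_lattice m n (A i) (Ai i) (\<nu> i)"
    and r: "\<And>i. i \<in> {1..<n} \<Longrightarrow> r i = card (lat_set m n (\<nu> i))" and H: "integral_frame m n r H"
  shows "\<exists>c. \<forall>d f. semi_inv m n r d f \<longrightarrow> f A H = c ^ d * f A (\<lambda>i. std_frame m n (\<nu> i))"
proof -
  have "\<forall>i\<in>{1..<n}. \<exists>c. \<forall>T. det (delta_mat m n (r i) T (A i) (H i)) =
      c * det (delta_mat m n (r i) T (A i) (std_frame m n (\<nu> i)))"
  proof
    fix i assume i: "i \<in> {1..<n}"
    show "\<exists>c. \<forall>T. det (delta_mat m n (r i) T (A i) (H i)) =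
      c * det (delta_mat m n (r i) T (A i) (std_frame m n (\<nu> i)))"
      unfolding r[OF i]
      by (rule triangular_lattice.delta_mat_frame_change[OF tri[OF i]])
        (use H i in \<open>simp add: integral_frame_def r\<close>)
  qed
  then obtain c where c: "\<forall>i\<in>{1..<n}. \<forall>T. det (delta_mat m n (r i) T (A i) (H i)) =
      c i * det (delta_mat m n (r i) T (A i) (std_frame m n (\<nu> i)))" by (rule bchoice[THEN exE])
  have "f A H = (\<Prod>i\<in>{1..<n}. c i) ^ d * f A (\<lambda>i. std_frame m n (\<nu> i))" if "semi_inv m n r d f" for d f
    using that
  proof induction
    case (delta T)
    have "(\<Prod>i\<in>{1..<n}. det (delta_mat m n (r i) (T i) (A i) (H i))) =
        (\<Prod>i\<in>{1..<n}. c i * det (delta_mat m n (r i) (T i) (A i) (std_frame m n (\<nu> i))))"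
      using c by (intro prod.cong) auto
    then show ?case by (simp add: prod.distrib)
  next
    case (add d f f')
    then show ?case by (simp add: distrib_left)
  next
    case (mult d f e f')
    then show ?case by (simp add: power_add mult_ac)
  qed simp
  then show ?thesis by blast
qed

lemma fun_algebra_loop_polys: "fun_algebra (loop_polys m I)"
  by standard (auto intro: loop_polys.intros)

text \<open>On a piece the poles are bounded, so a coefficient of an entry of \<open>g\<close> times
  a fixed series is a finite combination of coordinates.\<close>

lemma semi_inv_loop_poly:
  assumes "semi_inv m n r d f" and H: "integral_frame m n r H"
  shows "\<exists>p\<in>loop_polys m {1..<n}. \<forall>g\<in>loop_piece m {1..<n} N. f g H = p g"
proof -
  let ?I = "{1..<n}"
  interpret L: fun_algebra "loop_polys m ?I" by (rule fun_algebra_loop_polys)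
  show ?thesis
    using assms(1)
  proof induction
    case (const c)
    then show ?case by (intro bexI[of _ "\<lambda>_. c"]) (auto intro: loop_polys.const)
  next
    case (delta T)
    have "\<exists>p\<in>loop_polys m ?I. \<forall>g\<in>loop_piece m ?I N. det (delta_mat m n (r i) (T i) (g i) (H i)) = p g"
      if i: "i \<in> ?I" for i
    proof -
      have "\<exists>p. p \<in> loop_polys m ?I \<and> (\<forall>g\<in>loop_piece m ?I N. delta_mat m n (r i) (T i) (g i) (H i) $$ (a, b) = p g)"
        if ab: "a < m * (2 * n)" "b < m * (2 * n)" for a b
      proof (cases "b < r i")
        case True
        have "L.regular (loop_piece m ?I N) (\<lambda>g. g i $$ (a div (2 * n), c))" if c: "c \<in> {..<m}" for c
        proof (rule L.regularI)
          fix g assume "g \<in> loop_piece m ?I N"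
          then show "val_ge (- int N) (g i $$ (a div (2 * n), c))"
            using i c div_less[OF ab(1)] by (simp add: loop_piece_def val_ge_def)
        next
          fix e
          have "(\<lambda>g. fls_nth (g i $$ (a div (2 * n), c)) e) \<in> loop_polys m ?I"
            by (rule loop_polys.entry) (use i c div_less[OF ab(1)] in auto)
          then show "\<exists>p\<in>loop_polys m ?I. \<forall>g\<in>loop_piece m ?I N. fls_nth (g i $$ (a div (2 * n), c)) e = p g"
            by (rule bexI[rotated]) simp
        qed
        then have "L.regular (loop_piece m ?I N) (\<lambda>g. \<Sum>c<m. g i $$ (a div (2 * n), c) * H i b c)"
          by (intro L.regular_sum L.regular_mult L.regular_fixed)
        then obtain p where "p \<in> loop_polys m ?I"
          "\<And>g. g \<in> loop_piece m ?I N \<Longrightarrow> fls_nth (\<Sum>c<m. g i $$ (a div (2 * n), c) * H i b c) (expo n a) = p g"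
          using L.regular_nth by blast
        then show ?thesis using True ab by (intro exI[of _ p]) (simp add: delta_mat_def)
      next
        case False
        then show ?thesis using ab loop_polys.const by (intro exI[of _ "\<lambda>_. T i b a"]) (auto simp: delta_mat_def)
      qed
      then have "\<forall>a b. \<exists>p. a < m * (2 * n) \<longrightarrow> b < m * (2 * n) \<longrightarrow> p \<in> loop_polys m ?I \<and>
        (\<forall>g\<in>loop_piece m ?I N. delta_mat m n (r i) (T i) (g i) (H i) $$ (a, b) = p g)" by meson
      then obtain p where p: "\<forall>a b. a < m * (2 * n) \<longrightarrow> b < m * (2 * n) \<longrightarrow> p a b \<in> loop_polys m ?I \<and>
        (\<forall>g\<in>loop_piece m ?I N. delta_mat m n (r i) (T i) (g i) (H i) $$ (a, b) = p a b g)" by metis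
      define P where "P g = mat (m * (2 * n)) (m * (2 * n)) (\<lambda>(a, b). p a b g)" for g
      have "(\<lambda>g. det (P g)) \<in> loop_polys m ?I"
        by (rule L.det[of _ "m * (2 * n)"]) (use p in \<open>auto simp: P_def\<close>)
      moreover have "delta_mat m n (r i) (T i) (g i) (H i) = P g" if "g \<in> loop_piece m ?I N" for g
      proof (rule eq_matI)
        fix a b assume "a < dim_row (P g)" "b < dim_col (P g)"
        then show "delta_mat m n (r i) (T i) (g i) (H i) $$ (a, b) = P g $$ (a, b)"
          using p that by (simp add: P_def)
      qed (auto simp: P_def delta_mat_def)
      ultimately show ?thesis by (intro bexI[of _ "\<lambda>g. det (P g)"]) auto
    qed
    then have "\<forall>i\<in>?I. \<exists>p. p \<in> loop_polys m ?I \<and> (\<forall>g\<in>loop_piece m ?I N. det (delta_mat m n (r i) (T i) (g i) (H i)) = p g)"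
      by blast
    then obtain p where p: "\<forall>i\<in>?I. p i \<in> loop_polys m ?I \<and>
        (\<forall>g\<in>loop_piece m ?I N. det (delta_mat m n (r i) (T i) (g i) (H i)) = p i g)" by (rule bchoice[THEN exE])
    show ?case
    proof (intro bexI[of _ "\<lambda>g. \<Prod>i\<in>?I. p i g"] ballI)
      show "(\<lambda>g. \<Prod>i\<in>?I. p i g) \<in> loop_polys m ?I" by (rule L.prod) (use p in blast)
      fix g assume "g \<in> loop_piece m ?I N"
      then show "(\<Prod>i\<in>?I. det (delta_mat m n (r i) (T i) (g i) (H i))) = (\<Prod>i\<in>?I. p i g)"
        using p by (intro prod.cong) auto
    qed
  next
    case (add d f f')
    then obtain p q where "p \<in> loop_polys m ?I" "\<forall>g\<in>loop_piece m ?I N. f g H = p g"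
      "q \<in> loop_polys m ?I" "\<forall>g\<in>loop_piece m ?I N. f' g H = q g" by blast
    then show ?case by (intro bexI[of _ "\<lambda>g. p g + q g"]) (auto intro: loop_polys.add)
  next
    case (mult d f e f')
    then obtain p q where "p \<in> loop_polys m ?I" "\<forall>g\<in>loop_piece m ?I N. f g H = p g"
      "q \<in> loop_polys m ?I" "\<forall>g\<in>loop_piece m ?I N. f' g H = q g" by blast
    then show ?case by (intro bexI[of _ "\<lambda>g. p g * q g"]) (auto intro: loop_polys.mult)
  qed
qed

text \<open>Asking for all integral frames makes the set stable under right multiplication by
  integral matrices, which only changes the frame; so it is the full preimage of a subset of
  \<open>Gr_power\<close>.\<close>

definition semi_zeros :: "nat \<Rightarrow> nat \<Rightarrow> (nat \<Rightarrow> nat) \<Rightarrow>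
    ((nat \<Rightarrow> complex fls mat) \<Rightarrow> (nat \<Rightarrow> nat \<Rightarrow> nat \<Rightarrow> complex fls) \<Rightarrow> complex) \<Rightarrow> (nat \<Rightarrow> complex fls mat) set" where
  "semi_zeros m n r f = {g \<in> loop_power m {1..<n}. \<forall>H. integral_frame m n r H \<longrightarrow> f g H = 0}"

lemma loop_closed_semi_zeros:
  assumes f: "semi_inv m n r d f"
  shows "loop_closed m {1..<n} (semi_zeros m n r f)"
  unfolding loop_closed_def
proof (intro conjI allI)
  let ?I = "{1..<n}"
  show "semi_zeros m n r f \<subseteq> loop_power m ?I" by (auto simp: semi_zeros_def)
  fix N
  have "\<forall>H\<in>{H. integral_frame m n r H}. \<exists>p. p \<in> loop_polys m ?I \<and> (\<forall>g\<in>loop_piece m ?I N. f g H = p g)"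
  proof
    fix H assume "H \<in> {H. integral_frame m n r H}"
    then have "integral_frame m n r H" by simp
    from semi_inv_loop_poly[OF f this, of N]
    show "\<exists>p. p \<in> loop_polys m ?I \<and> (\<forall>g\<in>loop_piece m ?I N. f g H = p g)" by (simp add: Bex_def)
  qed
  then obtain p where p: "\<forall>H\<in>{H. integral_frame m n r H}. p H \<in> loop_polys m ?I \<and>
      (\<forall>g\<in>loop_piece m ?I N. f g H = p H g)" by (rule bchoice[THEN exE])
  show "\<exists>P\<subseteq>loop_polys m ?I. semi_zeros m n r f \<inter> loop_piece m ?I N = {g \<in> loop_piece m ?I N. \<forall>q\<in>P. q g = 0}"
  proof (intro exI[of _ "p ` {H. integral_frame m n r H}"] conjI)
    show "p ` {H. integral_frame m n r H} \<subseteq> loop_polys m ?I" using p by blast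
    show "semi_zeros m n r f \<inter> loop_piece m ?I N =
        {g \<in> loop_piece m ?I N. \<forall>q\<in>p ` {H. integral_frame m n r H}. q g = 0}"
    proof (rule Set.set_eqI)
      fix g
      show "g \<in> semi_zeros m n r f \<inter> loop_piece m ?I N \<longleftrightarrow>
          g \<in> {g \<in> loop_piece m ?I N. \<forall>q\<in>p ` {H. integral_frame m n r H}. q g = 0}"
      proof (cases "g \<in> loop_piece m ?I N")
        case True
        then have "f g H = p H g" if "integral_frame m n r H" for H using p that by simp
        moreover have "g \<in> loop_power m ?I" using True by (simp add: loop_piece_def)
        ultimately show ?thesis using True by (auto simp: semi_zeros_def)
      qed simp
    qed
  qed
qed

lemma semi_zeros_invariant:
  assumes f: "semi_inv m n r d f" and g: "g \<in> semi_zeros m n r f" and g': "g' \<in> loop_power m {1..<n}"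
    and eq: "Gr_proj m {1..<n} g' = Gr_proj m {1..<n} g"
  shows "g' \<in> semi_zeros m n r f"
proof -
  let ?I = "{1..<n}"
  have gK: "g i \<in> carrier (GL_K m)" "g' i \<in> carrier (GL_K m)" if "i \<in> ?I" for i
    using g g' that by (auto simp: semi_zeros_def loop_power_def)
  have "\<forall>i\<in>?I. \<exists>k. k \<in> GL_O m \<and> g' i = g i * k"
  proof
    fix i assume i: "i \<in> ?I"
    have "g i <#\<^bsub>GL_K m\<^esub> GL_O m = g' i <#\<^bsub>GL_K m\<^esub> GL_O m"
      using fun_cong[OF eq, of i] i by (simp add: Gr_proj_def)
    then show "\<exists>k. k \<in> GL_O m \<and> g' i = g i * k"
      unfolding coset_GL_O[OF gK[OF i]] by (simp add: Bex_def)
  qed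
  then obtain k where k: "\<forall>i\<in>?I. k i \<in> GL_O m \<and> g' i = g i * k i" by (rule bchoice[THEN exE])
  have "f g' H = 0" if H: "integral_frame m n r H" for H
  proof -
    have "f g' H = f (\<lambda>i. g i * k i) H" by (rule semi_inv_cong[OF f]) (use k in auto)
    also have "\<dots> = f g (frame_act m k H)"
      by (rule semi_inv_right_mult[OF f]) (use gK k GL_K_carrier_mat GL_O_carrier_mat in blast)+
    also have "\<dots> = 0"
    proof -
      have "integral_frame m n r (frame_act m k H)" by (rule integral_frame_act[OF H]) (use k in blast)
      then show ?thesis using g by (simp add: semi_zeros_def)
    qed
    finally show ?thesis .
  qed
  then show ?thesis using g' by (simp add: semi_zeros_def)
qed

lemma closedin_Gr_semi_zeros:
  assumes f: "semi_inv m n r d f"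
  shows "closedin (Gr_top m {1..<n}) (Gr_proj m {1..<n} ` semi_zeros m n r f)"
proof -
  let ?I = "{1..<n}"
  have "{g \<in> loop_power m ?I. Gr_proj m ?I g \<in> Gr_proj m ?I ` semi_zeros m n r f} = semi_zeros m n r f"
  proof (intro Set.set_eqI iffI)
    fix g assume "g \<in> {g \<in> loop_power m ?I. Gr_proj m ?I g \<in> Gr_proj m ?I ` semi_zeros m n r f}"
    then obtain g0 where "g \<in> loop_power m ?I" "g0 \<in> semi_zeros m n r f" "Gr_proj m ?I g = Gr_proj m ?I g0" by auto
    then show "g \<in> semi_zeros m n r f" using semi_zeros_invariant[OF f] by metis
  qed (auto simp: semi_zeros_def)
  moreover have "Gr_proj m ?I ` semi_zeros m n r f \<subseteq> Gr_power m ?I"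
    by (auto simp: semi_zeros_def intro: Gr_proj_Gr_power)
  ultimately show ?thesis unfolding closedin_Gr_top using loop_closed_semi_zeros[OF f] by simp
qed

section \<open>The cells of the convolution variety\<close>

definition psum :: "(nat \<Rightarrow> int list) \<Rightarrow> nat \<Rightarrow> nat \<Rightarrow> int" where
  "psum w i a = (\<Sum>j\<in>{1..i}. w j ! a)"

lemma psum_Suc: "psum w (Suc i) a = psum w i a + w (Suc i) ! a"
  by (simp add: psum_def)

definition cell_vars :: "nat \<Rightarrow> nat \<Rightarrow> (nat \<Rightarrow> int list) \<Rightarrow> (nat \<times> nat \<times> nat) set" where
  "cell_vars m n w = {(i, a, b). i \<in> {1..<n} \<and> a < b \<and> b < m \<and> w i ! b < w i ! a}"

definition cell_param :: "nat \<Rightarrow> (nat \<Rightarrow> int list) \<Rightarrow> (nat \<times> nat \<times> nat \<Rightarrow> complex) \<Rightarrow> nat \<Rightarrow> complex mat" where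
  "cell_param m w x i = mat m m (\<lambda>(a, b).
     if a = b then 1 else if a < b \<and> w i ! b < w i ! a then x (i, a, b) else 0)"

lemma cell_param_carrier [simp]: "cell_param m w x i \<in> carrier_mat m m"
  by (simp add: cell_param_def)

lemma echelon_cell_param: "echelon m ((!) (w i)) (cell_param m w x i)"
  by (auto simp: echelon_def cell_param_def)

lemma echelon_eq_cell_param:
  assumes "echelon m ((!) (w i)) u" "\<And>a b. x (i, a, b) = u $$ (a, b)"
  shows "u = cell_param m w x i"
proof (rule eq_matI)
  fix a b assume "a < dim_row (cell_param m w x i)" "b < dim_col (cell_param m w x i)"
  then have ab: "a < m" "b < m" by (auto simp: cell_param_def)
  show "u $$ (a, b) = cell_param m w x i $$ (a, b)"
    using echelonD(2)[OF assms(1) ab(1)] echelonD(3)[OF assms(1) ab] ab assms(2)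
    by (auto simp: cell_param_def)
qed (use echelonD(1)[OF assms(1)] in \<open>auto simp: cell_param_def\<close>)

lemma finite_cell_vars: "finite (cell_vars m n w)"
  by (rule finite_subset[of _ "{1..<n} \<times> {..<m} \<times> {..<m}"]) (auto simp: cell_vars_def)

lemma (in fun_algebra) regular_UNIV_nth:
  assumes "regular UNIV M"
  shows "(\<lambda>x. fls_nth (M x) e) \<in> F"
proof -
  obtain f where f: "f \<in> F" "\<And>x. x \<in> UNIV \<Longrightarrow> fls_nth (M x) e = f x"
    using regular_nth[OF assms] by blast
  have "(\<lambda>x. fls_nth (M x) e) = f" by (rule ext) (rule f(2)[OF UNIV_I])
  then show ?thesis using f(1) by simp
qed

lemma cell_param_entry:
  assumes "fun_algebra F" "c < d \<Longrightarrow> w i ! d < w i ! c \<Longrightarrow> (\<lambda>x. x (i, c, d)) \<in> F" "c < m" "d < m"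
  shows "(\<lambda>x. cell_param m w x i $$ (c, d)) \<in> F"
proof (cases "c < d \<and> w i ! d < w i ! c")
  case True
  then show ?thesis using assms by (simp add: cell_param_def)
next
  case False
  then have "(\<lambda>x. cell_param m w x i $$ (c, d)) = (\<lambda>_. if c = d then 1 else 0)"
    using assms by (auto simp: cell_param_def)
  then show ?thesis using fun_algebra.const[OF assms(1)] by simp
qed

text \<open>The dimensions \<open>r\<close> are a parameter of the locale and not defined from
  \<open>w\<close>, so that two cells with the same \<open>r\<close> can be compared by the same
  semi-invariants.\<close>

locale cell_weights =
  fixes m n :: nat and r :: "nat \<Rightarrow> nat" and w :: "nat \<Rightarrow> int list"
  assumes n: "n > 0"
    and two: "\<And>i. i \<in> {1..<n} \<Longrightarrow> \<exists>z. \<forall>a<m. w i ! a = z \<or> w i ! a = z + 1"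
    and small: "\<And>i a. i \<in> {1..<n} \<Longrightarrow> a < m \<Longrightarrow> \<bar>w i ! a\<bar> \<le> 1"
    and r: "\<And>i. i \<in> {1..<n} \<Longrightarrow> r i = card (lat_set m n (psum w i))"
begin

lemma psum_bound: "j < n \<Longrightarrow> a < m \<Longrightarrow> \<bar>psum w j a\<bar> \<le> int j"
proof (induction j)
  case (Suc j)
  then have "\<bar>psum w j a\<bar> \<le> int j" "\<bar>w (Suc j) ! a\<bar> \<le> 1" using small[of "Suc j" a] by auto
  then show ?case unfolding psum_Suc by linarith
qed (simp add: psum_def)

text \<open>Echelon factors are unitriangular, so the diagonal of the product collects the powers of
  \<open>t\<close>. A torus factor with exponents of absolute value at most 1 costs one order of
  poles, in the product and in its inverse.\<close>

lemma gprod_triangular: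
  assumes "j < n" "\<And>i. i \<in> {1..j} \<Longrightarrow> echelon m ((!) (w i)) (u i)"
  shows "mat_val_ge m (- int j) (gprod m u w j) \<and>
    (\<exists>Ai. mat_val_ge m (- int j) Ai \<and> gprod m u w j * Ai = 1\<^sub>m m) \<and>
    (\<forall>a b. b < a \<longrightarrow> a < m \<longrightarrow> gprod m u w j $$ (a, b) = 0) \<and>
    (\<forall>a<m. gprod m u w j $$ (a, a) = tp (psum w j a))"
  using assms
proof (induction j)
  case 0
  have "\<exists>Ai. mat_val_ge m 0 Ai \<and> 1\<^sub>m m * Ai = 1\<^sub>m m" by (rule exI[of _ "1\<^sub>m m"]) simp
  then show ?case by (simp add: psum_def)
next
  case (Suc j)
  define G where "G = gprod m u w j"
  define E where "E = cmat (u (Suc j)) * tpow m ((!) (w (Suc j)))"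
  have IH: "mat_val_ge m (- int j) G" "\<exists>Ai. mat_val_ge m (- int j) Ai \<and> G * Ai = 1\<^sub>m m"
    "\<And>a b. b < a \<Longrightarrow> a < m \<Longrightarrow> G $$ (a, b) = 0" "\<And>a. a < m \<Longrightarrow> G $$ (a, a) = tp (psum w j a)"
    using Suc.IH Suc.prems unfolding G_def by auto
  have u: "echelon m ((!) (w (Suc j))) (u (Suc j))" using Suc.prems(2)[of "Suc j"] by simp
  have uc: "u (Suc j) \<in> carrier_mat m m" by (rule echelonD(1)[OF u])
  have w1: "\<bar>w (Suc j) ! a\<bar> \<le> 1" if "a < m" for a by (rule small) (use Suc.prems that in auto)
  have Gc: "G \<in> carrier_mat m m" using IH(1) by (simp add: mat_val_ge_def)
  have Ec: "E \<in> carrier_mat m m" using uc by (simp add: E_def)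
  have E: "E $$ (a, b) = fls_const (u (Suc j) $$ (a, b)) * tp (w (Suc j) ! b)" if "a < m" "b < m" for a b
    unfolding E_def using uc that by (subst mult_tpow_index) (auto simp: cmat_index)
  have Ev: "mat_val_ge m (- 1) E"
    unfolding mat_val_ge_def
  proof (intro conjI Ec allI impI)
    fix a b assume ab: "a < m" "b < m"
    have "- 1 \<le> w (Suc j) ! b" using w1[OF ab(2)] by linarith
    then have "val_ge (0 + - 1) (E $$ (a, b))"
      unfolding E[OF ab] by (intro val_ge_mult) (auto simp: val_ge_tp)
    then show "val_ge (- 1) (E $$ (a, b))" by simp
  qed
  have GE: "gprod m u w (Suc j) = G * E" by (simp add: G_def E_def)
  have prod: "(G * E) $$ (a, b) = (\<Sum>k<m. G $$ (a, k) * E $$ (k, b))" if "a < m" "b < m" for a b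
    by (rule mult_mat_index[OF Gc Ec that])
  have E0: "E $$ (k, b) = 0" if "b < k" "k < m" for k b
    using echelonD(3)[OF u that(2), of b] that E[of k b] by (cases "u (Suc j) $$ (k, b) = 0") auto
  have 1: "mat_val_ge m (- int (Suc j)) (G * E)"
  proof -
    have e: "- int (Suc j) = - int j + - 1" by simp
    show ?thesis unfolding e by (rule mat_val_ge_mult[OF IH(1) Ev])
  qed
  have 2: "(G * E) $$ (a, b) = 0" if "b < a" "a < m" for a b
  proof -
    have "G $$ (a, k) * E $$ (k, b) = 0" if "k \<in> {..<m}" for k
      using IH(3)[of k a] E0[of b k] that \<open>b < a\<close> \<open>a < m\<close> by (cases "k < a") auto
    then have "(\<Sum>k<m. G $$ (a, k) * E $$ (k, b)) = 0" by (intro sum.neutral ballI)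
    then show ?thesis using prod[of a b] that by simp
  qed
  have 3: "(G * E) $$ (a, a) = tp (psum w (Suc j) a)" if a: "a < m" for a
  proof -
    have "G $$ (a, k) * E $$ (k, a) = (if k = a then G $$ (a, a) * E $$ (a, a) else 0)" if "k \<in> {..<m}" for k
      using IH(3)[of k a] E0[of a k] that a by (cases "k < a"; cases "k = a") auto
    then have "(\<Sum>k<m. G $$ (a, k) * E $$ (k, a)) = (\<Sum>k<m. if k = a then G $$ (a, a) * E $$ (a, a) else 0)"
      by (rule sum.cong[OF refl])
    then have "(G * E) $$ (a, a) = G $$ (a, a) * E $$ (a, a)" unfolding prod[OF a a] using a by simp
    then show ?thesis using IH(4)[OF a] E[OF a a] echelonD(2)[OF u a] by (simp add: psum_Suc tp_add)
  qed
  obtain Ai where Ai: "mat_val_ge m (- int j) Ai" "G * Ai = 1\<^sub>m m" using IH(2) by blast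
  obtain B where B: "B \<in> GL_O m" "cmat (u (Suc j)) * B = 1\<^sub>m m" using GL_O_inverse[OF echelon_GL_O[OF u]] by blast
  define Ei where "Ei = tpow m (\<lambda>a. - (w (Suc j) ! a)) * B"
  note c = GL_O_carrier_mat[OF B(1)] uc
  have Aic: "Ai \<in> carrier_mat m m" using Ai(1) by (simp add: mat_val_ge_def)
  have Eic: "Ei \<in> carrier_mat m m" using c by (simp add: Ei_def)
  have EEi: "E * Ei = 1\<^sub>m m"
  proof -
    have "E * Ei = cmat (u (Suc j)) * (tpow m ((!) (w (Suc j))) * (tpow m (\<lambda>a. - (w (Suc j) ! a)) * B))"
      unfolding E_def Ei_def using c by (simp add: mat_assoc[of _ m])
    also have "\<dots> = cmat (u (Suc j)) * B"
      using c by (subst mat_cancel[OF tpow_inverse(1)]) auto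
    finally show ?thesis using B(2) by simp
  qed
  have "G * E * (Ei * Ai) = G * (E * (Ei * Ai))" using Gc Ec Eic Aic by (simp add: mat_assoc[of _ m])
  also have "\<dots> = 1\<^sub>m m" unfolding mat_cancel[OF EEi Ec Eic Aic] by (rule Ai(2))
  finally have inv: "G * E * (Ei * Ai) = 1\<^sub>m m" .
  have "mat_val_ge m (- 1) (tpow m (\<lambda>a. - (w (Suc j) ! a)))"
    unfolding mat_val_ge_def using w1 by (auto simp: tpow_index val_ge_tp abs_le_iff)
  then have "mat_val_ge m (- 1) Ei" unfolding Ei_def using B(1) by (rule mat_val_ge_mult_GL_O(1))
  moreover have "- int (Suc j) = - 1 + - int j" by simp
  ultimately have "mat_val_ge m (- int (Suc j)) (Ei * Ai)" using mat_val_ge_mult[OF _ Ai(1), of "- 1" Ei] by metis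
  then show ?case unfolding GE using 1 2 3 inv by blast
qed

definition Ainv :: "(nat \<Rightarrow> complex mat) \<Rightarrow> nat \<Rightarrow> complex fls mat" where
  "Ainv u i = (SOME Ai. mat_val_ge m (- int i) Ai \<and> gprod m u w i * Ai = 1\<^sub>m m)"

lemma triangular_lattice:
  assumes u: "\<And>i. i \<in> {1..<n} \<Longrightarrow> echelon m ((!) (w i)) (u i)" and i: "i \<in> {1..<n}"
  shows "triangular_lattice m n (gprod m u w i) (Ainv u i) (psum w i)"
proof -
  have "i < n" "\<And>j. j \<in> {1..i} \<Longrightarrow> echelon m ((!) (w j)) (u j)" using u i by auto
  note G = gprod_triangular[OF this]
  have "\<exists>Ai. mat_val_ge m (- int i) Ai \<and> gprod m u w i * Ai = 1\<^sub>m m" using G by blast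
  from someI_ex[OF this] have Ai: "mat_val_ge m (- int i) (Ainv u i)" "gprod m u w i * Ainv u i = 1\<^sub>m m"
    unfolding Ainv_def by blast+
  have weak: "mat_val_ge m (- int n) B" if "mat_val_ge m (- int i) B" for B
    using that i val_ge_mono[of "- int i" _ "- int n"] unfolding mat_val_ge_def by simp
  have A: "mat_val_ge m (- int i) (gprod m u w i)" using G by blast
  show ?thesis
  proof
    show "n > 0" by (rule n)
    show "mat_val_ge m (- int n) (gprod m u w i)" by (rule weak[OF A])
    show "mat_val_ge m (- int n) (Ainv u i)" by (rule weak[OF Ai(1)])
    show "gprod m u w i * Ainv u i = 1\<^sub>m m" by (rule Ai(2))
    show "\<And>a b. b < a \<Longrightarrow> a < m \<Longrightarrow> gprod m u w i $$ (a, b) = 0" using G by blast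
    show "\<And>a. a < m \<Longrightarrow> gprod m u w i $$ (a, a) = tp (psum w i a)" using G by blast
    show "\<bar>psum w i a\<bar> \<le> int n" if "a < m" for a using psum_bound[of i a] i that by simp
  qed
qed

lemmas triangular_cell = triangular_lattice[of "cell_param m w x", OF echelon_cell_param] for x

definition frame :: "nat \<Rightarrow> nat \<Rightarrow> nat \<Rightarrow> complex fls" where
  "frame i = std_frame m n (psum w i)"

lemma integral_frame_frame: "integral_frame m n r frame"
  using std_frame_val_ge r by (auto simp: integral_frame_def frame_def)

text \<open>The Pluecker coordinate that belongs to the torus fixed point of the cell, whose
  vertices are the lattices with exponents \<open>psum w i\<close>.\<close>

definition base_inv :: "(nat \<Rightarrow> complex fls mat) \<Rightarrow> (nat \<Rightarrow> nat \<Rightarrow> nat \<Rightarrow> complex fls) \<Rightarrow> complex" where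
  "base_inv g H = (\<Prod>i\<in>{1..<n}. det (delta_mat m n (r i) (std_compl m n (psum w i) (\<lambda>q. q)) (g i) (H i)))"

definition base_value :: complex where
  "base_value = (\<Prod>i\<in>{1..<n}. det (perm_mat (m * (2 * n)) (lat_perm m n (psum w i))))"

lemma base_value_nonzero: "base_value \<noteq> 0"
  unfolding base_value_def using det_perm_mat[OF lat_perm(1)] by simp

lemma semi_inv_base_inv: "semi_inv m n r 1 base_inv"
  unfolding base_inv_def[abs_def] by (rule semi_inv.delta)

lemma base_inv_cell:
  assumes u: "\<And>i. i \<in> {1..<n} \<Longrightarrow> echelon m ((!) (w i)) (u i)"
  shows "base_inv (gprod m u w) frame = base_value"
  unfolding base_inv_def base_value_def
proof (intro prod.cong refl)
  fix i assume i: "i \<in> {1..<n}"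
  show "det (delta_mat m n (r i) (std_compl m n (psum w i) (\<lambda>q. q)) (gprod m u w i) (frame i)) =
      det (perm_mat (m * (2 * n)) (lat_perm m n (psum w i)))"
    unfolding r[OF i] frame_def by (rule triangular_lattice.det_delta_mat_std[OF triangular_lattice[OF u i]])
qed

text \<open>Normalized to be 1 on the cell of \<open>w\<close>, so that its powers raise the degree
  of a semi-invariant without changing the values on this cell.\<close>

definition unit_inv :: "(nat \<Rightarrow> complex fls mat) \<Rightarrow> (nat \<Rightarrow> nat \<Rightarrow> nat \<Rightarrow> complex fls) \<Rightarrow> complex" where
  "unit_inv g H = inverse base_value * base_inv g H"

lemma semi_inv_unit_inv: "semi_inv m n r 1 unit_inv"
  unfolding unit_inv_def[abs_def] by (rule semi_inv_scale[OF semi_inv_base_inv])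

lemma unit_inv_cell:
  assumes u: "\<And>i. i \<in> {1..<n} \<Longrightarrow> echelon m ((!) (w i)) (u i)"
  shows "unit_inv (gprod m u w) frame = 1"
proof -
  have "base_inv (gprod m u w) frame = base_value" by (rule base_inv_cell[OF u])
  then show ?thesis by (simp add: unit_inv_def base_value_nonzero)
qed

definition cell_eval :: "((nat \<Rightarrow> complex fls mat) \<Rightarrow> (nat \<Rightarrow> nat \<Rightarrow> nat \<Rightarrow> complex fls) \<Rightarrow> complex) \<Rightarrow>
    (nat \<times> nat \<times> nat \<Rightarrow> complex) \<Rightarrow> complex" where
  "cell_eval f x = f (gprod m (cell_param m w x) w) frame"

lemma cell_eval_unit_inv: "cell_eval unit_inv x = 1"
  unfolding cell_eval_def by (rule unit_inv_cell[of "cell_param m w x", OF echelon_cell_param])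

text \<open>An identity checked on standard frames extends to all integral frames by
  \<open>semi_inv_frame_change\<close>, and thus places the whole cell in a closed set.\<close>

lemma cell_eval_semi_zeros:
  assumes f: "semi_inv m n r d f" and z: "\<And>x. cell_eval f x = 0"
  shows "cell m n w \<subseteq> Gr_proj m {1..<n} ` semi_zeros m n r f"
proof
  fix y assume "y \<in> cell m n w"
  then obtain u where u: "y = Gr_proj m {1..<n} (gpolygon m n u w)"
    "\<forall>i\<in>{1..<n}. echelon m ((!) (w i)) (u i)" unfolding cell_def by blast
  define x where "x = (\<lambda>(i, a, b). u i $$ (a, b))"
  have ux: "u i = cell_param m w x i" if "i \<in> {1..<n}" for i
    by (rule echelon_eq_cell_param[of m w i "u i" x, OF u(2)[rule_format, OF that]]) (simp add: x_def)
  have eq: "gprod m u w i = gprod m (cell_param m w x) w i" if "i \<in> {1..<n}" for i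
    by (rule gprod_cong) (use ux that in auto)
  have "gpolygon m n u w \<in> semi_zeros m n r f"
    unfolding semi_zeros_def
  proof (intro CollectI conjI allI impI)
    show "gpolygon m n u w \<in> loop_power m {1..<n}"
      by (rule gpolygon_loop_power, rule echelon_GL_O, rule u(2)[rule_format])
    fix H assume H: "integral_frame m n r H"
    obtain c where c: "\<forall>d f. semi_inv m n r d f \<longrightarrow> f (gprod m (cell_param m w x) w) H =
        c ^ d * f (gprod m (cell_param m w x) w) (\<lambda>i. std_frame m n (psum w i))"
      using semi_inv_frame_change[where A = "gprod m (cell_param m w x) w" and Ai = "Ainv (cell_param m w x)",
          OF triangular_cell r H] by blast
    have "f (gpolygon m n u w) H = f (gprod m (cell_param m w x) w) H"
      by (rule semi_inv_cong[OF f]) (simp add: gpolygon_def eq)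
    also have "\<dots> = c ^ d * cell_eval f x" using c f by (simp add: cell_eval_def frame_def[abs_def])
    finally show "f (gpolygon m n u w) H = 0" by (simp add: z)
  qed
  then show "y \<in> Gr_proj m {1..<n} ` semi_zeros m n r f" using u(1) by blast
qed

lemma semi_zeros_cell_eval:
  assumes f: "semi_inv m n r d f" and sub: "cell m n w \<subseteq> Gr_proj m {1..<n} ` semi_zeros m n r f"
  shows "cell_eval f x = 0"
proof -
  let ?g = "gpolygon m n (cell_param m w x) w"
  have "Gr_proj m {1..<n} ?g \<in> cell m n w"
    unfolding cell_def by (intro CollectI exI[of _ "cell_param m w x"] conjI refl ballI echelon_cell_param)
  then have "Gr_proj m {1..<n} ?g \<in> Gr_proj m {1..<n} ` semi_zeros m n r f" using sub by blast
  then obtain g0 where g0: "g0 \<in> semi_zeros m n r f" "Gr_proj m {1..<n} ?g = Gr_proj m {1..<n} g0" by blast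
  have "?g \<in> loop_power m {1..<n}" by (rule gpolygon_loop_power, rule echelon_GL_O, rule echelon_cell_param)
  then have "?g \<in> semi_zeros m n r f" by (rule semi_zeros_invariant[OF f g0(1) _ g0(2)])
  then have "f ?g frame = 0" using integral_frame_frame by (simp add: semi_zeros_def)
  moreover have "f ?g frame = cell_eval f x"
    unfolding cell_eval_def by (rule semi_inv_cong[OF f]) (simp add: gpolygon_def)
  ultimately show ?thesis by simp
qed

text \<open>Homogeneous elements of all degrees, read as functions in the chart where
  \<open>unit_inv\<close> equals 1, as on an affine chart of a projective variety.\<close>

definition coord_algebra :: "((nat \<times> nat \<times> nat \<Rightarrow> complex) \<Rightarrow> complex) set" where
  "coord_algebra = {\<phi>. \<exists>d f. semi_inv m n r d f \<and> (\<forall>x. cell_eval f x = \<phi> x)}"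

lemma coord_algebra_raise:
  assumes "semi_inv m n r d f"
  shows "semi_inv m n r (d + e) (\<lambda>g H. f g H * unit_inv g H ^ e)"
    "cell_eval (\<lambda>g H. f g H * unit_inv g H ^ e) x = cell_eval f x"
  using semi_inv.mult[OF assms semi_inv_power[OF semi_inv_unit_inv, of e]] cell_eval_unit_inv[of x]
  by (simp_all add: cell_eval_def)

text \<open>Sums require equal degrees; each summand is raised by the degree of the other one with
  powers of \<open>unit_inv\<close>.\<close>

lemma fun_algebra_coord: "fun_algebra coord_algebra"
proof
  show "(\<lambda>_. c) \<in> coord_algebra" for c
    unfolding coord_algebra_def
    by (intro CollectI exI[of _ 0] exI[of _ "\<lambda>_ _. c"] conjI semi_inv.const) (simp add: cell_eval_def)
  fix \<phi> \<psi> assume "\<phi> \<in> coord_algebra" "\<psi> \<in> coord_algebra"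
  then obtain d f e g where f: "semi_inv m n r d f" "\<And>x. cell_eval f x = \<phi> x"
    and g: "semi_inv m n r e g" "\<And>x. cell_eval g x = \<psi> x" unfolding coord_algebra_def by auto
  show "(\<lambda>x. \<phi> x + \<psi> x) \<in> coord_algebra"
    unfolding coord_algebra_def
  proof (intro CollectI exI conjI allI)
    show "semi_inv m n r (d + e) (\<lambda>h H. f h H * unit_inv h H ^ e + g h H * unit_inv h H ^ d)"
      using coord_algebra_raise(1)[OF f(1), of e] coord_algebra_raise(1)[OF g(1), of d]
      by (intro semi_inv.add) (simp_all add: add.commute)
    show "cell_eval (\<lambda>h H. f h H * unit_inv h H ^ e + g h H * unit_inv h H ^ d) x = \<phi> x + \<psi> x" for x
      using f(2)[of x] g(2)[of x] cell_eval_unit_inv[of x] by (simp add: cell_eval_def)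
  qed
  show "(\<lambda>x. \<phi> x * \<psi> x) \<in> coord_algebra"
    unfolding coord_algebra_def
  proof (intro CollectI exI conjI allI)
    show "semi_inv m n r (d + e) (\<lambda>h H. f h H * g h H)" by (rule semi_inv.mult[OF f(1) g(1)])
    show "cell_eval (\<lambda>h H. f h H * g h H) x = \<phi> x * \<psi> x" for x
      using f(2)[of x] g(2)[of x] by (simp add: cell_eval_def)
  qed
qed

sublocale R: fun_algebra coord_algebra by (rule fun_algebra_coord)

text \<open>The inverse of \<open>lat_mat\<close>, because its determinant is 1.\<close>

definition cell_inverse :: "nat \<Rightarrow> (nat \<times> nat \<times> nat \<Rightarrow> complex) \<Rightarrow> complex mat" where
  "cell_inverse i x = adj_mat (lat_mat m n (psum w i) (\<lambda>q. q) (gprod m (cell_param m w x) w i))"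

lemma cell_inverse:
  assumes i: "i \<in> {1..<n}"
  shows "cell_inverse i x \<in> carrier_mat (m * (2 * n)) (m * (2 * n))"
    "lat_mat m n (psum w i) (\<lambda>q. q) (gprod m (cell_param m w x) w i) * cell_inverse i x = 1\<^sub>m (m * (2 * n))"
    "cell_inverse i x * lat_mat m n (psum w i) (\<lambda>q. q) (gprod m (cell_param m w x) w i) = 1\<^sub>m (m * (2 * n))"
  unfolding cell_inverse_def
  using adj_mat[OF lat_mat_carrier, of m n "psum w i" "\<lambda>q. q" "gprod m (cell_param m w x) w i"]
    triangular_lattice.det_lat_mat[OF triangular_cell[OF i, of x]]
  by (auto intro!: eq_matI)

text \<open>By Cramer's rule the entry is a Pluecker coordinate divided by the one that is constant
  on the cell. The two differ by one exchanged unit vector at the vertex \<open>i\<close>; the other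
  factors are equal and cancel.\<close>

lemma cell_inverse_coord:
  assumes i: "i \<in> {1..<n}" and q: "q0 < m * (2 * n)" "q0 \<notin> lat_set m n (psum w i)" "q1 < m * (2 * n)"
  shows "(\<lambda>x. cell_inverse i x $$ (q0, q1)) \<in> coord_algebra"
proof -
  define T where "T j = std_compl m n (psum w j) (if j = i then (\<lambda>q. q)(q0 := q1) else (\<lambda>q. q))" for j
  let ?f = "\<lambda>g H. inverse base_value * (\<Prod>j\<in>{1..<n}. det (delta_mat m n (r j) (T j) (g j) (H j)))"
  have "cell_eval ?f x = cell_inverse i x $$ (q0, q1)" for x
  proof -
    let ?A = "gprod m (cell_param m w x) w"
    let ?k = "\<lambda>j. det (perm_mat (m * (2 * n)) (lat_perm m n (psum w j)))"
    have "(\<Prod>j\<in>{1..<n}. det (delta_mat m n (r j) (T j) (?A j) (frame j))) =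
        (\<Prod>j\<in>{1..<n}. (if j = i then cell_inverse i x $$ (q0, q1) else 1) * ?k j)"
    proof (intro prod.cong refl)
      fix j assume j: "j \<in> {1..<n}"
      interpret t: triangular_lattice m n "?A j" "Ainv (cell_param m w x) j" "psum w j"
        by (rule triangular_cell[OF j])
      show "det (delta_mat m n (r j) (T j) (?A j) (frame j)) =
          (if j = i then cell_inverse i x $$ (q0, q1) else 1) * ?k j"
        unfolding r[OF j] frame_def T_def
        using t.det_delta_mat_std t.det_delta_mat_exchange[of q0 q1 "cell_inverse i x"] q cell_inverse(1,2)[OF i, of x]
        by auto
    qed
    also have "\<dots> = cell_inverse i x $$ (q0, q1) * base_value"
      unfolding prod.distrib base_value_def using i by simp
    finally show ?thesis using base_value_nonzero by (simp add: cell_eval_def)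
  qed
  moreover have "semi_inv m n r 1 ?f" by (rule semi_inv_scale, rule semi_inv.delta)
  ultimately show ?thesis unfolding coord_algebra_def by blast
qed

text \<open>The coordinate \<open>x (i, a, b)\<close> is the leading coefficient of the entry \<open>(a, b)\<close> of the \<open>i\<close>-th
  matrix, which is read off the Pluecker coordinates up to terms with coordinates of smaller \<open>(i, b - a)\<close>.\<close>

lemma coord_algebra_var:
  assumes "i \<in> {1..<n}" "a < b" "b < m" "w i ! b < w i ! a"
  shows "(\<lambda>x. x (i, a, b)) \<in> coord_algebra"
  using assms
proof (induction i arbitrary: a b rule: less_induct)
  case (less i)
  note IH_i = less.IH
  have i: "i \<in> {1..<n}" by (rule less.prems(1))
  define i' where "i' = i - 1"
  have i': "i = Suc i'" "i' < n" using i by (auto simp: i'_def)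
  have "R.regular_mat m UNIV (\<lambda>x. gprod m (cell_param m w x) w i')"
  proof (rule R.regular_mat_gprod)
    fix j c d assume j: "j \<in> {1..i'}" and cd: "c < m" "d < m"
    have "(\<lambda>x. x (j, c, d)) \<in> coord_algebra" if "c < d" "w j ! d < w j ! c"
      by (rule IH_i) (use j i i' that cd in auto)
    then show "(\<lambda>x. cell_param m w x j $$ (c, d)) \<in> coord_algebra"
      by (rule cell_param_entry[OF fun_algebra_coord _ cd])
  qed simp
  then have reg: "R.regular UNIV (\<lambda>x. gprod m (cell_param m w x) w i' $$ (c, k))" if "c < m" "k < m" for c k
    using that by (simp add: R.regular_mat_def)
  have B: "(\<lambda>x. fls_nth (gprod m (cell_param m w x) w i' $$ (c, k)) e) \<in> coord_algebra"
    if "c < m" "k < m" for c k e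
    by (rule R.regular_UNIV_nth[OF reg[OF that]])
  have B0: "gprod m (cell_param m w x) w i' $$ (c, k) = 0" if "k < c" "c < m" for x c k
    using gprod_triangular[of i' "cell_param m w x", OF i'(2) echelon_cell_param] that by blast
  have Bd: "gprod m (cell_param m w x) w i' $$ (c, c) = tp (psum w i' c)" if "c < m" for x c
    using gprod_triangular[of i' "cell_param m w x", OF i'(2) echelon_cell_param] that by blast
  have coef: "fls_nth (gprod m (cell_param m w x) w i $$ (c, d)) e =
      (\<Sum>k<m. fls_nth (gprod m (cell_param m w x) w i' $$ (c, k)) (e - w i ! d) * cell_param m w x i $$ (k, d))"
    if "c < m" "d < m" for x c d e
  proof -
    have Gc: "gprod m (cell_param m w x) w i' \<in> carrier_mat m m"
      by (rule GL_K_carrier_mat, rule gprod_GL_K, rule echelon_GL_O, rule echelon_cell_param)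
    have "gprod m (cell_param m w x) w i $$ (c, d) = (\<Sum>k<m. gprod m (cell_param m w x) w i' $$ (c, k) *
        (cmat (cell_param m w x i) * tpow m ((!) (w i))) $$ (k, d))"
      unfolding i'(1) gprod.simps by (rule mult_mat_index[OF Gc _ that]) simp
    also have "\<dots> = (\<Sum>k<m. gprod m (cell_param m w x) w i' $$ (c, k) * fls_const (cell_param m w x i $$ (k, d)) * tp (w i ! d))"
    proof (intro sum.cong refl)
      fix k assume "k \<in> {..<m}"
      then have "(cmat (cell_param m w x i) * tpow m ((!) (w i))) $$ (k, d) =
          fls_const (cell_param m w x i $$ (k, d)) * tp (w i ! d)"
        using that by (subst mult_tpow_index) (auto simp: cmat_index cell_param_def)
      then show "gprod m (cell_param m w x) w i' $$ (c, k) * (cmat (cell_param m w x i) * tpow m ((!) (w i))) $$ (k, d) =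
          gprod m (cell_param m w x) w i' $$ (c, k) * fls_const (cell_param m w x i $$ (k, d)) * tp (w i ! d)"
        by (simp add: mult.assoc)
    qed
    finally show ?thesis by (simp add: fls_nth_sum)
  qed
  show ?case
    using less.prems(2-4)
  proof (induction "b - a" arbitrary: a b rule: less_induct)
    case (less a b)
    note IH = less.hyps
    have u_coord: "(\<lambda>x. cell_param m w x i $$ (k, b)) \<in> coord_algebra" if "a < k" "k < m" for k
    proof (cases "k < b \<and> w i ! b < w i ! k")
      case True
      have "(\<lambda>x. x (i, k, b)) \<in> coord_algebra" by (rule IH) (use True that less.prems in auto)
      then show ?thesis using True less.prems that by (simp add: cell_param_def)
    next
      case False
      then have "(\<lambda>x. cell_param m w x i $$ (k, b)) = (\<lambda>_. if k = b then 1 else 0)"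
        using that less.prems by (auto simp: cell_param_def)
      then show ?thesis using R.const by simp
    qed
    have low: "(\<lambda>x. fls_nth (gprod m (cell_param m w x) w i $$ (c, b)) e) \<in> coord_algebra"
      if c: "a < c" "c < m" for c e
    proof -
      have "(\<lambda>x. fls_nth (gprod m (cell_param m w x) w i' $$ (c, k)) (e - w i ! b) * cell_param m w x i $$ (k, b)) \<in> coord_algebra"
        if "k \<in> {..<m}" for k
      proof (cases "k < c")
        case True
        then show ?thesis using B0[OF True c(2)] R.const by simp
      next
        case False
        then show ?thesis using c that by (intro R.mult B u_coord) auto
      qed
      then show ?thesis unfolding coef[OF c(2) less.prems(2)] by (rule R.sum)
    qed
    have am: "a < m" using less.prems by simp
    obtain z where z: "\<forall>a<m. w i ! a = z \<or> w i ! a = z + 1" using two[OF i] by blast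
    have step: "w i ! a = w i ! b + 1" using z[rule_format, OF am] z[rule_format, OF less.prems(2)] less.prems(3) by auto
    have psum_i: "psum w i c = psum w i' c + w i ! c" for c unfolding i'(1) by (rule psum_Suc)
    have pb: "\<bar>psum w i c\<bar> \<le> int n - 1" if "c < m" for c using psum_bound[of i c] i that by auto
    \<comment> \<open>The position just below the lattice in row \<open>a\<close>. There the summand
      \<open>k = a\<close> of the product contributes \<open>x (i, a, b)\<close>: its exponent is
      \<open>psum w i' a + w i ! b\<close>, and an inversion between adjacent values means
      \<open>w i ! b = w i ! a - 1\<close>.\<close>
    obtain q0 where q0: "q0 < m * (2 * n)" "q0 div (2 * n) = a" "expo n q0 = psum w i a - 1"
      by (rule coordinate_index[OF n am, of "psum w i a - 1"]) (use pb[OF am] in auto)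
    obtain q1 where q1: "q1 < m * (2 * n)" "q1 div (2 * n) = b" "expo n q1 = psum w i b"
      by (rule coordinate_index[OF n less.prems(2), of "psum w i b"]) (use pb[OF less.prems(2)] in auto)
    have q0_out: "q0 \<notin> lat_set m n (psum w i)" using q0 by (simp add: lat_set_def)
    \<comment> \<open>The summands with \<open>k < a\<close> vanish by triangularity. Those with
      \<open>k > a\<close> involve the partial product before step \<open>i\<close> and coordinates
      \<open>x (i, k, b)\<close> with a smaller difference of indices.\<close>
    define rest where "rest x = (\<Sum>k\<in>{..<m} - {a}. fls_nth (gprod m (cell_param m w x) w i' $$ (a, k)) (psum w i a - 1 - w i ! b) *
        cell_param m w x i $$ (k, b))" for x
    have rest: "rest \<in> coord_algebra"
      unfolding rest_def
    proof (rule R.sum)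
      fix k assume k: "k \<in> {..<m} - {a}"
      show "(\<lambda>x. fls_nth (gprod m (cell_param m w x) w i' $$ (a, k)) (psum w i a - 1 - w i ! b) *
        cell_param m w x i $$ (k, b)) \<in> coord_algebra"
      proof (cases "k < a")
        case True
        then show ?thesis using B0[OF True am] R.const by simp
      next
        case False
        then show ?thesis using k am by (intro R.mult B u_coord) auto
      qed
    qed
    have lead: "fls_nth (gprod m (cell_param m w x) w i $$ (a, b)) (psum w i a - 1) = x (i, a, b) + rest x" for x
    proof -
      have "fls_nth (gprod m (cell_param m w x) w i $$ (a, b)) (psum w i a - 1) =
          fls_nth (gprod m (cell_param m w x) w i' $$ (a, a)) (psum w i a - 1 - w i ! b) * cell_param m w x i $$ (a, b) + rest x"
        unfolding coef[OF am less.prems(2)] rest_def by (rule sum.remove) (use am in auto)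
      moreover have "fls_nth (gprod m (cell_param m w x) w i' $$ (a, a)) (psum w i a - 1 - w i ! b) = 1"
        unfolding Bd[OF am] fls_nth_tp psum_i step by simp
      moreover have "cell_param m w x i $$ (a, b) = x (i, a, b)" using less.prems am by (simp add: cell_param_def)
      ultimately show ?thesis by simp
    qed
    let ?S = "{q. q < m * (2 * n) \<and> a < q div (2 * n)}"
    have rel: "x (i, a, b) = - (\<Sum>q\<in>?S. cell_inverse i x $$ (q0, q) *
        fls_nth (gprod m (cell_param m w x) w i $$ (q div (2 * n), b)) (expo n q)) - rest x" for x
    proof -
      interpret t: triangular_lattice m n "gprod m (cell_param m w x) w i" "Ainv (cell_param m w x) i" "psum w i"
        by (rule triangular_cell[OF i])
      have "fls_nth (gprod m (cell_param m w x) w i $$ (a, b)) (expo n q0) = - (\<Sum>q\<in>?S. cell_inverse i x $$ (q0, q) *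
        fls_nth (gprod m (cell_param m w x) w i $$ (q div (2 * n), b)) (expo n q))"
        by (rule t.coefficient_relation[OF cell_inverse(1,3)[OF i] q0(1,2) q1 less.prems(1)])
      then show ?thesis using lead[of x] q0(3) by (simp add: eq_diff_eq)
    qed
    have "(\<lambda>x. - (\<Sum>q\<in>?S. cell_inverse i x $$ (q0, q) *
        fls_nth (gprod m (cell_param m w x) w i $$ (q div (2 * n), b)) (expo n q)) - rest x) \<in> coord_algebra"
    proof (intro R.diff R.minus R.sum R.mult rest)
      fix q assume "q \<in> ?S"
      then have q: "q < m * (2 * n)" "a < q div (2 * n)" by auto
      show "(\<lambda>x. cell_inverse i x $$ (q0, q)) \<in> coord_algebra" by (rule cell_inverse_coord[OF i q0(1) q0_out q(1)])
      show "(\<lambda>x. fls_nth (gprod m (cell_param m w x) w i $$ (q div (2 * n), b)) (expo n q)) \<in> coord_algebra"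
        by (rule low[OF q(2) div_less[OF q(1)]])
    qed
    then show ?case unfolding rel[symmetric] .
  qed
qed

text \<open>Complements \<open>coord_algebra_var\<close>: on a cell, semi-invariants are polynomials
  in as many variables as the cell has coordinates, which makes \<open>algebraic_dependence\<close>
  applicable.\<close>

lemma cell_eval_polyfun:
  assumes "semi_inv m n r d f"
  shows "cell_eval f \<in> polyfun (cell_vars m n w)"
proof -
  interpret P: fun_algebra "polyfun (cell_vars m n w)" by (rule fun_algebra_polyfun)
  have G: "P.regular_mat m UNIV (\<lambda>x. gprod m (cell_param m w x) w i)" if i: "i \<in> {1..<n}" for i
  proof (rule P.regular_mat_gprod)
    fix j c d assume j: "j \<in> {1..i}" and cd: "c < m" "d < m"
    have "(\<lambda>x. x (j, c, d)) \<in> polyfun (cell_vars m n w)" if "c < d" "w j ! d < w j ! c"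
      by (rule polyfun.var) (use that j i cd in \<open>auto simp: cell_vars_def\<close>)
    then show "(\<lambda>x. cell_param m w x j $$ (c, d)) \<in> polyfun (cell_vars m n w)"
      by (rule cell_param_entry[OF fun_algebra_polyfun _ cd])
  qed simp
  show ?thesis
    using assms
  proof induction
    case (const c)
    then show ?case unfolding cell_eval_def[abs_def] by (rule P.const)
  next
    case (delta T)
    show ?case
      unfolding cell_eval_def[abs_def]
    proof (rule P.prod, rule P.det)
      fix i a b assume i: "i \<in> {1..<n}" and ab: "a < m * (2 * n)" "b < m * (2 * n)"
      show "(\<lambda>x. delta_mat m n (r i) (T i) (gprod m (cell_param m w x) w i) (frame i) $$ (a, b)) \<in> polyfun (cell_vars m n w)"
      proof (cases "b < r i")
        case True
        have "P.regular UNIV (\<lambda>x. \<Sum>c<m. gprod m (cell_param m w x) w i $$ (a div (2 * n), c) * frame i b c)"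
          by (intro P.regular_sum P.regular_mult P.regular_fixed)
            (use G[OF i] div_less[OF ab(1)] in \<open>simp add: P.regular_mat_def\<close>)
        from P.regular_UNIV_nth[OF this, of "expo n a"] show ?thesis using True ab by (simp add: delta_mat_def)
      next
        case False
        then show ?thesis using ab P.const by (simp add: delta_mat_def)
      qed
    qed simp
  next
    case (add d f f')
    from P.add[OF add.IH] show ?case unfolding cell_eval_def[abs_def] .
  next
    case (mult d f e f')
    from P.mult[OF mult.IH] show ?case unfolding cell_eval_def[abs_def] .
  qed
qed

end

section \<open>No cell lies in the closure of another one\<close>

text \<open>The zero set of \<open>f\<close> is closed in \<open>Gr_top\<close>, so an identity on
  the cell of \<open>w\<close> passes to its closure and thus to the cell of
  \<open>v\<close>.\<close>

lemma cell_eval_transfer: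
  assumes v: "cell_weights m n r v" and w: "cell_weights m n r w"
    and sub: "cell m n v \<subseteq> (Gr_top m {1..<n}) closure_of (cell m n w)"
    and f: "semi_inv m n r d f" and zero: "\<And>x. cell_weights.cell_eval m n w f x = 0"
  shows "cell_weights.cell_eval m n v f x = 0"
proof (rule cell_weights.semi_zeros_cell_eval[OF v f])
  have "(Gr_top m {1..<n}) closure_of (cell m n w) \<subseteq> Gr_proj m {1..<n} ` semi_zeros m n r f"
    by (rule closure_of_minimal[OF cell_weights.cell_eval_semi_zeros[OF w f zero] closedin_Gr_semi_zeros[OF f]])
  then show "cell m n v \<subseteq> Gr_proj m {1..<n} ` semi_zeros m n r f" using sub by (rule subset_trans[rotated])
qed

text \<open>The complement fixed by \<open>v\<close> leaves more room in the rows from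
  \<open>b0\<close> on than the lattices in the cell of \<open>w\<close> can fill at the vertex
  \<open>i\<close>; one vanishing factor is enough.\<close>

lemma base_inv_vanishes:
  assumes v: "cell_weights m n r v" and w: "cell_weights m n r w" and i: "i \<in> {1..<n}"
    and less: "card {p \<in> lat_set m n (psum w i). b0 \<le> p div (2 * n)} < card {p \<in> lat_set m n (psum v i). b0 \<le> p div (2 * n)}"
  shows "cell_weights.cell_eval m n w (cell_weights.base_inv m n r v) x = 0"
proof -
  interpret V: cell_weights m n r v by (rule v)
  interpret W: cell_weights m n r w by (rule w)
  let ?A = "gprod m (cell_param m w x) w"
  have "det (delta_mat m n (r i) (std_compl m n (psum v i) (\<lambda>q. q)) (?A i) (W.frame i)) = 0"
    unfolding W.frame_def W.r[OF i]
    by (rule triangular_lattice.det_delta_mat_zero[OF W.triangular_cell[OF i] _ less])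
      (use V.r[OF i] W.r[OF i] in simp)
  then show ?thesis
    unfolding W.cell_eval_def V.base_inv_def using i by (intro prod_zero) auto
qed

text \<open>If the sums of the bottom weights of the cell of \<open>v\<close> are larger, then \<open>W.base_inv\<close> is a
  nonzero constant on the cell of \<open>w\<close> and vanishes on the one of \<open>v\<close>. The coordinates of the latter
  satisfy an algebraic relation on the former, by a dimension count; made homogeneous with
  \<open>W.base_inv\<close>, it restricts to its top degree part on the cell of \<open>v\<close>.\<close>

lemma cell_not_in_closure:
  assumes v: "cell_weights m n r v" and w: "cell_weights m n r w"
    and card: "card (cell_vars m n w) \<le> card (cell_vars m n v)"
    and sub: "cell m n v \<subseteq> (Gr_top m {1..<n}) closure_of (cell m n w)"
    and ia: "i \<in> {1..<n}" "a < m"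
  shows "psum v i a = psum w i a"
proof (rule ccontr)
  assume ne: "psum v i a \<noteq> psum w i a"
  interpret V: cell_weights m n r v by (rule v)
  interpret W: cell_weights m n r w by (rule w)
  obtain b0 where b0: "(\<Sum>a\<in>{b0..<m}. psum v i a) \<noteq> (\<Sum>a\<in>{b0..<m}. psum w i a)"
    using bottom_sums_differ[of a m "psum v i" "psum w i"] ia(2) ne by metis
  have bound: "\<bar>psum v i c\<bar> \<le> int n" "\<bar>psum w i c\<bar> \<le> int n" if "c < m" for c
    using V.psum_bound[of i c] W.psum_bound[of i c] ia that by auto
  define cv where "cv = card {p \<in> lat_set m n (psum v i). b0 \<le> p div (2 * n)}"
  define cw where "cw = card {p \<in> lat_set m n (psum w i). b0 \<le> p div (2 * n)}"
  have "int cv = (\<Sum>a\<in>{b0..<m}. int n - psum v i a)" "int cw = (\<Sum>a\<in>{b0..<m}. int n - psum w i a)"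
    unfolding cv_def cw_def using card_lat_set[OF V.n] bound by blast+
  then have "int cv \<noteq> int cw" using b0 by (simp add: sum_subtractf)
  then consider "cw < cv" | "cv < cw" by linarith
  then show False
  proof cases
    case 1
    \<comment> \<open>\<open>V.base_inv\<close> vanishes on the cell of \<open>w\<close>, hence on
      that of \<open>v\<close>, where it is a nonzero constant.\<close>
    have "V.cell_eval V.base_inv x = 0" for x
      by (rule cell_eval_transfer[OF v w sub V.semi_inv_base_inv base_inv_vanishes[OF v w ia(1) 1[unfolded cv_def cw_def]]])
    moreover have "V.cell_eval V.base_inv x = V.base_value" for x
      unfolding V.cell_eval_def by (rule V.base_inv_cell[of "cell_param m v x", OF echelon_cell_param])
    ultimately show False using V.base_value_nonzero by simp
  next
    case 2
    let ?X = "cell_vars m n v"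
    have G0: "V.cell_eval W.unit_inv x = 0" for x
      using base_inv_vanishes[OF w v ia(1) 2[unfolded cv_def cw_def], of x]
      by (simp add: V.cell_eval_def W.unit_inv_def)
    have "\<forall>y\<in>?X. \<exists>d f. semi_inv m n r d f \<and> (\<forall>x. V.cell_eval f x = x y)"
    proof
      fix y assume y: "y \<in> ?X"
      obtain i a b where iab: "y = (i, a, b)" by (cases y)
      have "(\<lambda>x. x (i, a, b)) \<in> V.coord_algebra"
        by (rule V.coord_algebra_var) (use y iab in \<open>auto simp: cell_vars_def\<close>)
      then show "\<exists>d f. semi_inv m n r d f \<and> (\<forall>x. V.cell_eval f x = x y)"
        unfolding V.coord_algebra_def iab by (rule CollectD)
    qed
    then obtain d where "\<forall>y\<in>?X. \<exists>f. semi_inv m n r (d y) f \<and> (\<forall>x. V.cell_eval f x = x y)"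
      by (rule bchoice[THEN exE])
    then obtain f where f: "\<forall>y\<in>?X. semi_inv m n r (d y) (f y) \<and> (\<forall>x. V.cell_eval (f y) x = x y)"
      by (rule bchoice[THEN exE])
    \<comment> \<open>The successor makes \<open>e\<close> positive even without coordinates, so
      that the power \<open>G\<close> of \<open>W.unit_inv\<close> still vanishes on the cell of
      \<open>v\<close>.\<close>
    define e where "e = Suc (\<Sum>y\<in>?X. d y)"
    have de: "d y \<le> e" if "y \<in> ?X" for y
      using member_le_sum[of y ?X d] that finite_cell_vars[of m n v] by (simp add: e_def)
    \<comment> \<open>\<open>None\<close> stands for a power of \<open>V.unit_inv\<close>, which is
      1 on the cell of \<open>v\<close>. With it there is one function more than coordinates of the
      cell of \<open>v\<close>, hence more than coordinates of the cell of \<open>w\<close>.\<close>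
    define K where "K = insert None (Some ` ?X)"
    define F where "F k = (case k of None \<Rightarrow> (\<lambda>g H. V.unit_inv g H ^ e)
      | Some y \<Rightarrow> (\<lambda>g H. f y g H * V.unit_inv g H ^ (e - d y)))" for k
    define G where "G = (\<lambda>g H. W.unit_inv g H ^ e)"
    have finK: "finite K" unfolding K_def using finite_cell_vars by simp
    have semiF: "semi_inv m n r e (F k)" if "k \<in> K" for k
    proof (cases k)
      case None
      then show ?thesis using semi_inv_power[OF V.semi_inv_unit_inv, of e] by (simp add: F_def)
    next
      case (Some y)
      then have y: "y \<in> ?X" using that by (auto simp: K_def)
      then have "semi_inv m n r (d y) (f y)" using f by blast
      from V.coord_algebra_raise(1)[OF this, of "e - d y"] show ?thesis
        using de[OF y] Some by (simp add: F_def)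
    qed
    have semiG: "semi_inv m n r e G"
      unfolding G_def using semi_inv_power[OF W.semi_inv_unit_inv, of e] by simp
    have F_None: "V.cell_eval (F None) x = 1" for x
      using V.cell_eval_unit_inv[of x] by (simp add: F_def V.cell_eval_def)
    have F_Some: "V.cell_eval (F (Some y)) x = x y" if y: "y \<in> ?X" for x y
    proof -
      have "semi_inv m n r (d y) (f y)" using f y by blast
      from V.coord_algebra_raise(2)[OF this, of "e - d y" x] show ?thesis using f y by (simp add: F_def)
    qed
    have cardK: "card (cell_vars m n w) < card K"
      using card finite_cell_vars[of m n v] by (simp add: K_def card_image)
    have pf: "W.cell_eval (F k) \<in> polyfun (cell_vars m n w)" if "k \<in> K" for k
      by (rule W.cell_eval_polyfun[OF semiF[OF that]])
    obtain D c where c: "\<exists>\<alpha>\<in>K \<rightarrow>\<^sub>E {..D}. c \<alpha> \<noteq> 0"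
      "\<And>x. (\<Sum>\<alpha>\<in>K \<rightarrow>\<^sub>E {..D}. c \<alpha> * (\<Prod>k\<in>K. W.cell_eval (F k) x ^ \<alpha> k)) = 0"
      by (rule algebraic_dependence[where F = "\<lambda>k. W.cell_eval (F k)", OF finite_cell_vars finK cardK pf])
        (assumption, rule that)
    define S where "S = {\<alpha> \<in> K \<rightarrow>\<^sub>E {..D}. c \<alpha> \<noteq> 0}"
    define deg where "deg \<alpha> = (\<Sum>k\<in>K. \<alpha> k)" for \<alpha> :: "(nat \<times> nat \<times> nat) option \<Rightarrow> nat"
    define L where "L = Max (deg ` S)"
    have finS: "finite S" unfolding S_def using finK by (auto simp: finite_PiE)
    have "S \<noteq> {}" using c(1) by (auto simp: S_def)
    then have "L \<in> deg ` S" unfolding L_def using finS by (intro Max_in) auto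
    then obtain \<alpha>0 where \<alpha>0: "\<alpha>0 \<in> S" "deg \<alpha>0 = L" by blast
    have degL: "deg \<alpha> \<le> L" if "\<alpha> \<in> S" for \<alpha>
      unfolding L_def using finS that by (intro Max_ge) auto
    \<comment> \<open>Powers of \<open>G\<close> pad all monomials to the top degree. On the cell of
      \<open>w\<close> they are 1 and \<open>Rel\<close> is the relation found; on the cell of
      \<open>v\<close> they are 0 and only the monomials of top degree survive.\<close>
    define Rel where "Rel g H = (\<Sum>\<alpha>\<in>S. c \<alpha> * (G g H ^ (L - deg \<alpha>) * (\<Prod>k\<in>K. F k g H ^ \<alpha> k)))" for g H
    have "semi_inv m n r (L * e) Rel"
      unfolding Rel_def[abs_def]
    proof (intro semi_inv_sum semi_inv_scale)
      fix \<alpha> assume \<alpha>: "\<alpha> \<in> S"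
      have "semi_inv m n r ((L - deg \<alpha>) * e + deg \<alpha> * e) (\<lambda>g H. G g H ^ (L - deg \<alpha>) * (\<Prod>k\<in>K. F k g H ^ \<alpha> k))"
        unfolding deg_def by (intro semi_inv.mult semi_inv_power[OF semiG] semi_inv_prod_power[OF finK semiF])
      moreover have "(L - deg \<alpha>) * e + deg \<alpha> * e = L * e"
        using degL[OF \<alpha>] by (simp add: add_mult_distrib[symmetric])
      ultimately show "semi_inv m n r (L * e) (\<lambda>g H. G g H ^ (L - deg \<alpha>) * (\<Prod>k\<in>K. F k g H ^ \<alpha> k))" by simp
    qed
    moreover have "W.cell_eval Rel x = 0" for x
    proof -
      have "W.cell_eval Rel x = (\<Sum>\<alpha>\<in>S. c \<alpha> * (\<Prod>k\<in>K. W.cell_eval (F k) x ^ \<alpha> k))"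
        using W.cell_eval_unit_inv[of x] by (simp add: W.cell_eval_def Rel_def G_def)
      also have "\<dots> = (\<Sum>\<alpha>\<in>K \<rightarrow>\<^sub>E {..D}. c \<alpha> * (\<Prod>k\<in>K. W.cell_eval (F k) x ^ \<alpha> k))"
        by (rule sum.mono_neutral_left) (use finK in \<open>auto simp: S_def finite_PiE\<close>)
      finally show ?thesis using c(2) by simp
    qed
    ultimately have V0: "V.cell_eval Rel x = 0" for x by (rule cell_eval_transfer[OF v w sub])
    define S' where "S' = {\<alpha> \<in> S. deg \<alpha> = L}"
    have top: "(\<Sum>\<alpha>\<in>S'. c \<alpha> * (\<Prod>y\<in>?X. x y ^ \<alpha> (Some y))) = 0" for x
    proof -
      have prodK: "(\<Prod>k\<in>K. V.cell_eval (F k) x ^ \<alpha> k) = (\<Prod>y\<in>?X. x y ^ \<alpha> (Some y))" for \<alpha>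
      proof -
        have "(\<Prod>k\<in>K. V.cell_eval (F k) x ^ \<alpha> k) =
            V.cell_eval (F None) x ^ \<alpha> None * (\<Prod>k\<in>Some ` ?X. V.cell_eval (F k) x ^ \<alpha> k)"
          unfolding K_def by (rule prod.insert) (use finite_cell_vars in auto)
        also have "(\<Prod>k\<in>Some ` ?X. V.cell_eval (F k) x ^ \<alpha> k) = (\<Prod>y\<in>?X. V.cell_eval (F (Some y)) x ^ \<alpha> (Some y))"
          by (subst prod.reindex) auto
        also have "\<dots> = (\<Prod>y\<in>?X. x y ^ \<alpha> (Some y))" using F_Some by (intro prod.cong) auto
        finally show ?thesis by (simp add: F_None)
      qed
      have Gx: "V.cell_eval G x = 0" using G0[of x] by (simp add: G_def V.cell_eval_def e_def)
      have "0 = (\<Sum>\<alpha>\<in>S. c \<alpha> * (V.cell_eval G x ^ (L - deg \<alpha>) * (\<Prod>k\<in>K. V.cell_eval (F k) x ^ \<alpha> k)))"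
        using V0[of x] by (simp add: V.cell_eval_def Rel_def)
      also have "\<dots> = (\<Sum>\<alpha>\<in>S'. c \<alpha> * (\<Prod>y\<in>?X. x y ^ \<alpha> (Some y)))"
        unfolding Gx prodK
      proof (rule sum.mono_neutral_cong_right)
        show "\<forall>\<alpha>\<in>S - S'. c \<alpha> * (0 ^ (L - deg \<alpha>) * (\<Prod>y\<in>?X. x y ^ \<alpha> (Some y))) = 0"
        proof
          fix \<alpha> assume "\<alpha> \<in> S - S'"
          then have "L - deg \<alpha> \<noteq> 0" using degL[of \<alpha>] by (auto simp: S'_def)
          then show "c \<alpha> * (0 ^ (L - deg \<alpha>) * (\<Prod>y\<in>?X. x y ^ \<alpha> (Some y))) = 0" by simp
        qed
      qed (use finS in \<open>auto simp: S'_def\<close>)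
      finally show ?thesis by simp
    qed
    have finS': "finite S'" using finS by (simp add: S'_def)
    have "c \<alpha>0 = 0"
    proof (rule monomials_independent[OF finite_cell_vars[of m n v] finS', of "\<lambda>\<alpha> y. \<alpha> (Some y)" c])
      show "\<alpha>0 \<in> S'" using \<alpha>0 by (simp add: S'_def)
      show "(\<Sum>\<alpha>\<in>S'. c \<alpha> * (\<Prod>y\<in>?X. x y ^ \<alpha> (Some y))) = 0" for x by (rule top)
      \<comment> \<open>Setting the variable of \<open>None\<close> to 1 merges no monomials here:
        the exponent at \<open>None\<close> is determined by the others and the common degree
        \<open>L\<close>.\<close>
      fix \<alpha> \<beta> assume \<alpha>\<beta>: "\<alpha> \<in> S'" "\<beta> \<in> S'" and eq: "\<And>y. y \<in> ?X \<Longrightarrow> \<alpha> (Some y) = \<beta> (Some y)"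
      have deg_K: "deg \<gamma> = \<gamma> None + (\<Sum>y\<in>?X. \<gamma> (Some y))" for \<gamma>
      proof -
        have "deg \<gamma> = \<gamma> None + (\<Sum>k\<in>Some ` ?X. \<gamma> k)"
          unfolding deg_def K_def by (rule sum.insert) (use finite_cell_vars in auto)
        also have "(\<Sum>k\<in>Some ` ?X. \<gamma> k) = (\<Sum>y\<in>?X. \<gamma> (Some y))" by (subst sum.reindex) auto
        finally show ?thesis .
      qed
      have "(\<Sum>y\<in>?X. \<alpha> (Some y)) = (\<Sum>y\<in>?X. \<beta> (Some y))" using eq by (intro sum.cong) auto
      then have "\<alpha> None = \<beta> None" using \<alpha>\<beta> deg_K[of \<alpha>] deg_K[of \<beta>] by (simp add: S'_def)
      then have "\<alpha> k = \<beta> k" if "k \<in> K" for k using eq that by (auto simp: K_def)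
      moreover have "\<alpha> \<in> K \<rightarrow>\<^sub>E {..D}" "\<beta> \<in> K \<rightarrow>\<^sub>E {..D}" using \<alpha>\<beta> by (auto simp: S'_def S_def)
      ultimately show "\<alpha> = \<beta>" by (intro PiE_ext) auto
    qed
    then show False using \<alpha>0 by (simp add: S_def)
  qed
qed


section \<open>All cells of the polygon space have the same dimension\<close>

definition inversions :: "nat \<Rightarrow> int list \<Rightarrow> (nat \<times> nat) set" where
  "inversions m u = {(a, b). a < b \<and> b < m \<and> u ! b < u ! a}"

definition coinversions :: "nat \<Rightarrow> int list \<Rightarrow> (nat \<times> nat) set" where
  "coinversions m u = {(a, b). a < b \<and> b < m \<and> u ! a < u ! b}"

definition pairs :: "nat \<Rightarrow> (nat \<times> nat) set" where
  "pairs m = {(a, b). a < b \<and> b < m}"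

lemma finite_pairs: "finite (pairs m)"
  by (rule finite_subset[of _ "{..<m} \<times> {..<m}"]) (auto simp: pairs_def)

lemma finite_inversions: "finite (inversions m u)" "finite (coinversions m u)"
  by (auto intro: finite_subset[OF _ finite_pairs[of m]] simp: inversions_def coinversions_def pairs_def)

text \<open>The right-hand side ignores the order of the positions, and so depends on the multiset
  of entries only.\<close>

lemma card_inversions_coinversions:
  "card (inversions m u) + card (coinversions m u) = card {(a, b). a < m \<and> b < m \<and> u ! b < u ! a}"
proof -
  have "card (coinversions m u) = card {(a, b). b < a \<and> a < m \<and> u ! b < u ! a}"
    by (rule bij_betw_same_card[of "\<lambda>(a, b). (b, a)"])
      (rule bij_betw_byWitness[where f' = "\<lambda>(a, b). (b, a)"], auto simp: coinversions_def)
  moreover have "{(a, b). a < m \<and> b < m \<and> u ! b < u ! a} = inversions m u \<union> {(a, b). b < a \<and> a < m \<and> u ! b < u ! a}"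
    by (auto simp: inversions_def not_less le_less)
  moreover have "inversions m u \<inter> {(a, b). b < a \<and> a < m \<and> u ! b < u ! a} = {}"
    by (auto simp: inversions_def)
  moreover have "finite {(a, b). b < a \<and> a < m \<and> u ! b < u ! a}"
    by (rule finite_subset[of _ "{..<m} \<times> {..<m}"]) auto
  ultimately show ?thesis using finite_inversions(1)[of m u] by (simp add: card_Un_disjoint)
qed

lemma card_unequal_pairs_mset:
  assumes "mset u = mset u'" "length u' = m"
  shows "card {(a, b). a < m \<and> b < m \<and> u ! b < u ! a} = card {(a, b). a < m \<and> b < m \<and> u' ! b < u' ! a}"
proof -
  obtain f where f: "f permutes {..<m}" "\<And>a. a < m \<Longrightarrow> u ! a = u' ! f a"
    using mset_permutation[OF assms] by metis
  define g where "g = inv_into UNIV f"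
  have g: "g permutes {..<m}" unfolding g_def by (rule permutes_inv[OF f(1)])
  have fg: "f (g a) = a" "g (f a) = a" for a unfolding g_def using permutes_inverses[OF f(1)] by auto
  have less: "f a < m" "g a < m" if "a < m" for a using permutes_lessThan[OF f(1) that] permutes_lessThan[OF g that] .
  show ?thesis
    by (rule bij_betw_same_card[of "\<lambda>(a, b). (f a, f b)"],
        rule bij_betw_byWitness[where f' = "\<lambda>(a, b). (g a, g b)"])
      (use f(2) fg less in auto)
qed

text \<open>With two adjacent values, \<open>u ! a - u ! b\<close> is 1, -1 or 0 according to the
  kind of the pair. The gain is that the right-hand side is linear in \<open>u\<close> and cancels
  over weights with sum zero.\<close>

lemma inversions_minus_coinversions:
  assumes "\<And>a. a < m \<Longrightarrow> u ! a = z \<or> u ! a = z + 1"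
  shows "int (card (inversions m u)) - int (card (coinversions m u)) = (\<Sum>(a, b)\<in>pairs m. u ! a - u ! b)"
proof -
  have "(\<Sum>(a, b)\<in>pairs m. u ! a - u ! b) =
      (\<Sum>p\<in>pairs m. (if p \<in> inversions m u then 1 else 0) - (if p \<in> coinversions m u then 1 else 0))"
  proof (intro sum.cong refl)
    fix p assume "p \<in> pairs m"
    then obtain a b where p: "p = (a, b)" "a < b" "b < m" by (auto simp: pairs_def)
    then show "(case p of (a, b) \<Rightarrow> u ! a - u ! b) =
        (if p \<in> inversions m u then 1 else 0) - (if p \<in> coinversions m u then 1 else 0)"
      using assms[of a] assms[of b] by (auto simp: inversions_def coinversions_def)
  qed
  also have "\<dots> = int (card (pairs m \<inter> inversions m u)) - int (card (pairs m \<inter> coinversions m u))"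
    using finite_pairs by (simp add: sum_subtractf sum.If_cases)
  also have "pairs m \<inter> inversions m u = inversions m u" by (auto simp: pairs_def inversions_def)
  also have "pairs m \<inter> coinversions m u = coinversions m u" by (auto simp: pairs_def coinversions_def)
  finally show ?thesis by simp
qed

lemma card_cell_vars: "card (cell_vars m n w) = (\<Sum>i\<in>{1..<n}. card (inversions m (w i)))"
proof -
  have "cell_vars m n w = (SIGMA i:{1..<n}. inversions m (w i))"
    by (auto simp: cell_vars_def inversions_def)
  then show ?thesis using finite_inversions by simp
qed

text \<open>Inversions plus coinversions depend on \<open>lam\<close> alone, and their difference
  cancels; together this fixes the number of inversions.\<close>

lemma sum_inversions:
  assumes mset: "\<And>i. i \<in> {1..n} \<Longrightarrow> mset (w i) = mset (lam i)"
    and lam: "\<And>i. i \<in> {1..n} \<Longrightarrow> lam i \<in> minuscule m" and zero: "\<And>a. a < m \<Longrightarrow> psum w n a = 0"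
  shows "2 * (\<Sum>i\<in>{1..n}. card (inversions m (w i))) =
    (\<Sum>i\<in>{1..n}. card {(a, b). a < m \<and> b < m \<and> lam i ! b < lam i ! a})"
proof -
  have len: "length (lam i) = m" if "i \<in> {1..n}" for i using minuscule_dominant[OF lam[OF that]] by (simp add: dominant_def)
  have "(\<Sum>i\<in>{1..n}. card (inversions m (w i)) + card (coinversions m (w i))) =
      (\<Sum>i\<in>{1..n}. card {(a, b). a < m \<and> b < m \<and> lam i ! b < lam i ! a})"
    unfolding card_inversions_coinversions
    by (intro sum.cong refl card_unequal_pairs_mset mset len)
  moreover have "(\<Sum>i\<in>{1..n}. int (card (inversions m (w i))) - int (card (coinversions m (w i)))) = 0"
  proof -
    have "(\<Sum>i\<in>{1..n}. int (card (inversions m (w i))) - int (card (coinversions m (w i)))) =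
        (\<Sum>i\<in>{1..n}. \<Sum>(a, b)\<in>pairs m. w i ! a - w i ! b)"
    proof (intro sum.cong refl)
      fix i assume i: "i \<in> {1..n}"
      obtain z where z: "set (lam i) \<subseteq> {z, z + 1}" using minuscule_two_valued[OF lam[OF i]] .
      have "set (w i) \<subseteq> {z, z + 1}" using mset_eq_setD[OF mset[OF i]] z by simp
      moreover have "length (w i) = m" using mset_eq_length[OF mset[OF i]] len[OF i] by simp
      ultimately show "int (card (inversions m (w i))) - int (card (coinversions m (w i))) =
          (\<Sum>(a, b)\<in>pairs m. w i ! a - w i ! b)"
        using nth_mem by (intro inversions_minus_coinversions[of m _ z]) blast
    qed
    also have "\<dots> = (\<Sum>(a, b)\<in>pairs m. \<Sum>i\<in>{1..n}. w i ! a - w i ! b)"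
      unfolding case_prod_unfold by (rule sum.swap)
    also have "\<dots> = (\<Sum>(a, b)\<in>pairs m. psum w n a - psum w n b)"
      by (simp add: psum_def sum_subtractf)
    also have "\<dots> = 0" using zero by (intro sum.neutral) (auto simp: pairs_def)
    finally show ?thesis .
  qed
  then have "int (\<Sum>i\<in>{1..n}. card (inversions m (w i))) = int (\<Sum>i\<in>{1..n}. card (coinversions m (w i)))"
    by (simp add: sum_subtractf)
  then have "(\<Sum>i\<in>{1..n}. card (inversions m (w i))) = (\<Sum>i\<in>{1..n}. card (coinversions m (w i)))"
    by (rule of_nat_eq_iff[THEN iffD1])
  ultimately show ?thesis by (simp add: sum.distrib)
qed

text \<open>The total over all \<open>n\<close> weights is the same for \<open>v\<close> and
  \<open>w\<close>, and the last weight of \<open>v\<close> takes no share of it.\<close>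

lemma card_cell_vars_le:
  assumes n: "n \<ge> 1" and lam: "\<And>i. i \<in> {1..n} \<Longrightarrow> lam i \<in> minuscule m"
    and v: "\<And>i. i \<in> {1..n} \<Longrightarrow> mset (v i) = mset (lam i)" "\<And>a. a < m \<Longrightarrow> psum v n a = 0"
    and w: "\<And>i. i \<in> {1..n} \<Longrightarrow> mset (w i) = mset (lam i)" "\<And>a. a < m \<Longrightarrow> psum w n a = 0"
    and vn: "\<And>a b. a < b \<Longrightarrow> b < m \<Longrightarrow> v n ! a \<le> v n ! b"
  shows "card (cell_vars m n w) \<le> card (cell_vars m n v)"
proof -
  have split: "(\<Sum>i\<in>{1..n}. card (inversions m (u i))) = (\<Sum>i\<in>{1..<n}. card (inversions m (u i))) + card (inversions m (u n))" for u
    using n by (cases n) (simp_all add: atLeastLessThanSuc_atLeastAtMost)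
  have "(\<Sum>i\<in>{1..n}. card (inversions m (w i))) = (\<Sum>i\<in>{1..n}. card (inversions m (v i)))"
    using sum_inversions[of n w lam m] sum_inversions[of n v lam m] lam v w by simp
  moreover have "inversions m (v n) = {}" using vn by (force simp: inversions_def)
  ultimately show ?thesis unfolding card_cell_vars using split[of v] split[of w] by simp
qed

text \<open>The codimension of \<open>t^n C[[t]]^m\<close> in the lattice at vertex
  \<open>i\<close>. It depends on the sum of the exponents only, hence is common to all
  rearrangements of the weights.\<close>

definition lattice_codim :: "nat \<Rightarrow> nat \<Rightarrow> (nat \<Rightarrow> int list) \<Rightarrow> nat \<Rightarrow> nat" where
  "lattice_codim m n lam i = nat (int (m * n) - (\<Sum>j\<in>{1..i}. sum_list (lam j)))"

lemma cell_weights_minuscule: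
  assumes n: "n \<ge> 1" and lam: "\<And>i. i \<in> {1..n} \<Longrightarrow> lam i \<in> minuscule m"
    and w: "\<And>i. i \<in> {1..n} \<Longrightarrow> mset (w i) = mset (lam i)"
  shows "cell_weights m n (lattice_codim m n lam) w"
proof -
  have len: "length (w i) = m" if "i \<in> {1..n}" for i
    using minuscule_dominant[OF lam[OF that]] mset_eq_length[OF w[OF that]] by (simp add: dominant_def)
  have vals: "\<exists>z. (z = 0 \<or> z = - 1) \<and> (\<forall>a<m. w i ! a = z \<or> w i ! a = z + 1)" if i: "i \<in> {1..n}" for i
  proof -
    obtain z where z: "set (lam i) \<subseteq> {z, z + 1}" "z = 0 \<or> z = - 1" using minuscule_two_valued[OF lam[OF i]] .
    have s: "set (w i) \<subseteq> {z, z + 1}" using mset_eq_setD[OF w[OF i]] z(1) by simp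
    have "w i ! a = z \<or> w i ! a = z + 1" if "a < m" for a
    proof -
      have "w i ! a \<in> set (w i)" using that len[OF i] by (intro nth_mem) simp
      then show ?thesis using s by blast
    qed
    then show ?thesis using z(2) by blast
  qed
  have small: "\<bar>w i ! a\<bar> \<le> 1" if "i \<in> {1..n}" "a < m" for i a
    using vals[OF that(1)] that(2) by auto
  have bound: "\<bar>psum w j a\<bar> \<le> int j" if "j \<le> n" "a < m" for j a
    using that
  proof (induction j)
    case (Suc j)
    then show ?case using small[of "Suc j" a] unfolding psum_Suc by auto
  qed (simp add: psum_def)
  show ?thesis
  proof
    show "n > 0" using n by simp
    show "\<exists>z. \<forall>a<m. w i ! a = z \<or> w i ! a = z + 1" if "i \<in> {1..<n}" for i
      using vals[of i] that by auto
    show "\<bar>w i ! a\<bar> \<le> 1" if "i \<in> {1..<n}" "a < m" for i a using small[of i a] that by auto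
    show "lattice_codim m n lam i = card (lat_set m n (psum w i))" if i: "i \<in> {1..<n}" for i
    proof -
      have b: "\<bar>psum w i a\<bar> \<le> int n" if "a < m" for a using bound[of i a] i that by auto
      have "int (card {p \<in> lat_set m n (psum w i). 0 \<le> p div (2 * n)}) = (\<Sum>a\<in>{0..<m}. int n - psum w i a)"
        by (rule card_lat_set) (use n b in auto)
      moreover have "(\<Sum>a\<in>{0..<m}. psum w i a) = (\<Sum>j\<in>{1..i}. sum_list (lam j))"
      proof -
        have "(\<Sum>a\<in>{0..<m}. psum w i a) = (\<Sum>j\<in>{1..i}. \<Sum>a\<in>{0..<m}. w j ! a)"
          unfolding psum_def by (rule sum.swap)
        also have "\<dots> = (\<Sum>j\<in>{1..i}. sum_list (lam j))"
        proof (intro sum.cong refl)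
          fix j assume "j \<in> {1..i}"
          then have j: "j \<in> {1..n}" using i by auto
          have "(\<Sum>a\<in>{0..<m}. w j ! a) = sum_list (w j)" using len[OF j] by (simp add: sum_list_sum_nth)
          also have "\<dots> = sum_list (lam j)" using w[OF j] by (metis sum_mset_sum_list)
          finally show "(\<Sum>a\<in>{0..<m}. w j ! a) = sum_list (lam j)" .
        qed
        finally show ?thesis .
      qed
      ultimately have "int (card (lat_set m n (psum w i))) = int (m * n) - (\<Sum>j\<in>{1..i}. sum_list (lam j))"
        by (simp add: sum_subtractf)
      then show ?thesis unfolding lattice_codim_def by (metis nat_int)
    qed
  qed
qed

section \<open>The local rule\<close>

text \<open>The arguments are the corners NW, NE and SW, of which the last two enter
  symmetrically.\<close>

definition local_rule :: "nat \<Rightarrow> int list \<Rightarrow> int list \<Rightarrow> int list \<Rightarrow> int list" where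
  "local_rule m \<alpha> \<beta> \<gamma> = sort_weight (map (\<lambda>k. \<gamma> ! k + \<beta> ! k - \<alpha> ! k) [0..<m])"

definition diff :: "nat \<Rightarrow> int list \<Rightarrow> int list \<Rightarrow> int list" where
  "diff m x y = map (\<lambda>k. y ! k - x ! k) [0..<m]"

lemma local_rule_sym: "local_rule m \<alpha> \<beta> \<gamma> = local_rule m \<alpha> \<gamma> \<beta>"
  by (simp add: local_rule_def add.commute)

lemma sort_weight_unique: "mset y = mset x \<Longrightarrow> sorted_wrt (\<ge>) y \<Longrightarrow> sort_weight x = y"
  unfolding sort_weight_def
  using properties_for_sort[of "rev y" x] by (simp add: sorted_wrt_rev)

lemma mset_sort_weight [simp]: "mset (sort_weight x) = mset x"
  by (simp add: sort_weight_def)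

lemma local_rule_dominant: "local_rule m \<alpha> \<beta> \<gamma> \<in> dominant m"
  by (simp add: local_rule_def dominant_def sort_weight_def sorted_wrt_rev)

text \<open>Composing \<open>f\<close> with the transposition that makes it fix the last index does
  not decrease the sum, as a product of two nonnegative differences is added; then the induction
  applies. This is the rearrangement inequality.\<close>

lemma rearrangement:
  fixes g y :: "nat \<Rightarrow> int"
  assumes "f permutes {..<m}" "\<And>a b. a \<le> b \<Longrightarrow> b < m \<Longrightarrow> g b \<le> g a" "\<And>a b. a \<le> b \<Longrightarrow> b < m \<Longrightarrow> y b \<le> y a"
  shows "(\<Sum>a<m. g a * y (f a)) \<le> (\<Sum>a<m. g a * y a)"
  using assms
proof (induction m arbitrary: f)
  case (Suc m)
  define k where "k = inv_into UNIV f m"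
  have fk: "f k = m" unfolding k_def by (rule permutes_inverses(1)[OF Suc.prems(1)])
  have kS: "k < Suc m"
    unfolding k_def by (rule permutes_lessThan[OF permutes_inv[OF Suc.prems(1)]]) simp
  define f' where "f' = f \<circ> transpose k m"
  have f'S: "f' permutes {..<Suc m}"
    unfolding f'_def by (rule permutes_compose[OF permutes_swap_id Suc.prems(1)]) (use kS in auto)
  have f'm: "f' m = m" by (simp add: f'_def fk)
  have "f' permutes {..<m}"
    by (rule permutes_superset[OF f'S]) (use f'm in \<open>auto simp: less_Suc_eq\<close>)
  then have IH: "(\<Sum>a<m. g a * y (f' a)) \<le> (\<Sum>a<m. g a * y a)"
    by (rule Suc.IH) (use Suc.prems in auto)
  have fm: "f m < Suc m" by (rule permutes_lessThan[OF Suc.prems(1)]) simp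
  have "(\<Sum>a<Suc m. g a * y (f a)) \<le> (\<Sum>a<Suc m. g a * y (f' a))"
  proof (cases "k = m")
    case True
    then show ?thesis by (simp add: f'_def)
  next
    case False
    have split: "(\<Sum>a<Suc m. h a) = h k + h m + (\<Sum>a\<in>{..<Suc m} - {k, m}. h a)" for h :: "nat \<Rightarrow> int"
    proof -
      have "(\<Sum>a<Suc m. h a) = (\<Sum>a\<in>{..<Suc m} - {k, m}. h a) + (\<Sum>a\<in>{k, m}. h a)"
        by (rule sum.subset_diff) (use kS in auto)
      then show ?thesis using False by simp
    qed
    have rest: "(\<Sum>a\<in>{..<Suc m} - {k, m}. g a * y (f' a)) = (\<Sum>a\<in>{..<Suc m} - {k, m}. g a * y (f a))"
      by (intro sum.cong) (auto simp: f'_def transpose_def)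
    have f'k: "f' k = f m" by (simp add: f'_def)
    have "0 \<le> (g k - g m) * (y (f m) - y m)"
      using Suc.prems(2)[of k m] Suc.prems(3)[of "f m" m] kS fm by (intro mult_nonneg_nonneg) auto
    then show ?thesis unfolding split rest fk f'm f'k by (simp add: algebra_simps)
  qed
  also have "(\<Sum>a<Suc m. g a * y (f' a)) \<le> (\<Sum>a<Suc m. g a * y a)" using IH f'm by simp
  finally show ?case .
qed simp

text \<open>\<open>\<delta>\<close> is the sorted vector
  \<open>\<gamma> + (\<beta> - \<alpha>)\<close>. Sorting preserves its length and sum and can only
  increase its scalar product with the dominant \<open>\<gamma>\<close>, so it moves no farther from
  \<open>\<gamma>\<close>.\<close>

lemma local_rule_contracts:
  fixes \<alpha> \<beta> :: "int list"
  assumes \<gamma>: "\<gamma> \<in> dominant m"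
  defines "\<delta> \<equiv> local_rule m \<alpha> \<beta> \<gamma>"
  shows "(\<Sum>a<m. (\<delta> ! a - \<gamma> ! a)\<^sup>2) \<le> (\<Sum>a<m. (\<beta> ! a - \<alpha> ! a)\<^sup>2)"
    "(\<Sum>a<m. \<delta> ! a - \<gamma> ! a) = (\<Sum>a<m. \<beta> ! a - \<alpha> ! a)"
proof -
  define x where "x = map (\<lambda>k. \<gamma> ! k + \<beta> ! k - \<alpha> ! k) [0..<m]"
  have x: "x ! a = \<gamma> ! a + \<beta> ! a - \<alpha> ! a" if "a < m" for a using that by (simp add: x_def)
  have \<delta>d: "\<delta> \<in> dominant m" unfolding \<delta>_def by (rule local_rule_dominant)
  have "mset x = mset \<delta>" unfolding \<delta>_def local_rule_def x_def by simp
  then obtain f where f: "f permutes {..<m}" "\<And>a. a < m \<Longrightarrow> x ! a = \<delta> ! f a"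
    using mset_permutation[of x \<delta> m] \<delta>d by (auto simp: dominant_def)
  have reindex: "(\<Sum>a<m. h (x ! a)) = (\<Sum>a<m. h (\<delta> ! a))" for h :: "int \<Rightarrow> int"
  proof -
    have "(\<Sum>a<m. h (x ! a)) = (\<Sum>a<m. h (\<delta> ! f a))" using f(2) by (intro sum.cong) auto
    also have "\<dots> = (\<Sum>a<m. h (\<delta> ! a))" using sum.permute[OF f(1), of "\<lambda>a. h (\<delta> ! a)"] by (simp add: o_def)
    finally show ?thesis .
  qed
  have re: "(\<Sum>a<m. \<gamma> ! a * \<delta> ! f a) \<le> (\<Sum>a<m. \<gamma> ! a * \<delta> ! a)"
    by (rule rearrangement[OF f(1)]) (use \<gamma> \<delta>d dominant_antimono in blast)+
  have "(\<Sum>a<m. (\<beta> ! a - \<alpha> ! a)\<^sup>2) = (\<Sum>a<m. (x ! a)\<^sup>2 + (\<gamma> ! a)\<^sup>2 - 2 * (\<gamma> ! a * \<delta> ! f a))"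
    by (intro sum.cong refl) (simp add: x f(2)[symmetric] power2_eq_square algebra_simps)
  also have "\<dots> = (\<Sum>a<m. (\<delta> ! a)\<^sup>2) + (\<Sum>a<m. (\<gamma> ! a)\<^sup>2) - 2 * (\<Sum>a<m. \<gamma> ! a * \<delta> ! f a)"
    by (simp add: sum.distrib sum_subtractf sum_distrib_left reindex[of "\<lambda>y. y\<^sup>2"])
  also have "\<dots> \<ge> (\<Sum>a<m. (\<delta> ! a)\<^sup>2) + (\<Sum>a<m. (\<gamma> ! a)\<^sup>2) - 2 * (\<Sum>a<m. \<gamma> ! a * \<delta> ! a)" using re by simp
  also have "(\<Sum>a<m. (\<delta> ! a)\<^sup>2) + (\<Sum>a<m. (\<gamma> ! a)\<^sup>2) - 2 * (\<Sum>a<m. \<gamma> ! a * \<delta> ! a) = (\<Sum>a<m. (\<delta> ! a - \<gamma> ! a)\<^sup>2)"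
    by (simp add: power2_diff sum.distrib sum_subtractf sum_distrib_left mult_ac)
  finally show "(\<Sum>a<m. (\<delta> ! a - \<gamma> ! a)\<^sup>2) \<le> (\<Sum>a<m. (\<beta> ! a - \<alpha> ! a)\<^sup>2)" .
  have "(\<Sum>a<m. \<delta> ! a - \<gamma> ! a) = (\<Sum>a<m. x ! a) - (\<Sum>a<m. \<gamma> ! a)" using reindex[of "\<lambda>y. y"] by (simp add: sum_subtractf)
  also have "\<dots> = (\<Sum>a<m. \<beta> ! a - \<alpha> ! a)" by (simp add: x sum_subtractf[symmetric])
  finally show "(\<Sum>a<m. \<delta> ! a - \<gamma> ! a) = (\<Sum>a<m. \<beta> ! a - \<alpha> ! a)" .
qed

text \<open>For an integer \<open>x\<close> the product \<open>(x - z) * (x - z - 1)\<close> is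
  nonnegative and vanishes just at \<open>z\<close> and \<open>z + 1\<close>. Hence, for a given
  sum, the elements of a minuscule orbit are the shortest integer vectors.\<close>

lemma mset_eq_minuscule:
  assumes lam: "l \<in> minuscule m" and x: "length x = m"
    and sq: "(\<Sum>a<m. (x ! a)\<^sup>2) \<le> (\<Sum>a<m. (l ! a)\<^sup>2)" and sum: "(\<Sum>a<m. x ! a) = (\<Sum>a<m. l ! a)"
  shows "mset x = mset l"
proof -
  obtain z where z: "set l \<subseteq> {z, z + 1}" "z = 0 \<or> z = - 1" using minuscule_two_valued[OF lam] .
  have ll: "length l = m" using minuscule_dominant[OF lam] by (simp add: dominant_def)
  have lz: "(l ! a)\<^sup>2 = (2 * z + 1) * l ! a" if "a < m" for a
  proof -
    have "l ! a \<in> set l" using that ll by simp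
    then have "l ! a = z \<or> l ! a = z + 1" using z(1) by blast
    then show ?thesis using z(2) by auto
  qed
  \<comment> \<open>As \<open>z\<close> is 0 or -1, \<open>z * (z + 1) = 0\<close>, and
    \<open>h\<close> is the product of the differences to \<open>z\<close> and
    \<open>z + 1\<close>.\<close>
  define h where "h a = (x ! a)\<^sup>2 - (2 * z + 1) * x ! a" for a
  have roots: "h a = (x ! a - z) * (x ! a - z - 1)" for a
    using z(2) by (auto simp: h_def power2_eq_square algebra_simps)
  have h0: "h a \<ge> 0" for a
  proof -
    have "x ! a - z \<le> 0 \<or> x ! a - z - 1 \<ge> 0" by linarith
    then show ?thesis unfolding roots by (auto intro: mult_nonneg_nonneg mult_nonpos_nonpos)
  qed
  have "(\<Sum>a<m. h a) \<le> 0"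
  proof -
    have "(\<Sum>a<m. (l ! a)\<^sup>2) = (2 * z + 1) * (\<Sum>a<m. l ! a)" using lz by (simp add: sum_distrib_left)
    then show ?thesis using sq sum by (simp add: h_def sum_subtractf sum_distrib_left[symmetric])
  qed
  moreover have "(\<Sum>a<m. h a) \<ge> 0" using h0 by (intro sum_nonneg)
  ultimately have "(\<Sum>a<m. h a) = 0" by simp
  then have "h a = 0" if "a < m" for a using h0 that by (simp add: sum_nonneg_eq_0_iff)
  then have "x ! a = z \<or> x ! a = z + 1" if "a < m" for a using that unfolding roots by fastforce
  then have "set x \<subseteq> {z, z + 1}" using x unfolding set_conv_nth by blast
  then show ?thesis
    using z(1) sum x ll by (intro two_valued_mset_eq) (simp_all add: sum_list_sum_nth atLeast0LessThan)
qed

text \<open>The step has two adjacent values, so by \<open>sorting_permutation\<close> its sum with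
  \<open>\<gamma>\<close> is sorted by a permutation that fixes \<open>\<gamma>\<close>; only the
  step gets permuted.\<close>

lemma local_rule_step:
  assumes \<gamma>: "\<gamma> \<in> dominant m" and v: "set (diff m \<alpha> \<beta>) \<subseteq> {z, z + 1}"
  shows "mset (diff m \<gamma> (local_rule m \<alpha> \<beta> \<gamma>)) = mset (diff m \<alpha> \<beta>)"
proof -
  define v where "v = diff m \<alpha> \<beta>"
  have lv: "length v = m" by (simp add: v_def diff_def)
  obtain f where f: "f permutes {..<m}" "\<And>a. a < m \<Longrightarrow> \<gamma> ! f a = \<gamma> ! a"
    "\<And>a b. a \<le> b \<Longrightarrow> b < m \<Longrightarrow> \<gamma> ! b + v ! f b \<le> \<gamma> ! a + v ! f a"
    using sorting_permutation[OF \<gamma> lv] assms(2) unfolding v_def by metis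
  define x where "x = map (\<lambda>k. \<gamma> ! k + \<beta> ! k - \<alpha> ! k) [0..<m]"
  have x: "x ! a = \<gamma> ! a + v ! a" if "a < m" for a using that by (simp add: x_def v_def diff_def)
  have lx: "length x = m" by (simp add: x_def)
  define y where "y = map (\<lambda>a. \<gamma> ! a + v ! f a) [0..<m]"
  have "y = permute_list f x"
    unfolding y_def permute_list_def lx
    by (rule map_cong[OF refl]) (use f(2) x permutes_lessThan[OF f(1)] in auto)
  then have "mset y = mset x" using f(1) lx by simp
  moreover have "sorted_wrt (\<ge>) y" using f(3) by (simp add: y_def sorted_wrt_iff_nth_less)
  ultimately have "local_rule m \<alpha> \<beta> \<gamma> = y" unfolding local_rule_def x_def[symmetric] by (rule sort_weight_unique)
  then have "diff m \<gamma> (local_rule m \<alpha> \<beta> \<gamma>) = permute_list f v"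
    unfolding diff_def y_def permute_list_def lv by simp
  then show ?thesis using f(1) lv by (simp add: v_def)
qed

text \<open>The counts are those of a conjugate partition, with thresholds \<open>h\<close> in all
  integers.\<close>

lemma antimono_determined_by_counts:
  assumes "x \<in> dominant m" "y \<in> dominant m"
    and count: "\<And>h. card {k. k < m \<and> h \<le> x ! k} = card {k. k < m \<and> h \<le> y ! k}"
  shows "x = y"
proof (rule nth_equalityI)
  show "length x = length y" using assms by (simp add: dominant_def)
  have le: "x ! k \<le> y ! k" if "k < m" "x \<in> dominant m" "y \<in> dominant m"
    "\<And>h. card {k. k < m \<and> h \<le> x ! k} = card {k. k < m \<and> h \<le> y ! k}" for k x y
  proof (rule ccontr)
    assume less: "\<not> x ! k \<le> y ! k"
    have "{..k} \<subseteq> {j. j < m \<and> x ! k \<le> x ! j}" using that(1) dominant_antimono[OF that(2)] by auto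
    then have "card {..k} \<le> card {j. j < m \<and> x ! k \<le> x ! j}" by (intro card_mono) auto
    moreover have "{j. j < m \<and> x ! k \<le> y ! j} \<subseteq> {..<k}"
    proof
      fix j assume j: "j \<in> {j. j < m \<and> x ! k \<le> y ! j}"
      show "j \<in> {..<k}"
      proof (rule ccontr)
        assume "j \<notin> {..<k}"
        then have "y ! j \<le> y ! k" using dominant_antimono[OF that(3), of k j] j by auto
        then show False using j less by auto
      qed
    qed
    then have "card {j. j < m \<and> x ! k \<le> y ! j} \<le> card {..<k}" by (intro card_mono) auto
    ultimately show False using that(4)[of "x ! k"] by simp
  qed
  fix k assume "k < length x"
  then have "k < m" using assms by (simp add: dominant_def)
  then show "x ! k = y ! k" using le[of k x y] le[of k y x] assms by (intro antisym) auto
qed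

text \<open>For steps with values in \<open>{0, 1}\<close> this is an identity of indicator functions of the positions.\<close>

lemma local_rule_threshold:
  assumes v: "set (diff m \<alpha> \<beta>) \<subseteq> {z, z + 1}" and u: "set (diff m \<alpha> \<gamma>) \<subseteq> {y, y + 1}"
  shows "card {k. k < m \<and> h + z + y \<le> local_rule m \<alpha> \<beta> \<gamma> ! k} + card {k. k < m \<and> h - 1 \<le> \<alpha> ! k} =
    card ({k. k < m \<and> h + z \<le> \<beta> ! k} \<union> {k. k < m \<and> h + y \<le> \<gamma> ! k}) +
    card ({k. k < m \<and> h - 1 + z \<le> \<beta> ! k} \<inter> {k. k < m \<and> h - 1 + y \<le> \<gamma> ! k})"
proof -
  have count: "card {k. k < m \<and> P k} = (\<Sum>k<m. if P k then 1 else 0)" for P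
    by (simp add: sum.If_cases Int_def)
  define x where "x = map (\<lambda>k. \<gamma> ! k + \<beta> ! k - \<alpha> ! k) [0..<m]"
  have "mset x = mset (local_rule m \<alpha> \<beta> \<gamma>)" unfolding local_rule_def x_def by simp
  then obtain f where f: "f permutes {..<m}" "\<And>a. a < m \<Longrightarrow> x ! a = local_rule m \<alpha> \<beta> \<gamma> ! f a"
    using mset_permutation[of x "local_rule m \<alpha> \<beta> \<gamma>" m] local_rule_dominant[of m \<alpha> \<beta> \<gamma>] by (auto simp: dominant_def)
  have "(\<Sum>k<m. if h + z + y \<le> local_rule m \<alpha> \<beta> \<gamma> ! k then 1 else 0) =
      (\<Sum>k<m. if h + z + y \<le> local_rule m \<alpha> \<beta> \<gamma> ! f k then 1 else (0::nat))"
    using sum.permute[OF f(1), of "\<lambda>k. if h + z + y \<le> local_rule m \<alpha> \<beta> \<gamma> ! k then 1 else (0::nat)"] by (simp add: o_def)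
  also have "\<dots> = (\<Sum>k<m. if h + z + y \<le> \<gamma> ! k + \<beta> ! k - \<alpha> ! k then 1 else 0)"
    using f(2) by (intro sum.cong) (auto simp: x_def)
  finally have \<delta>: "card {k. k < m \<and> h + z + y \<le> local_rule m \<alpha> \<beta> \<gamma> ! k} =
      (\<Sum>k<m. if h + z + y \<le> \<gamma> ! k + \<beta> ! k - \<alpha> ! k then 1 else 0)" unfolding count .
  have un: "{k. k < m \<and> h + z \<le> \<beta> ! k} \<union> {k. k < m \<and> h + y \<le> \<gamma> ! k} = {k. k < m \<and> (h + z \<le> \<beta> ! k \<or> h + y \<le> \<gamma> ! k)}"
    "{k. k < m \<and> h - 1 + z \<le> \<beta> ! k} \<inter> {k. k < m \<and> h - 1 + y \<le> \<gamma> ! k} =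
      {k. k < m \<and> (h - 1 + z \<le> \<beta> ! k \<and> h - 1 + y \<le> \<gamma> ! k)}" by auto
  show ?thesis
    unfolding \<delta> un count sum.distrib[symmetric]
  proof (intro sum.cong refl)
    fix k assume "k \<in> {..<m}"
    then have "\<beta> ! k - \<alpha> ! k \<in> set (diff m \<alpha> \<beta>)" "\<gamma> ! k - \<alpha> ! k \<in> set (diff m \<alpha> \<gamma>)" by (auto simp: diff_def)
    then have "\<beta> ! k - \<alpha> ! k = z \<or> \<beta> ! k - \<alpha> ! k = z + 1" "\<gamma> ! k - \<alpha> ! k = y \<or> \<gamma> ! k - \<alpha> ! k = y + 1"
      using u v by blast+
    then show "(if h + z + y \<le> \<gamma> ! k + \<beta> ! k - \<alpha> ! k then 1 else 0) + (if h - 1 \<le> \<alpha> ! k then 1 else 0) =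
      (if h + z \<le> \<beta> ! k \<or> h + y \<le> \<gamma> ! k then 1 else 0) +
      (if h - 1 + z \<le> \<beta> ! k \<and> h - 1 + y \<le> \<gamma> ! k then 1 else (0::nat))" by auto
  qed
qed

text \<open>In the counting identity of \<open>local_rule_threshold\<close> all terms but the one of
  \<open>\<alpha>\<close> are given by \<open>\<beta>\<close>, \<open>\<gamma>\<close> and the
  result of the rule.\<close>

lemma local_rule_cancel:
  assumes v: "set (diff m \<alpha> \<beta>) \<subseteq> {z, z + 1}" "set (diff m \<alpha>' \<beta>) \<subseteq> {z, z + 1}"
    and u: "set (diff m \<alpha> \<gamma>) \<subseteq> {y, y + 1}" "set (diff m \<alpha>' \<gamma>) \<subseteq> {y, y + 1}"
    and d: "\<alpha> \<in> dominant m" "\<alpha>' \<in> dominant m" and eq: "local_rule m \<alpha> \<beta> \<gamma> = local_rule m \<alpha>' \<beta> \<gamma>"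
  shows "\<alpha> = \<alpha>'"
proof (rule antimono_determined_by_counts[OF d])
  fix h
  show "card {k. k < m \<and> h \<le> \<alpha> ! k} = card {k. k < m \<and> h \<le> \<alpha>' ! k}"
    using local_rule_threshold[OF v(1) u(1), of "h + 1"] local_rule_threshold[OF v(2) u(2), of "h + 1"] eq by simp
qed


section \<open>Growth diagrams and paths\<close>

text \<open>Types are indexed from 1 to \<open>n\<close>, hence the shift by one before and after
  the reduction.\<close>

definition residue :: "nat \<Rightarrow> int \<Rightarrow> nat" where
  "residue n k = nat ((k - 1) mod int n) + 1"

text \<open>Row \<open>i\<close> starts in column \<open>i\<close>, so its step number
  \<open>j\<close> leaves column \<open>i + j - 1\<close> and has the type of that column.\<close>

definition shifted :: "nat \<Rightarrow> (nat \<Rightarrow> int list) \<Rightarrow> int \<Rightarrow> nat \<Rightarrow> int list" where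
  "shifted n lam i j = lam (residue n (i + int j - 1))"

definition row :: "nat \<Rightarrow> (int \<times> int \<Rightarrow> int list) \<Rightarrow> int \<Rightarrow> nat \<Rightarrow> int list" where
  "row n L i = (\<lambda>j\<in>{0..n}. L (i, i + int j))"

text \<open>A row starts one column later than the row above: its entry \<open>j\<close> stands
  below entry \<open>j + 1\<close> of \<open>\<rho>\<close>.\<close>

primrec next_entry :: "nat \<Rightarrow> (nat \<Rightarrow> int list) \<Rightarrow> nat \<Rightarrow> int list" where
  "next_entry m \<rho> 0 = zero_weight m"
| "next_entry m \<rho> (Suc j) = local_rule m (\<rho> (Suc j)) (\<rho> (Suc (Suc j))) (next_entry m \<rho> j)"

text \<open>The last vertex lies beyond the end of the row above, out of reach of the local rule; in
  a diagram it carries the zero weight.\<close>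

definition next_row :: "nat \<Rightarrow> nat \<Rightarrow> (nat \<Rightarrow> int list) \<Rightarrow> nat \<Rightarrow> int list" where
  "next_row m n \<rho> = (\<lambda>j\<in>{0..n}. if j = n then zero_weight m else next_entry m \<rho> j)"

lemma residue_range: "n \<ge> 1 \<Longrightarrow> residue n k \<in> {1..n}"
  using pos_mod_bound[of "int n" "k - 1"] by (auto simp: residue_def nat_less_iff Suc_le_eq)

lemma residue_add: "residue n (k + int n) = residue n k"
proof -
  have "k + int n - 1 = (k - 1) + int n" by simp
  then show ?thesis unfolding residue_def by (metis mod_add_self2)
qed

lemma residue_self: "j \<in> {1..n} \<Longrightarrow> residue n (int j) = j"
  by (auto simp: residue_def)

lemma residue_cong:
  assumes "n \<ge> 1"
  shows "[int (residue n k) = k] (mod int n)"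
proof -
  have "int (residue n k) = (k - 1) mod int n + 1" using assms by (simp add: residue_def)
  then show ?thesis by (simp add: cong_def mod_simps)
qed

lemma residue_unique:
  assumes "r \<in> {1..n}" "[int r = k] (mod int n)"
  shows "r = residue n k"
proof -
  have "(int r - 1) mod int n = (k - 1) mod int n" using assms(2) by (metis cong_def mod_diff_left_eq)
  moreover have "(int r - 1) mod int n = int r - 1" using assms(1) by (intro mod_pos_pos_trivial) auto
  ultimately have "nat ((k - 1) mod int n) = r - 1" using assms(1) by auto
  then show ?thesis using assms(1) by (simp add: residue_def)
qed

locale minuscule_sequence =
  fixes m n :: nat and lam :: "nat \<Rightarrow> int list"
  assumes n: "n \<ge> 1" and lam: "\<And>r. r \<in> {1..n} \<Longrightarrow> lam r \<in> minuscule m"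
begin

abbreviation "paths i \<equiv> minuscule_paths m n (shifted n lam i)"

lemma shifted_minuscule: "shifted n lam i j \<in> minuscule m"
  unfolding shifted_def by (rule lam[OF residue_range[OF n]])

lemma shifted_add: "shifted n lam (i + 1) j = shifted n lam i (Suc j)"
  by (simp add: shifted_def algebra_simps)

lemma shifted_period: "shifted n lam (i + int n) j = shifted n lam i j"
proof -
  have "i + int n + int j - 1 = (i + int j - 1) + int n" by simp
  then show ?thesis unfolding shifted_def by (metis residue_add)
qed

lemma zero_weight_nth: "a < m \<Longrightarrow> zero_weight m ! a = 0"
  by (simp add: zero_weight_def)

lemma weight_step_diff: "weight_step m \<rho> (Suc j) = diff m (\<rho> j) (\<rho> (Suc j))"
  by (simp add: weight_step_def diff_def)

lemma paths_two_valued: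
  assumes "\<rho> \<in> paths i" "j < n" "set (shifted n lam i (Suc j)) \<subseteq> {z, z + 1}"
  shows "set (diff m (\<rho> j) (\<rho> (Suc j))) \<subseteq> {z, z + 1}"
proof -
  have "mset (weight_step m \<rho> (Suc j)) = mset (shifted n lam i (Suc j))"
    by (rule minuscule_pathsD(4)[OF assms(1)]) (use assms(2) in auto)
  then show ?thesis using assms(3) mset_eq_setD unfolding weight_step_diff by blast
qed

text \<open>On each square the rule reproduces the step opposite to the new one up to order, in both
  directions. The first vertical step is minus the first step of \<open>\<rho>\<close>, and this
  type persists along the row.\<close>

lemma next_entry_props:
  assumes \<rho>: "\<rho> \<in> paths i"
  shows "j < n \<Longrightarrow> next_entry m \<rho> j \<in> dominant m"
    and "j < n \<Longrightarrow> mset (diff m (\<rho> (Suc j)) (next_entry m \<rho> j)) = mset (map uminus (shifted n lam i 1))"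
    and "Suc j < n \<Longrightarrow> mset (diff m (next_entry m \<rho> j) (next_entry m \<rho> (Suc j))) = mset (shifted n lam i (Suc (Suc j)))"
proof -
  obtain y where y: "set (shifted n lam i 1) \<subseteq> {y, y + 1}" using minuscule_two_valued[OF shifted_minuscule] .
  define c where "c = map uminus (shifted n lam i 1)"
  have c: "set c \<subseteq> {- (y + 1), - (y + 1) + 1}" using y by (auto simp: c_def)
  have dom: "next_entry m \<rho> j \<in> dominant m" for j
    by (cases j) (simp_all add: zero_weight_dominant local_rule_dominant)
  show "next_entry m \<rho> j \<in> dominant m" by (rule dom)
  have ver: "mset (diff m (\<rho> (Suc j)) (next_entry m \<rho> j)) = mset c" if "j < n" for j
    using that
  proof (induction j)
    case 0
    have "weight_step m \<rho> 1 = map (\<lambda>k. \<rho> 1 ! k) [0..<m]"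
      using minuscule_pathsD(2)[OF \<rho>] by (simp add: weight_step_def zero_weight_nth)
    then have "diff m (\<rho> 1) (zero_weight m) = map uminus (weight_step m \<rho> 1)"
      by (simp add: diff_def zero_weight_nth)
    moreover have "mset (weight_step m \<rho> 1) = mset (shifted n lam i 1)"
      by (rule minuscule_pathsD(4)[OF \<rho>]) (use n in auto)
    ultimately show ?case by (simp add: c_def)
  next
    case (Suc j)
    have IH: "mset (diff m (\<rho> (Suc j)) (next_entry m \<rho> j)) = mset c" using Suc by simp
    have d: "\<rho> (Suc (Suc j)) \<in> dominant m" by (rule minuscule_pathsD(1)[OF \<rho>]) (use Suc.prems in auto)
    have "set (diff m (\<rho> (Suc j)) (next_entry m \<rho> j)) \<subseteq> {- (y + 1), - (y + 1) + 1}" using c mset_eq_setD[OF IH] by simp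
    from local_rule_step[OF d this] show ?case using IH by (simp add: local_rule_sym)
  qed
  show "j < n \<Longrightarrow> mset (diff m (\<rho> (Suc j)) (next_entry m \<rho> j)) = mset (map uminus (shifted n lam i 1))"
    using ver unfolding c_def .
  assume j: "Suc j < n"
  obtain z where z: "set (shifted n lam i (Suc (Suc j))) \<subseteq> {z, z + 1}" using minuscule_two_valued[OF shifted_minuscule] .
  have "mset (diff m (next_entry m \<rho> j) (next_entry m \<rho> (Suc j))) = mset (diff m (\<rho> (Suc j)) (\<rho> (Suc (Suc j))))"
    unfolding next_entry.simps by (rule local_rule_step[OF dom paths_two_valued[OF \<rho> j z]])
  also have "\<dots> = mset (shifted n lam i (Suc (Suc j)))"
    unfolding weight_step_diff[symmetric] by (rule minuscule_pathsD(4)[OF \<rho>]) (use j in auto)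
  finally show "mset (diff m (next_entry m \<rho> j) (next_entry m \<rho> (Suc j))) = mset (shifted n lam i (Suc (Suc j)))" .
qed

lemma next_row_paths:
  assumes \<rho>: "\<rho> \<in> paths i"
  shows "next_row m n \<rho> \<in> paths (i + 1)"
  unfolding minuscule_paths_def
proof (intro CollectI conjI ballI)
  show "next_row m n \<rho> \<in> {0..n} \<rightarrow>\<^sub>E dominant m"
    unfolding next_row_def using next_entry_props(1)[OF \<rho>] zero_weight_dominant by auto
  show "next_row m n \<rho> 0 = zero_weight m" "next_row m n \<rho> n = zero_weight m" by (auto simp: next_row_def)
  fix j assume j: "j \<in> {1..n}"
  then obtain k where k: "j = Suc k" "k < n" by (cases j) auto
  show "mset (weight_step m (next_row m n \<rho>) j) = mset (shifted n lam (i + 1) j)"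
  proof (cases "Suc k = n")
    case False
    then have "weight_step m (next_row m n \<rho>) j = diff m (next_entry m \<rho> k) (next_entry m \<rho> (Suc k))"
      unfolding k weight_step_diff using k by (simp add: next_row_def)
    then show ?thesis using next_entry_props(3)[OF \<rho>, of k] False k by (simp add: shifted_add)
  next
    case True
    \<comment> \<open>The last step leads back to zero. It is minus the last vertical step, hence
      has the type of the first step of \<open>\<rho>\<close>, which by periodicity is the type due
      at this place of row \<open>i + 1\<close>.\<close>
    have "next_entry m \<rho> k \<in> dominant m" by (rule next_entry_props(1)[OF \<rho> k(2)])
    then have "weight_step m (next_row m n \<rho>) j = map uminus (diff m (\<rho> n) (next_entry m \<rho> k))"
      unfolding k weight_step_diff minuscule_pathsD(3)[OF \<rho>] using k True
      by (simp add: next_row_def diff_def zero_weight_nth)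
    moreover have "mset (diff m (\<rho> n) (next_entry m \<rho> k)) = mset (map uminus (shifted n lam i 1))"
      using next_entry_props(2)[OF \<rho> k(2)] True by simp
    ultimately have "mset (weight_step m (next_row m n \<rho>) j) = mset (map uminus (map uminus (shifted n lam i 1)))"
      by (simp only: mset_map)
    also have "\<dots> = mset (shifted n lam i 1)" by (simp add: multiset.map_comp o_def del: mset_map)
    also have "shifted n lam i 1 = shifted n lam (i + 1) j"
      using shifted_period[of i 1] True k by (simp add: shifted_def algebra_simps)
    finally show ?thesis .
  qed
qed

text \<open>The row is recovered from right to left: in each square the three corners other than NW
  are known, and the NW corner is found by \<open>local_rule_cancel\<close>.\<close>

lemma next_row_inj: "inj_on (next_row m n) (paths i)"
proof (rule inj_onI)
  fix \<rho> \<sigma> assume \<rho>: "\<rho> \<in> paths i" and \<sigma>: "\<sigma> \<in> paths i" and eq: "next_row m n \<rho> = next_row m n \<sigma>"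
  have same: "next_entry m \<rho> j = next_entry m \<sigma> j" if "j < n" for j
    using fun_cong[OF eq, of j] that by (simp add: next_row_def)
  obtain y where y: "set (shifted n lam i 1) \<subseteq> {y, y + 1}" using minuscule_two_valued[OF shifted_minuscule] .
  have ver: "set (diff m (\<tau> (Suc j)) (next_entry m \<tau> j)) \<subseteq> {- (y + 1), - (y + 1) + 1}"
    if "\<tau> \<in> paths i" "j < n" for \<tau> j
    using mset_eq_setD[OF next_entry_props(2)[OF that]] y by auto
  have agree: "\<rho> (n - k) = \<sigma> (n - k)" if "k \<le> n" for k
    using that
  proof (induction k)
    case 0
    then show ?case using minuscule_pathsD(3)[OF \<rho>] minuscule_pathsD(3)[OF \<sigma>] by simp
  next
    case (Suc k)
    have IH: "\<rho> (n - k) = \<sigma> (n - k)" using Suc by simp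
    define j where "j = n - Suc k"
    have jn: "j < n" "n - k = Suc j" using Suc.prems by (auto simp: j_def)
    have IH': "\<sigma> (Suc j) = \<rho> (Suc j)" using IH jn by simp
    have "\<rho> j = \<sigma> j"
    proof (cases j)
      case 0
      then show ?thesis using minuscule_pathsD(2)[OF \<rho>] minuscule_pathsD(2)[OF \<sigma>] by simp
    next
      case (Suc l)
      have ln: "l < n" using jn Suc by simp
      obtain z where z: "set (shifted n lam i (Suc j)) \<subseteq> {z, z + 1}" using minuscule_two_valued[OF shifted_minuscule] .
      show ?thesis
      proof (rule local_rule_cancel[where \<beta> = "\<rho> (Suc j)" and \<gamma> = "next_entry m \<rho> l"])
        show "set (diff m (\<rho> j) (\<rho> (Suc j))) \<subseteq> {z, z + 1}" by (rule paths_two_valued[OF \<rho> jn(1) z])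
        show "set (diff m (\<sigma> j) (\<rho> (Suc j))) \<subseteq> {z, z + 1}"
          using paths_two_valued[OF \<sigma> jn(1) z] unfolding IH' .
        show "set (diff m (\<rho> j) (next_entry m \<rho> l)) \<subseteq> {- (y + 1), - (y + 1) + 1}"
          unfolding Suc by (rule ver[OF \<rho> ln])
        show "set (diff m (\<sigma> j) (next_entry m \<rho> l)) \<subseteq> {- (y + 1), - (y + 1) + 1}"
          unfolding Suc same[OF ln] by (rule ver[OF \<sigma> ln])
        show "\<rho> j \<in> dominant m" "\<sigma> j \<in> dominant m"
          using minuscule_pathsD(1)[OF \<rho>] minuscule_pathsD(1)[OF \<sigma>] jn by auto
        show "local_rule m (\<rho> j) (\<rho> (Suc j)) (next_entry m \<rho> l) = local_rule m (\<sigma> j) (\<rho> (Suc j)) (next_entry m \<rho> l)"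
          using same[OF jn(1)] same[OF ln] IH' unfolding Suc by simp
      qed
    qed
    then show ?case by (simp add: j_def)
  qed
  show "\<rho> = \<sigma>"
  proof (rule PiE_ext)
    show "\<rho> \<in> {0..n} \<rightarrow>\<^sub>E dominant m" "\<sigma> \<in> {0..n} \<rightarrow>\<^sub>E dominant m"
      using \<rho> \<sigma> by (simp_all add: minuscule_paths_def)
    show "\<rho> j = \<sigma> j" if "j \<in> {0..n}" for j using agree[of "n - j"] that by simp
  qed
qed

text \<open>Each step changes an entry by at most 1, so all entries lie between \<open>-n\<close>
  and \<open>n\<close>.\<close>

lemma finite_paths: "finite (paths i)"
proof (rule finite_subset)
  show "finite ({0..n} \<rightarrow>\<^sub>E {xs. set xs \<subseteq> {- int n..int n} \<and> length xs = m})"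
    by (intro finite_PiE finite_lists_length_eq) auto
  show "paths i \<subseteq> {0..n} \<rightarrow>\<^sub>E {xs. set xs \<subseteq> {- int n..int n} \<and> length xs = m}"
  proof
    fix \<rho> assume \<rho>: "\<rho> \<in> paths i"
    have bound: "\<bar>\<rho> j ! a\<bar> \<le> int j" if "j \<le> n" "a < m" for j a
      using that
    proof (induction j)
      case 0
      then show ?case using minuscule_pathsD(2)[OF \<rho>] by (simp add: zero_weight_nth)
    next
      case (Suc j)
      obtain z where z: "set (shifted n lam i (Suc j)) \<subseteq> {z, z + 1}" "z = 0 \<or> z = - 1"
        using minuscule_two_valued[OF shifted_minuscule] .
      have "\<rho> (Suc j) ! a - \<rho> j ! a \<in> set (diff m (\<rho> j) (\<rho> (Suc j)))" using Suc.prems by (auto simp: diff_def)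
      then have "\<rho> (Suc j) ! a - \<rho> j ! a \<in> {z, z + 1}" using paths_two_valued[OF \<rho> _ z(1)] Suc.prems by auto
      then show ?case using Suc z(2) by auto
    qed
    have mem: "\<rho> \<in> {0..n} \<rightarrow>\<^sub>E dominant m" using \<rho> by (simp add: minuscule_paths_def)
    have "set (\<rho> j) \<subseteq> {- int n..int n} \<and> length (\<rho> j) = m" if j: "j \<in> {0..n}" for j
    proof -
      have l: "length (\<rho> j) = m" using mem j by (auto simp: dominant_def)
      have "\<rho> j ! a \<in> {- int n..int n}" if "a < m" for a using bound[of j a] j that by auto
      then show ?thesis using l by (auto simp: in_set_conv_nth)
    qed
    then show "\<rho> \<in> {0..n} \<rightarrow>\<^sub>E {xs. set xs \<subseteq> {- int n..int n} \<and> length xs = m}"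
      using mem by (auto simp: PiE_def)
  qed
qed

text \<open>The numbers of paths do not decrease from row to row and are periodic with period
  \<open>n\<close>, so they are constant and the injections are bijections.\<close>

lemma next_row_bij: "bij_betw (next_row m n) (paths i) (paths (i + 1))"
proof -
  have sub: "next_row m n ` paths i \<subseteq> paths (i + 1)" for i using next_row_paths by blast
  have le: "card (paths i) \<le> card (paths (i + 1))" for i
    by (rule card_inj_on_le[OF next_row_inj sub finite_paths])
  have "card (paths (i + 1)) \<le> card (paths (i + 1 + int k))" for k
  proof (induction k)
    case (Suc k)
    have "i + 1 + int (Suc k) = i + 1 + int k + 1" by simp
    then show ?case using order.trans[OF Suc le[of "i + 1 + int k"]] by (simp only:)
  qed simp
  from this[of "n - 1"] have "card (paths (i + 1)) \<le> card (paths (i + int n))"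
    using n by (simp add: of_nat_diff)
  also have "shifted n lam (i + int n) = shifted n lam i" by (rule ext) (rule shifted_period)
  then have "paths (i + int n) = paths i" by simp
  finally have "card (paths (i + 1)) \<le> card (next_row m n ` paths i)" by (simp add: card_image[OF next_row_inj])
  then have "next_row m n ` paths i = paths (i + 1)" by (intro card_seteq finite_paths sub)
  then show ?thesis using next_row_inj by (simp add: bij_betw_def)
qed

section \<open>From growth diagrams to paths and back\<close>

lemma diagramD:
  assumes "L \<in> affine_growth_diagrams m n lam"
  shows "i \<le> j \<Longrightarrow> j \<le> i + int n \<Longrightarrow> L (i, j) \<in> dominant m"
    "L (i, i) = zero_weight m" "L (i, i + int n) = zero_weight m"
    "L (i, i + 1) = lam (residue n i)"
    "i + 1 \<le> j \<Longrightarrow> j \<le> i + int n - 1 \<Longrightarrow>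
      L (i + 1, j + 1) = local_rule m (L (i, j)) (L (i, j + 1)) (L (i + 1, j))"
  using assms residue_range[OF n] residue_cong[OF n]
  unfolding affine_growth_diagrams_def local_rule_def staircase_def by (auto simp: PiE_iff)

text \<open>Vertical steps do not get longer from left to right. The first one, at column
  \<open>i + 1\<close>, is minus \<open>lam (residue n i)\<close>; the last one, at column
  \<open>i + n\<close>, starts from zero and is the weight on the left-hand side.\<close>

lemma diagram_vertical:
  assumes L: "L \<in> affine_growth_diagrams m n lam"
  shows "(\<Sum>a<m. (L (i + 1, i + int n) ! a)\<^sup>2) \<le> (\<Sum>a<m. (lam (residue n i) ! a)\<^sup>2)"
proof -
  define V where "V J = (\<Sum>a<m. (L (i + 1, J) ! a - L (i, J) ! a)\<^sup>2)" for J
  have "V (i + 1 + int k) \<le> V (i + 1)" if "k < n" for k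
    using that
  proof (induction k)
    case (Suc k)
    let ?J = "i + 1 + int k"
    have J: "i + 1 \<le> ?J" "?J \<le> i + int n - 1" using Suc.prems by auto
    have "L (i, ?J + 1) \<in> dominant m" by (rule diagramD(1)[OF L]) (use J in auto)
    from local_rule_contracts(1)[OF this, of "L (i, ?J)" "L (i + 1, ?J)"]
    have "V (?J + 1) \<le> V ?J"
      unfolding V_def diagramD(5)[OF L J] by (subst local_rule_sym)
    moreover have "?J + 1 = i + 1 + int (Suc k)" by simp
    ultimately show ?case using Suc by simp
  qed simp
  from this[of "n - 1"] have "V (i + int n) \<le> V (i + 1)" using n by (simp add: of_nat_diff)
  then show ?thesis
    unfolding V_def diagramD(2,3,4)[OF L] by (simp add: zero_weight_nth)
qed

text \<open>Between the columns \<open>J\<close> and \<open>J + 1\<close>, horizontal steps do not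
  get longer downwards. At the top, \<open>i = J + 1 - n\<close>, the step is minus a weight that
  \<open>diagram_vertical\<close> bounds. The sum of the entries stays constant and is read off at
  the bottom, \<open>i = J\<close>.\<close>

lemma diagram_horizontal:
  fixes J :: int and k :: nat
  assumes L: "L \<in> affine_growth_diagrams m n lam" and k: "k < n"
  defines "i \<equiv> J + 1 - int n + int k"
  shows "(\<Sum>a<m. (L (i, J + 1) ! a - L (i, J) ! a)\<^sup>2) \<le> (\<Sum>a<m. (lam (residue n J) ! a)\<^sup>2)"
    "(\<Sum>a<m. L (i, J + 1) ! a - L (i, J) ! a) = (\<Sum>a<m. lam (residue n J) ! a)"
proof -
  define Q where "Q i = (\<Sum>a<m. (L (i, J + 1) ! a - L (i, J) ! a)\<^sup>2)" for i
  define S where "S i = (\<Sum>a<m. L (i, J + 1) ! a - L (i, J) ! a)" for i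
  let ?start = "J + 1 - int n"
  have step: "Q (?start + int (Suc k)) \<le> Q (?start + int k) \<and> S (?start + int (Suc k)) = S (?start + int k)" if "Suc k < n" for k
  proof -
    let ?i = "?start + int k"
    have J: "?i + 1 \<le> J" "J \<le> ?i + int n - 1" using that by auto
    have "L (?i + 1, J) \<in> dominant m" by (rule diagramD(1)[OF L]) (use J in auto)
    note c = local_rule_contracts[OF this, of "L (?i, J)" "L (?i, J + 1)"]
    have "?start + int (Suc k) = ?i + 1" unfolding of_nat_Suc by linarith
    then show ?thesis
      using c unfolding Q_def S_def diagramD(5)[OF L J, symmetric] by simp
  qed
  have Q: "Q (?start + int k) \<le> Q ?start" if "k < n" for k
    using that
  proof (induction k)
    case (Suc k)
    then show ?case using step[of k] by simp
  qed simp
  have S: "S (?start + int k) = S ?start" if "k < n" for k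
    using that
  proof (induction k)
    case (Suc k)
    then show ?case using step[of k] by simp
  qed simp
  have res: "residue n (J - int n) = residue n J" using residue_add[of n "J - int n"] by simp
  have "Q ?start = (\<Sum>a<m. (L (?start, J) ! a)\<^sup>2)"
    using diagramD(3)[OF L, of ?start] by (simp add: Q_def zero_weight_nth)
  also have "\<dots> \<le> (\<Sum>a<m. (lam (residue n J) ! a)\<^sup>2)"
  proof -
    have e: "J - int n + 1 = ?start" "J - int n + int n = J" by simp_all
    show ?thesis using diagram_vertical[OF L, of "J - int n"] unfolding res e .
  qed
  finally show "(\<Sum>a<m. (L (i, J + 1) ! a - L (i, J) ! a)\<^sup>2) \<le> (\<Sum>a<m. (lam (residue n J) ! a)\<^sup>2)"
    using Q[OF k] unfolding Q_def i_def by linarith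
  have "S J = (\<Sum>a<m. lam (residue n J) ! a)"
    unfolding S_def diagramD(2,4)[OF L] by (simp add: zero_weight_nth)
  moreover have "S J = S ?start" using S[of "n - 1"] n by (simp add: of_nat_diff)
  ultimately show "(\<Sum>a<m. L (i, J + 1) ! a - L (i, J) ! a) = (\<Sum>a<m. lam (residue n J) ! a)"
    using S[OF k] unfolding S_def i_def by simp
qed

text \<open>The local rule alone does not force adjacent weights to differ by a weight of the minuscule
  orbit. Going once around the strip does: the lengths of the steps cannot increase.\<close>

lemma row_paths:
  assumes L: "L \<in> affine_growth_diagrams m n lam"
  shows "row n L i \<in> paths i"
  unfolding minuscule_paths_def
proof (intro CollectI conjI ballI)
  show "row n L i \<in> {0..n} \<rightarrow>\<^sub>E dominant m"
    unfolding row_def using diagramD(1)[OF L] by auto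
  show "row n L i 0 = zero_weight m" "row n L i n = zero_weight m"
    using diagramD(2,3)[OF L] by (simp_all add: row_def)
  fix j assume "j \<in> {1..n}"
  then obtain l where l: "j = Suc l" "l < n" by (cases j) auto
  define J where "J = i + int l"
  define k where "k = n - Suc l"
  have i: "i = J + 1 - int n + int k" "k < n" using l by (auto simp: J_def k_def)
  have step: "weight_step m (row n L i) j = map (\<lambda>a. L (i, J + 1) ! a - L (i, J) ! a) [0..<m]"
    using l by (simp add: weight_step_def row_def J_def algebra_simps)
  note h = diagram_horizontal[OF L i(2), of J, folded i(1)]
  show "mset (weight_step m (row n L i) j) = mset (shifted n lam i j)"
  proof (rule mset_eq_minuscule[OF shifted_minuscule])
    have s: "shifted n lam i j = lam (residue n J)" by (simp add: shifted_def l J_def)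
    show "length (weight_step m (row n L i) j) = m" by (simp add: weight_step_def)
    show "(\<Sum>a<m. (weight_step m (row n L i) j ! a)\<^sup>2) \<le> (\<Sum>a<m. (shifted n lam i j ! a)\<^sup>2)"
      unfolding s step using h(1) by simp
    show "(\<Sum>a<m. weight_step m (row n L i) j ! a) = (\<Sum>a<m. shifted n lam i j ! a)"
      unfolding s step using h(2) by simp
  qed
qed

lemma row_next_row:
  assumes L: "L \<in> affine_growth_diagrams m n lam"
  shows "row n L (i + 1) = next_row m n (row n L i)"
proof -
  have entry: "next_entry m (row n L i) j = L (i + 1, i + 1 + int j)" if "j < n" for j
    using that
  proof (induction j)
    case 0
    then show ?case using diagramD(2)[OF L, of "i + 1"] by simp
  next
    case (Suc j)
    have "L (i + 1, (i + 1 + int j) + 1) =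
        local_rule m (L (i, i + 1 + int j)) (L (i, i + 1 + int j + 1)) (L (i + 1, i + 1 + int j))"
      by (rule diagramD(5)[OF L]) (use Suc.prems in auto)
    then show ?case using Suc by (simp add: row_def algebra_simps)
  qed
  show ?thesis
  proof
    fix j show "row n L (i + 1) j = next_row m n (row n L i) j"
      using entry[of j] diagramD(3)[OF L, of "i + 1"] by (auto simp: row_def next_row_def)
  qed
qed

text \<open>Rows below follow by the local rule, rows above because \<open>next_row\<close> is
  injective.\<close>

lemma diagram_determined:
  assumes L: "L \<in> affine_growth_diagrams m n lam" and L': "L' \<in> affine_growth_diagrams m n lam"
    and eq: "row n L 1 = row n L' 1"
  shows "L = L'"
proof -
  have up: "row n L (1 + int k) = row n L' (1 + int k)" for k
  proof (induction k)
    case (Suc k)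
    then show ?case using row_next_row[OF L, of "1 + int k"] row_next_row[OF L', of "1 + int k"] by (simp add: algebra_simps)
  qed (simp add: eq)
  have down: "row n L (1 - int k) = row n L' (1 - int k)" for k
  proof (induction k)
    case (Suc k)
    let ?i = "1 - int (Suc k)"
    have "next_row m n (row n L ?i) = next_row m n (row n L' ?i)"
      using Suc row_next_row[OF L, of ?i] row_next_row[OF L', of ?i] by simp
    then show ?case using inj_onD[OF next_row_inj _ row_paths[OF L] row_paths[OF L']] by blast
  qed (simp add: eq)
  have all: "row n L i = row n L' i" for i
  proof (cases "i \<ge> 1")
    case True
    then show ?thesis using up[of "nat (i - 1)"] by simp
  next
    case False
    then show ?thesis using down[of "nat (1 - i)"] by simp
  qed
  show ?thesis
  proof (rule PiE_ext)
    show "L \<in> staircase n \<rightarrow>\<^sub>E dominant m" "L' \<in> staircase n \<rightarrow>\<^sub>E dominant m"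
      using L L' by (simp_all add: affine_growth_diagrams_def)
    fix p assume "p \<in> staircase n"
    then obtain i j where p: "p = (i, j)" "i \<le> j" "j \<le> i + int n" by (auto simp: staircase_def)
    have "row n L i (nat (j - i)) = row n L' i (nat (j - i))" by (simp add: all)
    moreover have "nat (j - i) \<le> n" "i + int (nat (j - i)) = j" using p by auto
    ultimately show "L p = L' p" unfolding row_def p(1) by simp
  qed
qed

text \<open>Downwards the rows are iterates of \<open>next_row\<close>, upwards they are preimages,
  which exist because \<open>next_row\<close> is onto.\<close>

lemma path_extends:
  assumes \<rho>: "\<rho> \<in> paths 1"
  obtains R where "R 1 = \<rho>" "\<And>i. R i \<in> paths i" "\<And>i. R (i + 1) = next_row m n (R i)"
proof -
  define U where "U k = (next_row m n ^^ k) \<rho>" for k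
  have U: "U k \<in> paths (1 + int k)" for k
  proof (induction k)
    case 0
    then show ?case using \<rho> by (simp add: U_def)
  next
    case (Suc k)
    then show ?case using next_row_paths[OF Suc] by (simp add: U_def algebra_simps)
  qed
  have "\<exists>D. \<forall>k. D k \<in> paths (1 - int k) \<and> (D 0 = \<rho> \<and> next_row m n (D (Suc k)) = D k)"
  proof -
    define D where "D = rec_nat \<rho> (\<lambda>k \<tau>. inv_into (paths (- int k)) (next_row m n) \<tau>)"
    have D0: "D 0 = \<rho>" and DS: "D (Suc k) = inv_into (paths (- int k)) (next_row m n) (D k)" for k
      by (simp_all add: D_def)
    have im: "next_row m n ` paths (- int k) = paths (1 - int k)" for k
      using next_row_bij[of "- int k"] by (simp add: bij_betw_def)
    have D: "D k \<in> paths (1 - int k)" for k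
    proof (induction k)
      case 0
      then show ?case using \<rho> by (simp add: D0)
    next
      case (Suc k)
      have "inv_into (paths (- int k)) (next_row m n) (D k) \<in> paths (- int k)"
        by (rule inv_into_into) (use Suc im in simp)
      then show ?case by (simp add: DS)
    qed
    have "next_row m n (D (Suc k)) = D k" for k
      unfolding DS by (rule f_inv_into_f[of "D k" "next_row m n" "paths (- int k)"]) (use D[of k] im in simp)
    then show ?thesis using D D0 by blast
  qed
  then obtain D where D: "\<And>k. D k \<in> paths (1 - int k)" "D 0 = \<rho>" "\<And>k. next_row m n (D (Suc k)) = D k" by (elim exE) (rule that, (drule spec, elim conjE, assumption)+)
  define R where "R i = (if i \<ge> 1 then U (nat (i - 1)) else D (nat (1 - i)))" for i :: int
  show ?thesis
  proof (rule that[of R])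
    show "R 1 = \<rho>" by (simp add: R_def U_def)
    show "R i \<in> paths i" for i
      using U[of "nat (i - 1)"] D(1)[of "nat (1 - i)"] by (cases "i \<ge> 1") (simp_all add: R_def)
    show "R (i + 1) = next_row m n (R i)" for i
    proof (cases "i \<ge> 1")
      case True
      then have "nat (i + 1 - 1) = Suc (nat (i - 1))" by simp
      then show ?thesis using True by (simp add: R_def U_def)
    next
      case False
      then have s: "nat (1 - i) = Suc (nat (- i))" by simp
      have "next_row m n (R i) = D (nat (- i))" using False D(3)[of "nat (- i)"] by (simp add: R_def s)
      moreover have "R (i + 1) = D (nat (- i))"
        using False D(2) by (cases "i = 0") (auto simp: R_def U_def)
      ultimately show ?thesis by simp
    qed
  qed
qed

lemma diagram_of_path:
  assumes \<rho>: "\<rho> \<in> paths 1"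
  shows "\<exists>L\<in>affine_growth_diagrams m n lam. row n L 1 = \<rho>"
proof -
  obtain R where R: "R 1 = \<rho>" "\<And>i. R i \<in> paths i" "\<And>i. R (i + 1) = next_row m n (R i)" by (rule path_extends[OF \<rho>]) (rule that)
  define L where "L = (\<lambda>(i, j)\<in>staircase n. R i (nat (j - i)))"
  have L: "L (i, j) = R i (nat (j - i))" if "i \<le> j" "j \<le> i + int n" for i j
    using that by (simp add: L_def staircase_def)
  have Rmem: "R i \<in> {0..n} \<rightarrow>\<^sub>E dominant m" for i using R(2)[of i] by (simp add: minuscule_paths_def)
  have "L \<in> affine_growth_diagrams m n lam"
    unfolding affine_growth_diagrams_def
  proof (intro CollectI conjI allI ballI impI)
    show "L \<in> staircase n \<rightarrow>\<^sub>E dominant m"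
    proof (rule PiE_I)
      fix p assume "p \<in> staircase n"
      then obtain i j where p: "p = (i, j)" "i \<le> j" "j \<le> i + int n" by (auto simp: staircase_def)
      then have "nat (j - i) \<in> {0..n}" by auto
      then show "L p \<in> dominant m" using Rmem[of i] p L by auto
    qed (simp add: L_def)
    show "L (i, i) = zero_weight m" for i using L[of i i] minuscule_pathsD(2)[OF R(2)] by simp
    show "L (i, i + int n) = zero_weight m" for i using L[of i "i + int n"] minuscule_pathsD(3)[OF R(2)] by simp
    fix i r assume r: "r \<in> {1..n}" "[int r = i] (mod int n)"
    have Li: "L (i, i + 1) = R i 1" using L[of i "i + 1"] n by simp
    have d: "R i 1 \<in> dominant m" by (rule minuscule_pathsD(1)[OF R(2)]) (use n in auto)
    \<comment> \<open>A path fixes its first step only up to order; as this weight and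
      \<open>lam r\<close> are both dominant, they agree.\<close>
    have "weight_step m (R i) 1 = R i 1"
      using minuscule_pathsD(2)[OF R(2), of i] d
      by (intro nth_equalityI) (auto simp: weight_step_def dominant_def zero_weight_nth)
    then have "mset (R i 1) = mset (lam r)"
      using minuscule_pathsD(4)[OF R(2), of 1 i] n residue_unique[OF r] by (simp add: shifted_def)
    then have "sort_weight (lam r) = R i 1" using d by (intro sort_weight_unique) (auto simp: dominant_def)
    moreover have "sort_weight (lam r) = lam r"
      using minuscule_dominant[OF lam[OF r(1)]] by (intro sort_weight_unique) (auto simp: dominant_def)
    ultimately show "L (i, i + 1) = lam r" using Li by simp
  next
    fix i j assume "i + 1 \<le> j \<and> j \<le> i + int n - 1"
    then have j: "i + 1 \<le> j" "j \<le> i + int n - 1" by auto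
    define k where "k = nat (j - i - 1)"
    have k: "nat (j - i) = Suc k" "nat (j + 1 - i) = Suc (Suc k)" "nat (j - (i + 1)) = k"
      "nat (j + 1 - (i + 1)) = Suc k" "Suc k < n" using j by (auto simp: k_def)
    have "L (i + 1, j + 1) = next_row m n (R i) (Suc k)" using L[of "i + 1" "j + 1"] j R(3)[of i] k(4) by simp
    also have "\<dots> = local_rule m (R i (Suc k)) (R i (Suc (Suc k))) (next_row m n (R i) k)"
      using k(5) by (simp add: next_row_def)
    also have "\<dots> = local_rule m (L (i, j)) (L (i, j + 1)) (L (i + 1, j))"
      using L[of i j] L[of i "j + 1"] L[of "i + 1" j] j k(1,2,3) R(3)[of i] by simp
    finally show "L (i + 1, j + 1) = sort_weight (map (\<lambda>k. L (i + 1, j) ! k + L (i, j + 1) ! k - L (i, j) ! k) [0..<m])"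
      by (simp add: local_rule_def)
  qed
  moreover have "row n L 1 = \<rho>"
  proof
    fix j show "row n L 1 j = \<rho> j"
    proof (cases "j \<in> {0..n}")
      case True
      then show ?thesis using L[of 1 "1 + int j"] R(1) by (simp add: row_def)
    next
      case False
      then have "\<rho> j = undefined" using Rmem[of 1] R(1) by (auto simp: PiE_def extensional_def)
      then show ?thesis using False by (auto simp: row_def)
    qed
  qed
  ultimately show ?thesis by blast
qed

lemma paths_1: "paths 1 = minuscule_paths m n lam"
proof -
  have "shifted n lam 1 j = lam j" if "j \<in> {1..n}" for j
    using residue_self[OF that] by (simp add: shifted_def)
  then show ?thesis by (simp add: minuscule_paths_def cong: conj_cong)
qed

lemma diagrams_bij_paths:
  "bij_betw (\<lambda>L. row n L 1) (affine_growth_diagrams m n lam) (minuscule_paths m n lam)"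
  unfolding paths_1[symmetric]
proof (rule bij_betw_imageI)
  show "inj_on (\<lambda>L. row n L 1) (affine_growth_diagrams m n lam)"
    by (rule inj_onI) (rule diagram_determined)
  show "(\<lambda>L. row n L 1) ` affine_growth_diagrams m n lam = paths 1"
  proof (intro subset_antisym subsetI)
    fix \<rho> assume "\<rho> \<in> (\<lambda>L. row n L 1) ` affine_growth_diagrams m n lam"
    then show "\<rho> \<in> paths 1" using row_paths by blast
  next
    fix \<rho> assume "\<rho> \<in> paths 1"
    then show "\<rho> \<in> (\<lambda>L. row n L 1) ` affine_growth_diagrams m n lam" using diagram_of_path by blast
  qed
qed

end

section \<open>The components of the polygon space\<close>

lemma irreducible_in_UN:
  assumes S: "irreducible_in X S" and F: "finite F" "\<And>i. i \<in> F \<Longrightarrow> closedin X (C i)" "S \<subseteq> (\<Union>i\<in>F. C i)"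
  shows "\<exists>i\<in>F. S \<subseteq> C i"
  using F
proof (induction F rule: finite_induct)
  case empty
  then show ?case using S by (simp add: irreducible_in_def)
next
  case (insert j F)
  have "closedin X (C j)" by (rule insert.prems) simp
  moreover have "closedin X (\<Union>i\<in>F. C i)" by (rule closedin_Union) (use insert in auto)
  moreover have "S \<subseteq> C j \<union> (\<Union>i\<in>F. C i)" using insert.prems(2) by simp
  ultimately have "S \<subseteq> C j \<or> S \<subseteq> (\<Union>i\<in>F. C i)" using S unfolding irreducible_in_def by blast
  then show ?case
  proof
    assume "S \<subseteq> (\<Union>i\<in>F. C i)"
    then have "\<exists>i\<in>F. S \<subseteq> C i" by (rule insert.IH[rotated]) (rule insert.prems(1), simp)
    then show ?case by simp
  qed simp
qed

lemma irreducible_in_closure: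
  assumes "irreducible_in X S"
  shows "irreducible_in X (X closure_of S)"
  unfolding irreducible_in_def
proof (intro conjI allI impI)
  have S: "S \<subseteq> topspace X" "S \<noteq> {}" using assms by (simp_all add: irreducible_in_def)
  have cl: "S \<subseteq> X closure_of S" by (rule closure_of_subset[OF S(1)])
  show "X closure_of S \<subseteq> topspace X" by (rule closure_of_subset_topspace)
  show "X closure_of S \<noteq> {}" using S(2) cl by auto
  fix A B assume AB: "closedin X A \<and> closedin X B \<and> X closure_of S \<subseteq> A \<union> B"
  then have "S \<subseteq> A \<or> S \<subseteq> B" using assms cl unfolding irreducible_in_def by (meson order_trans)
  then show "X closure_of S \<subseteq> A \<or> X closure_of S \<subseteq> B" using AB closure_of_minimal by metis
qed

lemma irreducible_in_subtopology:
  assumes S: "irreducible_in X S" and sub: "S \<subseteq> Y"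
  shows "irreducible_in (subtopology X Y) S"
  unfolding irreducible_in_def
proof (intro conjI allI impI)
  show "S \<subseteq> topspace (subtopology X Y)" "S \<noteq> {}" using S sub by (auto simp: irreducible_in_def)
  fix A B assume AB: "closedin (subtopology X Y) A \<and> closedin (subtopology X Y) B \<and> S \<subseteq> A \<union> B"
  then obtain A' B' where A': "closedin X A'" "A = A' \<inter> Y" and B': "closedin X B'" "B = B' \<inter> Y"
    unfolding closedin_subtopology by blast
  have "S \<subseteq> A' \<union> B'" using AB A' B' by auto
  then have "S \<subseteq> A' \<or> S \<subseteq> B'" using S A' B' unfolding irreducible_in_def by blast
  then show "S \<subseteq> A \<or> S \<subseteq> B" using sub A'(2) B'(2) by auto
qed

text \<open>An irreducible set lies in the closure of one of the finitely many \<open>S p\<close>,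
  so every maximal one is such a closure; and by \<open>ne\<close> none of these closures contains
  another.\<close>

lemma bij_betw_irreducible_components:
  assumes cover: "topspace X = (\<Union>p\<in>P. S p)" and fin: "finite P"
    and irr: "\<And>p. p \<in> P \<Longrightarrow> irreducible_in X (S p)"
    and ne: "\<And>p q. p \<in> P \<Longrightarrow> q \<in> P \<Longrightarrow> S p \<subseteq> X closure_of S q \<Longrightarrow> p = q"
  shows "bij_betw (\<lambda>p. X closure_of S p) P (irreducible_components X)"
proof -
  have sub: "S p \<subseteq> X closure_of S p" if "p \<in> P" for p
    by (rule closure_of_subset) (use irr[OF that] in \<open>simp add: irreducible_in_def\<close>)
  have big: "\<exists>p\<in>P. T \<subseteq> X closure_of S p" if T: "irreducible_in X T" for T
  proof -
    have "T \<subseteq> topspace X" using T by (simp add: irreducible_in_def)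
    then have "T \<subseteq> (\<Union>p\<in>P. X closure_of S p)" unfolding cover using sub by fastforce
    then show ?thesis
      by (intro irreducible_in_UN[OF T fin, of "\<lambda>p. X closure_of S p"] closedin_closure_of)
  qed
  have max: "p = q" if "p \<in> P" "q \<in> P" "X closure_of S p \<subseteq> X closure_of S q" for p q
    using ne[OF that(1,2)] sub[OF that(1)] that(3) by simp
  have comp: "X closure_of S p \<in> irreducible_components X" if p: "p \<in> P" for p
    unfolding irreducible_components_def
  proof (intro CollectI conjI allI impI)
    show "irreducible_in X (X closure_of S p)" by (rule irreducible_in_closure[OF irr[OF p]])
    fix T assume T: "irreducible_in X T \<and> X closure_of S p \<subseteq> T"
    then obtain q where q: "q \<in> P" "T \<subseteq> X closure_of S q" using big[of T] by auto
    then have "p = q" using max[OF p q(1)] order_trans[of "X closure_of S p" T "X closure_of S q"] T by simp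
    then show "T = X closure_of S p" using T q by simp
  qed
  show ?thesis
  proof (rule bij_betw_imageI)
    show "inj_on (\<lambda>p. X closure_of S p) P" by (rule inj_onI) (rule max, simp_all)
    show "(\<lambda>p. X closure_of S p) ` P = irreducible_components X"
    proof (intro subset_antisym subsetI)
      fix T assume "T \<in> (\<lambda>p. X closure_of S p) ` P"
      then show "T \<in> irreducible_components X" using comp by auto
    next
      fix T assume T: "T \<in> irreducible_components X"
      then have Ti: "irreducible_in X T" by (simp add: irreducible_components_def)
      then obtain p where p: "p \<in> P" "T \<subseteq> X closure_of S p" using big[of T] by auto
      have "X closure_of S p = T"
        using T p(2) irreducible_in_closure[OF irr[OF p(1)]] by (simp add: irreducible_components_def)
      then show "T \<in> (\<lambda>p. X closure_of S p) ` P" using p(1) by auto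
    qed
  qed
qed

lemma cell_cong:
  assumes "\<And>i. i \<in> {1..<n} \<Longrightarrow> w i = w' i"
  shows "cell m n w = cell m n w'"
proof -
  have "gpolygon m n u w = gpolygon m n u w'" for u
    unfolding gpolygon_def by (rule restrict_ext, rule gprod_cong) (use assms in auto)
  moreover have "(\<forall>i\<in>{1..<n}. echelon m ((!) (w i)) (u i)) \<longleftrightarrow> (\<forall>i\<in>{1..<n}. echelon m ((!) (w' i)) (u i))" for u
    using assms by simp
  ultimately show ?thesis unfolding cell_def by simp
qed

text \<open>The sums telescope. This links the diagonal exponents of a cell to the weights of its
  path.\<close>

lemma psum_weight_step:
  assumes "mu \<in> minuscule_paths m n lam" "a < m"
  shows "psum (weight_step m mu) i a = mu i ! a"
proof (induction i)
  case 0
  then show ?case using minuscule_pathsD(2)[OF assms(1)] assms(2) by (simp add: psum_def zero_weight_def)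
next
  case (Suc i)
  then show ?case using assms(2) by (simp add: psum_Suc weight_step_def)
qed

context minuscule_sequence
begin

definition closed_weights :: "(nat \<Rightarrow> int list) set" where
  "closed_weights = {w \<in> {1..n} \<rightarrow>\<^sub>E (\<Union>i\<in>{1..n}. {xs. mset xs = mset (lam i)}).
     (\<forall>i\<in>{1..n}. mset (w i) = mset (lam i)) \<and> (\<forall>a<m. psum w n a = 0)}"

lemma finite_closed_weights: "finite closed_weights"
proof (rule finite_subset)
  show "closed_weights \<subseteq> {1..n} \<rightarrow>\<^sub>E (\<Union>i\<in>{1..n}. {xs. mset xs = mset (lam i)})"
    unfolding closed_weights_def by (rule Collect_restrict)
  have "finite {xs. mset xs = mset (lam i)}" for i
    by (rule mset_eq_finite)
  then show "finite ({1..n} \<rightarrow>\<^sub>E (\<Union>i\<in>{1..n}. {xs. mset xs = mset (lam i)}))"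
    by (intro finite_PiE) auto
qed

text \<open>The product of all factors is upper triangular and integral, so its diagonal exponents
  \<open>psum w n a\<close> are nonnegative; its determinant is a unit, so they add up to
  zero.\<close>

lemma psum_eq_0:
  assumes w: "\<And>i. i \<in> {1..n} \<Longrightarrow> mset (w i) = mset (lam i)"
    and u: "\<And>i. i \<in> {1..n} \<Longrightarrow> echelon m ((!) (w i)) (u i)"
    and G: "gprod m u w n \<in> GL_O m" and a: "a < m"
  shows "psum w n a = 0"
proof -
  \<comment> \<open>The locale only describes the products of fewer than \<open>n\<close> steps, so a dummy step is appended.\<close>
  define lam' where "lam' = lam(Suc n := lam n)"
  define w' where "w' = w(Suc n := lam n)"
  interpret C: cell_weights m "Suc n" "lattice_codim m (Suc n) lam'" w'
  proof (rule cell_weights_minuscule)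
    fix i assume "i \<in> {1..Suc n}"
    then have "i \<in> {1..n} \<or> i = Suc n" by auto
    then show "lam' i \<in> minuscule m" "mset (w' i) = mset (lam' i)"
      using lam[of i] lam[of n] w[of i] n by (auto simp: lam'_def w'_def)
  qed simp
  define A where "A = gprod m u w n"
  have A: "gprod m u w' n = A" unfolding A_def by (rule gprod_cong) (auto simp: w'_def)
  have p: "psum w' n b = psum w n b" for b unfolding psum_def by (rule sum.cong) (auto simp: w'_def)
  have u': "echelon m ((!) (w' i)) (u i)" if "i \<in> {1..n}" for i using u[OF that] that by (simp add: w'_def)
  have low: "A $$ (b, c) = 0" if "c < b" "b < m" for b c using C.gprod_triangular[OF lessI u'] that unfolding A by blast
  have diag: "A $$ (b, b) = tp (psum w n b)" if "b < m" for b
    using C.gprod_triangular[OF lessI u'] that unfolding A p by blast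
  have int: "mat_val_ge m 0 A" and det: "fls_nth (det A) 0 \<noteq> 0" using G by (simp_all add: A_def GL_O_iff)
  have Ac: "A \<in> carrier_mat m m" using int by (simp add: mat_val_ge_def)
  have ge: "0 \<le> psum w n b" if "b < m" for b
  proof -
    have "val_ge 0 (A $$ (b, b))" using int that by (simp add: mat_val_ge_def)
    then show ?thesis unfolding diag[OF that] val_ge_tp .
  qed
  have "upper_triangular A" by (rule upper_triangularI) (use low Ac in auto)
  then have "det A = prod_list (diag_mat A)" by (rule det_upper_triangular[OF _ Ac])
  also have "diag_mat A = map (\<lambda>b. tp (psum w n b)) [0..<m]"
    unfolding diag_mat_def using Ac diag by auto
  also have "prod_list \<dots> = tp (\<Sum>b<m. psum w n b)"
    by (induction m) (simp_all add: tp_add)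
  finally have "(\<Sum>b<m. psum w n b) = 0" using det by (auto simp: fls_nth_tp split: if_splits)
  then show ?thesis using sum_nonneg_eq_0_iff[of "{..<m}" "psum w n"] ge a by simp
qed

lemma Poly_closed_weights_cover:
  assumes "x \<in> Poly m n lam"
  obtains w where "w \<in> closed_weights" "x \<in> cell m n w"
proof -
  obtain w u where w: "\<And>i. i \<in> {1..n} \<Longrightarrow> mset (w i) = mset (lam i)"
    and u: "\<And>i. i \<in> {1..n} \<Longrightarrow> echelon m ((!) (w i)) (u i)"
    and x: "x = Gr_proj m {1..<n} (gpolygon m n u w)" and G: "gprod m u w n \<in> GL_O m"
    by (rule Poly_cell_cover[OF assms n lam]) (assumption, rule that)
  have "psum (restrict w {1..n}) n a = psum w n a" for a
    unfolding psum_def by (rule sum.cong) auto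
  then have "restrict w {1..n} \<in> closed_weights"
    unfolding closed_weights_def using w psum_eq_0[OF w u G] by auto
  moreover have "x \<in> cell m n w"
    unfolding cell_def x using u by (intro CollectI exI[of _ u] conjI refl ballI) auto
  then have "x \<in> cell m n (restrict w {1..n})"
    by (subst cell_cong[where w' = w]) auto
  ultimately show thesis by (rule that)
qed

text \<open>The last step of a path leads from a dominant weight to zero, hence is weakly increasing
  and has no inversions. This gives the comparison of dimensions that
  \<open>cell_not_in_closure\<close> asks for.\<close>

lemma path_cell_in_closure:
  assumes mu: "mu \<in> minuscule_paths m n lam" and w: "w \<in> closed_weights"
    and sub: "cell m n (weight_step m mu) \<subseteq> (Gr_top m {1..<n}) closure_of (cell m n w)"
    and i: "i \<in> {1..<n}" and a: "a < m"
  shows "psum w i a = mu i ! a"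
proof -
  let ?v = "weight_step m mu"
  have wm: "mset (w j) = mset (lam j)" if "j \<in> {1..n}" for j using w that by (simp add: closed_weights_def)
  have w0: "psum w n b = 0" if "b < m" for b using w that by (simp add: closed_weights_def)
  note vm = minuscule_pathsD(4)[OF mu]
  note ps = psum_weight_step[OF mu]
  have v0: "psum ?v n b = 0" if "b < m" for b
    using ps[OF that, of n] minuscule_pathsD(3)[OF mu] that by (simp add: zero_weight_nth)
  have vn: "?v n ! b \<le> ?v n ! c" if "b < c" "c < m" for b c
  proof -
    have "mu (n - 1) \<in> dominant m" by (rule minuscule_pathsD(1)[OF mu]) simp
    then have "mu (n - 1) ! c \<le> mu (n - 1) ! b" using that by (intro dominant_antimono) auto
    then show ?thesis using that minuscule_pathsD(3)[OF mu] by (simp add: weight_step_def zero_weight_nth)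
  qed
  have "card (cell_vars m n w) \<le> card (cell_vars m n ?v)"
    by (rule card_cell_vars_le[OF n lam vm v0 wm w0 vn])
  from cell_not_in_closure[OF cell_weights_minuscule[OF n lam vm] cell_weights_minuscule[OF n lam wm] this sub i a]
  show ?thesis using ps[OF a, of i] by simp
qed

text \<open>The piece of \<open>nu\<close> is irreducible and covered by the closures of finitely
  many cells, so it lies in one of these closures. The cells of \<open>mu\<close> and of
  \<open>nu\<close> then lie there too, and the partial sums of the weights of that one cell equal
  both paths.\<close>

lemma path_piece_not_in_closure:
  assumes mu: "mu \<in> minuscule_paths m n lam" and nu: "nu \<in> minuscule_paths m n lam"
    and sub: "path_piece m n mu \<subseteq> (Gr_top m {1..<n}) closure_of (path_piece m n nu)"
  shows "mu = nu"
proof -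
  let ?X = "Gr_top m {1..<n}"
  have irr: "irreducible_in ?X (path_piece m n nu)" by (rule irreducible_path_piece)
  have top: "path_piece m n nu \<subseteq> topspace ?X" using irr by (simp add: irreducible_in_def)
  have cover: "path_piece m n nu \<subseteq> (\<Union>w\<in>closed_weights. ?X closure_of (cell m n w))"
  proof
    fix x assume x: "x \<in> path_piece m n nu"
    then have "x \<in> Poly m n lam"
      using path_piece_subset_Poly[OF nu minuscule_dominant[OF lam]] by (rule subsetD[rotated])
    then obtain w where w: "w \<in> closed_weights" "x \<in> cell m n w" by (rule Poly_closed_weights_cover)
    have "x \<in> topspace ?X" using x top by (rule subsetD[rotated])
    then have "x \<in> ?X closure_of (cell m n w)" using w(2) unfolding in_closure_of by auto
    then show "x \<in> (\<Union>w\<in>closed_weights. ?X closure_of (cell m n w))" using w(1) by (rule UN_I[rotated])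
  qed
  have "\<exists>w\<in>closed_weights. path_piece m n nu \<subseteq> ?X closure_of (cell m n w)"
    by (rule irreducible_in_UN[OF irr finite_closed_weights _ cover]) (rule closedin_closure_of)
  then obtain w where w: "w \<in> closed_weights" "path_piece m n nu \<subseteq> ?X closure_of (cell m n w)"
    by (elim bexE)
  have mu': "cell m n (weight_step m mu) \<subseteq> ?X closure_of (cell m n w)"
    by (rule order_trans[OF order_trans[OF cell_subset_path_piece[OF mu] sub] closure_of_minimal[OF w(2) closedin_closure_of]])
  have nu': "cell m n (weight_step m nu) \<subseteq> ?X closure_of (cell m n w)"
    using cell_subset_path_piece[OF nu] w(2) by (rule order_trans)
  show ?thesis
  proof (rule PiE_ext)
    show "mu \<in> {0..n} \<rightarrow>\<^sub>E dominant m" "nu \<in> {0..n} \<rightarrow>\<^sub>E dominant m"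
      using mu nu by (simp_all add: minuscule_paths_def)
    fix i assume i: "i \<in> {0..n}"
    consider "i = 0" | "i = n" | "i \<in> {1..<n}" using i by force
    then show "mu i = nu i"
    proof cases
      case 1
      then show ?thesis using minuscule_pathsD(2)[OF mu] minuscule_pathsD(2)[OF nu] by simp
    next
      case 2
      then show ?thesis using minuscule_pathsD(3)[OF mu] minuscule_pathsD(3)[OF nu] by simp
    next
      case 3
      show ?thesis
      proof (rule nth_equalityI)
        show "length (mu i) = length (nu i)"
          using minuscule_pathsD(1)[OF mu, of i] minuscule_pathsD(1)[OF nu, of i] i by (simp add: dominant_def)
        fix a assume "a < length (mu i)"
        then have "a < m" using minuscule_pathsD(1)[OF mu, of i] i by (simp add: dominant_def)
        then show "mu i ! a = nu i ! a"
          using path_cell_in_closure[OF mu w(1) mu' 3] path_cell_in_closure[OF nu w(1) nu' 3] by simp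
      qed
    qed
  qed
qed

lemma components_bij_paths:
  "bij_betw (\<lambda>mu. Poly_top m n lam closure_of path_piece m n mu) (minuscule_paths m n lam)
    (irreducible_components (Poly_top m n lam))"
proof (rule bij_betw_irreducible_components)
  have sub: "path_piece m n mu \<subseteq> Poly m n lam" if "mu \<in> minuscule_paths m n lam" for mu
    by (rule path_piece_subset_Poly[OF that minuscule_dominant[OF lam]])
  have "Poly m n lam \<subseteq> (\<Union>mu\<in>minuscule_paths m n lam. path_piece m n mu)"
  proof
    fix x assume "x \<in> Poly m n lam"
    then obtain mu where "mu \<in> minuscule_paths m n lam" "x \<in> path_piece m n mu"
      by (rule Poly_path_cover[OF _ n lam])
    then show "x \<in> (\<Union>mu\<in>minuscule_paths m n lam. path_piece m n mu)" by (rule UN_I[of mu])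
  qed
  moreover have "topspace (Poly_top m n lam) = Poly m n lam"
    unfolding Poly_top_def topspace_subtopology topspace_Gr_top by (auto simp: Poly_def)
  ultimately show "topspace (Poly_top m n lam) = (\<Union>mu\<in>minuscule_paths m n lam. path_piece m n mu)"
    using sub by (simp add: subset_antisym UN_least)
  show "finite (minuscule_paths m n lam)" using finite_paths[of 1] unfolding paths_1 .
  show "irreducible_in (Poly_top m n lam) (path_piece m n mu)" if "mu \<in> minuscule_paths m n lam" for mu
    unfolding Poly_top_def by (rule irreducible_in_subtopology[OF irreducible_path_piece sub[OF that]])
  fix mu nu assume mu: "mu \<in> minuscule_paths m n lam" and nu: "nu \<in> minuscule_paths m n lam"
    and c: "path_piece m n mu \<subseteq> Poly_top m n lam closure_of path_piece m n nu"
  have "Poly_top m n lam closure_of path_piece m n nu \<subseteq> (Gr_top m {1..<n}) closure_of path_piece m n nu"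
    unfolding Poly_top_def by (rule closure_of_subtopology_subset)
  with c show "mu = nu" by (intro path_piece_not_in_closure[OF mu nu]) (rule order_trans)
qed

end

theorem theorem5p5:
  fixes m n :: nat and lam :: "nat \<Rightarrow> int list"
  assumes "m \<ge> 1" and "n \<ge> 1"
    and "\<And>r. r \<in> {1..n} \<Longrightarrow> lam r \<in> minuscule m"
  shows "\<exists>f. bij_betw f (irreducible_components (Poly_top m n lam)) (affine_growth_diagrams m n lam)"
proof -
  interpret minuscule_sequence m n lam by (rule minuscule_sequence.intro[OF assms(2,3)])
  show ?thesis
    by (rule exI, rule bij_betw_trans[OF bij_betw_inv_into[OF components_bij_paths] bij_betw_inv_into[OF diagrams_bij_paths]])
qed

end
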